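(* Let $F$ be any field, $K_1,K_2$ quadratic étale $F$-algebras with nontrivial automorphisms $\sigma_1,\sigma_2$, $K=K_1\otimes_FK_2$, $\tau_3$ the automorphism $x\otimes y\mapsto x^{\sigma_1}\otimes y^{\sigma_2}$ of $K$, and $K_3=K^{\tau_3}$. Let $\mathcal Q_{\mathrm{reg}}(K_1,K_2)$ be the set of isomorphism classes of regular quaternion embeddings $(B,\alpha_1,\alpha_2)$ of $(K_1,K_2)$, and let $\mathrm{inv}(B,\alpha_1,\alpha_2)\in K_3$ be the unique $\xi\in K_3$ with $\mathrm{Nrd}_B(\alpha(x))=\mathrm{Tr}_{K_3/F}(\xi xx^{\tau_3})$ for all $x\in K$, where $\alpha(x_1\otimes x_2)=\alpha_1(x_1)\alpha_2(x_2)$. Then $\mathrm{inv}$ is a bijection $$\mathcal Q_{\mathrm{reg}}(K_1,K_2)\xrightarrow{\ \sim\ }\{\xi\in K_3^\times:\mathrm{Tr}_{K_3/F}(\xi)=1\}.$$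
   Context: A quadratic étale $F$-algebra is a separable quadratic field extension of $F$ or $F\oplus F$. A quaternion embedding of $(K_1,K_2)$ is a triple $(B,\alpha_1,\alpha_2)$ with $B$ a quaternion algebra (central simple of dimension $4$) over $F$ and $\alpha_i:K_i\to B$ $F$-algebra embeddings; isomorphisms of triples are $F$-algebra isomorphisms of the quaternion algebras compatible with the embeddings. It is regular if $\alpha_1(K_1)\cup\alpha_2(K_2)$ generates $B$ as an $F$-algebra. The element $\xi$ defining $\mathrm{inv}$ exists, is unique, and has trace $1$. *)

theory Defs
  imports "HOL-Algebra.Algebra" "HOL-Library.Equipollence"
begin

section \<open>Algebras over a field\<close>

text \<open>The library locale \<open>algebra\<close> covers commutative algebras only.\<close>

locale assoc_algebra = module + M?: ring M +
  assumes smult_mult_left: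
      "\<lbrakk>a \<in> carrier R; x \<in> carrier M; y \<in> carrier M\<rbrakk> \<Longrightarrow>
        (a \<odot>\<^bsub>M\<^esub> x) \<otimes>\<^bsub>M\<^esub> y = a \<odot>\<^bsub>M\<^esub> (x \<otimes>\<^bsub>M\<^esub> y)"
    and smult_mult_right:
      "\<lbrakk>a \<in> carrier R; x \<in> carrier M; y \<in> carrier M\<rbrakk> \<Longrightarrow>
        x \<otimes>\<^bsub>M\<^esub> (a \<odot>\<^bsub>M\<^esub> y) = a \<odot>\<^bsub>M\<^esub> (x \<otimes>\<^bsub>M\<^esub> y)"

definition alg_hom :: "('f, 'r) ring_scheme \<Rightarrow> ('f, 'a, 's) module_scheme \<Rightarrow>
    ('f, 'b, 't) module_scheme \<Rightarrow> ('a \<Rightarrow> 'b) set" where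
  "alg_hom F A B = {h \<in> ring_hom A B.
     \<forall>c \<in> carrier F. \<forall>x \<in> carrier A. h (c \<odot>\<^bsub>A\<^esub> x) = c \<odot>\<^bsub>B\<^esub> h x}"

definition alg_iso :: "('f, 'r) ring_scheme \<Rightarrow> ('f, 'a, 's) module_scheme \<Rightarrow>
    ('f, 'b, 't) module_scheme \<Rightarrow> ('a \<Rightarrow> 'b) set" where
  "alg_iso F A B = {h \<in> alg_hom F A B. bij_betw h (carrier A) (carrier B)}"

text \<open>The image \<open>F \<cdot> 1\<close> of \<open>F\<close> in an algebra. It is what the library notions for embedded
  algebras (\<open>dimension\<close>, \<open>independent\<close>, \<open>Span\<close>, \<open>Irr\<close>) take as their base field.\<close>

definition scalars :: "('f, 'r) ring_scheme \<Rightarrow> ('f, 'a, 's) module_scheme \<Rightarrow> 'a set" where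
  "scalars F A = (\<lambda>c. c \<odot>\<^bsub>A\<^esub> \<one>\<^bsub>A\<^esub>) ` carrier F"

definition has_dim :: "('f, 'r) ring_scheme \<Rightarrow> ('f, 'a, 's) module_scheme \<Rightarrow> nat \<Rightarrow> bool" where
  "has_dim F A n \<longleftrightarrow> ring.dimension A n (scalars F A) (carrier A)"

definition alg_generate :: "('f, 'r) ring_scheme \<Rightarrow> ('f, 'a, 's) module_scheme \<Rightarrow> 'a set \<Rightarrow> 'a set"
  where "alg_generate F A S = generate_ring A (scalars F A \<union> S)"

text \<open>The trace \<open>Tr\<^bsub>A/F\<^esub>(x)\<close> of a finite-dimensional algebra: the trace of the matrix \<open>m\<close> of
  multiplication by \<open>x\<close> with respect to any basis \<open>us\<close>.\<close>

definition alg_trace :: "('f, 'r) ring_scheme \<Rightarrow> ('f, 'a, 's) module_scheme \<Rightarrow> 'a \<Rightarrow> 'f" where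
  "alg_trace F A x = (THE t. \<exists>us m.
     ring.independent A (scalars F A) us \<and> ring.Span A (scalars F A) us = carrier A \<and>
     (\<forall>i < length us. \<forall>j < length us. m i j \<in> carrier F) \<and>
     (\<forall>j < length us. x \<otimes>\<^bsub>A\<^esub> (us ! j) = (\<Oplus>\<^bsub>A\<^esub>i \<in> {..<length us}. m i j \<odot>\<^bsub>A\<^esub> (us ! i))) \<and>
     t = (\<Oplus>\<^bsub>F\<^esub>i \<in> {..<length us}. m i i))"


section \<open>Quadratic etale algebras\<close>

definition direct_sum_alg :: "'f ring \<Rightarrow> ('f, 'f \<times> 'f) module" where
  "direct_sum_alg F = ring.extend (RDirProd F F)
     (module.fields (\<lambda>c v. (c \<otimes>\<^bsub>F\<^esub> fst v, c \<otimes>\<^bsub>F\<^esub> snd v)))"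

text \<open>A quadratic extension field \<open>K\<close> is a splitting field of the minimal polynomial of each of its
  elements outside \<open>F\<close>, so that multiple roots of minimal polynomials need only be excluded
  in \<open>K\<close> itself.\<close>

definition separable_quadratic_field :: "'f ring \<Rightarrow> ('f, 'k) module \<Rightarrow> bool" where
  "separable_quadratic_field F K \<longleftrightarrow> field K \<and> has_dim F K 2 \<and>
     (\<forall>x \<in> carrier K. \<forall>y \<in> carrier K. ring.alg_mult K (ring.Irr K (scalars F K) x) y \<le> 1)"

definition quadratic_etale :: "'f ring \<Rightarrow> ('f, 'k) module \<Rightarrow> bool" where
  "quadratic_etale F K \<longleftrightarrow> algebra F K \<and>
     (separable_quadratic_field F K \<or> alg_iso F K (direct_sum_alg F) \<noteq> {})"

definition nontrivial_automorphism :: "'f ring \<Rightarrow> ('f, 'k) module \<Rightarrow> ('k \<Rightarrow> 'k) \<Rightarrow> bool" where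
  "nontrivial_automorphism F K \<sigma> \<longleftrightarrow> \<sigma> \<in> alg_iso F K K \<and> (\<exists>x \<in> carrier K. \<sigma> x \<noteq> x)"


section \<open>Tensor products of commutative algebras\<close>

text \<open>\<open>monoid_alg F G\<close> is the algebra \<open>F[G]\<close> of finitely supported functions on a monoid \<open>G\<close>, with
  convolution product; \<open>delta F p\<close> is its basis element at \<open>p\<close>.\<close>

definition support :: "('f, 'r) ring_scheme \<Rightarrow> ('p \<Rightarrow> 'f) \<Rightarrow> 'p set" where
  "support F f = {p. f p \<noteq> \<zero>\<^bsub>F\<^esub>}"

definition delta :: "('f, 'r) ring_scheme \<Rightarrow> 'p \<Rightarrow> 'p \<Rightarrow> 'f" where
  "delta F p = (\<lambda>q. if q = p then \<one>\<^bsub>F\<^esub> else \<zero>\<^bsub>F\<^esub>)"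

definition monoid_alg :: "('f, 'r) ring_scheme \<Rightarrow> ('p, 's) monoid_scheme \<Rightarrow> ('f, 'p \<Rightarrow> 'f) module" where
  "monoid_alg F G = \<lparr>
     carrier = {f. range f \<subseteq> carrier F \<and> finite (support F f) \<and> support F f \<subseteq> carrier G},
     monoid.mult = (\<lambda>f g p. \<Oplus>\<^bsub>F\<^esub>s \<in> {s \<in> support F f \<times> support F g. fst s \<otimes>\<^bsub>G\<^esub> snd s = p}.
       f (fst s) \<otimes>\<^bsub>F\<^esub> g (snd s)),
     one = delta F \<one>\<^bsub>G\<^esub>,
     ring.zero = (\<lambda>p. \<zero>\<^bsub>F\<^esub>),
     add = (\<lambda>f g p. f p \<oplus>\<^bsub>F\<^esub> g p),
     smult = (\<lambda>c f p. c \<otimes>\<^bsub>F\<^esub> f p)\<rparr>"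

text \<open>\<open>K\<^sub>1 \<otimes>\<^sub>F K\<^sub>2\<close> is the free \<open>F\<close>-module on \<open>K\<^sub>1 \<times> K\<^sub>2\<close>, which is the algebra of the multiplicative
  monoid \<open>K\<^sub>1 \<times> K\<^sub>2\<close>, modulo the relations of bilinearity. Multiplication by a basis element maps
  these relations to relations of the same kind, so that the ideal they generate is their span.\<close>

abbreviation free_alg :: "('f, 'r) ring_scheme \<Rightarrow> ('f, 'k1, 's) module_scheme \<Rightarrow>
    ('f, 'k2, 't) module_scheme \<Rightarrow> ('f, 'k1 \<times> 'k2 \<Rightarrow> 'f) module" where
  "free_alg F K1 K2 \<equiv> monoid_alg F (K1 \<times>\<times> K2)"

definition bilinear_relations :: "('f, 'r) ring_scheme \<Rightarrow> ('f, 'k1, 's) module_scheme \<Rightarrow>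
    ('f, 'k2, 't) module_scheme \<Rightarrow> ('k1 \<times> 'k2 \<Rightarrow> 'f) set" where
  "bilinear_relations F K1 K2 = (let A = free_alg F K1 K2 in
     {delta F (x \<oplus>\<^bsub>K1\<^esub> x', y) \<ominus>\<^bsub>A\<^esub> (delta F (x, y) \<oplus>\<^bsub>A\<^esub> delta F (x', y)) | x x' y.
        x \<in> carrier K1 \<and> x' \<in> carrier K1 \<and> y \<in> carrier K2} \<union>
     {delta F (x, y \<oplus>\<^bsub>K2\<^esub> y') \<ominus>\<^bsub>A\<^esub> (delta F (x, y) \<oplus>\<^bsub>A\<^esub> delta F (x, y')) | x y y'.
        x \<in> carrier K1 \<and> y \<in> carrier K2 \<and> y' \<in> carrier K2} \<union>
     {delta F (c \<odot>\<^bsub>K1\<^esub> x, y) \<ominus>\<^bsub>A\<^esub> c \<odot>\<^bsub>A\<^esub> delta F (x, y) | c x y.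
        c \<in> carrier F \<and> x \<in> carrier K1 \<and> y \<in> carrier K2} \<union>
     {delta F (x, c \<odot>\<^bsub>K2\<^esub> y) \<ominus>\<^bsub>A\<^esub> c \<odot>\<^bsub>A\<^esub> delta F (x, y) | c x y.
        c \<in> carrier F \<and> x \<in> carrier K1 \<and> y \<in> carrier K2})"

definition tensor_ideal :: "('f, 'r) ring_scheme \<Rightarrow> ('f, 'k1, 's) module_scheme \<Rightarrow>
    ('f, 'k2, 't) module_scheme \<Rightarrow> ('k1 \<times> 'k2 \<Rightarrow> 'f) set" where
  "tensor_ideal F K1 K2 = Idl\<^bsub>free_alg F K1 K2\<^esub> (bilinear_relations F K1 K2)"

definition tensor :: "('f, 'r) ring_scheme \<Rightarrow> ('f, 'k1, 's) module_scheme \<Rightarrow>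
    ('f, 'k2, 't) module_scheme \<Rightarrow> ('f, ('k1 \<times> 'k2 \<Rightarrow> 'f) set) module" where
  "tensor F K1 K2 = (let A = free_alg F K1 K2; I = tensor_ideal F K1 K2 in
     ring.extend (A Quot I) (module.fields (\<lambda>c C. \<Union>f \<in> C. I +>\<^bsub>A\<^esub> (c \<odot>\<^bsub>A\<^esub> f))))"

definition pure_tensor :: "('f, 'r) ring_scheme \<Rightarrow> ('f, 'k1, 's) module_scheme \<Rightarrow>
    ('f, 'k2, 't) module_scheme \<Rightarrow> 'k1 \<Rightarrow> 'k2 \<Rightarrow> ('k1 \<times> 'k2 \<Rightarrow> 'f) set" where
  "pure_tensor F K1 K2 x y = tensor_ideal F K1 K2 +>\<^bsub>free_alg F K1 K2\<^esub> delta F (x, y)"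

text \<open>The linear map \<open>K\<^sub>1 \<otimes>\<^sub>F K\<^sub>2 \<rightarrow> M\<close> with \<open>x \<otimes> y \<mapsto> \<beta> x y\<close> induced by a bilinear map \<open>\<beta>\<close>: the
  linear extension of \<open>\<beta>\<close> to the free module is constant on each coset.\<close>

definition tensor_lift :: "('f, 'r) ring_scheme \<Rightarrow> ('f, 'm, 's) module_scheme \<Rightarrow>
    ('k1 \<Rightarrow> 'k2 \<Rightarrow> 'm) \<Rightarrow> ('k1 \<times> 'k2 \<Rightarrow> 'f) set \<Rightarrow> 'm" where
  "tensor_lift F M \<beta> C =
     the_elem ((\<lambda>f. \<Oplus>\<^bsub>M\<^esub>p \<in> support F f. f p \<odot>\<^bsub>M\<^esub> \<beta> (fst p) (snd p)) ` C)"

definition tau3 :: "'f ring \<Rightarrow> ('f, 'k1) module \<Rightarrow> ('f, 'k2) module \<Rightarrow> ('k1 \<Rightarrow> 'k1) \<Rightarrow> ('k2 \<Rightarrow> 'k2) \<Rightarrow>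
    ('k1 \<times> 'k2 \<Rightarrow> 'f) set \<Rightarrow> ('k1 \<times> 'k2 \<Rightarrow> 'f) set" where
  "tau3 F K1 K2 \<sigma>1 \<sigma>2 =
     tensor_lift F (tensor F K1 K2) (\<lambda>x y. pure_tensor F K1 K2 (\<sigma>1 x) (\<sigma>2 y))"

definition K3 :: "'f ring \<Rightarrow> ('f, 'k1) module \<Rightarrow> ('f, 'k2) module \<Rightarrow> ('k1 \<Rightarrow> 'k1) \<Rightarrow> ('k2 \<Rightarrow> 'k2) \<Rightarrow>
    ('f, ('k1 \<times> 'k2 \<Rightarrow> 'f) set) module" where
  "K3 F K1 K2 \<sigma>1 \<sigma>2 = (tensor F K1 K2)
     \<lparr>carrier := {x \<in> carrier (tensor F K1 K2). tau3 F K1 K2 \<sigma>1 \<sigma>2 x = x}\<rparr>"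


section \<open>Quaternion algebras\<close>

definition central_simple :: "'f ring \<Rightarrow> ('f, 'b) module \<Rightarrow> bool" where
  "central_simple F B \<longleftrightarrow> assoc_algebra F B \<and> \<one>\<^bsub>B\<^esub> \<noteq> \<zero>\<^bsub>B\<^esub> \<and>
     {z \<in> carrier B. \<forall>x \<in> carrier B. z \<otimes>\<^bsub>B\<^esub> x = x \<otimes>\<^bsub>B\<^esub> z} = scalars F B \<and>
     (\<forall>I. ideal I B \<longrightarrow> I = {\<zero>\<^bsub>B\<^esub>} \<or> I = carrier B)"

definition quaternion_algebra :: "'f ring \<Rightarrow> ('f, 'b) module \<Rightarrow> bool" where
  "quaternion_algebra F B \<longleftrightarrow> central_simple F B \<and> has_dim F B 4"

text \<open>The standard involution \<open>x \<mapsto> x\<^sup>*\<close> of a quaternion algebra is its only \<open>F\<close>-linear involutive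
  antiautomorphism with \<open>x x\<^sup>* \<in> F\<close> for all \<open>x\<close>, and the reduced norm is \<open>Nrd(x) = x x\<^sup>*\<close>.\<close>

definition standard_involution :: "'f ring \<Rightarrow> ('f, 'b) module \<Rightarrow> ('b \<Rightarrow> 'b) \<Rightarrow> bool" where
  "standard_involution F B J \<longleftrightarrow>
     J \<in> carrier B \<rightarrow> carrier B \<and> J \<one>\<^bsub>B\<^esub> = \<one>\<^bsub>B\<^esub> \<and>
     (\<forall>x \<in> carrier B. \<forall>y \<in> carrier B. J (x \<oplus>\<^bsub>B\<^esub> y) = J x \<oplus>\<^bsub>B\<^esub> J y) \<and>
     (\<forall>c \<in> carrier F. \<forall>x \<in> carrier B. J (c \<odot>\<^bsub>B\<^esub> x) = c \<odot>\<^bsub>B\<^esub> J x) \<and>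
     (\<forall>x \<in> carrier B. \<forall>y \<in> carrier B. J (x \<otimes>\<^bsub>B\<^esub> y) = J y \<otimes>\<^bsub>B\<^esub> J x) \<and>
     (\<forall>x \<in> carrier B. J (J x) = x) \<and>
     (\<forall>x \<in> carrier B. x \<otimes>\<^bsub>B\<^esub> J x \<in> scalars F B)"

definition reduced_norm :: "'f ring \<Rightarrow> ('f, 'b) module \<Rightarrow> 'b \<Rightarrow> 'f" where
  "reduced_norm F B x = (THE n. n \<in> carrier F \<and>
     (\<exists>J. standard_involution F B J \<and> x \<otimes>\<^bsub>B\<^esub> J x = n \<odot>\<^bsub>B\<^esub> \<one>\<^bsub>B\<^esub>))"


section \<open>Quaternion embeddings\<close>

type_synonym ('f, 'k1, 'k2, 'b) embedding_triple =
  "('f, 'b) module \<times> ('k1 \<Rightarrow> 'b) \<times> ('k2 \<Rightarrow> 'b)"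

definition quaternion_embeddings :: "'f ring \<Rightarrow> ('f, 'k1) module \<Rightarrow> ('f, 'k2) module \<Rightarrow>
    ('f, 'k1, 'k2, 'b) embedding_triple set" where
  "quaternion_embeddings F K1 K2 = {(B, \<alpha>1, \<alpha>2). quaternion_algebra F B \<and>
     \<alpha>1 \<in> alg_hom F K1 B \<and> inj_on \<alpha>1 (carrier K1) \<and>
     \<alpha>2 \<in> alg_hom F K2 B \<and> inj_on \<alpha>2 (carrier K2)}"

definition regular_embeddings :: "'f ring \<Rightarrow> ('f, 'k1) module \<Rightarrow> ('f, 'k2) module \<Rightarrow>
    ('f, 'k1, 'k2, 'b) embedding_triple set" where
  "regular_embeddings F K1 K2 = {(B, \<alpha>1, \<alpha>2) \<in> quaternion_embeddings F K1 K2.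
     alg_generate F B (\<alpha>1 ` carrier K1 \<union> \<alpha>2 ` carrier K2) = carrier B}"

definition embedding_iso :: "'f ring \<Rightarrow> ('f, 'k1) module \<Rightarrow> ('f, 'k2) module \<Rightarrow>
    (('f, 'k1, 'k2, 'b) embedding_triple \<times> ('f, 'k1, 'k2, 'b) embedding_triple) set" where
  "embedding_iso F K1 K2 = {((B, \<alpha>1, \<alpha>2), (B', \<alpha>1', \<alpha>2')).
     (B, \<alpha>1, \<alpha>2) \<in> quaternion_embeddings F K1 K2 \<and>
     (B', \<alpha>1', \<alpha>2') \<in> quaternion_embeddings F K1 K2 \<and>
     (\<exists>\<phi> \<in> alg_iso F B B'. (\<forall>x \<in> carrier K1. \<phi> (\<alpha>1 x) = \<alpha>1' x) \<and>
       (\<forall>y \<in> carrier K2. \<phi> (\<alpha>2 y) = \<alpha>2' y))}"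

text \<open>Isomorphism classes of algebras whose elements are drawn from the type \<open>'b\<close>. As soon as \<open>'b\<close>
  has at least as many elements as \<open>F\<^sup>4\<close>, every quaternion algebra over \<open>F\<close>, on whatever type,
  is isomorphic to one on \<open>'b\<close>.\<close>

definition Q_reg :: "'f ring \<Rightarrow> ('f, 'k1) module \<Rightarrow> ('f, 'k2) module \<Rightarrow>
    ('f, 'k1, 'k2, 'b) embedding_triple set set" where
  "Q_reg F K1 K2 = regular_embeddings F K1 K2 // embedding_iso F K1 K2"

definition is_quat_inv :: "'f ring \<Rightarrow> ('f, 'k1) module \<Rightarrow> ('f, 'k2) module \<Rightarrow>
    ('k1 \<Rightarrow> 'k1) \<Rightarrow> ('k2 \<Rightarrow> 'k2) \<Rightarrow> ('f, 'k1, 'k2, 'b) embedding_triple \<Rightarrow>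
    ('k1 \<times> 'k2 \<Rightarrow> 'f) set \<Rightarrow> bool" where
  "is_quat_inv F K1 K2 \<sigma>1 \<sigma>2 = (\<lambda>(B, \<alpha>1, \<alpha>2) \<xi>.
     let K = tensor F K1 K2; \<alpha> = tensor_lift F B (\<lambda>x y. \<alpha>1 x \<otimes>\<^bsub>B\<^esub> \<alpha>2 y) in
     \<xi> \<in> carrier (K3 F K1 K2 \<sigma>1 \<sigma>2) \<and>
     (\<forall>x \<in> carrier K. reduced_norm F B (\<alpha> x) =
        alg_trace F (K3 F K1 K2 \<sigma>1 \<sigma>2) (\<xi> \<otimes>\<^bsub>K\<^esub> (x \<otimes>\<^bsub>K\<^esub> tau3 F K1 K2 \<sigma>1 \<sigma>2 x))))"

definition quat_inv :: "'f ring \<Rightarrow> ('f, 'k1) module \<Rightarrow> ('f, 'k2) module \<Rightarrow>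
    ('k1 \<Rightarrow> 'k1) \<Rightarrow> ('k2 \<Rightarrow> 'k2) \<Rightarrow> ('f, 'k1, 'k2, 'b) embedding_triple \<Rightarrow>
    ('k1 \<times> 'k2 \<Rightarrow> 'f) set" where
  "quat_inv F K1 K2 \<sigma>1 \<sigma>2 T = (THE \<xi>. is_quat_inv F K1 K2 \<sigma>1 \<sigma>2 T \<xi>)"

definition quat_inv_class :: "'f ring \<Rightarrow> ('f, 'k1) module \<Rightarrow> ('f, 'k2) module \<Rightarrow>
    ('k1 \<Rightarrow> 'k1) \<Rightarrow> ('k2 \<Rightarrow> 'k2) \<Rightarrow> ('f, 'k1, 'k2, 'b) embedding_triple set \<Rightarrow>
    ('k1 \<times> 'k2 \<Rightarrow> 'f) set" where
  "quat_inv_class F K1 K2 \<sigma>1 \<sigma>2 C = the_elem (quat_inv F K1 K2 \<sigma>1 \<sigma>2 ` C)"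

end

theory Submission
  imports Defs
begin

text \<open>Write \<open>K\<^sub>i = F[x]\<close> with \<open>x\<^sup>2 = t\<^sub>i x - n\<^sub>i\<close>, and let \<open>a\<close>, \<open>b\<close> be the images of the two generators in
  a regular quaternion embedding. The element \<open>s = a b + b\<^sup>* a\<^sup>*\<close> commutes with \<open>a\<close> and \<open>b\<close>, so it is a
  scalar; hence \<open>1, a, b, ab\<close> is a basis whose multiplication table depends only on \<open>s\<close>, and the
  isomorphism class of the embedding is determined by \<open>s\<close>. Conversely the algebra with this table is
  central simple if and only if \<open>s\<^sup>2 - t\<^sub>3 s + n\<^sub>3\<close>, which is the square of \<open>a b - b a\<close>, does not vanish;
  here \<open>t\<^sub>3\<close>, \<open>n\<^sub>3\<close> are the trace and norm of a generator \<open>c\<close> of \<open>K\<^sub>3\<close>. Comparing reduced norms,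
  the invariant is the element \<open>\<xi>\<close> with \<open>Tr(\<xi>) = 1\<close> and \<open>Tr(\<xi> c) = s\<close>, and for it
  \<open>s\<^sup>2 - t\<^sub>3 s + n\<^sub>3 = - (t\<^sub>3\<^sup>2 - 4 n\<^sub>3) N(\<xi>)\<close>, so that units correspond to quaternion algebras.\<close>

text \<open>Characteristic two is included, so squares are not completed: a quadratic algebra keeps
  a trace and a norm coefficient, and separability appears as t^2 - 4 n being nonzero. For the same
  reason the fixed algebra is generated by c = a b + a' b' with a' = t1 - a and b' = t2 - b; its
  conjugate is a b' + a' b, and 1, c is a basis in every characteristic. Both sides of the equation
  defining the invariant involve one pair of quadratic forms. For z = z0 + z1 a + z2 b + z3 ab there
  are N0 and N1 = z0 z3 - z1 z2 such that z tau(z) = N0 + N1 c in K, while the reduced norm is N0 +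
  s N1. The equation becomes N0 Tr(\<xi>) + N1 Tr(\<xi> c) = N0 + s N1, and two test values of z
  separate the coefficients. The trace form in the basis 1, c has determinant t3^2 - 4 n3, the
  product of the two given discriminants, so each s has exactly one \<xi>. The tensor product is a
  quotient of an enormous free module; none of this is a computation before it is identified with a
  model on quadruples.\<close>

section \<open>Polynomial identities in commutative rings given by carriers\<close>

text \<open>The product of all commutative rings on a type is a type class ring that maps onto each of
  them, so that polynomial identities can be proved with the type class methods. The integer
  component only ensures \<open>0 \<noteq> 1\<close>.\<close>

typedef 'f ring_family =
  "{p :: ('f ring \<Rightarrow> 'f) \<times> int. \<forall>R. if cring R then fst p R \<in> carrier R else fst p R = undefined}"
  by (rule exI[of _ "(\<lambda>R. if cring R then \<zero>\<^bsub>R\<^esub> else undefined, 0)"])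
    (simp add: cring.cring_simprules)

setup_lifting type_definition_ring_family

instantiation ring_family :: (type) comm_ring_1
begin

lift_definition zero_ring_family :: "'a ring_family"
  is "(\<lambda>R. if cring R then \<zero>\<^bsub>R\<^esub> else undefined, 0)"
  by (simp add: cring.cring_simprules)

lift_definition one_ring_family :: "'a ring_family"
  is "(\<lambda>R. if cring R then \<one>\<^bsub>R\<^esub> else undefined, 1)"
  by (simp add: cring.cring_simprules)

lift_definition plus_ring_family :: "'a ring_family \<Rightarrow> 'a ring_family \<Rightarrow> 'a ring_family"
  is "\<lambda>p q. (\<lambda>R. if cring R then fst p R \<oplus>\<^bsub>R\<^esub> fst q R else undefined, snd p + snd q)"
  by (simp add: cring.cring_simprules)

lift_definition times_ring_family :: "'a ring_family \<Rightarrow> 'a ring_family \<Rightarrow> 'a ring_family"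
  is "\<lambda>p q. (\<lambda>R. if cring R then fst p R \<otimes>\<^bsub>R\<^esub> fst q R else undefined, snd p * snd q)"
  by (simp add: cring.cring_simprules)

lift_definition uminus_ring_family :: "'a ring_family \<Rightarrow> 'a ring_family"
  is "\<lambda>p. (\<lambda>R. if cring R then \<ominus>\<^bsub>R\<^esub> fst p R else undefined, - snd p)"
  by (simp add: cring.cring_simprules)

definition minus_ring_family :: "'a ring_family \<Rightarrow> 'a ring_family \<Rightarrow> 'a ring_family" where
  "minus_ring_family x y = x + - y"

instance
proof
  fix a b c :: "'a ring_family"
  show "a * b * c = a * (b * c)"
    by transfer (simp add: fun_eq_iff cring.cring_simprules)
  show "a * b = b * a"
    by transfer (simp add: fun_eq_iff cring.cring_simprules)
  show "1 * a = a"
    by transfer (auto simp: fun_eq_iff prod_eq_iff cring.cring_simprules)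
  show "a + b + c = a + (b + c)"
    by transfer (simp add: fun_eq_iff cring.cring_simprules)
  show "a + b = b + a"
    by transfer (simp add: fun_eq_iff cring.cring_simprules)
  show "0 + a = a"
    by transfer (auto simp: fun_eq_iff prod_eq_iff cring.cring_simprules)
  show "- a + a = 0"
    by transfer (simp add: fun_eq_iff cring.cring_simprules)
  show "a - b = a + - b"
    by (fact minus_ring_family_def)
  show "(a + b) * c = a * c + b * c"
    by transfer (simp add: fun_eq_iff cring.cring_simprules algebra_simps)
  show "(0 :: 'a ring_family) \<noteq> 1"
    by transfer simp
qed

end

text \<open>The families are indexed by plain ring records, so a ring record with further fields is
  looked up through its truncation.\<close>

lift_definition component :: "('f, 'm) ring_scheme \<Rightarrow> 'f ring_family \<Rightarrow> 'f"
  is "\<lambda>R p. fst p (ring.truncate R)" .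

lemma (in cring) cring_truncate: "cring (ring.truncate R)"
proof (rule cringI)
  show "abelian_group (ring.truncate R)"
    by (rule abelian_groupI) (auto simp: ring.defs cring_simprules intro!: bexI[of _ "\<ominus> x" for x])
  show "comm_monoid (ring.truncate R)"
    by (rule comm_monoidI) (auto simp: ring.defs cring_simprules)
qed (auto simp: ring.defs cring_simprules)

context cring
begin

text \<open>The equations are oriented so that simplification collects a whole term into
  \<open>component R\<close> of a single class ring expression, where \<open>algebra_simps\<close>
  applies.\<close>

lemma component_simps:
  "component R x \<in> carrier R"
  "\<zero> = component R 0"
  "\<one> = component R 1"
  "component R x \<oplus> component R y = component R (x + y)"
  "component R x \<otimes> component R y = component R (x * y)"
  "\<ominus> component R x = component R (- x)"
  "component R x \<ominus> component R y = component R (x - y)"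
proof -
  note tr = cring_truncate
  have tr_simps: "carrier (ring.truncate S) = carrier S" "\<zero>\<^bsub>ring.truncate S\<^esub> = \<zero>\<^bsub>S\<^esub>"
    "\<one>\<^bsub>ring.truncate S\<^esub> = \<one>\<^bsub>S\<^esub>" "add (ring.truncate S) = add S"
    "monoid.mult (ring.truncate S) = monoid.mult S" for S :: "('a, 'b) ring_scheme"
    by (auto simp: ring.defs)
  show closed: "component R x \<in> carrier R" for x
    using tr Rep_ring_family[of x] tr_simps(1)[of R] by (auto simp: component.rep_eq)
  show zero: "\<zero> = component R 0"
    using tr by transfer (simp add: tr_simps)
  show "\<one> = component R 1"
    using tr by transfer (simp add: tr_simps)
  show add: "component R x \<oplus> component R y = component R (x + y)" for x y
    using tr by transfer (simp add: tr_simps)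
  show "component R x \<otimes> component R y = component R (x * y)"
    using tr by transfer (simp add: tr_simps)
  \<comment> \<open>Negation is not a record field but is determined by carrier and addition, so it
    is obtained from the uniqueness of additive inverses and not by transfer.\<close>
  have uminus: "\<ominus> component R x = component R (- x)" for x
    using closed by (intro sum_zero_eq_neg[symmetric]) (simp_all add: add zero)
  then show "\<ominus> component R x = component R (- x)" .
  show "component R x \<ominus> component R y = component R (x - y)"
    unfolding a_minus_def uminus add by simp
qed

text \<open>Surjectivity of the projection. Eliminating each variable with this rule turns an
  identity between elements of a carrier into one in the class ring.\<close>

lemma component_cases:
  assumes "x \<in> carrier R"
  obtains y where "x = component R y"
proof -
  \<comment> \<open>The family that is \<open>x\<close> at the given ring and zero at every other
    commutative ring.\<close>
  define p where "p = (\<lambda>S :: 'a ring. if cring S then if S = ring.truncate R then x else \<zero>\<^bsub>S\<^esub>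
    else undefined, 0 :: int)"
  have "p \<in> {p. \<forall>S. if cring S then fst p S \<in> carrier S else fst p S = undefined}"
    using assms by (auto simp: p_def cring.cring_simprules(2) ring.defs)
  then have "component R (Abs_ring_family p) = x"
    using cring_truncate by (simp add: component.rep_eq Abs_ring_family_inverse p_def)
  with that show ?thesis by metis
qed

end

section \<open>Algebras over a field\<close>

text \<open>Nontriviality makes the map from the base field into the algebra injective, so that
  \<open>scalars R M\<close> is a copy of the field and can serve as base field of the dimension
  theory.\<close>

locale field_algebra = assoc_algebra + field R +
  assumes one_not_zero_M: "\<one>\<^bsub>M\<^esub> \<noteq> \<zero>\<^bsub>M\<^esub>"
begin

lemma scalar_mult:
  assumes "c \<in> carrier R" "x \<in> carrier M"
  shows "(c \<odot>\<^bsub>M\<^esub> \<one>\<^bsub>M\<^esub>) \<otimes>\<^bsub>M\<^esub> x = c \<odot>\<^bsub>M\<^esub> x" "x \<otimes>\<^bsub>M\<^esub> (c \<odot>\<^bsub>M\<^esub> \<one>\<^bsub>M\<^esub>) = c \<odot>\<^bsub>M\<^esub> x"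
  using assms by (simp_all add: smult_mult_left smult_mult_right)

lemma smult_eq_zero:
  assumes "c \<in> carrier R" "x \<in> carrier M" "c \<odot>\<^bsub>M\<^esub> x = \<zero>\<^bsub>M\<^esub>" "x \<noteq> \<zero>\<^bsub>M\<^esub>"
  shows "c = \<zero>"
proof (rule ccontr)
  assume "c \<noteq> \<zero>"
  then have "c \<in> Units R" using assms field_Units by auto
  then have "x = (inv c \<otimes> c) \<odot>\<^bsub>M\<^esub> x" using assms by simp
  also have "\<dots> = inv c \<odot>\<^bsub>M\<^esub> (c \<odot>\<^bsub>M\<^esub> x)"
    using \<open>c \<in> Units R\<close> assms by (intro smult_assoc1) auto
  also have "\<dots> = \<zero>\<^bsub>M\<^esub>" using \<open>c \<in> Units R\<close> assms by (simp add: smult_r_null)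
  finally show False using assms by simp
qed

lemma scalars_inj:
  assumes "c \<in> carrier R" "d \<in> carrier R" "c \<odot>\<^bsub>M\<^esub> \<one>\<^bsub>M\<^esub> = d \<odot>\<^bsub>M\<^esub> \<one>\<^bsub>M\<^esub>"
  shows "c = d"
proof -
  have "(c \<ominus> d) \<odot>\<^bsub>M\<^esub> \<one>\<^bsub>M\<^esub> = \<zero>\<^bsub>M\<^esub>"
    using assms by (simp add: R.minus_eq smult_l_distr smult_l_minus M.r_neg)
  then have "c \<ominus> d = \<zero>" using assms one_not_zero_M by (intro smult_eq_zero) auto
  then show ?thesis using assms by simp
qed

text \<open>Entry point to the dimension theory, which is stated over a subfield of the ring. The
  inverse of a nonzero scalar is the image of the inverse in the field.\<close>

lemma scalars_subfield: "subfield (scalars R M) M"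
proof (intro subfieldI subcringI subringI)
  show "scalars R M \<subseteq> carrier M" by (auto simp: scalars_def)
  show "\<one>\<^bsub>M\<^esub> \<in> scalars R M" by (force simp: scalars_def)
  show "\<ominus>\<^bsub>M\<^esub> h \<in> scalars R M" if "h \<in> scalars R M" for h
    using that by (auto simp: scalars_def smult_l_minus[symmetric])
  show "h1 \<otimes>\<^bsub>M\<^esub> h2 \<in> scalars R M" "h1 \<oplus>\<^bsub>M\<^esub> h2 \<in> scalars R M" "h1 \<otimes>\<^bsub>M\<^esub> h2 = h2 \<otimes>\<^bsub>M\<^esub> h1"
    if h: "h1 \<in> scalars R M" "h2 \<in> scalars R M" for h1 h2
  proof -
    obtain c d where cd: "c \<in> carrier R" "d \<in> carrier R"
      "h1 = c \<odot>\<^bsub>M\<^esub> \<one>\<^bsub>M\<^esub>" "h2 = d \<odot>\<^bsub>M\<^esub> \<one>\<^bsub>M\<^esub>"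
      using h by (auto simp: scalars_def)
    have "h1 \<otimes>\<^bsub>M\<^esub> h2 = (c \<otimes> d) \<odot>\<^bsub>M\<^esub> \<one>\<^bsub>M\<^esub>" "h2 \<otimes>\<^bsub>M\<^esub> h1 = (d \<otimes> c) \<odot>\<^bsub>M\<^esub> \<one>\<^bsub>M\<^esub>"
      "h1 \<oplus>\<^bsub>M\<^esub> h2 = (c \<oplus> d) \<odot>\<^bsub>M\<^esub> \<one>\<^bsub>M\<^esub>"
      using cd by (simp_all add: scalar_mult smult_assoc1[symmetric] smult_l_distr R.m_comm)
    then show "h1 \<otimes>\<^bsub>M\<^esub> h2 \<in> scalars R M" "h1 \<oplus>\<^bsub>M\<^esub> h2 \<in> scalars R M"
      "h1 \<otimes>\<^bsub>M\<^esub> h2 = h2 \<otimes>\<^bsub>M\<^esub> h1"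
      using cd by (auto simp: scalars_def R.m_comm)
  qed
  show "Units (M\<lparr>carrier := scalars R M\<rparr>) = scalars R M - {\<zero>\<^bsub>M\<^esub>}"
  proof (intro equalityI subsetI)
    fix x assume "x \<in> Units (M\<lparr>carrier := scalars R M\<rparr>)"
    then obtain y where "x \<in> scalars R M" "y \<in> scalars R M" "y \<otimes>\<^bsub>M\<^esub> x = \<one>\<^bsub>M\<^esub>"
      by (auto simp: Units_def)
    then show "x \<in> scalars R M - {\<zero>\<^bsub>M\<^esub>}"
      using one_not_zero_M by (auto simp: scalars_def)
  next
    fix x assume "x \<in> scalars R M - {\<zero>\<^bsub>M\<^esub>}"
    then obtain c where c: "c \<in> carrier R" "x = c \<odot>\<^bsub>M\<^esub> \<one>\<^bsub>M\<^esub>" "x \<noteq> \<zero>\<^bsub>M\<^esub>"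
      by (auto simp: scalars_def)
    then have "c \<in> Units R" by (auto simp: field_Units smult_l_null)
    then have "inv c \<odot>\<^bsub>M\<^esub> \<one>\<^bsub>M\<^esub> \<otimes>\<^bsub>M\<^esub> x = \<one>\<^bsub>M\<^esub>" "x \<otimes>\<^bsub>M\<^esub> (inv c \<odot>\<^bsub>M\<^esub> \<one>\<^bsub>M\<^esub>) = \<one>\<^bsub>M\<^esub>"
      "inv c \<in> carrier R"
      using c by (auto simp: scalar_mult smult_assoc1[symmetric])
    then show "x \<in> Units (M\<lparr>carrier := scalars R M\<rparr>)"
      using c unfolding Units_def by (force simp: scalars_def)
  qed
qed

text \<open>\<open>combine\<close> takes its coefficients from the image of the field inside
  \<open>M\<close>; here they come from the field itself. The recursion runs over the vectors, so it
  is meaningful for coefficient lists of the same length.\<close>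

primrec lincomb :: "'a list \<Rightarrow> 'c list \<Rightarrow> 'c" where
  "lincomb cs [] = \<zero>\<^bsub>M\<^esub>"
| "lincomb cs (u # us) = hd cs \<odot>\<^bsub>M\<^esub> u \<oplus>\<^bsub>M\<^esub> lincomb (tl cs) us"

lemma combine_scalars:
  assumes "set cs \<subseteq> carrier R" "set us \<subseteq> carrier M" "length cs = length us"
  shows "M.combine (map (\<lambda>c. c \<odot>\<^bsub>M\<^esub> \<one>\<^bsub>M\<^esub>) cs) us = lincomb cs us"
  using assms(3,1,2) by (induction cs us rule: list_induct2) (simp_all add: scalar_mult)

lemma scalars_listE:
  assumes "set ks \<subseteq> scalars R M"
  obtains cs where "set cs \<subseteq> carrier R" "ks = map (\<lambda>c. c \<odot>\<^bsub>M\<^esub> \<one>\<^bsub>M\<^esub>) cs"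
proof -
  have "\<exists>cs. set cs \<subseteq> carrier R \<and> ks = map (\<lambda>c. c \<odot>\<^bsub>M\<^esub> \<one>\<^bsub>M\<^esub>) cs"
    using assms
  proof (induction ks)
    case (Cons k ks)
    then obtain c cs where "set cs \<subseteq> carrier R" "ks = map (\<lambda>c. c \<odot>\<^bsub>M\<^esub> \<one>\<^bsub>M\<^esub>) cs"
      "c \<in> carrier R" "k = c \<odot>\<^bsub>M\<^esub> \<one>\<^bsub>M\<^esub>"
      by (auto simp: scalars_def)
    then show ?case by (intro exI[of _ "c # cs"]) auto
  qed simp
  with that show ?thesis by blast
qed

lemma Span_eq_lincomb:
  assumes "set us \<subseteq> carrier M"
  shows "M.Span (scalars R M) us = {lincomb cs us | cs. length cs = length us \<and> set cs \<subseteq> carrier R}"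
proof -
  interpret K: subfield "scalars R M" M by (fact scalars_subfield)
  show ?thesis
    unfolding M.Span_eq_combine_set_length_version[OF scalars_subfield assms]
  proof (intro equalityI subsetI; clarify)
    fix ks assume "length ks = length us" "set ks \<subseteq> scalars R M"
    then obtain cs where "set cs \<subseteq> carrier R" "ks = map (\<lambda>c. c \<odot>\<^bsub>M\<^esub> \<one>\<^bsub>M\<^esub>) cs"
      using scalars_listE by blast
    then show "\<exists>cs. M.combine ks us = lincomb cs us \<and> length cs = length us \<and> set cs \<subseteq> carrier R"
      using combine_scalars assms \<open>length ks = length us\<close> by auto
  next
    fix cs assume "length cs = length us" "set cs \<subseteq> carrier R"
    then show "\<exists>ks. lincomb cs us = M.combine ks us \<and> length ks = length us \<and> set ks \<subseteq> scalars R M"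
      using combine_scalars assms
      by (intro exI[of _ "map (\<lambda>c. c \<odot>\<^bsub>M\<^esub> \<one>\<^bsub>M\<^esub>) cs"]) (auto simp: scalars_def)
  qed
qed

text \<open>Coefficients are moved between the field and its image in \<open>M\<close>; that a
  vanishing image forces a vanishing coefficient is \<open>smult_eq_zero\<close> for the unit
  vector.\<close>

lemma independent_iff_lincomb:
  assumes us: "set us \<subseteq> carrier M"
  shows "M.independent (scalars R M) us \<longleftrightarrow>
    (\<forall>cs. length cs = length us \<and> set cs \<subseteq> carrier R \<and> lincomb cs us = \<zero>\<^bsub>M\<^esub> \<longrightarrow> set cs \<subseteq> {\<zero>})"
proof (intro iffI allI impI; (elim conjE)?)
  fix cs
  assume ind: "M.independent (scalars R M) us" and cs: "length cs = length us" "set cs \<subseteq> carrier R"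
    "lincomb cs us = \<zero>\<^bsub>M\<^esub>"
  let ?ks = "map (\<lambda>c. c \<odot>\<^bsub>M\<^esub> \<one>\<^bsub>M\<^esub>) cs"
  have "set ?ks \<subseteq> scalars R M" "M.combine ?ks us = \<zero>\<^bsub>M\<^esub>"
    using cs us by (auto simp: scalars_def combine_scalars)
  from M.independent_imp_trivial_combine[OF scalars_subfield ind this]
  have "set ?ks \<subseteq> {\<zero>\<^bsub>M\<^esub>}" using cs by simp
  then show "set cs \<subseteq> {\<zero>}"
    using cs smult_eq_zero[OF _ _ _ one_not_zero_M] by (auto simp: subset_iff)
next
  assume *: "\<forall>cs. length cs = length us \<and> set cs \<subseteq> carrier R \<and> lincomb cs us = \<zero>\<^bsub>M\<^esub> \<longrightarrow> set cs \<subseteq> {\<zero>}"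
  show "M.independent (scalars R M) us"
  proof (rule ccontr)
    assume "\<not> M.independent (scalars R M) us"
    obtain ks where ks: "length ks = length us" "M.combine ks us = \<zero>\<^bsub>M\<^esub>" "set ks \<subseteq> scalars R M"
      "set ks \<noteq> {\<zero>\<^bsub>M\<^esub>}"
      by (rule M.dependent_imp_non_trivial_combine[OF scalars_subfield us
            \<open>\<not> M.independent (scalars R M) us\<close>])
    have "us \<noteq> []"
      using \<open>\<not> M.independent (scalars R M) us\<close> M.independent.li_Nil by auto
    obtain cs where cs: "set cs \<subseteq> carrier R" "ks = map (\<lambda>c. c \<odot>\<^bsub>M\<^esub> \<one>\<^bsub>M\<^esub>) cs"
      using scalars_listE[OF ks(3)] by blast
    then have "set cs \<subseteq> {\<zero>}"
      using * ks us combine_scalars by auto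
    then have "set ks \<subseteq> {\<zero>\<^bsub>M\<^esub>}" using cs by (auto simp: smult_l_null)
    with ks \<open>us \<noteq> []\<close> show False by (cases ks) auto
  qed
qed

lemma has_dimI:
  assumes "M.independent (scalars R M) us" "M.Span (scalars R M) us = carrier M" "length us = n"
  shows "has_dim R M n"
  using M.dimensionI[OF scalars_subfield] assms unfolding has_dim_def by metis

lemma basis_length:
  assumes "has_dim R M n" "M.independent (scalars R M) us" "M.Span (scalars R M) us = carrier M"
  shows "length us = n"
  using assms M.dimension_is_inj[OF scalars_subfield _ M.dimensionI[OF scalars_subfield]]
  unfolding has_dim_def by metis

text \<open>Dropping each vector that lies in the span of its successors keeps the span. The clause
  on equal lengths records that nothing was dropped, which is what a dimension count can
  exploit.\<close>

lemma exists_independent_sublist: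
  assumes "set us \<subseteq> carrier M"
  shows "\<exists>vs. set vs \<subseteq> carrier M \<and> M.independent (scalars R M) vs \<and> length vs \<le> length us \<and>
    M.Span (scalars R M) vs = M.Span (scalars R M) us \<and> (length vs = length us \<longrightarrow> vs = us)"
  using assms
proof (induction us)
  case Nil
  show ?case by (intro exI[of _ "[]"]) (simp add: M.independent.li_Nil)
next
  case (Cons u us)
  then obtain vs where vs: "set vs \<subseteq> carrier M" "M.independent (scalars R M) vs"
    "length vs \<le> length us" "M.Span (scalars R M) vs = M.Span (scalars R M) us"
    "length vs = length us \<Longrightarrow> vs = us"
    by auto
  have span: "M.Span (scalars R M) (u # us) = M.Span (scalars R M) (u # vs)"
    using vs(4) by simp
  show ?case
  proof (cases "u \<in> M.Span (scalars R M) vs")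
    case True
    then have "set (u # vs) \<subseteq> M.Span (scalars R M) vs"
      using M.Span_base_incl[OF scalars_subfield vs(1)] by simp
    from M.mono_Span_subset[OF scalars_subfield this vs(1)]
    have "M.Span (scalars R M) (u # vs) = M.Span (scalars R M) vs"
      using M.mono_Span[OF scalars_subfield vs(1)] Cons.prems by (intro equalityI) simp_all
    then show ?thesis
      using vs span by (intro exI[of _ vs]) (simp del: M.Span.simps)
  next
    case False
    then have "M.independent (scalars R M) (u # vs)"
      using vs Cons.prems by (intro M.independent.li_Cons) auto
    then show ?thesis
      using vs span Cons.prems by (intro exI[of _ "u # vs"]) (simp del: M.Span.simps)
  qed
qed

text \<open>A basis extracted from the list has \<open>n\<close> elements by invariance of
  dimension, so it is the whole list.\<close>

lemma spanning_list_independent: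
  assumes "has_dim R M n" "set us \<subseteq> carrier M" "M.Span (scalars R M) us = carrier M" "length us = n"
  shows "M.independent (scalars R M) us"
proof -
  obtain vs where vs: "M.independent (scalars R M) vs"
    "M.Span (scalars R M) vs = M.Span (scalars R M) us" "length vs = length us \<longrightarrow> vs = us"
    using exists_independent_sublist[OF assms(2)] by blast
  with assms(3) have "M.Span (scalars R M) vs = carrier M" by simp
  from basis_length[OF assms(1) vs(1) this] show ?thesis
    using vs assms(4) by simp
qed

end

text \<open>Transport of structure: \<open>M\<close> is only a record closed under its operations.
  Injectivity of \<open>g\<close> reduces every axiom to the one in \<open>A\<close>, and
  surjectivity supplies the additive inverses.\<close>

lemma field_algebra_pullback:
  assumes "field_algebra F A" and bij: "bij_betw g (carrier M) (carrier A)"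
    and closed: "\<zero>\<^bsub>M\<^esub> \<in> carrier M" "\<one>\<^bsub>M\<^esub> \<in> carrier M"
      "\<And>x y. x \<in> carrier M \<Longrightarrow> y \<in> carrier M \<Longrightarrow> x \<oplus>\<^bsub>M\<^esub> y \<in> carrier M"
      "\<And>x y. x \<in> carrier M \<Longrightarrow> y \<in> carrier M \<Longrightarrow> x \<otimes>\<^bsub>M\<^esub> y \<in> carrier M"
      "\<And>c x. c \<in> carrier F \<Longrightarrow> x \<in> carrier M \<Longrightarrow> c \<odot>\<^bsub>M\<^esub> x \<in> carrier M"
    and hom: "g \<zero>\<^bsub>M\<^esub> = \<zero>\<^bsub>A\<^esub>" "g \<one>\<^bsub>M\<^esub> = \<one>\<^bsub>A\<^esub>"
      "\<And>x y. x \<in> carrier M \<Longrightarrow> y \<in> carrier M \<Longrightarrow> g (x \<oplus>\<^bsub>M\<^esub> y) = g x \<oplus>\<^bsub>A\<^esub> g y"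
      "\<And>x y. x \<in> carrier M \<Longrightarrow> y \<in> carrier M \<Longrightarrow> g (x \<otimes>\<^bsub>M\<^esub> y) = g x \<otimes>\<^bsub>A\<^esub> g y"
      "\<And>c x. c \<in> carrier F \<Longrightarrow> x \<in> carrier M \<Longrightarrow> g (c \<odot>\<^bsub>M\<^esub> x) = c \<odot>\<^bsub>A\<^esub> g x"
  shows "field_algebra F M" "g \<in> alg_iso F M A"
proof -
  interpret A: field_algebra F A by fact
  have g: "x \<in> carrier M \<Longrightarrow> g x \<in> carrier A" for x
    using bij by (auto simp: bij_betw_def)
  have eqI: "x = y" if "g x = g y" "x \<in> carrier M" "y \<in> carrier M" for x y
    using that bij by (auto simp: bij_betw_def inj_on_def)
  note simps = closed hom g
  have M: "abelian_group M"
  proof (rule abelian_groupI)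
    fix x assume x: "x \<in> carrier M"
    then have "\<ominus>\<^bsub>A\<^esub> g x \<in> carrier A" using g by simp
    then obtain y where y: "y \<in> carrier M" "g y = \<ominus>\<^bsub>A\<^esub> g x"
      using bij by (metis bij_betw_imp_surj_on imageE)
    then show "\<exists>y\<in>carrier M. y \<oplus>\<^bsub>M\<^esub> x = \<zero>\<^bsub>M\<^esub>"
      using x by (intro bexI[of _ y] eqI) (simp_all add: simps A.M.l_neg)
  qed (auto intro!: eqI simp: simps A.M.add.m_assoc A.M.add.m_comm A.M.add.m_lcomm)
  show "field_algebra F M"
  proof (intro field_algebra.intro assoc_algebra.intro assoc_algebra_axioms.intro field_algebra_axioms.intro
      module.intro module_axioms.intro ringI)
    show "monoid M"
      by (rule monoidI) (auto intro!: eqI simp: simps A.M.m_assoc)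
    show "\<one>\<^bsub>M\<^esub> \<noteq> \<zero>\<^bsub>M\<^esub>"
      using A.one_not_zero_M hom(1,2) by auto
  qed (auto intro!: eqI A.R.is_cring M A.field_axioms simp: simps A.M.l_distr A.M.r_distr A.smult_mult_left
      A.smult_mult_right A.smult_l_distr A.smult_r_distr A.smult_assoc1)
  show "g \<in> alg_iso F M A"
    using bij by (auto simp: alg_iso_def alg_hom_def ring_hom_def simps)
qed

section \<open>Homomorphisms and isomorphisms of algebras\<close>

lemma alg_homD:
  assumes "h \<in> alg_hom F A B"
  shows "\<And>x. x \<in> carrier A \<Longrightarrow> h x \<in> carrier B"
    "\<And>x y. x \<in> carrier A \<Longrightarrow> y \<in> carrier A \<Longrightarrow> h (x \<otimes>\<^bsub>A\<^esub> y) = h x \<otimes>\<^bsub>B\<^esub> h y"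
    "\<And>x y. x \<in> carrier A \<Longrightarrow> y \<in> carrier A \<Longrightarrow> h (x \<oplus>\<^bsub>A\<^esub> y) = h x \<oplus>\<^bsub>B\<^esub> h y"
    "h \<one>\<^bsub>A\<^esub> = \<one>\<^bsub>B\<^esub>"
    "\<And>c x. c \<in> carrier F \<Longrightarrow> x \<in> carrier A \<Longrightarrow> h (c \<odot>\<^bsub>A\<^esub> x) = c \<odot>\<^bsub>B\<^esub> h x"
  using assms by (auto simp: alg_hom_def ring_hom_def)

lemma alg_isoD:
  assumes "h \<in> alg_iso F A B"
  shows "h \<in> alg_hom F A B" "bij_betw h (carrier A) (carrier B)" "inj_on h (carrier A)"
    "h ` carrier A = carrier B"
  using assms by (auto simp: alg_iso_def bij_betw_def)

lemma alg_hom_zero: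
  assumes "h \<in> alg_hom F A B" "ring A" "ring B"
  shows "h \<zero>\<^bsub>A\<^esub> = \<zero>\<^bsub>B\<^esub>"
  using assms ring_hom_zero[of h A B] by (simp add: alg_hom_def)

lemma alg_iso_comp:
  assumes "g \<in> alg_iso F A B" "h \<in> alg_iso F B C"
  shows "h \<circ> g \<in> alg_iso F A C"
  using alg_homD[OF alg_isoD(1)[OF assms(1)]] alg_homD[OF alg_isoD(1)[OF assms(2)]]
    bij_betw_trans[OF alg_isoD(2)[OF assms(1)] alg_isoD(2)[OF assms(2)]]
  by (auto simp: alg_iso_def alg_hom_def ring_hom_def)

lemma alg_iso_inv:
  assumes "h \<in> alg_iso F A B" "field_algebra F A"
  shows "inv_into (carrier A) h \<in> alg_iso F B A"
proof -
  interpret A: field_algebra F A by fact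
  note h = alg_homD[OF alg_isoD(1)[OF assms(1)]]
  note bij = alg_isoD(2,3)[OF assms(1)]
  have surj: "\<exists>x\<in>carrier A. y = h x" if "y \<in> carrier B" for y
    using bij(1) that by (auto simp: bij_betw_def)
  have inv: "inv_into (carrier A) h (h x) = x" if "x \<in> carrier A" for x
    using bij that by simp
  have "inv_into (carrier A) h \<in> alg_hom F B A"
    unfolding alg_hom_def ring_hom_def
    by (auto simp: inv h(2,3,5)[symmetric] dest!: surj) (metis A.M.one_closed h(4) inv)
  then show ?thesis
    using bij(1) by (simp add: alg_iso_def bij_betw_inv_into)
qed

lemma alg_iso_scalars:
  assumes "h \<in> alg_iso F A B" "field_algebra F A"
  shows "scalars F B = h ` scalars F A"
proof -
  interpret A: field_algebra F A by fact
  show ?thesis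
    using alg_homD(4,5)[OF alg_isoD(1)[OF assms(1)]] by (force simp: scalars_def image_iff)
qed

lemma alg_iso_has_dim:
  assumes "h \<in> alg_iso F A B" "field_algebra F A" "field_algebra F B" "has_dim F A n"
  shows "has_dim F B n"
proof -
  interpret A: field_algebra F A by fact
  interpret B: field_algebra F B by fact
  interpret h: ring_hom_ring A B h
    using alg_isoD(1)[OF assms(1)] by unfold_locales (simp add: alg_hom_def)
  show ?thesis
    using h.inj_hom_dimension[OF A.scalars_subfield B.one_not_zero_M alg_isoD(3)[OF assms(1)]]
      assms(4) alg_iso_scalars[OF assms(1,2)] alg_isoD(4)[OF assms(1)]
    by (simp add: has_dim_def)
qed

section \<open>Coordinate models\<close>

text \<open>\<open>quad_alg F t n\<close> is \<open>F[a]\<close> with \<open>a\<^sup>2 = t a - n\<close>, in coordinates with respect to \<open>1, a\<close>.\<close>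

definition quad_alg :: "'f ring \<Rightarrow> 'f \<Rightarrow> 'f \<Rightarrow> ('f, 'f \<times> 'f) module" where
  "quad_alg F t n = \<lparr>
     carrier = carrier F \<times> carrier F,
     monoid.mult = (\<lambda>(x0, x1) (y0, y1).
       (x0 \<otimes>\<^bsub>F\<^esub> y0 \<ominus>\<^bsub>F\<^esub> n \<otimes>\<^bsub>F\<^esub> (x1 \<otimes>\<^bsub>F\<^esub> y1),
        x0 \<otimes>\<^bsub>F\<^esub> y1 \<oplus>\<^bsub>F\<^esub> x1 \<otimes>\<^bsub>F\<^esub> y0 \<oplus>\<^bsub>F\<^esub> t \<otimes>\<^bsub>F\<^esub> (x1 \<otimes>\<^bsub>F\<^esub> y1))),
     one = (\<one>\<^bsub>F\<^esub>, \<zero>\<^bsub>F\<^esub>),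
     ring.zero = (\<zero>\<^bsub>F\<^esub>, \<zero>\<^bsub>F\<^esub>),
     add = (\<lambda>(x0, x1) (y0, y1). (x0 \<oplus>\<^bsub>F\<^esub> y0, x1 \<oplus>\<^bsub>F\<^esub> y1)),
     smult = (\<lambda>c (x0, x1). (c \<otimes>\<^bsub>F\<^esub> x0, c \<otimes>\<^bsub>F\<^esub> x1))\<rparr>"

type_synonym 'f quadruple = "'f \<times> 'f \<times> 'f \<times> 'f"

definition quadruple_add :: "'f ring \<Rightarrow> 'f quadruple \<Rightarrow> 'f quadruple \<Rightarrow> 'f quadruple" where
  "quadruple_add F = (\<lambda>(x0, x1, x2, x3) (y0, y1, y2, y3).
     (x0 \<oplus>\<^bsub>F\<^esub> y0, x1 \<oplus>\<^bsub>F\<^esub> y1, x2 \<oplus>\<^bsub>F\<^esub> y2, x3 \<oplus>\<^bsub>F\<^esub> y3))"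

definition quadruple_smult :: "'f ring \<Rightarrow> 'f \<Rightarrow> 'f quadruple \<Rightarrow> 'f quadruple" where
  "quadruple_smult F c = (\<lambda>(x0, x1, x2, x3).
     (c \<otimes>\<^bsub>F\<^esub> x0, c \<otimes>\<^bsub>F\<^esub> x1, c \<otimes>\<^bsub>F\<^esub> x2, c \<otimes>\<^bsub>F\<^esub> x3))"

text \<open>An algebra with basis \<open>1, a, b, ab\<close> and \<open>a\<^sup>2 = t a - n\<close> is determined by the left
  multiplication \<open>L\<close> by \<open>b\<close>.\<close>

definition lmult_a :: "'f ring \<Rightarrow> 'f \<Rightarrow> 'f \<Rightarrow> 'f quadruple \<Rightarrow> 'f quadruple" where
  "lmult_a F t n = (\<lambda>(y0, y1, y2, y3).
     (\<ominus>\<^bsub>F\<^esub> (n \<otimes>\<^bsub>F\<^esub> y1), y0 \<oplus>\<^bsub>F\<^esub> t \<otimes>\<^bsub>F\<^esub> y1, \<ominus>\<^bsub>F\<^esub> (n \<otimes>\<^bsub>F\<^esub> y3), y2 \<oplus>\<^bsub>F\<^esub> t \<otimes>\<^bsub>F\<^esub> y3))"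

definition biquad_alg :: "'f ring \<Rightarrow> 'f \<Rightarrow> 'f \<Rightarrow> ('f quadruple \<Rightarrow> 'f quadruple) \<Rightarrow>
    ('f, 'f quadruple) module" where
  "biquad_alg F t n L = \<lparr>
     carrier = carrier F \<times> carrier F \<times> carrier F \<times> carrier F,
     monoid.mult = (\<lambda>(x0, x1, x2, x3) y.
       quadruple_add F (quadruple_add F (quadruple_smult F x0 y) (quadruple_smult F x1 (lmult_a F t n y)))
         (quadruple_add F (quadruple_smult F x2 (L y)) (quadruple_smult F x3 (lmult_a F t n (L y))))),
     one = (\<one>\<^bsub>F\<^esub>, \<zero>\<^bsub>F\<^esub>, \<zero>\<^bsub>F\<^esub>, \<zero>\<^bsub>F\<^esub>),
     ring.zero = (\<zero>\<^bsub>F\<^esub>, \<zero>\<^bsub>F\<^esub>, \<zero>\<^bsub>F\<^esub>, \<zero>\<^bsub>F\<^esub>),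
     add = quadruple_add F,
     smult = quadruple_smult F\<rparr>"

text \<open>Left multiplication by b when b commutes with a and b^2 = t b - n. With it
  \<open>biquad_alg\<close> becomes the tensor product of two quadratic algebras.\<close>

definition commuting_b :: "'f ring \<Rightarrow> 'f \<Rightarrow> 'f \<Rightarrow> 'f quadruple \<Rightarrow> 'f quadruple" where
  "commuting_b F t n = (\<lambda>(y0, y1, y2, y3).
     (\<ominus>\<^bsub>F\<^esub> (n \<otimes>\<^bsub>F\<^esub> y2), \<ominus>\<^bsub>F\<^esub> (n \<otimes>\<^bsub>F\<^esub> y3), y0 \<oplus>\<^bsub>F\<^esub> t \<otimes>\<^bsub>F\<^esub> y2, y1 \<oplus>\<^bsub>F\<^esub> t \<otimes>\<^bsub>F\<^esub> y3))"

text \<open>This comes from \<open>b\<^sup>2 = t\<^sub>2 b - n\<^sub>2\<close> and \<open>b a = s - t\<^sub>1 t\<^sub>2 + t\<^sub>2 a + t\<^sub>1 b - a b\<close>; the latter says that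
  the trace of \<open>a b\<close> is \<open>s\<close>.\<close>

definition trace_b :: "'f ring \<Rightarrow> 'f \<Rightarrow> 'f \<Rightarrow> 'f \<Rightarrow> 'f \<Rightarrow> 'f quadruple \<Rightarrow> 'f quadruple" where
  "trace_b F t1 t2 n2 s = (\<lambda>(y0, y1, y2, y3).
     ((s \<ominus>\<^bsub>F\<^esub> t1 \<otimes>\<^bsub>F\<^esub> t2) \<otimes>\<^bsub>F\<^esub> y1 \<ominus>\<^bsub>F\<^esub> n2 \<otimes>\<^bsub>F\<^esub> y2 \<ominus>\<^bsub>F\<^esub> n2 \<otimes>\<^bsub>F\<^esub> (t1 \<otimes>\<^bsub>F\<^esub> y3),
      t2 \<otimes>\<^bsub>F\<^esub> y1 \<oplus>\<^bsub>F\<^esub> n2 \<otimes>\<^bsub>F\<^esub> y3,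
      y0 \<oplus>\<^bsub>F\<^esub> t1 \<otimes>\<^bsub>F\<^esub> y1 \<oplus>\<^bsub>F\<^esub> t2 \<otimes>\<^bsub>F\<^esub> y2 \<oplus>\<^bsub>F\<^esub> s \<otimes>\<^bsub>F\<^esub> y3,
      \<ominus>\<^bsub>F\<^esub> y1))"

lemmas quadruple_defs = quadruple_add_def quadruple_smult_def lmult_a_def commuting_b_def trace_b_def

section \<open>Operations and associativity of the models\<close>

locale quadratic_pair = field F for F :: "'f ring" (structure) +
  fixes t1 n1 t2 n2 :: 'f
  assumes t1 [simp, intro]: "t1 \<in> carrier F" and n1 [simp, intro]: "n1 \<in> carrier F"
    and t2 [simp, intro]: "t2 \<in> carrier F" and n2 [simp, intro]: "n2 \<in> carrier F"
begin

abbreviation "tensor_model \<equiv> biquad_alg F t1 n1 (commuting_b F t2 n2)"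

abbreviation "quat_model s \<equiv> biquad_alg F t1 n1 (trace_b F t1 t2 n2 s)"

lemma quad_alg_simps [simp]:
  "carrier (quad_alg F t n) = carrier F \<times> carrier F"
  "\<one>\<^bsub>quad_alg F t n\<^esub> = (\<one>, \<zero>)" "\<zero>\<^bsub>quad_alg F t n\<^esub> = (\<zero>, \<zero>)"
  "(x0, x1) \<oplus>\<^bsub>quad_alg F t n\<^esub> (y0, y1) = (x0 \<oplus> y0, x1 \<oplus> y1)"
  "c \<odot>\<^bsub>quad_alg F t n\<^esub> (x0, x1) = (c \<otimes> x0, c \<otimes> x1)"
  by (simp_all add: quad_alg_def)

lemma biquad_alg_simps [simp]:
  "carrier (biquad_alg F t n L) = carrier F \<times> carrier F \<times> carrier F \<times> carrier F"
  "\<one>\<^bsub>biquad_alg F t n L\<^esub> = (\<one>, \<zero>, \<zero>, \<zero>)" "\<zero>\<^bsub>biquad_alg F t n L\<^esub> = (\<zero>, \<zero>, \<zero>, \<zero>)"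
  "(x0, x1, x2, x3) \<oplus>\<^bsub>biquad_alg F t n L\<^esub> (y0, y1, y2, y3) = (x0 \<oplus> y0, x1 \<oplus> y1, x2 \<oplus> y2, x3 \<oplus> y3)"
  "c \<odot>\<^bsub>biquad_alg F t n L\<^esub> (x0, x1, x2, x3) = (c \<otimes> x0, c \<otimes> x1, c \<otimes> x2, c \<otimes> x3)"
  by (simp_all add: biquad_alg_def quadruple_defs)

lemma quad_alg_mult:
  "(x0, x1) \<otimes>\<^bsub>quad_alg F t n\<^esub> (y0, y1) = (x0 \<otimes> y0 \<ominus> n \<otimes> (x1 \<otimes> y1), x0 \<otimes> y1 \<oplus> x1 \<otimes> y0 \<oplus> t \<otimes> (x1 \<otimes> y1))"
  by (simp add: quad_alg_def)

lemma biquad_alg_mult: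
  "(x0, x1, x2, x3) \<otimes>\<^bsub>biquad_alg F t n L\<^esub> y =
     quadruple_add F (quadruple_add F (quadruple_smult F x0 y) (quadruple_smult F x1 (lmult_a F t n y)))
         (quadruple_add F (quadruple_smult F x2 (L y)) (quadruple_smult F x3 (lmult_a F t n (L y))))"
  by (simp add: biquad_alg_def)

lemma quad_alg_algebra:
  assumes [intro]: "t \<in> carrier F" "n \<in> carrier F"
  shows "field_algebra F (quad_alg F t n)"
proof -
  let ?A = "quad_alg F t n"
  have t: "t \<in> carrier F" "n \<in> carrier F" by fact+
  have mult_closed: "(x0, x1) \<otimes>\<^bsub>?A\<^esub> (y0, y1) \<in> carrier F \<times> carrier F"
    if "x0 \<in> carrier F" "x1 \<in> carrier F" "y0 \<in> carrier F" "y1 \<in> carrier F" for x0 x1 y0 y1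
    using that t by (simp add: quad_alg_mult)
  have assoc: "((x0, x1) \<otimes>\<^bsub>?A\<^esub> (y0, y1)) \<otimes>\<^bsub>?A\<^esub> (z0, z1) = (x0, x1) \<otimes>\<^bsub>?A\<^esub> ((y0, y1) \<otimes>\<^bsub>?A\<^esub> (z0, z1))"
    if "x0 \<in> carrier F" "x1 \<in> carrier F" "y0 \<in> carrier F" "y1 \<in> carrier F" "z0 \<in> carrier F" "z1 \<in> carrier F"
    for x0 x1 y0 y1 z0 z1
    using that t unfolding quad_alg_mult
    by (elim component_cases) (simp add: component_simps algebra_simps)
  have abelian: "abelian_group ?A"
  proof (rule abelian_groupI)
    fix x assume "x \<in> carrier ?A"
    then show "\<exists>y\<in>carrier ?A. y \<oplus>\<^bsub>?A\<^esub> x = \<zero>\<^bsub>?A\<^esub>"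
      by (intro bexI[of _ "(\<ominus> fst x, \<ominus> snd x)"]) (auto simp: l_neg)
  qed (auto simp: a_ac)
  show ?thesis
  proof (intro field_algebra.intro assoc_algebra.intro assoc_algebra_axioms.intro field_algebra_axioms.intro
      module.intro module_axioms.intro ringI is_cring field_axioms abelian)
    show "monoid ?A"
    proof (rule monoidI)
      show "x \<otimes>\<^bsub>?A\<^esub> y \<in> carrier ?A" if "x \<in> carrier ?A" "y \<in> carrier ?A" for x y
        using that mult_closed by auto
      show "(x \<otimes>\<^bsub>?A\<^esub> y) \<otimes>\<^bsub>?A\<^esub> z = x \<otimes>\<^bsub>?A\<^esub> (y \<otimes>\<^bsub>?A\<^esub> z)"
        if "x \<in> carrier ?A" "y \<in> carrier ?A" "z \<in> carrier ?A" for x y z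
        using that assoc by auto
    qed (use t in \<open>auto simp: quad_alg_mult minus_eq\<close>)
  qed (use t in \<open>auto simp: quad_alg_mult l_distr r_distr m_assoc elim!: component_cases\<close>,
       (simp add: component_simps algebra_simps)+)
qed

text \<open>Associativity has to be checked on generators only. A product x z is a linear
  combination of z, a z, \<open>L z\<close> and a times \<open>L z\<close>, so (x y) z = x (y z)
  follows once the left multiplications by a and by b commute with right multiplication by z. For a
  this is a consequence of a^2 = t1 a - n1, for b it is the hypothesis \<open>L_mult\<close>. The
  value of \<open>L\<close> at the unit makes the unit neutral on the right.\<close>

lemma biquad_algI:
  fixes L
  defines "A \<equiv> biquad_alg F t1 n1 L"
  assumes closed: "\<And>y. y \<in> carrier A \<Longrightarrow> L y \<in> carrier A"
    and add: "\<And>x y. x \<in> carrier A \<Longrightarrow> y \<in> carrier A \<Longrightarrow> L (x \<oplus>\<^bsub>A\<^esub> y) = L x \<oplus>\<^bsub>A\<^esub> L y"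
    and smult: "\<And>c x. c \<in> carrier F \<Longrightarrow> x \<in> carrier A \<Longrightarrow> L (c \<odot>\<^bsub>A\<^esub> x) = c \<odot>\<^bsub>A\<^esub> L x"
    and one: "L \<one>\<^bsub>A\<^esub> = (\<zero>, \<zero>, \<one>, \<zero>)"
    and L_mult: "\<And>y z. y \<in> carrier A \<Longrightarrow> z \<in> carrier A \<Longrightarrow> L (y \<otimes>\<^bsub>A\<^esub> z) = L y \<otimes>\<^bsub>A\<^esub> z"
  shows "field_algebra F A"
proof -
  have abelian: "abelian_group A"
  proof (rule abelian_groupI)
    fix x assume "x \<in> carrier A"
    then obtain x0 x1 x2 x3 where x: "x = (x0, x1, x2, x3)"
      "x0 \<in> carrier F" "x1 \<in> carrier F" "x2 \<in> carrier F" "x3 \<in> carrier F"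
      by (auto simp: A_def)
    then show "\<exists>y\<in>carrier A. y \<oplus>\<^bsub>A\<^esub> x = \<zero>\<^bsub>A\<^esub>"
      by (intro bexI[of _ "(\<ominus> x0, \<ominus> x1, \<ominus> x2, \<ominus> x3)"]) (auto simp: A_def l_neg)
  qed (auto simp: A_def a_ac)
  have mult: "x \<otimes>\<^bsub>A\<^esub> y = (case x of (x0, x1, x2, x3) \<Rightarrow>
      (x0 \<odot>\<^bsub>A\<^esub> y \<oplus>\<^bsub>A\<^esub> x1 \<odot>\<^bsub>A\<^esub> lmult_a F t1 n1 y) \<oplus>\<^bsub>A\<^esub>
      (x2 \<odot>\<^bsub>A\<^esub> L y \<oplus>\<^bsub>A\<^esub> x3 \<odot>\<^bsub>A\<^esub> lmult_a F t1 n1 (L y)))" for x y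
    by (simp add: A_def biquad_alg_def split: prod.split)
  have cl: "\<And>x y. x \<in> carrier A \<Longrightarrow> y \<in> carrier A \<Longrightarrow> x \<oplus>\<^bsub>A\<^esub> y \<in> carrier A"
    "\<And>x. x \<in> carrier A \<Longrightarrow> lmult_a F t1 n1 x \<in> carrier A"
    "\<And>c x. c \<in> carrier F \<Longrightarrow> x \<in> carrier A \<Longrightarrow> c \<odot>\<^bsub>A\<^esub> x \<in> carrier A"
    by (auto simp: A_def lmult_a_def)
  have la: "lmult_a F t1 n1 (x \<oplus>\<^bsub>A\<^esub> y) = lmult_a F t1 n1 x \<oplus>\<^bsub>A\<^esub> lmult_a F t1 n1 y"
    if "x \<in> carrier A" "y \<in> carrier A" for x y
    using that t1 n1 unfolding A_def biquad_alg_simps lmult_a_def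
    by (elim SigmaE component_cases) (simp add: component_simps algebra_simps)
  have la_smult: "lmult_a F t1 n1 (c \<odot>\<^bsub>A\<^esub> x) = c \<odot>\<^bsub>A\<^esub> lmult_a F t1 n1 x"
    if "c \<in> carrier F" "x \<in> carrier A" for x c
    using that t1 n1 unfolding A_def biquad_alg_simps lmult_a_def
    by (elim SigmaE component_cases) (simp add: component_simps algebra_simps)
  interpret A: abelian_group A by (fact abelian)
  have distr:
    "\<And>c d x. c \<in> carrier F \<Longrightarrow> d \<in> carrier F \<Longrightarrow> x \<in> carrier A \<Longrightarrow> (c \<oplus> d) \<odot>\<^bsub>A\<^esub> x = c \<odot>\<^bsub>A\<^esub> x \<oplus>\<^bsub>A\<^esub> d \<odot>\<^bsub>A\<^esub> x"
    "\<And>c x y. c \<in> carrier F \<Longrightarrow> x \<in> carrier A \<Longrightarrow> y \<in> carrier A \<Longrightarrow>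
      c \<odot>\<^bsub>A\<^esub> (x \<oplus>\<^bsub>A\<^esub> y) = c \<odot>\<^bsub>A\<^esub> x \<oplus>\<^bsub>A\<^esub> c \<odot>\<^bsub>A\<^esub> y"
    "\<And>c d x. c \<in> carrier F \<Longrightarrow> d \<in> carrier F \<Longrightarrow> x \<in> carrier A \<Longrightarrow> (c \<otimes> d) \<odot>\<^bsub>A\<^esub> x = c \<odot>\<^bsub>A\<^esub> (d \<odot>\<^bsub>A\<^esub> x)"
    by (auto simp: A_def l_distr r_distr m_assoc)
  have mult_closed: "x \<otimes>\<^bsub>A\<^esub> y \<in> carrier A" if "x \<in> carrier A" "y \<in> carrier A" for x y
  proof -
    obtain x0 x1 x2 x3 where x: "x = (x0, x1, x2, x3)"
      "x0 \<in> carrier F" "x1 \<in> carrier F" "x2 \<in> carrier F" "x3 \<in> carrier F"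
      using \<open>x \<in> carrier A\<close> by (auto simp: A_def)
    then show ?thesis using \<open>y \<in> carrier A\<close> by (simp add: mult cl closed)
  qed
  have L_quad: "L y = (y0, y1, y2, y3) \<Longrightarrow> y \<in> carrier A \<Longrightarrow>
    y0 \<in> carrier F \<and> y1 \<in> carrier F \<and> y2 \<in> carrier F \<and> y3 \<in> carrier F" for y y0 y1 y2 y3
    using closed[of y] by (simp add: A_def)
  have distr_right: "(x \<oplus>\<^bsub>A\<^esub> y) \<otimes>\<^bsub>A\<^esub> z = x \<otimes>\<^bsub>A\<^esub> z \<oplus>\<^bsub>A\<^esub> y \<otimes>\<^bsub>A\<^esub> z"
    if "x \<in> carrier A" "y \<in> carrier A" "z \<in> carrier A" for x y z
  proof -
    obtain x0 x1 x2 x3 y0 y1 y2 y3 where xy: "x = (x0, x1, x2, x3)" "y = (y0, y1, y2, y3)"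
      "x0 \<in> carrier F" "x1 \<in> carrier F" "x2 \<in> carrier F" "x3 \<in> carrier F"
      "y0 \<in> carrier F" "y1 \<in> carrier F" "y2 \<in> carrier F" "y3 \<in> carrier F"
      using \<open>x \<in> carrier A\<close> \<open>y \<in> carrier A\<close> by (auto simp: A_def)
    then have "x \<oplus>\<^bsub>A\<^esub> y = (x0 \<oplus> y0, x1 \<oplus> y1, x2 \<oplus> y2, x3 \<oplus> y3)"
      by (simp add: A_def)
    with xy show ?thesis using \<open>z \<in> carrier A\<close>
      by (simp add: mult cl closed distr A.a_ac)
  qed
  have smult_left: "(c \<odot>\<^bsub>A\<^esub> x) \<otimes>\<^bsub>A\<^esub> y = c \<odot>\<^bsub>A\<^esub> (x \<otimes>\<^bsub>A\<^esub> y)"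
    if "c \<in> carrier F" "x \<in> carrier A" "y \<in> carrier A" for c x y
  proof -
    obtain x0 x1 x2 x3 where x: "x = (x0, x1, x2, x3)"
      "x0 \<in> carrier F" "x1 \<in> carrier F" "x2 \<in> carrier F" "x3 \<in> carrier F"
      using \<open>x \<in> carrier A\<close> by (auto simp: A_def)
    then have "c \<odot>\<^bsub>A\<^esub> x = (c \<otimes> x0, c \<otimes> x1, c \<otimes> x2, c \<otimes> x3)"
      by (simp add: A_def)
    with x show ?thesis using that
      by (simp add: mult cl closed distr)
  qed
  have la_mult: "lmult_a F t1 n1 (y \<otimes>\<^bsub>A\<^esub> z) = lmult_a F t1 n1 y \<otimes>\<^bsub>A\<^esub> z"
    if "y \<in> carrier A" "z \<in> carrier A" for y z
  proof -
    \<comment> \<open>Here \<open>w\<close> stands for \<open>L z\<close>. The identity expresses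
      a^2 = t1 a - n1 on the pairs z, a z and w, a w.\<close>
    have "lmult_a F t1 n1 ((y0 \<odot>\<^bsub>A\<^esub> z \<oplus>\<^bsub>A\<^esub> y1 \<odot>\<^bsub>A\<^esub> lmult_a F t1 n1 z) \<oplus>\<^bsub>A\<^esub>
        (y2 \<odot>\<^bsub>A\<^esub> w \<oplus>\<^bsub>A\<^esub> y3 \<odot>\<^bsub>A\<^esub> lmult_a F t1 n1 w)) =
      (\<ominus> (n1 \<otimes> y1) \<odot>\<^bsub>A\<^esub> z \<oplus>\<^bsub>A\<^esub> (y0 \<oplus> t1 \<otimes> y1) \<odot>\<^bsub>A\<^esub> lmult_a F t1 n1 z) \<oplus>\<^bsub>A\<^esub>
        (\<ominus> (n1 \<otimes> y3) \<odot>\<^bsub>A\<^esub> w \<oplus>\<^bsub>A\<^esub> (y2 \<oplus> t1 \<otimes> y3) \<odot>\<^bsub>A\<^esub> lmult_a F t1 n1 w)"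
      if "y0 \<in> carrier F" "y1 \<in> carrier F" "y2 \<in> carrier F" "y3 \<in> carrier F"
        "z \<in> carrier A" "w \<in> carrier A" for y0 y1 y2 y3 z w
      using that t1 n1 unfolding A_def biquad_alg_simps
      by (elim SigmaE component_cases) (simp add: lmult_a_def component_simps algebra_simps)
    moreover obtain y0 y1 y2 y3 where "y = (y0, y1, y2, y3)"
      "y0 \<in> carrier F" "y1 \<in> carrier F" "y2 \<in> carrier F" "y3 \<in> carrier F"
      using \<open>y \<in> carrier A\<close> by (auto simp: A_def)
    moreover from this have "lmult_a F t1 n1 y = (\<ominus> (n1 \<otimes> y1), y0 \<oplus> t1 \<otimes> y1, \<ominus> (n1 \<otimes> y3), y2 \<oplus> t1 \<otimes> y3)"
      by (simp add: lmult_a_def)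
    ultimately show ?thesis
      using that(2) closed by (simp add: mult)
  qed
  have assoc: "(x \<otimes>\<^bsub>A\<^esub> y) \<otimes>\<^bsub>A\<^esub> z = x \<otimes>\<^bsub>A\<^esub> (y \<otimes>\<^bsub>A\<^esub> z)"
    if "x \<in> carrier A" "y \<in> carrier A" "z \<in> carrier A" for x y z
  proof -
    obtain x0 x1 x2 x3 where x: "x = (x0, x1, x2, x3)"
      "x0 \<in> carrier F" "x1 \<in> carrier F" "x2 \<in> carrier F" "x3 \<in> carrier F"
      using \<open>x \<in> carrier A\<close> by (auto simp: A_def)
    then have "(x \<otimes>\<^bsub>A\<^esub> y) \<otimes>\<^bsub>A\<^esub> z =
      (x0 \<odot>\<^bsub>A\<^esub> (y \<otimes>\<^bsub>A\<^esub> z) \<oplus>\<^bsub>A\<^esub> x1 \<odot>\<^bsub>A\<^esub> (lmult_a F t1 n1 y \<otimes>\<^bsub>A\<^esub> z)) \<oplus>\<^bsub>A\<^esub>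
      (x2 \<odot>\<^bsub>A\<^esub> (L y \<otimes>\<^bsub>A\<^esub> z) \<oplus>\<^bsub>A\<^esub> x3 \<odot>\<^bsub>A\<^esub> (lmult_a F t1 n1 (L y) \<otimes>\<^bsub>A\<^esub> z))"
      unfolding mult[of x y] using that closed by (simp add: distr_right smult_left cl)
    also have "\<dots> = x \<otimes>\<^bsub>A\<^esub> (y \<otimes>\<^bsub>A\<^esub> z)"
      using that x closed by (simp add: mult[of "(x0, x1, x2, x3)" "y \<otimes>\<^bsub>A\<^esub> z"] la_mult[symmetric] L_mult[symmetric])
    finally show ?thesis .
  qed
  show ?thesis
  proof (intro field_algebra.intro assoc_algebra.intro assoc_algebra_axioms.intro field_algebra_axioms.intro
      module.intro module_axioms.intro ringI is_cring field_axioms abelian)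
    show "monoid A"
    proof (rule monoidI)
      show "\<one>\<^bsub>A\<^esub> \<otimes>\<^bsub>A\<^esub> x = x" if "x \<in> carrier A" for x
      proof -
        obtain y0 y1 y2 y3 where "L x = (y0, y1, y2, y3)" by (cases "L x")
        with that L_quad[OF this that] show ?thesis
          by (auto simp: A_def biquad_alg_mult quadruple_defs)
      qed
      show "x \<otimes>\<^bsub>A\<^esub> \<one>\<^bsub>A\<^esub> = x" if "x \<in> carrier A" for x
        using that one by (auto simp: A_def biquad_alg_mult quadruple_defs)
    qed (use mult_closed assoc in \<open>auto simp: A_def\<close>)
    show "\<one>\<^bsub>A\<^esub> \<noteq> \<zero>\<^bsub>A\<^esub>" by (simp add: A_def)
    show "z \<otimes>\<^bsub>A\<^esub> (x \<oplus>\<^bsub>A\<^esub> y) = z \<otimes>\<^bsub>A\<^esub> x \<oplus>\<^bsub>A\<^esub> z \<otimes>\<^bsub>A\<^esub> y"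
      if "x \<in> carrier A" "y \<in> carrier A" "z \<in> carrier A" for x y z
    proof -
      obtain z0 z1 z2 z3 where z: "z = (z0, z1, z2, z3)"
        "z0 \<in> carrier F" "z1 \<in> carrier F" "z2 \<in> carrier F" "z3 \<in> carrier F"
        using \<open>z \<in> carrier A\<close> by (auto simp: A_def)
      then show ?thesis using that(1,2)
        by (simp add: mult cl closed add la la_smult distr A.a_ac)
    qed
    show "x \<otimes>\<^bsub>A\<^esub> (c \<odot>\<^bsub>A\<^esub> y) = c \<odot>\<^bsub>A\<^esub> (x \<otimes>\<^bsub>A\<^esub> y)"
      if "c \<in> carrier F" "x \<in> carrier A" "y \<in> carrier A" for c x y
    proof -
      obtain x0 x1 x2 x3 where x: "x = (x0, x1, x2, x3)"
        "x0 \<in> carrier F" "x1 \<in> carrier F" "x2 \<in> carrier F" "x3 \<in> carrier F"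
        using \<open>x \<in> carrier A\<close> by (auto simp: A_def)
      then show ?thesis using that
        by (simp add: mult cl closed smult la la_smult distr(1,2) distr(3)[symmetric] m_comm)
    qed
      show "\<one> \<odot>\<^bsub>A\<^esub> x = x" if "x \<in> carrier A" for x
      using that by (auto simp: A_def)
  qed (simp_all add: cl distr distr_right smult_left)
qed

lemma tensor_model_algebra:
  shows "field_algebra F (tensor_model)"
proof (rule biquad_algI)
  show "commuting_b F t2 n2 (y \<otimes>\<^bsub>tensor_model\<^esub> z) = commuting_b F t2 n2 y \<otimes>\<^bsub>tensor_model\<^esub> z"
    if "y \<in> carrier (tensor_model)" "z \<in> carrier (tensor_model)" for y z
    using that t1 n1 t2 n2 unfolding biquad_alg_simps
    by (elim SigmaE component_cases)
      (simp add: biquad_alg_mult quadruple_defs component_simps algebra_simps)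
  show "commuting_b F t2 n2 (x \<oplus>\<^bsub>tensor_model\<^esub> y) = commuting_b F t2 n2 x \<oplus>\<^bsub>tensor_model\<^esub> commuting_b F t2 n2 y"
    if "x \<in> carrier (tensor_model)" "y \<in> carrier (tensor_model)" for x y
    using that t1 n1 t2 n2 unfolding biquad_alg_simps
    by (elim SigmaE component_cases) (simp add: quadruple_defs component_simps algebra_simps)
  show "commuting_b F t2 n2 (c \<odot>\<^bsub>tensor_model\<^esub> x) = c \<odot>\<^bsub>tensor_model\<^esub> commuting_b F t2 n2 x"
    if "c \<in> carrier F" "x \<in> carrier (tensor_model)" for c x
    using that t1 n1 t2 n2 unfolding biquad_alg_simps
    by (elim SigmaE component_cases) (simp add: quadruple_defs component_simps algebra_simps)
qed (auto simp: commuting_b_def)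

text \<open>\<open>L_mult\<close> is a polynomial identity in the coordinates, the coefficients and
  \<open>s\<close>. The relations for b^2 and b a are therefore consistent for every
  \<open>s\<close>, and the parameter only decides whether the algebra is central simple.\<close>

lemma quat_model_algebra:
  assumes s: "s \<in> carrier F"
  shows "field_algebra F (quat_model s)"
proof (rule biquad_algI)
  show "trace_b F t1 t2 n2 s (y \<otimes>\<^bsub>quat_model s\<^esub> z) = trace_b F t1 t2 n2 s y \<otimes>\<^bsub>quat_model s\<^esub> z"
    if "y \<in> carrier (quat_model s)" "z \<in> carrier (quat_model s)" for y z
    using that t1 n1 t2 n2 s unfolding biquad_alg_simps
    by (elim SigmaE component_cases)
      (simp add: biquad_alg_mult quadruple_defs component_simps algebra_simps)
  show "trace_b F t1 t2 n2 s (x \<oplus>\<^bsub>quat_model s\<^esub> y) = trace_b F t1 t2 n2 s x \<oplus>\<^bsub>quat_model s\<^esub> trace_b F t1 t2 n2 s y"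
    if "x \<in> carrier (quat_model s)" "y \<in> carrier (quat_model s)" for x y
    using that t1 n1 t2 n2 s unfolding biquad_alg_simps
    by (elim SigmaE component_cases) (simp add: quadruple_defs component_simps algebra_simps)
  show "trace_b F t1 t2 n2 s (c \<odot>\<^bsub>quat_model s\<^esub> x) = c \<odot>\<^bsub>quat_model s\<^esub> trace_b F t1 t2 n2 s x"
    if "c \<in> carrier F" "x \<in> carrier (quat_model s)" for c x
    using that t1 n1 t2 n2 s unfolding biquad_alg_simps
    by (elim SigmaE component_cases) (simp add: quadruple_defs component_simps algebra_simps)
qed (use s in \<open>auto simp: trace_b_def minus_eq\<close>)

end

section \<open>Bases of the models and the trace of a quadratic algebra\<close>

lemma (in quadratic_pair) quad_alg_lincomb:
  assumes "t \<in> carrier F" "n \<in> carrier F" "c0 \<in> carrier F" "c1 \<in> carrier F"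
  shows "field_algebra.lincomb (quad_alg F t n) [c0, c1] [(\<one>, \<zero>), (\<zero>, \<one>)] = (c0, c1)"
proof -
  interpret A: field_algebra F "quad_alg F t n" using assms by (intro quad_alg_algebra)
  show ?thesis using assms by simp
qed

lemma (in quadratic_pair) quad_alg_basis:
  fixes t n
  assumes tn: "t \<in> carrier F" "n \<in> carrier F"
  defines "A \<equiv> quad_alg F t n" and "us \<equiv> [(\<one>, \<zero>), (\<zero>, \<one>)]"
  shows "ring.independent A (scalars F A) us" "ring.Span A (scalars F A) us = carrier A"
    "has_dim F A 2"
proof -
  interpret A: field_algebra F A unfolding A_def using tn by (intro quad_alg_algebra)
  have us: "set us \<subseteq> carrier A" by (simp add: us_def A_def)
  have lin: "A.lincomb [c0, c1] us = (c0, c1)" if "c0 \<in> carrier F" "c1 \<in> carrier F" for c0 c1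
    using that tn quad_alg_lincomb by (simp only: A_def us_def)
  have two: "\<exists>c0 c1. cs = [c0, c1]" if "length cs = length us" for cs :: "'a list"
    using that by (auto simp: us_def length_Suc_conv)
  show "A.M.independent (scalars F A) us"
    unfolding A.independent_iff_lincomb[OF us]
    by (auto dest!: two simp: lin) (auto simp: A_def)
  show "A.M.Span (scalars F A) us = carrier A"
    unfolding A.Span_eq_lincomb[OF us]
  proof (intro equalityI subsetI)
    fix x assume "x \<in> carrier A"
    then obtain c0 c1 where "x = (c0, c1)" "c0 \<in> carrier F" "c1 \<in> carrier F"
      by (auto simp: A_def)
    then show "x \<in> {A.lincomb cs us |cs. length cs = length us \<and> set cs \<subseteq> carrier F}"
      by (intro CollectI exI[of _ "[c0, c1]"]) (simp only: lin, simp add: us_def)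
  next
    fix x assume "x \<in> {A.lincomb cs us |cs. length cs = length us \<and> set cs \<subseteq> carrier F}"
    then show "x \<in> carrier A"
      by (auto dest!: two simp: lin) (auto simp: A_def)
  qed
  then show "has_dim F A 2"
    using A.has_dimI \<open>A.M.independent (scalars F A) us\<close> by (simp add: us_def)
qed

lemma (in quadratic_pair) biquad_alg_basis:
  fixes L
  defines "A \<equiv> biquad_alg F t1 n1 L"
  assumes alg: "field_algebra F A"
  shows "has_dim F A 4"
proof -
  interpret A: field_algebra F A by fact
  define us where "us = [(\<one>, \<zero>, \<zero>, \<zero>), (\<zero>, \<one>, \<zero>, \<zero>), (\<zero>, \<zero>, \<one>, \<zero>), (\<zero>, \<zero>, \<zero>, \<one>)]"
  have us: "set us \<subseteq> carrier A" by (simp add: us_def A_def)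
  have lin: "A.lincomb [c0, c1, c2, c3] us = (c0, c1, c2, c3)"
    if "c0 \<in> carrier F" "c1 \<in> carrier F" "c2 \<in> carrier F" "c3 \<in> carrier F" for c0 c1 c2 c3
    using that by (simp add: us_def A_def field_algebra.lincomb.simps[OF alg[unfolded A_def]])
  have four: "\<exists>c0 c1 c2 c3. cs = [c0, c1, c2, c3]" if "length cs = length us" for cs :: "'a list"
    using that by (auto simp: us_def length_Suc_conv)
  have "A.M.independent (scalars F A) us"
    unfolding A.independent_iff_lincomb[OF us]
    by (auto dest!: four simp: lin) (auto simp: A_def)
  moreover have "A.M.Span (scalars F A) us = carrier A"
    unfolding A.Span_eq_lincomb[OF us]
  proof (intro equalityI subsetI)
    fix x assume "x \<in> carrier A"
    then obtain c0 c1 c2 c3 where "x = (c0, c1, c2, c3)"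
      "c0 \<in> carrier F" "c1 \<in> carrier F" "c2 \<in> carrier F" "c3 \<in> carrier F"
      by (auto simp: A_def)
    then show "x \<in> {A.lincomb cs us |cs. length cs = length us \<and> set cs \<subseteq> carrier F}"
      by (intro CollectI exI[of _ "[c0, c1, c2, c3]"]) (simp only: lin, simp add: us_def)
  next
    fix x assume "x \<in> {A.lincomb cs us |cs. length cs = length us \<and> set cs \<subseteq> carrier F}"
    then show "x \<in> carrier A"
      by (auto dest!: four simp: lin) (auto simp: A_def)
  qed
  ultimately show ?thesis
    using A.has_dimI by (simp add: us_def)
qed

text \<open>\<open>alg_trace\<close> is a definite description over all bases, so besides the matrix
  in the basis 1, a the independence of the basis is needed. For an arbitrary basis e, f it is
  derived from the determinant of the coordinates of e and f.\<close>

lemma (in quadratic_pair) alg_trace_quad: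
  assumes \<kappa>: "\<kappa> \<in> alg_iso F (quad_alg F t n) K" and K: "field_algebra F K"
    and tn: "t \<in> carrier F" "n \<in> carrier F" and uv: "u \<in> carrier F" "v \<in> carrier F"
  shows "alg_trace F K (\<kappa> (u, v)) = u \<oplus> u \<oplus> t \<otimes> v"
proof -
  let ?Q = "quad_alg F t n"
  interpret Q: field_algebra F ?Q using tn by (intro quad_alg_algebra)
  interpret K: field_algebra F K by (fact K)
  note hom = alg_homD[OF alg_isoD(1)[OF \<kappa>]]
  have inj: "x = y" if "\<kappa> x = \<kappa> y" "x \<in> carrier ?Q" "y \<in> carrier ?Q" for x y
    using alg_isoD(3)[OF \<kappa>] that by (auto simp: inj_on_def)
  have surj: "\<exists>x0 x1. x0 \<in> carrier F \<and> x1 \<in> carrier F \<and> y = \<kappa> (x0, x1)" if "y \<in> carrier K" for y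
    using alg_isoD(4)[OF \<kappa>] that by auto
  interpret \<kappa>: ring_hom_ring ?Q K \<kappa>
    using alg_isoD(1)[OF \<kappa>] by unfold_locales (simp add: alg_hom_def)
  have dim: "has_dim F K 2"
    using alg_iso_has_dim[OF \<kappa> _ K] quad_alg_basis(3)[OF tn] Q.field_algebra_axioms by simp
  have lin: "K.lincomb [c0, c1] [\<kappa> (x0, x1), \<kappa> (y0, y1)] = \<kappa> (c0 \<otimes> x0 \<oplus> c1 \<otimes> y0, c0 \<otimes> x1 \<oplus> c1 \<otimes> y1)"
    if "c0 \<in> carrier F" "c1 \<in> carrier F" "x0 \<in> carrier F" "x1 \<in> carrier F" "y0 \<in> carrier F" "y1 \<in> carrier F"
    for c0 c1 x0 x1 y0 y1
    using that hom(1) by (simp add: hom(3)[symmetric] hom(5)[symmetric])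
  show ?thesis
    unfolding alg_trace_def
  proof (rule the_equality)
    let ?us = "[\<kappa> (\<one>, \<zero>), \<kappa> (\<zero>, \<one>)]"
    \<comment> \<open>The columns are the coordinates of (u + v a) 1 = u + v a and (u + v a) a = - n
      v + (u + t v) a.\<close>
    let ?m = "\<lambda>i j :: nat. if i = 0 then if j = 0 then u else \<ominus> (n \<otimes> v)
      else if j = 0 then v else u \<oplus> t \<otimes> v"
    have us: "set ?us \<subseteq> carrier K" using hom(1) by simp
    have "K.M.Span (scalars F K) ?us = carrier K"
      unfolding K.Span_eq_lincomb[OF us]
    proof (intro equalityI subsetI)
      fix y assume "y \<in> carrier K"
      then obtain c0 c1 where "y = \<kappa> (c0, c1)" "c0 \<in> carrier F" "c1 \<in> carrier F"
        using surj by blast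
      then show "y \<in> {K.lincomb cs ?us |cs. length cs = length ?us \<and> set cs \<subseteq> carrier F}"
        by (intro CollectI exI[of _ "[c0, c1]"]) (simp only: lin one_closed zero_closed, simp)
    next
      fix y assume "y \<in> {K.lincomb cs ?us |cs. length cs = length ?us \<and> set cs \<subseteq> carrier F}"
      then obtain c0 c1 where "y = K.lincomb [c0, c1] ?us" "c0 \<in> carrier F" "c1 \<in> carrier F"
        by (auto simp: length_Suc_conv)
      then show "y \<in> carrier K" using hom(1) by (simp only: lin one_closed zero_closed) simp
    qed
    moreover from K.spanning_list_independent[OF dim us this]
    have "K.M.independent (scalars F K) ?us" by simp
    moreover have "\<kappa> (u, v) \<otimes>\<^bsub>K\<^esub> (?us ! j) = (\<Oplus>\<^bsub>K\<^esub>i\<in>{..<length ?us}. ?m i j \<odot>\<^bsub>K\<^esub> ?us ! i)"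
      if "j < length ?us" for j
      using that uv tn hom(1) less_2_cases[of j]
      by (auto simp: hom(2,3,5)[symmetric] lessThan_Suc quad_alg_mult minus_eq Pi_iff)
    moreover have "u \<oplus> u \<oplus> t \<otimes> v = (\<Oplus>i\<in>{..<length ?us}. ?m i i)"
      using uv tn by (simp add: lessThan_Suc a_ac)
    ultimately show "\<exists>us m. K.M.independent (scalars F K) us \<and> K.M.Span (scalars F K) us = carrier K \<and>
        (\<forall>i<length us. \<forall>j<length us. m i j \<in> carrier F) \<and>
        (\<forall>j<length us. \<kappa> (u, v) \<otimes>\<^bsub>K\<^esub> us ! j = (\<Oplus>\<^bsub>K\<^esub>i\<in>{..<length us}. m i j \<odot>\<^bsub>K\<^esub> us ! i)) \<and>
        u \<oplus> u \<oplus> t \<otimes> v = (\<Oplus>i\<in>{..<length us}. m i i)"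
      using uv tn by (intro exI[of _ ?us] exI[of _ ?m]) auto
  next
    fix r
    assume "\<exists>us m. K.M.independent (scalars F K) us \<and> K.M.Span (scalars F K) us = carrier K \<and>
        (\<forall>i<length us. \<forall>j<length us. m i j \<in> carrier F) \<and>
        (\<forall>j<length us. \<kappa> (u, v) \<otimes>\<^bsub>K\<^esub> us ! j = (\<Oplus>\<^bsub>K\<^esub>i\<in>{..<length us}. m i j \<odot>\<^bsub>K\<^esub> us ! i)) \<and>
        r = (\<Oplus>i\<in>{..<length us}. m i i)"
    then obtain us m where ind: "K.M.independent (scalars F K) us"
      and span: "K.M.Span (scalars F K) us = carrier K"
      and m: "\<forall>i<length us. \<forall>j<length us. m i j \<in> carrier F"
      and mult: "\<forall>j<length us. \<kappa> (u, v) \<otimes>\<^bsub>K\<^esub> us ! j = (\<Oplus>\<^bsub>K\<^esub>i\<in>{..<length us}. m i j \<odot>\<^bsub>K\<^esub> us ! i)"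
      and r: "r = (\<Oplus>i\<in>{..<length us}. m i i)"
      by blast
    have len: "length us = 2" using K.basis_length[OF dim ind span] .
    have us_carr: "set us \<subseteq> carrier K" using K.M.independent_in_carrier[OF ind] .
    obtain e f where ef: "us = [e, f]" using len by (auto simp: length_Suc_conv numeral_2_eq_2)
    obtain e0 e1 f0 f1 where e: "e0 \<in> carrier F" "e1 \<in> carrier F" "e = \<kappa> (e0, e1)"
      and f: "f0 \<in> carrier F" "f1 \<in> carrier F" "f = \<kappa> (f0, f1)"
      using us_carr surj[of e] surj[of f] ef by auto
    obtain m00 m01 m10 m11 where mm: "m 0 0 = m00" "m 0 1 = m01" "m 1 0 = m10" "m 1 1 = m11"
      "m00 \<in> carrier F" "m01 \<in> carrier F" "m10 \<in> carrier F" "m11 \<in> carrier F"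
      using m ef by (auto simp: numeral_2_eq_2)
    have r': "r = m00 \<oplus> m11"
      using mm r ef by (simp add: lessThan_Suc a_ac)
    have lin0: "K.lincomb [c0, c1] us = \<kappa> (c0 \<otimes> e0 \<oplus> c1 \<otimes> f0, c0 \<otimes> e1 \<oplus> c1 \<otimes> f1)"
      if "c0 \<in> carrier F" "c1 \<in> carrier F" for c0 c1
      using lin that ef e f by simp
    have ind': "c0 = \<zero> \<and> c1 = \<zero>" if "c0 \<in> carrier F" "c1 \<in> carrier F"
      "c0 \<otimes> e0 \<oplus> c1 \<otimes> f0 = \<zero>" "c0 \<otimes> e1 \<oplus> c1 \<otimes> f1 = \<zero>" for c0 c1
    proof -
      have "K.lincomb [c0, c1] us = \<zero>\<^bsub>K\<^esub>"
        using that lin0 \<kappa>.hom_zero by simp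
      with that have "set [c0, c1] \<subseteq> {\<zero>}"
        using K.independent_iff_lincomb[OF us_carr, THEN iffD1, OF ind, rule_format, of "[c0, c1]"] len
        by simp
      then show ?thesis by simp
    qed
    define det where "det = e0 \<otimes> f1 \<ominus> e1 \<otimes> f0"
    have det: "det \<in> carrier F" using e f by (simp add: det_def)
    have "det \<noteq> \<zero>"
    proof
      assume "det = \<zero>"
      then have *: "e0 \<otimes> f1 = e1 \<otimes> f0" using e f by (simp add: det_def)
      \<comment> \<open>If the determinant vanishes, the combinations f1 e - e1 f and f0 e - e0 f
        are zero. Independence gives f1 = f0 = 0, so f itself is zero.\<close>
      have "f1 \<otimes> e0 \<oplus> (\<ominus> e1) \<otimes> f0 = \<zero>" "f1 \<otimes> e1 \<oplus> (\<ominus> e1) \<otimes> f1 = \<zero>"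
        "f0 \<otimes> e0 \<oplus> (\<ominus> e0) \<otimes> f0 = \<zero>" "f0 \<otimes> e1 \<oplus> (\<ominus> e0) \<otimes> f1 = \<zero>"
        using e f * by (simp_all add: l_minus r_minus r_neg m_comm)
      then have "f1 = \<zero>" "f0 = \<zero>"
        using ind'[of f1 "\<ominus> e1"] ind'[of f0 "\<ominus> e0"] e f by auto
      then have "\<one> = \<zero>" using ind'[of \<zero> \<one>] e f by simp
      then show False by simp
    qed
    have "\<kappa> (u, v) \<otimes>\<^bsub>K\<^esub> e = m00 \<odot>\<^bsub>K\<^esub> e \<oplus>\<^bsub>K\<^esub> m10 \<odot>\<^bsub>K\<^esub> f"
      "\<kappa> (u, v) \<otimes>\<^bsub>K\<^esub> f = m01 \<odot>\<^bsub>K\<^esub> e \<oplus>\<^bsub>K\<^esub> m11 \<odot>\<^bsub>K\<^esub> f"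
      using mult[rule_format, of 0] mult[rule_format, of 1] us_carr mm
      by (simp_all add: ef lessThan_Suc K.M.a_comm)
    then have "\<kappa> (u \<otimes> e0 \<ominus> n \<otimes> (v \<otimes> e1), u \<otimes> e1 \<oplus> v \<otimes> e0 \<oplus> t \<otimes> (v \<otimes> e1)) =
        \<kappa> (m00 \<otimes> e0 \<oplus> m10 \<otimes> f0, m00 \<otimes> e1 \<oplus> m10 \<otimes> f1)"
      "\<kappa> (u \<otimes> f0 \<ominus> n \<otimes> (v \<otimes> f1), u \<otimes> f1 \<oplus> v \<otimes> f0 \<oplus> t \<otimes> (v \<otimes> f1)) =
        \<kappa> (m01 \<otimes> e0 \<oplus> m11 \<otimes> f0, m01 \<otimes> e1 \<oplus> m11 \<otimes> f1)"
      using e f uv mm by (simp_all add: hom(2,3,5)[symmetric] quad_alg_mult)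
    then have eqs: "u \<otimes> e0 \<ominus> n \<otimes> (v \<otimes> e1) = m00 \<otimes> e0 \<oplus> m10 \<otimes> f0"
      "u \<otimes> e1 \<oplus> v \<otimes> e0 \<oplus> t \<otimes> (v \<otimes> e1) = m00 \<otimes> e1 \<oplus> m10 \<otimes> f1"
      "u \<otimes> f0 \<ominus> n \<otimes> (v \<otimes> f1) = m01 \<otimes> e0 \<oplus> m11 \<otimes> f0"
      "u \<otimes> f1 \<oplus> v \<otimes> f0 \<oplus> t \<otimes> (v \<otimes> f1) = m01 \<otimes> e1 \<oplus> m11 \<otimes> f1"
      using e f uv tn mm by (auto dest!: inj)
    \<comment> \<open>For multiplication by x = u + v a one has det(x e, f) + det(e, x f) = Tr(x)
      det(e, f). The left side is computed once from u and v and once from the matrix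
      \<open>m\<close>.\<close>
    have "(u \<oplus> u \<oplus> t \<otimes> v) \<otimes> det =
        (u \<otimes> e0 \<ominus> n \<otimes> (v \<otimes> e1)) \<otimes> f1 \<ominus> (u \<otimes> e1 \<oplus> v \<otimes> e0 \<oplus> t \<otimes> (v \<otimes> e1)) \<otimes> f0 \<oplus>
        (e0 \<otimes> (u \<otimes> f1 \<oplus> v \<otimes> f0 \<oplus> t \<otimes> (v \<otimes> f1)) \<ominus> e1 \<otimes> (u \<otimes> f0 \<ominus> n \<otimes> (v \<otimes> f1)))"
      using e(1,2) f(1,2) uv tn unfolding det_def
      by (elim component_cases) (simp add: component_simps algebra_simps)
    also have "\<dots> = (m00 \<oplus> m11) \<otimes> det"
      unfolding eqs using e(1,2) f(1,2) mm(5-8) unfolding det_def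
      by (elim component_cases) (simp add: component_simps algebra_simps)
    finally show "r = u \<oplus> u \<oplus> t \<otimes> v"
      using r' \<open>det \<noteq> \<zero>\<close> det uv tn mm m_rcancel[of det "m00 \<oplus> m11" "u \<oplus> u \<oplus> t \<otimes> v"] by simp
  qed
qed

section \<open>Monoid algebras\<close>

locale field_monoid = field F + G: monoid G for F (structure) and G
begin

abbreviation "FG \<equiv> monoid_alg F G"

lemma monoid_alg_carrier:
  "f \<in> carrier FG \<longleftrightarrow> (\<forall>p. f p \<in> carrier F) \<and> finite (support F f) \<and> support F f \<subseteq> carrier G"
  by (auto simp: monoid_alg_def)

lemma monoid_alg_one [simp]: "\<one>\<^bsub>FG\<^esub> = delta F \<one>\<^bsub>G\<^esub>"
  by (simp add: monoid_alg_def)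

lemma monoid_alg_simps [simp]:
  "\<zero>\<^bsub>FG\<^esub> = (\<lambda>p. \<zero>)"
  "(f \<oplus>\<^bsub>FG\<^esub> g) p = f p \<oplus> g p" "(c \<odot>\<^bsub>FG\<^esub> f) p = c \<otimes> f p"
  by (simp_all add: monoid_alg_def)

lemma support_delta: "support F (delta F p) = {p}"
  by (auto simp: support_def delta_def)

lemma delta_closed [simp]: "p \<in> carrier G \<Longrightarrow> delta F p \<in> carrier FG"
  by (simp add: monoid_alg_carrier support_delta) (simp add: delta_def)

lemma support_add: "support F (f \<oplus>\<^bsub>FG\<^esub> g) \<subseteq> support F f \<union> support F g"
  by (auto simp: support_def)

lemma support_smult: "c \<in> carrier F \<Longrightarrow> support F (c \<odot>\<^bsub>FG\<^esub> f) \<subseteq> support F f"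
  by (auto simp: support_def)

lemma monoid_alg_module: "module F FG"
proof (intro module.intro module_axioms.intro is_cring abelian_groupI)
  show add: "f \<oplus>\<^bsub>FG\<^esub> g \<in> carrier FG" if "f \<in> carrier FG" "g \<in> carrier FG" for f g
    using that finite_subset[OF support_add[of f g]] subset_trans[OF support_add[of f g]]
    by (simp add: monoid_alg_carrier)
  show smult: "c \<odot>\<^bsub>FG\<^esub> f \<in> carrier FG" if "c \<in> carrier F" "f \<in> carrier FG" for c f
    using that finite_subset[OF support_smult[of c f]] subset_trans[OF support_smult[of c f]]
    by (simp add: monoid_alg_carrier)
  show "\<exists>g\<in>carrier FG. g \<oplus>\<^bsub>FG\<^esub> f = \<zero>\<^bsub>FG\<^esub>" if "f \<in> carrier FG" for f
    using that smult[of "\<ominus> \<one>" f]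
    by (intro bexI[of _ "\<ominus> \<one> \<odot>\<^bsub>FG\<^esub> f"]) (auto simp: fun_eq_iff monoid_alg_carrier l_minus l_neg)
  show "\<zero>\<^bsub>FG\<^esub> \<in> carrier FG"
    by (simp add: monoid_alg_carrier support_def)
qed (auto simp: fun_eq_iff monoid_alg_carrier l_distr r_distr m_assoc a_ac)

sublocale FG: module F FG by (fact monoid_alg_module)

text \<open>One point of the support is removed at a time. Statements that are linear in an element
  are thereby reduced to the basis elements \<open>delta F p\<close>.\<close>

lemma monoid_alg_induct [consumes 1, case_names zero step]:
  assumes f: "f \<in> carrier FG"
    and zero: "P \<zero>\<^bsub>FG\<^esub>"
    and step: "\<And>f c p. \<lbrakk>f \<in> carrier FG; P f; c \<in> carrier F; p \<in> carrier G\<rbrakk> \<Longrightarrow>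
      P (f \<oplus>\<^bsub>FG\<^esub> c \<odot>\<^bsub>FG\<^esub> delta F p)"
  shows "P f"
proof -
  have "finite (support F f)" using f by (simp add: monoid_alg_carrier)
  then show ?thesis using f
  proof (induction "support F f" arbitrary: f rule: finite_induct)
    case empty
    then have "f = \<zero>\<^bsub>FG\<^esub>" by (auto simp: support_def)
    then show ?case using zero by simp
  next
    case (insert p A)
    let ?g = "f(p := \<zero>)"
    have A: "A = support F ?g" using insert.hyps by (auto simp: support_def)
    have p: "p \<in> carrier G" "f p \<in> carrier F"
      using insert.hyps(4) insert.prems by (auto simp: monoid_alg_carrier)
    have g: "?g \<in> carrier FG"
      using insert.prems insert.hyps A by (auto simp: monoid_alg_carrier)
    have "f = ?g \<oplus>\<^bsub>FG\<^esub> f p \<odot>\<^bsub>FG\<^esub> delta F p"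
      using insert.prems by (auto simp: fun_eq_iff delta_def monoid_alg_carrier)
    then show ?case using step[OF g insert.hyps(3)[OF A g] p(2,1)] by simp
  qed
qed

text \<open>The support of a sum or a multiple may be smaller than that of its constituents, so the
  convolution sums are padded with zero terms to common finite index sets before they are
  compared.\<close>

lemma convolution:
  assumes "f \<in> carrier FG" "g \<in> carrier FG" "finite P" "finite Q" "support F f \<subseteq> P" "support F g \<subseteq> Q"
  shows "(f \<otimes>\<^bsub>FG\<^esub> g) q = (\<Oplus>s\<in>{s \<in> P \<times> Q. fst s \<otimes>\<^bsub>G\<^esub> snd s = q}. f (fst s) \<otimes> g (snd s))"
proof -
  have "(f \<otimes>\<^bsub>FG\<^esub> g) q =
      (\<Oplus>s\<in>{s \<in> support F f \<times> support F g. fst s \<otimes>\<^bsub>G\<^esub> snd s = q}. f (fst s) \<otimes> g (snd s))"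
    by (simp add: monoid_alg_def)
  also have "\<dots> = (\<Oplus>s\<in>{s \<in> P \<times> Q. fst s \<otimes>\<^bsub>G\<^esub> snd s = q}. f (fst s) \<otimes> g (snd s))"
    using assms by (intro add.finprod_mono_neutral_cong_left)
      (auto simp: monoid_alg_carrier support_def)
  finally show ?thesis .
qed

lemma mult_closed:
  assumes "f \<in> carrier FG" "g \<in> carrier FG"
  shows "f \<otimes>\<^bsub>FG\<^esub> g \<in> carrier FG"
proof -
  let ?S = "(\<lambda>s. fst s \<otimes>\<^bsub>G\<^esub> snd s) ` (support F f \<times> support F g)"
  have *: "(f \<otimes>\<^bsub>FG\<^esub> g) q = \<zero>" if "q \<notin> ?S" for q
  proof -
    have "{s \<in> support F f \<times> support F g. fst s \<otimes>\<^bsub>G\<^esub> snd s = q} = {}" using that by blast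
    then show ?thesis by (simp only: monoid_alg_def monoid.simps finsum_empty)
  qed
  have "support F (f \<otimes>\<^bsub>FG\<^esub> g) \<subseteq> ?S"
    using * by (auto simp: support_def)
  moreover have "?S \<subseteq> carrier G" "finite ?S" using assms by (auto simp: monoid_alg_carrier subset_iff)
  moreover have "(f \<otimes>\<^bsub>FG\<^esub> g) q \<in> carrier F" for q
    using assms unfolding monoid_alg_def by (auto intro!: finsum_closed m_closed simp: image_subset_iff)
  ultimately show ?thesis by (auto simp: monoid_alg_carrier intro: finite_subset)
qed

lemma delta_mult:
  assumes "p \<in> carrier G" "q \<in> carrier G"
  shows "delta F p \<otimes>\<^bsub>FG\<^esub> delta F q = delta F (p \<otimes>\<^bsub>G\<^esub> q)"
proof
  fix r
  have "{s \<in> {p} \<times> {q}. fst s \<otimes>\<^bsub>G\<^esub> snd s = r} = (if r = p \<otimes>\<^bsub>G\<^esub> q then {(p, q)} else {})" by auto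
  then show "(delta F p \<otimes>\<^bsub>FG\<^esub> delta F q) r = delta F (p \<otimes>\<^bsub>G\<^esub> q) r"
    by (simp add: monoid_alg_def support_delta) (simp add: delta_def)
qed

lemma convolution_bilinear:
  assumes f: "f \<in> carrier FG" and g: "g \<in> carrier FG" and h: "h \<in> carrier FG"
  shows "(f \<oplus>\<^bsub>FG\<^esub> g) \<otimes>\<^bsub>FG\<^esub> h = f \<otimes>\<^bsub>FG\<^esub> h \<oplus>\<^bsub>FG\<^esub> g \<otimes>\<^bsub>FG\<^esub> h"
    "h \<otimes>\<^bsub>FG\<^esub> (f \<oplus>\<^bsub>FG\<^esub> g) = h \<otimes>\<^bsub>FG\<^esub> f \<oplus>\<^bsub>FG\<^esub> h \<otimes>\<^bsub>FG\<^esub> g"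
    "\<And>c. c \<in> carrier F \<Longrightarrow> (c \<odot>\<^bsub>FG\<^esub> f) \<otimes>\<^bsub>FG\<^esub> h = c \<odot>\<^bsub>FG\<^esub> (f \<otimes>\<^bsub>FG\<^esub> h)"
    "\<And>c. c \<in> carrier F \<Longrightarrow> h \<otimes>\<^bsub>FG\<^esub> (c \<odot>\<^bsub>FG\<^esub> f) = c \<odot>\<^bsub>FG\<^esub> (h \<otimes>\<^bsub>FG\<^esub> f)"
proof -
  let ?P = "support F f \<union> support F g" and ?Q = "support F h"
  have fin: "finite ?P" "finite ?Q" using assms by (auto simp: monoid_alg_carrier)
  have cl: "f p \<in> carrier F" "g p \<in> carrier F" "h p \<in> carrier F" for p
    using assms by (auto simp: monoid_alg_carrier)
  let ?S = "\<lambda>q. {s \<in> ?P \<times> ?Q. fst s \<otimes>\<^bsub>G\<^esub> snd s = q}"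
  let ?S' = "\<lambda>q. {s \<in> ?Q \<times> ?P. fst s \<otimes>\<^bsub>G\<^esub> snd s = q}"
  have fin': "finite (?S q)" "finite (?S' q)" for q using fin by auto
  have conv1: "(k \<otimes>\<^bsub>FG\<^esub> h) q = (\<Oplus>s\<in>?S q. k (fst s) \<otimes> h (snd s))"
    and conv2: "(h \<otimes>\<^bsub>FG\<^esub> k) q = (\<Oplus>s\<in>?S' q. h (fst s) \<otimes> k (snd s))"
    if "k \<in> carrier FG" "support F k \<subseteq> ?P" for k q
    using that fin h by (intro convolution; simp)+
  have closed: "f \<oplus>\<^bsub>FG\<^esub> g \<in> carrier FG" using f g by simp
  show "(f \<oplus>\<^bsub>FG\<^esub> g) \<otimes>\<^bsub>FG\<^esub> h = f \<otimes>\<^bsub>FG\<^esub> h \<oplus>\<^bsub>FG\<^esub> g \<otimes>\<^bsub>FG\<^esub> h"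
  proof
    fix q
    have "((f \<oplus>\<^bsub>FG\<^esub> g) \<otimes>\<^bsub>FG\<^esub> h) q =
        (\<Oplus>s\<in>?S q. f (fst s) \<otimes> h (snd s) \<oplus> g (fst s) \<otimes> h (snd s))"
      unfolding conv1[OF closed support_add] monoid_alg_simps
      using cl by (intro finsum_cong') (auto simp: l_distr)
    also have "\<dots> = (f \<otimes>\<^bsub>FG\<^esub> h) q \<oplus> (g \<otimes>\<^bsub>FG\<^esub> h) q"
      unfolding conv1[OF f Un_upper1] conv1[OF g Un_upper2]
      using cl by (intro finsum_addf) auto
    finally show "((f \<oplus>\<^bsub>FG\<^esub> g) \<otimes>\<^bsub>FG\<^esub> h) q = (f \<otimes>\<^bsub>FG\<^esub> h \<oplus>\<^bsub>FG\<^esub> g \<otimes>\<^bsub>FG\<^esub> h) q"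
      by simp
  qed
  show "h \<otimes>\<^bsub>FG\<^esub> (f \<oplus>\<^bsub>FG\<^esub> g) = h \<otimes>\<^bsub>FG\<^esub> f \<oplus>\<^bsub>FG\<^esub> h \<otimes>\<^bsub>FG\<^esub> g"
  proof
    fix q
    have "(h \<otimes>\<^bsub>FG\<^esub> (f \<oplus>\<^bsub>FG\<^esub> g)) q =
        (\<Oplus>s\<in>?S' q. h (fst s) \<otimes> f (snd s) \<oplus> h (fst s) \<otimes> g (snd s))"
      unfolding conv2[OF closed support_add] monoid_alg_simps
      using cl by (intro finsum_cong') (auto simp: r_distr)
    also have "\<dots> = (h \<otimes>\<^bsub>FG\<^esub> f) q \<oplus> (h \<otimes>\<^bsub>FG\<^esub> g) q"
      unfolding conv2[OF f Un_upper1] conv2[OF g Un_upper2]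
      using cl by (intro finsum_addf) auto
    finally show "(h \<otimes>\<^bsub>FG\<^esub> (f \<oplus>\<^bsub>FG\<^esub> g)) q = (h \<otimes>\<^bsub>FG\<^esub> f \<oplus>\<^bsub>FG\<^esub> h \<otimes>\<^bsub>FG\<^esub> g) q"
      by simp
  qed
  fix c assume c: "c \<in> carrier F"
  then have sup: "support F (c \<odot>\<^bsub>FG\<^esub> f) \<subseteq> ?P" "c \<odot>\<^bsub>FG\<^esub> f \<in> carrier FG"
    using support_smult[OF c, of f] f by auto
  show "(c \<odot>\<^bsub>FG\<^esub> f) \<otimes>\<^bsub>FG\<^esub> h = c \<odot>\<^bsub>FG\<^esub> (f \<otimes>\<^bsub>FG\<^esub> h)"
  proof
    fix q
    have "((c \<odot>\<^bsub>FG\<^esub> f) \<otimes>\<^bsub>FG\<^esub> h) q = (\<Oplus>s\<in>?S q. c \<otimes> (f (fst s) \<otimes> h (snd s)))"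
      unfolding conv1[OF sup(2,1)] monoid_alg_simps
      using cl c by (intro finsum_cong') (auto simp: m_assoc)
    also have "\<dots> = c \<otimes> (f \<otimes>\<^bsub>FG\<^esub> h) q"
      unfolding conv1[OF f Un_upper1] using cl c fin' by (intro finsum_rdistr[symmetric]) auto
    finally show "((c \<odot>\<^bsub>FG\<^esub> f) \<otimes>\<^bsub>FG\<^esub> h) q = (c \<odot>\<^bsub>FG\<^esub> (f \<otimes>\<^bsub>FG\<^esub> h)) q" by simp
  qed
  show "h \<otimes>\<^bsub>FG\<^esub> (c \<odot>\<^bsub>FG\<^esub> f) = c \<odot>\<^bsub>FG\<^esub> (h \<otimes>\<^bsub>FG\<^esub> f)"
  proof
    fix q
    have "(h \<otimes>\<^bsub>FG\<^esub> (c \<odot>\<^bsub>FG\<^esub> f)) q = (\<Oplus>s\<in>?S' q. c \<otimes> (h (fst s) \<otimes> f (snd s)))"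
      unfolding conv2[OF sup(2,1)] monoid_alg_simps
      using cl c by (intro finsum_cong') (auto simp: m_lcomm)
    also have "\<dots> = c \<otimes> (h \<otimes>\<^bsub>FG\<^esub> f) q"
      unfolding conv2[OF f Un_upper1] using cl c fin' by (intro finsum_rdistr[symmetric]) auto
    finally show "(h \<otimes>\<^bsub>FG\<^esub> (c \<odot>\<^bsub>FG\<^esub> f)) q = (c \<odot>\<^bsub>FG\<^esub> (h \<otimes>\<^bsub>FG\<^esub> f)) q" by simp
  qed
qed

lemma convolution_zero:
  "\<zero>\<^bsub>FG\<^esub> \<otimes>\<^bsub>FG\<^esub> f = \<zero>\<^bsub>FG\<^esub>" "f \<otimes>\<^bsub>FG\<^esub> \<zero>\<^bsub>FG\<^esub> = \<zero>\<^bsub>FG\<^esub>"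
  by (simp_all add: monoid_alg_def support_def)

lemmas convolution_simps = convolution_bilinear convolution_zero delta_mult mult_closed
  FG.smult_r_distr FG.smult_r_null

declare monoid_alg_simps [simp del]

text \<open>By bilinearity, associativity is reduced to basis elements by induction on the third,
  then the second, then the first factor; on basis elements it is associativity in
  \<open>G\<close>.\<close>

lemma monoid_alg_algebra: "field_algebra F FG"
proof -
  note [simp] = convolution_simps
  have d1: "delta F \<one>\<^bsub>G\<^esub> \<otimes>\<^bsub>FG\<^esub> f = f" "f \<otimes>\<^bsub>FG\<^esub> delta F \<one>\<^bsub>G\<^esub> = f" if "f \<in> carrier FG" for f
    using that by (induction f rule: monoid_alg_induct) simp_all
  have a1: "(delta F p \<otimes>\<^bsub>FG\<^esub> delta F q) \<otimes>\<^bsub>FG\<^esub> h = delta F p \<otimes>\<^bsub>FG\<^esub> (delta F q \<otimes>\<^bsub>FG\<^esub> h)"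
    if "h \<in> carrier FG" "p \<in> carrier G" "q \<in> carrier G" for p q h
    using that by (induction h rule: monoid_alg_induct) (simp_all add: G.m_assoc)
  have a2: "(delta F p \<otimes>\<^bsub>FG\<^esub> g) \<otimes>\<^bsub>FG\<^esub> h = delta F p \<otimes>\<^bsub>FG\<^esub> (g \<otimes>\<^bsub>FG\<^esub> h)"
    if "g \<in> carrier FG" "h \<in> carrier FG" "p \<in> carrier G" for p g h
    using that a1 by (induction g rule: monoid_alg_induct) simp_all
  have a3: "(f \<otimes>\<^bsub>FG\<^esub> g) \<otimes>\<^bsub>FG\<^esub> h = f \<otimes>\<^bsub>FG\<^esub> (g \<otimes>\<^bsub>FG\<^esub> h)"
    if "f \<in> carrier FG" "g \<in> carrier FG" "h \<in> carrier FG" for f g h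
    using that a2 by (induction f rule: monoid_alg_induct) simp_all
  have ne: "delta F \<one>\<^bsub>G\<^esub> \<noteq> \<zero>\<^bsub>FG\<^esub>"
    by (auto simp: delta_def fun_eq_iff monoid_alg_simps)
  show ?thesis
    by (intro field_algebra.intro assoc_algebra.intro assoc_algebra_axioms.intro
        field_algebra_axioms.intro ringI monoidI monoid_alg_module field_axioms FG.M.abelian_group_axioms)
      (simp_all add: d1 a3 ne)
qed

sublocale FG: field_algebra F FG by (fact monoid_alg_algebra)

section \<open>The universal property of the monoid algebra\<close>

definition linear_extension :: "('a, 'm, 's) module_scheme \<Rightarrow> ('c \<Rightarrow> 'm) \<Rightarrow> ('c \<Rightarrow> 'a) \<Rightarrow> 'm" where
  "linear_extension M \<psi> f = (\<Oplus>\<^bsub>M\<^esub>p \<in> support F f. f p \<odot>\<^bsub>M\<^esub> \<psi> p)"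

context
  fixes M :: "('a, 'm, 's) module_scheme" and \<psi> :: "'c \<Rightarrow> 'm"
  assumes M: "module F M" and \<psi>: "\<psi> \<in> carrier G \<rightarrow> carrier M"
begin

interpretation M: module F M by (fact M)

lemma linear_extension_superset:
  assumes "f \<in> carrier FG" "finite P" "support F f \<subseteq> P" "P \<subseteq> carrier G"
  shows "linear_extension M \<psi> f = (\<Oplus>\<^bsub>M\<^esub>p \<in> P. f p \<odot>\<^bsub>M\<^esub> \<psi> p)"
  unfolding linear_extension_def using assms \<psi>
  by (intro M.add.finprod_mono_neutral_cong_left)
    (auto simp: monoid_alg_carrier support_def M.smult_l_null Pi_iff subset_iff)

lemma linear_extension_closed:
  "f \<in> carrier FG \<Longrightarrow> linear_extension M \<psi> f \<in> carrier M"
  unfolding linear_extension_def using \<psi>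
  by (intro M.M.finsum_closed) (auto simp: monoid_alg_carrier Pi_iff subset_iff)

lemma linear_extension_delta:
  assumes "p \<in> carrier G" shows "linear_extension M \<psi> (delta F p) = \<psi> p"
proof -
  have "\<psi> p \<in> carrier M" using \<psi> assms by auto
  then show ?thesis by (simp add: linear_extension_def support_delta) (simp add: delta_def)
qed

lemma linear_extension_add:
  assumes "f \<in> carrier FG" "g \<in> carrier FG"
  shows "linear_extension M \<psi> (f \<oplus>\<^bsub>FG\<^esub> g) = linear_extension M \<psi> f \<oplus>\<^bsub>M\<^esub> linear_extension M \<psi> g"
proof -
  let ?P = "support F f \<union> support F g"
  have P: "finite ?P" "?P \<subseteq> carrier G" using assms by (auto simp: monoid_alg_carrier)
  have cl: "f p \<in> carrier F" "g p \<in> carrier F" for p using assms by (auto simp: monoid_alg_carrier)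
  have \<psi>P: "p \<in> ?P \<Longrightarrow> \<psi> p \<in> carrier M" for p using \<psi> P by auto
  have "linear_extension M \<psi> (f \<oplus>\<^bsub>FG\<^esub> g) = (\<Oplus>\<^bsub>M\<^esub>p \<in> ?P. f p \<odot>\<^bsub>M\<^esub> \<psi> p \<oplus>\<^bsub>M\<^esub> g p \<odot>\<^bsub>M\<^esub> \<psi> p)"
    unfolding linear_extension_superset[OF FG.M.a_closed[OF assms] P(1) support_add P(2)] monoid_alg_simps
    using cl \<psi>P by (intro M.M.finsum_cong') (auto simp: M.smult_l_distr)
  also have "\<dots> = linear_extension M \<psi> f \<oplus>\<^bsub>M\<^esub> linear_extension M \<psi> g"
    using assms P cl \<psi>P by (subst M.M.finsum_addf) (auto simp: linear_extension_superset[of _ ?P])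
  finally show ?thesis .
qed

lemma linear_extension_smult:
  assumes "f \<in> carrier FG" "c \<in> carrier F"
  shows "linear_extension M \<psi> (c \<odot>\<^bsub>FG\<^esub> f) = c \<odot>\<^bsub>M\<^esub> linear_extension M \<psi> f"
proof -
  let ?P = "support F f"
  have P: "finite ?P" "?P \<subseteq> carrier G" using assms by (auto simp: monoid_alg_carrier)
  have cl: "f p \<in> carrier F" for p using assms by (auto simp: monoid_alg_carrier)
  have \<psi>P: "p \<in> ?P \<Longrightarrow> \<psi> p \<in> carrier M" for p using \<psi> P by auto
  show ?thesis
    using assms P cl \<psi>P support_smult
    by (simp add: linear_extension_superset[of _ ?P] M.finsum_smult_ldistr Pi_iff monoid_alg_simps)
      (auto intro!: M.M.finsum_cong' simp: M.smult_assoc1)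
qed

lemma linear_extension_zero: "linear_extension M \<psi> \<zero>\<^bsub>FG\<^esub> = \<zero>\<^bsub>M\<^esub>"
  by (simp add: linear_extension_def support_def monoid_alg_simps)

text \<open>A linear map is determined by its values on the basis elements. This identifies maps
  given through coordinates with the sum that occurs in \<open>tensor_lift\<close>.\<close>

lemma linear_extension_unique:
  assumes f: "f \<in> carrier FG"
    and closed: "\<And>f. f \<in> carrier FG \<Longrightarrow> h f \<in> carrier M"
    and add: "\<And>f g. f \<in> carrier FG \<Longrightarrow> g \<in> carrier FG \<Longrightarrow> h (f \<oplus>\<^bsub>FG\<^esub> g) = h f \<oplus>\<^bsub>M\<^esub> h g"
    and smult: "\<And>c f. c \<in> carrier F \<Longrightarrow> f \<in> carrier FG \<Longrightarrow> h (c \<odot>\<^bsub>FG\<^esub> f) = c \<odot>\<^bsub>M\<^esub> h f"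
    and delta: "\<And>p. p \<in> carrier G \<Longrightarrow> h (delta F p) = \<psi> p"
  shows "h f = linear_extension M \<psi> f"
  using f
proof (induction f rule: monoid_alg_induct)
  case zero
  have "h (\<zero> \<odot>\<^bsub>FG\<^esub> \<zero>\<^bsub>FG\<^esub>) = \<zero>\<^bsub>M\<^esub>"
    using FG.M.zero_closed closed[OF FG.M.zero_closed] by (subst smult) (simp_all add: M.smult_l_null)
  moreover have "\<zero> \<odot>\<^bsub>FG\<^esub> \<zero>\<^bsub>FG\<^esub> = \<zero>\<^bsub>FG\<^esub>" by (simp add: FG.smult_l_null)
  ultimately show ?case by (simp only: linear_extension_zero)
next
  case (step f c p)
  then show ?case
    using \<psi> by (simp add: add smult delta linear_extension_add linear_extension_smult linear_extension_delta)
qed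

end

text \<open>Both sides of the multiplication law are bilinear, so multiplicativity on the basis
  suffices. It makes the coordinate map on the monoid algebra a ring homomorphism, whose kernel is
  then an ideal.\<close>

lemma linear_extension_hom:
  assumes M: "field_algebra F M" and \<psi>: "\<psi> \<in> carrier G \<rightarrow> carrier M"
    and mult: "\<And>p q. p \<in> carrier G \<Longrightarrow> q \<in> carrier G \<Longrightarrow> \<psi> (p \<otimes>\<^bsub>G\<^esub> q) = \<psi> p \<otimes>\<^bsub>M\<^esub> \<psi> q"
    and one: "\<psi> \<one>\<^bsub>G\<^esub> = \<one>\<^bsub>M\<^esub>"
  shows "linear_extension M \<psi> \<in> alg_hom F FG M"
proof -
  interpret M: field_algebra F M by (fact M)
  note le = linear_extension_closed[OF M.module_axioms \<psi>] linear_extension_delta[OF M.module_axioms \<psi>]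
    linear_extension_add[OF M.module_axioms \<psi>] linear_extension_smult[OF M.module_axioms \<psi>]
    linear_extension_zero[OF M.module_axioms \<psi>]
  note [simp] = convolution_simps le M.smult_mult_left M.smult_mult_right
    M.M.l_distr M.M.r_distr
  have 1: "linear_extension M \<psi> (delta F p \<otimes>\<^bsub>FG\<^esub> g) = \<psi> p \<otimes>\<^bsub>M\<^esub> linear_extension M \<psi> g"
    if "g \<in> carrier FG" "p \<in> carrier G" for p g
    using that \<psi> by (induction g rule: monoid_alg_induct) (auto simp: mult Pi_iff)
  have 2: "linear_extension M \<psi> (f \<otimes>\<^bsub>FG\<^esub> g) = linear_extension M \<psi> f \<otimes>\<^bsub>M\<^esub> linear_extension M \<psi> g"
    if "f \<in> carrier FG" "g \<in> carrier FG" for f g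
    using that \<psi> by (induction f rule: monoid_alg_induct) (auto simp: 1 Pi_iff)
  show ?thesis
    unfolding alg_hom_def ring_hom_def by (auto simp: 2 one)
qed

end

section \<open>Quadratic etale algebras\<close>

text \<open>The element (0, 1) is idempotent, so its coefficients are t = 1 and n = 0, and (y0, y1)
  = y0 (1, 1) + (y1 - y0) (0, 1).\<close>

lemma (in quadratic_pair) direct_sum_alg_iso:
  "field_algebra F (direct_sum_alg F)"
  "(\<lambda>(y0, y1). (y0, y1 \<ominus> y0)) \<in> alg_iso F (direct_sum_alg F) (quad_alg F \<one> \<zero>)"
proof -
  have "x0 \<oplus> (x1 \<oplus> \<ominus> x0) = x1" if "x0 \<in> carrier F" "x1 \<in> carrier F" for x0 x1
    using that by (elim component_cases) (simp add: component_simps)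
  note cancel = this
  have diff_self: "x \<ominus> x = \<zero>" if "x \<in> carrier F" for x
    using that by (simp add: minus_eq r_neg)
  have bij: "bij_betw (\<lambda>(y0, y1). (y0, y1 \<ominus> y0)) (carrier F \<times> carrier F) (carrier F \<times> carrier F)"
    by (rule bij_betwI[where g = "\<lambda>(x0, x1). (x0, x0 \<oplus> x1)"])
      (auto simp: minus_eq cancel a_assoc r_neg)
  have simps: "carrier (direct_sum_alg F) = carrier F \<times> carrier F"
    "\<one>\<^bsub>direct_sum_alg F\<^esub> = (\<one>, \<one>)" "\<zero>\<^bsub>direct_sum_alg F\<^esub> = (\<zero>, \<zero>)"
    "(x0, x1) \<oplus>\<^bsub>direct_sum_alg F\<^esub> (y0, y1) = (x0 \<oplus> y0, x1 \<oplus> y1)"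
    "(x0, x1) \<otimes>\<^bsub>direct_sum_alg F\<^esub> (y0, y1) = (x0 \<otimes> y0, x1 \<otimes> y1)"
    "c \<odot>\<^bsub>direct_sum_alg F\<^esub> (x0, x1) = (c \<otimes> x0, c \<otimes> x1)" for x0 x1 y0 y1 c
    by (auto simp: direct_sum_alg_def RDirProd_def DirProd_def ring.defs monoid.defs module.defs)
  have mult: "(x0 \<otimes> y0, x1 \<otimes> y1 \<ominus> x0 \<otimes> y0) =
      (x0, x1 \<ominus> x0) \<otimes>\<^bsub>quad_alg F \<one> \<zero>\<^esub> (y0, y1 \<ominus> y0)"
    "(x0 \<oplus> y0, (x1 \<oplus> y1) \<ominus> (x0 \<oplus> y0)) = (x0 \<oplus> y0, (x1 \<ominus> x0) \<oplus> (y1 \<ominus> y0))"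
    "x0 \<otimes> (y1 \<ominus> y0) = x0 \<otimes> y1 \<ominus> x0 \<otimes> y0"
    if "x0 \<in> carrier F" "x1 \<in> carrier F" "y0 \<in> carrier F" "y1 \<in> carrier F" for x0 x1 y0 y1
    using that unfolding quad_alg_mult
    by (elim component_cases, simp add: component_simps algebra_simps)+
  have "field_algebra F (quad_alg F \<one> \<zero>)" by (intro quad_alg_algebra) auto
  note pullback = field_algebra_pullback[OF this, where M = "direct_sum_alg F" and
      g = "\<lambda>(y0, y1). (y0, y1 \<ominus> y0)"]
  show "field_algebra F (direct_sum_alg F)"
    by (rule pullback) (use bij in \<open>auto simp: simps mult(2,3) mult(1)[symmetric] diff_self\<close>)
  show "(\<lambda>(y0, y1). (y0, y1 \<ominus> y0)) \<in> alg_iso F (direct_sum_alg F) (quad_alg F \<one> \<zero>)"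
    by (rule pullback) (use bij in \<open>auto simp: simps mult(2,3) mult(1)[symmetric] diff_self\<close>)
qed

section \<open>Generators of quadratic algebras and the conjugate root\<close>

abbreviation discriminant :: "'f ring \<Rightarrow> 'f \<Rightarrow> 'f \<Rightarrow> 'f" where
  "discriminant F t n \<equiv> t \<otimes>\<^bsub>F\<^esub> t \<ominus>\<^bsub>F\<^esub> (n \<oplus>\<^bsub>F\<^esub> n \<oplus>\<^bsub>F\<^esub> n \<oplus>\<^bsub>F\<^esub> n)"

text \<open>As a is not a scalar, 1 and a are independent, hence a basis in dimension two; the
  coordinates of a^2 are the coefficients -n and t.\<close>

lemma quadratic_generator:
  fixes F :: "'f ring" and K :: "('f, 'k) module"
  assumes K: "field_algebra F K" and comm: "cring K" and dim: "has_dim F K 2"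
    and a: "a \<in> carrier K" "a \<notin> scalars F K"
  obtains t n where "t \<in> carrier F" "n \<in> carrier F"
    "(\<lambda>(x0, x1). x0 \<odot>\<^bsub>K\<^esub> \<one>\<^bsub>K\<^esub> \<oplus>\<^bsub>K\<^esub> x1 \<odot>\<^bsub>K\<^esub> a) \<in> alg_iso F (quad_alg F t n) K"
proof -
  interpret K: field_algebra F K by fact
  interpret C: cring K by fact
  let ?\<kappa> = "\<lambda>(x0, x1). x0 \<odot>\<^bsub>K\<^esub> \<one>\<^bsub>K\<^esub> \<oplus>\<^bsub>K\<^esub> x1 \<odot>\<^bsub>K\<^esub> a"
  have us: "set [\<one>\<^bsub>K\<^esub>, a] \<subseteq> carrier K" using a by simp
  have lin: "K.lincomb [x0, x1] [\<one>\<^bsub>K\<^esub>, a] = ?\<kappa> (x0, x1)"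
    if "x0 \<in> carrier F" "x1 \<in> carrier F" for x0 x1
    using that a by simp
  have zero: "x0 = \<zero>\<^bsub>F\<^esub> \<and> x1 = \<zero>\<^bsub>F\<^esub>"
    if x: "x0 \<in> carrier F" "x1 \<in> carrier F" and eq: "?\<kappa> (x0, x1) = \<zero>\<^bsub>K\<^esub>" for x0 x1
  proof (cases "x1 = \<zero>\<^bsub>F\<^esub>")
    case True
    then have "x0 \<odot>\<^bsub>K\<^esub> \<one>\<^bsub>K\<^esub> = \<zero>\<^bsub>K\<^esub>" using eq x a by (simp add: K.smult_l_null)
    then show ?thesis using K.smult_eq_zero[OF _ _ _ K.one_not_zero_M] x True by auto
  next
    case False
    then have u: "x1 \<in> Units F" "inv\<^bsub>F\<^esub> x1 \<in> carrier F" using x K.field_Units by auto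
    have "x1 \<odot>\<^bsub>K\<^esub> a = \<ominus>\<^bsub>K\<^esub> (x0 \<odot>\<^bsub>K\<^esub> \<one>\<^bsub>K\<^esub>)"
      using eq x a by (intro K.M.minus_equality[symmetric]) (simp_all add: K.M.a_comm)
    also have "\<dots> = (\<ominus>\<^bsub>F\<^esub> x0) \<odot>\<^bsub>K\<^esub> \<one>\<^bsub>K\<^esub>" using x by (simp add: K.smult_l_minus)
    finally have "inv\<^bsub>F\<^esub> x1 \<odot>\<^bsub>K\<^esub> (x1 \<odot>\<^bsub>K\<^esub> a) = inv\<^bsub>F\<^esub> x1 \<odot>\<^bsub>K\<^esub> ((\<ominus>\<^bsub>F\<^esub> x0) \<odot>\<^bsub>K\<^esub> \<one>\<^bsub>K\<^esub>)" by simp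
    then have "a = (inv\<^bsub>F\<^esub> x1 \<otimes>\<^bsub>F\<^esub> \<ominus>\<^bsub>F\<^esub> x0) \<odot>\<^bsub>K\<^esub> \<one>\<^bsub>K\<^esub>"
      using u x a by (simp add: K.smult_assoc1[symmetric])
    then show ?thesis using a u x by (auto simp: scalars_def)
  qed
  have ind: "K.M.independent (scalars F K) [\<one>\<^bsub>K\<^esub>, a]"
    unfolding K.independent_iff_lincomb[OF us]
  proof (intro allI impI; elim conjE)
    fix cs assume cs: "length cs = length [\<one>\<^bsub>K\<^esub>, a]" "set cs \<subseteq> carrier F"
      "K.lincomb cs [\<one>\<^bsub>K\<^esub>, a] = \<zero>\<^bsub>K\<^esub>"
    then obtain x0 x1 where x: "cs = [x0, x1]" "x0 \<in> carrier F" "x1 \<in> carrier F"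
      by (auto simp: length_Suc_conv)
    then have "?\<kappa> (x0, x1) = \<zero>\<^bsub>K\<^esub>" using cs(3) lin by simp
    from zero[OF x(2,3) this] show "set cs \<subseteq> {\<zero>\<^bsub>F\<^esub>}" using x by simp
  qed
  have span: "K.M.Span (scalars F K) [\<one>\<^bsub>K\<^esub>, a] = carrier K"
    using K.M.independent_length_eq_dimension[OF K.scalars_subfield dim[unfolded has_dim_def] ind us]
    by simp
  have surj: "\<exists>x0 x1. x0 \<in> carrier F \<and> x1 \<in> carrier F \<and> y = ?\<kappa> (x0, x1)" if "y \<in> carrier K" for y
  proof -
    obtain cs where cs: "y = K.lincomb cs [\<one>\<^bsub>K\<^esub>, a]" "length cs = length [\<one>\<^bsub>K\<^esub>, a]" "set cs \<subseteq> carrier F"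
      using \<open>y \<in> carrier K\<close> unfolding span[symmetric] K.Span_eq_lincomb[OF us] by blast
    then obtain x0 x1 where "cs = [x0, x1]" "x0 \<in> carrier F" "x1 \<in> carrier F"
      by (auto simp: length_Suc_conv)
    with cs(1) lin show ?thesis by blast
  qed
  obtain m t where tm: "t \<in> carrier F" "m \<in> carrier F" "a \<otimes>\<^bsub>K\<^esub> a = ?\<kappa> (m, t)"
    using surj[of "a \<otimes>\<^bsub>K\<^esub> a"] a by auto
  let ?n = "\<ominus>\<^bsub>F\<^esub> m"
  have mult: "?\<kappa> (x0 \<otimes>\<^bsub>F\<^esub> y0 \<ominus>\<^bsub>F\<^esub> ?n \<otimes>\<^bsub>F\<^esub> (x1 \<otimes>\<^bsub>F\<^esub> y1),
        x0 \<otimes>\<^bsub>F\<^esub> y1 \<oplus>\<^bsub>F\<^esub> x1 \<otimes>\<^bsub>F\<^esub> y0 \<oplus>\<^bsub>F\<^esub> t \<otimes>\<^bsub>F\<^esub> (x1 \<otimes>\<^bsub>F\<^esub> y1)) = ?\<kappa> (x0, x1) \<otimes>\<^bsub>K\<^esub> ?\<kappa> (y0, y1)"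
    if "x0 \<in> carrier F" "x1 \<in> carrier F" "y0 \<in> carrier F" "y1 \<in> carrier F" for x0 x1 y0 y1
  proof -
    have "?\<kappa> (x0, x1) \<otimes>\<^bsub>K\<^esub> ?\<kappa> (y0, y1) =
      (x0 \<otimes>\<^bsub>F\<^esub> y0) \<odot>\<^bsub>K\<^esub> \<one>\<^bsub>K\<^esub> \<oplus>\<^bsub>K\<^esub> (x0 \<otimes>\<^bsub>F\<^esub> y1) \<odot>\<^bsub>K\<^esub> a \<oplus>\<^bsub>K\<^esub> (x1 \<otimes>\<^bsub>F\<^esub> y0) \<odot>\<^bsub>K\<^esub> a \<oplus>\<^bsub>K\<^esub>
        (x1 \<otimes>\<^bsub>F\<^esub> y1) \<odot>\<^bsub>K\<^esub> (a \<otimes>\<^bsub>K\<^esub> a)"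
      using that a by (simp add: K.M.l_distr K.M.r_distr K.smult_mult_left K.smult_mult_right K.M.a_ac
          K.smult_r_distr K.smult_assoc1[symmetric] K.R.m_comm)
    also have "\<dots> = ?\<kappa> (x0 \<otimes>\<^bsub>F\<^esub> y0 \<ominus>\<^bsub>F\<^esub> ?n \<otimes>\<^bsub>F\<^esub> (x1 \<otimes>\<^bsub>F\<^esub> y1),
        x0 \<otimes>\<^bsub>F\<^esub> y1 \<oplus>\<^bsub>F\<^esub> x1 \<otimes>\<^bsub>F\<^esub> y0 \<oplus>\<^bsub>F\<^esub> t \<otimes>\<^bsub>F\<^esub> (x1 \<otimes>\<^bsub>F\<^esub> y1))"
      unfolding tm(3) using that a tm(1,2)
      by (simp add: K.smult_l_distr K.smult_r_distr K.smult_assoc1[symmetric] K.R.minus_eq K.R.l_minus K.R.r_minus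
          K.M.a_ac K.R.m_ac)
    finally show ?thesis by simp
  qed
  have inj: "x = y" if xy: "x \<in> carrier F \<times> carrier F" "y \<in> carrier F \<times> carrier F" "?\<kappa> x = ?\<kappa> y" for x y
  proof -
    obtain x0 x1 y0 y1 where eq: "x = (x0, x1)" "y = (y0, y1)" by (cases x, cases y)
    with xy have c: "x0 \<in> carrier F" "x1 \<in> carrier F" "y0 \<in> carrier F" "y1 \<in> carrier F" by auto
    have "?\<kappa> (x0 \<ominus>\<^bsub>F\<^esub> y0, x1 \<ominus>\<^bsub>F\<^esub> y1) = ?\<kappa> (x0, x1) \<ominus>\<^bsub>K\<^esub> ?\<kappa> (y0, y1)"
      using c a by (simp add: K.R.minus_eq K.M.minus_eq K.smult_l_distr K.smult_l_minus K.M.minus_add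
          K.M.a_ac)
    also have "\<dots> = \<zero>\<^bsub>K\<^esub>" using xy(3) c a by (simp add: eq)
    finally show ?thesis using zero[of "x0 \<ominus>\<^bsub>F\<^esub> y0" "x1 \<ominus>\<^bsub>F\<^esub> y1"] c eq by simp
  qed
  have bij: "bij_betw ?\<kappa> (carrier F \<times> carrier F) (carrier K)"
    unfolding bij_betw_def
  proof
    show "inj_on ?\<kappa> (carrier F \<times> carrier F)" using inj by (rule inj_onI)
    show "?\<kappa> ` (carrier F \<times> carrier F) = carrier K" using surj a by (force simp: image_iff)
  qed
  interpret Q: quadratic_pair F t ?n t ?n
    using tm by unfold_locales auto
  define k where "k = ?\<kappa>"
  have k: "k (x0, x1) \<in> carrier K" "k (\<one>\<^bsub>F\<^esub>, \<zero>\<^bsub>F\<^esub>) = \<one>\<^bsub>K\<^esub>" "k (\<zero>\<^bsub>F\<^esub>, \<zero>\<^bsub>F\<^esub>) = \<zero>\<^bsub>K\<^esub>"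
    "k (x0 \<oplus>\<^bsub>F\<^esub> y0, x1 \<oplus>\<^bsub>F\<^esub> y1) = k (x0, x1) \<oplus>\<^bsub>K\<^esub> k (y0, y1)"
    "k (x0 \<otimes>\<^bsub>F\<^esub> y0, x0 \<otimes>\<^bsub>F\<^esub> y1) = x0 \<odot>\<^bsub>K\<^esub> k (y0, y1)"
    if "x0 \<in> carrier F" "x1 \<in> carrier F" "y0 \<in> carrier F" "y1 \<in> carrier F" for x0 x1 y0 y1
    using that a by (simp_all add: k_def K.smult_l_null K.smult_l_distr K.smult_r_distr
        K.smult_assoc1 K.M.a_ac)
  have "k \<in> alg_iso F (quad_alg F t ?n) K"
    by (rule field_algebra_pullback[OF K])
      (use tm bij in \<open>auto simp: k mult[folded k_def] k_def[symmetric] Q.quad_alg_mult\<close>)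
  then have "?\<kappa> \<in> alg_iso F (quad_alg F t ?n) K" unfolding k_def .
  then show ?thesis using that tm by blast
qed

text \<open>The polynomial x^2 - t1 x + n1 can have more than two roots in F[a], for instance scalar
  ones when F[a] is split. Those are excluded by \<open>q \<noteq> \<zero>\<close>, and if the
  discriminant is nonzero, the only root p + q a left besides a is t1 - a.\<close>

lemma (in quadratic_pair) conjugate_root:
  assumes pq [simp]: "p \<in> carrier F" "q \<in> carrier F"
    and disc: "discriminant F t1 n1 \<noteq> \<zero>"
    and q: "q \<noteq> \<zero>" and ne: "(p, q) \<noteq> (\<zero>, \<one>)"
    and root1: "p \<otimes> p \<ominus> n1 \<otimes> (q \<otimes> q) = t1 \<otimes> p \<ominus> n1"
    and root2: "p \<otimes> q \<oplus> q \<otimes> p \<oplus> t1 \<otimes> (q \<otimes> q) = t1 \<otimes> q"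
  shows "p = t1 \<and> q = \<ominus> \<one>"
proof -
  \<comment> \<open>The difference of the two sides of \<open>root2\<close> is q e, so e is what
    remains of this equation after cancelling q; e' is the difference of the two sides of
    \<open>root1\<close>.\<close>
  define e where "e = p \<oplus> p \<oplus> q \<otimes> t1 \<ominus> t1"
  define e' where "e' = p \<otimes> p \<ominus> n1 \<otimes> (q \<otimes> q) \<ominus> (t1 \<otimes> p \<ominus> n1)"
  have [simp]: "e \<in> carrier F" by (simp add: e_def)
  have "q \<otimes> e = (p \<otimes> q \<oplus> q \<otimes> p \<oplus> t1 \<otimes> (q \<otimes> q)) \<ominus> t1 \<otimes> q"
    using pq t1 unfolding e_def by (elim component_cases) (simp add: component_simps algebra_simps)
  also have "\<dots> = \<zero>" unfolding root2 using pq by (simp add: r_neg minus_eq)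
  finally have e: "e = \<zero>" using q pq integral[of q e] by auto
  have e': "e' = \<zero>" unfolding e'_def root1 using pq by (simp add: r_neg minus_eq)
  \<comment> \<open>Completing the square without dividing: 4 e' - ((2 p - t1)^2 - (q t1)^2) is (q^2
    - 1) times the discriminant, and (2 p - t1)^2 - (q t1)^2 is a multiple of e.\<close>
  have "(q \<otimes> q \<ominus> \<one>) \<otimes> discriminant F t1 n1 =
      (e' \<oplus> e' \<oplus> e' \<oplus> e') \<ominus> e \<otimes> (p \<oplus> p \<ominus> q \<otimes> t1 \<ominus> t1)"
    using pq t1 n1 unfolding e_def e'_def
    by (elim component_cases) (simp add: component_simps algebra_simps)
  also have "\<dots> = \<zero>" unfolding e e' using pq by (simp add: minus_eq)
  finally have qq: "q \<otimes> q \<ominus> \<one> = \<zero>" using disc integral[of "q \<otimes> q \<ominus> \<one>" "discriminant F t1 n1"] by auto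
  have "(q \<ominus> \<one>) \<otimes> (q \<oplus> \<one>) = q \<otimes> q \<ominus> \<one>"
    using pq by (elim component_cases) (simp add: component_simps algebra_simps)
  with qq have "q \<ominus> \<one> = \<zero> \<or> q \<oplus> \<one> = \<zero>" using integral[of "q \<ominus> \<one>" "q \<oplus> \<one>"] by auto
  then have q_cases: "q = \<one> \<or> q = \<ominus> \<one>"
    using minus_equality[of q \<one>] by auto
  have "p \<otimes> (p \<ominus> t1) = e' \<oplus> n1 \<otimes> (q \<otimes> q \<ominus> \<one>)"
    using pq t1 n1 unfolding e'_def by (elim component_cases) (simp add: component_simps algebra_simps)
  then have "p \<otimes> (p \<ominus> t1) = \<zero>" by (simp add: qq e')
  then have "p = \<zero> \<or> p \<ominus> t1 = \<zero>" using integral[of p "p \<ominus> t1"] by auto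
  then have p_cases: "p = \<zero> \<or> p = t1" by auto
  \<comment> \<open>The wrong pairings, q = 1 with p = t1 and q = -1 with p = 0, force 2 t1 = 0.
    Then t1 = 0 or the characteristic is two, and each pairing coincides with the asserted pair or
    with the excluded pair (0, 1).\<close>
  have tt: "t1 = \<zero> \<or> \<one> \<oplus> \<one> = \<zero>" if "t1 \<oplus> t1 = \<zero>"
    using that integral[of t1 "\<one> \<oplus> \<one>"] by (auto simp: r_distr)
  have char2: "\<ominus> \<one> = \<one>" if "\<one> \<oplus> \<one> = \<zero>"
    using minus_equality[OF that] by simp
  show ?thesis
  proof (cases "q = \<one>")
    case True
    then have "p = t1" using ne p_cases by auto
    with e True have "t1 \<oplus> t1 = \<zero>" by (simp add: e_def minus_eq a_assoc r_neg)
    from tt[OF this] show ?thesis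
    proof
      assume "t1 = \<zero>"
      with \<open>p = t1\<close> True ne show ?thesis by simp
    next
      assume "\<one> \<oplus> \<one> = \<zero>"
      with char2 \<open>p = t1\<close> True show ?thesis by simp
    qed
  next
    case False
    then have q': "q = \<ominus> \<one>" using q_cases by simp
    have "p = t1"
    proof (rule ccontr)
      assume "p \<noteq> t1"
      then have "p = \<zero>" using p_cases by simp
      then have "\<ominus> (t1 \<oplus> t1) = \<zero>" using e q' by (simp add: e_def minus_eq l_minus minus_add)
      then have "t1 \<oplus> t1 = \<zero>" using minus_minus[of "t1 \<oplus> t1"] by simp
      with tt \<open>p \<noteq> t1\<close> \<open>p = \<zero>\<close> have "\<one> \<oplus> \<one> = \<zero>" by auto
      with char2 q' False show False by simp
    qed
    with q' show ?thesis by simp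
  qed
qed

lemma (in field_algebra) fixed_scalars:
  assumes "h \<in> alg_hom R M M" "x \<in> scalars R M"
  shows "h x = x"
  using assms alg_homD(4,5)[OF assms(1)] by (auto simp: scalars_def)

text \<open>The two alternatives of the definition are brought to common data. In the split case the
  dimension is transported from the model with coefficients 1 and 0.\<close>

lemma quadratic_etale_algebra:
  fixes F :: "'f ring" and K :: "('f, 'k) module"
  assumes F: "field F" and K: "quadratic_etale F K"
  shows "field_algebra F K" "cring K" "has_dim F K 2"
proof -
  interpret F: field F by fact
  interpret Q10: quadratic_pair F "\<one>\<^bsub>F\<^esub>" "\<zero>\<^bsub>F\<^esub>" "\<one>\<^bsub>F\<^esub>" "\<zero>\<^bsub>F\<^esub>" by unfold_locales auto
  interpret K: algebra F K using K by (simp add: quadratic_etale_def)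
  have cases: "separable_quadratic_field F K \<or> (\<exists>h. h \<in> alg_iso F K (direct_sum_alg F))"
    using K by (auto simp: quadratic_etale_def)
  have ring: "ring K" by unfold_locales
  interpret D: field_algebra F "direct_sum_alg F" by (fact Q10.direct_sum_alg_iso(1))
  have "\<one>\<^bsub>K\<^esub> \<noteq> \<zero>\<^bsub>K\<^esub>"
    using cases
  proof
    assume "separable_quadratic_field F K"
    then interpret KF: field K by (simp add: separable_quadratic_field_def)
    show ?thesis by simp
  next
    assume "\<exists>h. h \<in> alg_iso F K (direct_sum_alg F)"
    then obtain h where "h \<in> alg_hom F K (direct_sum_alg F)" by (auto simp: alg_iso_def)
    then show ?thesis
      using alg_homD(4) alg_hom_zero[OF _ ring D.M.ring_axioms] D.one_not_zero_M by metis
  qed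
  then have "field_algebra F K"
    by (intro field_algebra.intro assoc_algebra.intro assoc_algebra_axioms.intro
        field_algebra_axioms.intro K.module_axioms ring F)
      (simp_all add: K.smult_assoc2 K.m_comm[of _ "_ \<odot>\<^bsub>K\<^esub> _"], simp add: K.m_comm)
  then show Kalg: "field_algebra F K" .
  show "cring K" by (fact K.is_cring)
  show "has_dim F K 2"
    using cases
  proof
    assume "\<exists>h. h \<in> alg_iso F K (direct_sum_alg F)"
    then obtain h where "h \<in> alg_iso F K (quad_alg F \<one>\<^bsub>F\<^esub> \<zero>\<^bsub>F\<^esub>)"
      using alg_iso_comp[OF _ Q10.direct_sum_alg_iso(2)] by blast
    from alg_iso_has_dim[OF alg_iso_inv[OF this Kalg] _ Kalg] show ?thesis
      using Q10.quad_alg_basis(3) Q10.quad_alg_algebra by simp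
  qed (simp add: separable_quadratic_field_def)
qed

text \<open>Coordinates are taken with respect to an element a moved by \<sigma>. It is not a
  scalar, as scalars are fixed, so it generates the algebra; its image is another root of the same
  polynomial and hence t - a by \<open>conjugate_root\<close>.\<close>

lemma etale_coordinates:
  fixes F :: "'f ring" and K :: "('f, 'k) module"
  assumes F: "field F" and K: "quadratic_etale F K" and \<sigma>: "nontrivial_automorphism F K \<sigma>"
  obtains t n \<kappa> where "t \<in> carrier F" "n \<in> carrier F" "discriminant F t n \<noteq> \<zero>\<^bsub>F\<^esub>"
    "field_algebra F K" "\<kappa> \<in> alg_iso F (quad_alg F t n) K"
    "\<And>x0 x1. \<lbrakk>x0 \<in> carrier F; x1 \<in> carrier F\<rbrakk> \<Longrightarrow>
      \<sigma> (\<kappa> (x0, x1)) = \<kappa> (x0 \<oplus>\<^bsub>F\<^esub> t \<otimes>\<^bsub>F\<^esub> x1, \<ominus>\<^bsub>F\<^esub> x1)"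
proof -
  interpret F: field F by fact
  interpret K: field_algebra F K by (fact quadratic_etale_algebra(1)[OF F K])
  interpret C: cring K by (fact quadratic_etale_algebra(2)[OF F K])
  interpret Q10: quadratic_pair F "\<one>\<^bsub>F\<^esub>" "\<zero>\<^bsub>F\<^esub>" "\<one>\<^bsub>F\<^esub>" "\<zero>\<^bsub>F\<^esub>" by unfold_locales auto
  note Kalg = K.field_algebra_axioms and dim = quadratic_etale_algebra(3)[OF F K]
  have cases: "separable_quadratic_field F K \<or> (\<exists>h. h \<in> alg_iso F K (direct_sum_alg F))"
    using K by (auto simp: quadratic_etale_def)
  have \<sigma>_iso: "\<sigma> \<in> alg_iso F K K" using \<sigma> by (simp add: nontrivial_automorphism_def)
  note \<sigma>_hom = alg_homD[OF alg_isoD(1)[OF \<sigma>_iso]]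
  obtain a where a: "a \<in> carrier K" "\<sigma> a \<noteq> a" using \<sigma> by (auto simp: nontrivial_automorphism_def)
  then have a': "a \<notin> scalars F K" using K.fixed_scalars[OF alg_isoD(1)[OF \<sigma>_iso]] by blast
  define \<kappa> where "\<kappa> = (\<lambda>(x0, x1). x0 \<odot>\<^bsub>K\<^esub> \<one>\<^bsub>K\<^esub> \<oplus>\<^bsub>K\<^esub> x1 \<odot>\<^bsub>K\<^esub> a)"
  obtain t n where tn [simp]: "t \<in> carrier F" "n \<in> carrier F"
    and \<kappa>: "\<kappa> \<in> alg_iso F (quad_alg F t n) K"
    using quadratic_generator[OF Kalg C.is_cring dim a(1) a'] unfolding \<kappa>_def by blast
  interpret Q: quadratic_pair F t n t n by unfold_locales auto
  note \<kappa>_hom = alg_homD[OF alg_isoD(1)[OF \<kappa>]]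
  have \<kappa>_inj: "x = y" if "\<kappa> x = \<kappa> y" "x \<in> carrier F \<times> carrier F" "y \<in> carrier F \<times> carrier F" for x y
    using alg_isoD(3)[OF \<kappa>] that by (auto simp: inj_on_def)
  have a_eq: "a = \<kappa> (\<zero>\<^bsub>F\<^esub>, \<one>\<^bsub>F\<^esub>)" using a by (simp add: \<kappa>_def K.smult_l_null)
  have scal: "\<kappa> (c, \<zero>\<^bsub>F\<^esub>) = c \<odot>\<^bsub>K\<^esub> \<one>\<^bsub>K\<^esub>" if "c \<in> carrier F" for c
    using a that by (simp add: \<kappa>_def K.smult_l_null)
  have aa: "a \<otimes>\<^bsub>K\<^esub> a = \<kappa> (\<ominus>\<^bsub>F\<^esub> n, t)"
    unfolding a_eq by (subst \<kappa>_hom(2)[symmetric]) (simp_all add: Q.quad_alg_mult F.minus_eq)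
  have aa': "a \<otimes>\<^bsub>K\<^esub> a = t \<odot>\<^bsub>K\<^esub> a \<ominus>\<^bsub>K\<^esub> n \<odot>\<^bsub>K\<^esub> \<one>\<^bsub>K\<^esub>"
  proof -
    have "\<kappa> (\<ominus>\<^bsub>F\<^esub> n, t) = \<ominus>\<^bsub>K\<^esub> (n \<odot>\<^bsub>K\<^esub> \<one>\<^bsub>K\<^esub>) \<oplus>\<^bsub>K\<^esub> t \<odot>\<^bsub>K\<^esub> a"
      by (simp add: \<kappa>_def K.smult_l_minus)
    also have "\<dots> = t \<odot>\<^bsub>K\<^esub> a \<ominus>\<^bsub>K\<^esub> n \<odot>\<^bsub>K\<^esub> \<one>\<^bsub>K\<^esub>"
      unfolding K.M.minus_eq using a by (intro K.M.a_comm) auto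
    finally show ?thesis unfolding aa .
  qed
  have "\<sigma> a \<in> \<kappa> ` (carrier F \<times> carrier F)"
    using \<sigma>_hom(1)[OF a(1)] alg_isoD(4)[OF \<kappa>] by simp
  then obtain p q where pq: "p \<in> carrier F" "q \<in> carrier F" "\<sigma> a = \<kappa> (p, q)" by blast
  have ne: "(p, q) \<noteq> (\<zero>\<^bsub>F\<^esub>, \<one>\<^bsub>F\<^esub>)" using a(2) pq a_eq by auto
  have q: "q \<noteq> \<zero>\<^bsub>F\<^esub>"
  proof
    assume "q = \<zero>\<^bsub>F\<^esub>"
    then have "\<sigma> a = \<sigma> (p \<odot>\<^bsub>K\<^esub> \<one>\<^bsub>K\<^esub>)" using pq scal \<sigma>_hom(4,5) by simp
    then have "a = p \<odot>\<^bsub>K\<^esub> \<one>\<^bsub>K\<^esub>" using alg_isoD(3)[OF \<sigma>_iso] a pq by (auto simp: inj_on_def)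
    then show False using a' pq by (auto simp: scalars_def)
  qed
  have \<sigma>_root: "\<sigma> a \<otimes>\<^bsub>K\<^esub> \<sigma> a = t \<odot>\<^bsub>K\<^esub> \<sigma> a \<ominus>\<^bsub>K\<^esub> n \<odot>\<^bsub>K\<^esub> \<one>\<^bsub>K\<^esub>"
  proof -
    have "\<sigma> a \<otimes>\<^bsub>K\<^esub> \<sigma> a = \<sigma> (t \<odot>\<^bsub>K\<^esub> a \<oplus>\<^bsub>K\<^esub> (\<ominus>\<^bsub>F\<^esub> n) \<odot>\<^bsub>K\<^esub> \<one>\<^bsub>K\<^esub>)"
      using a aa' by (simp add: \<sigma>_hom(2)[symmetric] K.M.minus_eq K.smult_l_minus)
    also have "\<dots> = t \<odot>\<^bsub>K\<^esub> \<sigma> a \<oplus>\<^bsub>K\<^esub> (\<ominus>\<^bsub>F\<^esub> n) \<odot>\<^bsub>K\<^esub> \<one>\<^bsub>K\<^esub>"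
      using a by (simp only: \<sigma>_hom K.smult_closed K.M.one_closed F.a_inv_closed tn)
    finally show ?thesis by (simp add: K.M.minus_eq K.smult_l_minus)
  qed
  have "\<kappa> (p \<otimes>\<^bsub>F\<^esub> p \<ominus>\<^bsub>F\<^esub> n \<otimes>\<^bsub>F\<^esub> (q \<otimes>\<^bsub>F\<^esub> q), p \<otimes>\<^bsub>F\<^esub> q \<oplus>\<^bsub>F\<^esub> q \<otimes>\<^bsub>F\<^esub> p \<oplus>\<^bsub>F\<^esub> t \<otimes>\<^bsub>F\<^esub> (q \<otimes>\<^bsub>F\<^esub> q))
      = \<kappa> (p, q) \<otimes>\<^bsub>K\<^esub> \<kappa> (p, q)"
    using pq by (subst \<kappa>_hom(2)[symmetric]) (simp_all add: Q.quad_alg_mult)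
  also have "\<dots> = t \<odot>\<^bsub>K\<^esub> \<kappa> (p, q) \<oplus>\<^bsub>K\<^esub> \<kappa> (\<ominus>\<^bsub>F\<^esub> n, \<zero>\<^bsub>F\<^esub>)"
    using \<sigma>_root pq scal by (simp add: K.M.minus_eq K.smult_l_minus)
  also have "\<dots> = \<kappa> (t \<otimes>\<^bsub>F\<^esub> p \<ominus>\<^bsub>F\<^esub> n, t \<otimes>\<^bsub>F\<^esub> q)"
    using pq by (simp add: \<kappa>_hom(3,5)[symmetric] F.minus_eq)
  finally have roots: "p \<otimes>\<^bsub>F\<^esub> p \<ominus>\<^bsub>F\<^esub> n \<otimes>\<^bsub>F\<^esub> (q \<otimes>\<^bsub>F\<^esub> q) = t \<otimes>\<^bsub>F\<^esub> p \<ominus>\<^bsub>F\<^esub> n"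
    "p \<otimes>\<^bsub>F\<^esub> q \<oplus>\<^bsub>F\<^esub> q \<otimes>\<^bsub>F\<^esub> p \<oplus>\<^bsub>F\<^esub> t \<otimes>\<^bsub>F\<^esub> (q \<otimes>\<^bsub>F\<^esub> q) = t \<otimes>\<^bsub>F\<^esub> q"
    using pq by (auto dest!: \<kappa>_inj)
  \<comment> \<open>In both cases the discriminant is the square of a nonzero difference of roots:
    of a and its image in the field case, of the two components of a in the split case.\<close>
  have disc: "discriminant F t n \<noteq> \<zero>\<^bsub>F\<^esub>"
    using cases
  proof
    assume "separable_quadratic_field F K"
    then interpret KF: field K by (simp add: separable_quadratic_field_def)
    let ?T = "t \<odot>\<^bsub>K\<^esub> \<one>\<^bsub>K\<^esub>" and ?N = "n \<odot>\<^bsub>K\<^esub> \<one>\<^bsub>K\<^esub>"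
    have c: "?T \<in> carrier K" "?N \<in> carrier K" "\<sigma> a \<in> carrier K" using \<sigma>_hom(1) a by auto
    have eqs: "a \<otimes>\<^bsub>K\<^esub> a \<ominus>\<^bsub>K\<^esub> (?T \<otimes>\<^bsub>K\<^esub> a \<ominus>\<^bsub>K\<^esub> ?N) = \<zero>\<^bsub>K\<^esub>"
      "\<sigma> a \<otimes>\<^bsub>K\<^esub> \<sigma> a \<ominus>\<^bsub>K\<^esub> (?T \<otimes>\<^bsub>K\<^esub> \<sigma> a \<ominus>\<^bsub>K\<^esub> ?N) = \<zero>\<^bsub>K\<^esub>"
      using a c \<sigma>_root aa' by (simp_all add: K.scalar_mult K.M.r_neg K.M.minus_eq)
    \<comment> \<open>Subtracting the two root equations. The first factor is nonzero because
      \<sigma> moves a, so the two roots add up to t.\<close>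
    have "(\<sigma> a \<ominus>\<^bsub>K\<^esub> a) \<otimes>\<^bsub>K\<^esub> (\<sigma> a \<oplus>\<^bsub>K\<^esub> a \<ominus>\<^bsub>K\<^esub> ?T) =
        (\<sigma> a \<otimes>\<^bsub>K\<^esub> \<sigma> a \<ominus>\<^bsub>K\<^esub> (?T \<otimes>\<^bsub>K\<^esub> \<sigma> a \<ominus>\<^bsub>K\<^esub> ?N)) \<ominus>\<^bsub>K\<^esub> (a \<otimes>\<^bsub>K\<^esub> a \<ominus>\<^bsub>K\<^esub> (?T \<otimes>\<^bsub>K\<^esub> a \<ominus>\<^bsub>K\<^esub> ?N))"
      using a(1) c by (elim C.component_cases) (simp add: C.component_simps algebra_simps)
    also have "\<dots> = \<zero>\<^bsub>K\<^esub>" unfolding eqs by (simp add: K.M.minus_eq)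
    finally have T: "\<sigma> a \<oplus>\<^bsub>K\<^esub> a \<ominus>\<^bsub>K\<^esub> ?T = \<zero>\<^bsub>K\<^esub>"
      using KF.integral[of "\<sigma> a \<ominus>\<^bsub>K\<^esub> a"] a c by auto
    \<comment> \<open>The squared difference of the roots equals t^2 - 4 n modulo the root equation
      of a and the relation for the sum of the roots.\<close>
    have "(\<sigma> a \<ominus>\<^bsub>K\<^esub> a) \<otimes>\<^bsub>K\<^esub> (\<sigma> a \<ominus>\<^bsub>K\<^esub> a) =
        (?T \<otimes>\<^bsub>K\<^esub> ?T \<ominus>\<^bsub>K\<^esub> (?N \<oplus>\<^bsub>K\<^esub> ?N \<oplus>\<^bsub>K\<^esub> ?N \<oplus>\<^bsub>K\<^esub> ?N)) \<oplus>\<^bsub>K\<^esub>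
        (let e = a \<otimes>\<^bsub>K\<^esub> a \<ominus>\<^bsub>K\<^esub> (?T \<otimes>\<^bsub>K\<^esub> a \<ominus>\<^bsub>K\<^esub> ?N) in e \<oplus>\<^bsub>K\<^esub> e \<oplus>\<^bsub>K\<^esub> e \<oplus>\<^bsub>K\<^esub> e) \<oplus>\<^bsub>K\<^esub>
        (\<sigma> a \<oplus>\<^bsub>K\<^esub> a \<ominus>\<^bsub>K\<^esub> ?T) \<otimes>\<^bsub>K\<^esub> (\<sigma> a \<ominus>\<^bsub>K\<^esub> a \<ominus>\<^bsub>K\<^esub> a \<ominus>\<^bsub>K\<^esub> a \<oplus>\<^bsub>K\<^esub> ?T)"
      using a(1) c unfolding Let_def by (elim C.component_cases) (simp add: C.component_simps algebra_simps)
    also have "\<dots> = ?T \<otimes>\<^bsub>K\<^esub> ?T \<ominus>\<^bsub>K\<^esub> (?N \<oplus>\<^bsub>K\<^esub> ?N \<oplus>\<^bsub>K\<^esub> ?N \<oplus>\<^bsub>K\<^esub> ?N)"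
      unfolding eqs T Let_def using a c by simp
    also have "\<dots> = discriminant F t n \<odot>\<^bsub>K\<^esub> \<one>\<^bsub>K\<^esub>"
      by (simp add: K.M.minus_eq F.minus_eq K.scalar_mult K.smult_l_distr K.smult_l_minus K.smult_assoc1)
    finally have "discriminant F t n \<odot>\<^bsub>K\<^esub> \<one>\<^bsub>K\<^esub> \<noteq> \<zero>\<^bsub>K\<^esub>"
      using KF.integral[of "\<sigma> a \<ominus>\<^bsub>K\<^esub> a" "\<sigma> a \<ominus>\<^bsub>K\<^esub> a"] a c by auto
    then show ?thesis using K.smult_l_null[OF K.M.one_closed] by metis
  next
    assume "\<exists>h. h \<in> alg_iso F K (direct_sum_alg F)"
    then obtain h where h: "h \<in> alg_iso F K (direct_sum_alg F)" by blast
    note h_hom = alg_homD[OF alg_isoD(1)[OF h]]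
    have simps: "carrier (direct_sum_alg F) = carrier F \<times> carrier F"
      "\<one>\<^bsub>direct_sum_alg F\<^esub> = (\<one>\<^bsub>F\<^esub>, \<one>\<^bsub>F\<^esub>)"
      "(x0, x1) \<oplus>\<^bsub>direct_sum_alg F\<^esub> (y0, y1) = (x0 \<oplus>\<^bsub>F\<^esub> y0, x1 \<oplus>\<^bsub>F\<^esub> y1)"
      "(x0, x1) \<otimes>\<^bsub>direct_sum_alg F\<^esub> (y0, y1) = (x0 \<otimes>\<^bsub>F\<^esub> y0, x1 \<otimes>\<^bsub>F\<^esub> y1)"
      "c \<odot>\<^bsub>direct_sum_alg F\<^esub> (x0, x1) = (c \<otimes>\<^bsub>F\<^esub> x0, c \<otimes>\<^bsub>F\<^esub> x1)" for x0 x1 y0 y1 c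
      by (auto simp: direct_sum_alg_def RDirProd_def DirProd_def ring.defs monoid.defs module.defs)
    obtain u v where uv: "h a = (u, v)" "u \<in> carrier F" "v \<in> carrier F"
      using h_hom(1)[OF a(1)] by (auto simp: simps)
    have "u \<noteq> v"
    proof
      assume "u = v"
      then have "h a = h (u \<odot>\<^bsub>K\<^esub> \<one>\<^bsub>K\<^esub>)" using uv h_hom by (simp add: simps)
      then have "a = u \<odot>\<^bsub>K\<^esub> \<one>\<^bsub>K\<^esub>" using alg_isoD(3)[OF h] a uv by (auto simp: inj_on_def)
      then show False using a' uv by (auto simp: scalars_def)
    qed
    have "h (a \<otimes>\<^bsub>K\<^esub> a) = h (t \<odot>\<^bsub>K\<^esub> a \<oplus>\<^bsub>K\<^esub> (\<ominus>\<^bsub>F\<^esub> n) \<odot>\<^bsub>K\<^esub> \<one>\<^bsub>K\<^esub>)"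
      using aa' a by (simp add: K.M.minus_eq K.smult_l_minus)
    then have "(u \<otimes>\<^bsub>F\<^esub> u, v \<otimes>\<^bsub>F\<^esub> v) = (t \<otimes>\<^bsub>F\<^esub> u \<oplus>\<^bsub>F\<^esub> \<ominus>\<^bsub>F\<^esub> n, t \<otimes>\<^bsub>F\<^esub> v \<oplus>\<^bsub>F\<^esub> \<ominus>\<^bsub>F\<^esub> n)"
      using a uv by (simp add: h_hom simps)
    then have eqs: "u \<otimes>\<^bsub>F\<^esub> u \<ominus>\<^bsub>F\<^esub> (t \<otimes>\<^bsub>F\<^esub> u \<ominus>\<^bsub>F\<^esub> n) = \<zero>\<^bsub>F\<^esub>" "v \<otimes>\<^bsub>F\<^esub> v \<ominus>\<^bsub>F\<^esub> (t \<otimes>\<^bsub>F\<^esub> v \<ominus>\<^bsub>F\<^esub> n) = \<zero>\<^bsub>F\<^esub>"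
      using uv by (simp_all add: F.minus_eq F.r_neg)
    \<comment> \<open>The components u and v are roots in F and take over the roles of a and its
      image.\<close>
    have "(u \<ominus>\<^bsub>F\<^esub> v) \<otimes>\<^bsub>F\<^esub> (u \<oplus>\<^bsub>F\<^esub> v \<ominus>\<^bsub>F\<^esub> t) =
        (u \<otimes>\<^bsub>F\<^esub> u \<ominus>\<^bsub>F\<^esub> (t \<otimes>\<^bsub>F\<^esub> u \<ominus>\<^bsub>F\<^esub> n)) \<ominus>\<^bsub>F\<^esub> (v \<otimes>\<^bsub>F\<^esub> v \<ominus>\<^bsub>F\<^esub> (t \<otimes>\<^bsub>F\<^esub> v \<ominus>\<^bsub>F\<^esub> n))"
      using uv(2,3) tn by (elim F.component_cases) (simp add: F.component_simps algebra_simps)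
    also have "\<dots> = \<zero>\<^bsub>F\<^esub>" unfolding eqs by (simp add: F.minus_eq)
    finally have T: "u \<oplus>\<^bsub>F\<^esub> v \<ominus>\<^bsub>F\<^esub> t = \<zero>\<^bsub>F\<^esub>"
      using F.integral[of "u \<ominus>\<^bsub>F\<^esub> v"] \<open>u \<noteq> v\<close> uv by auto
    have "(u \<ominus>\<^bsub>F\<^esub> v) \<otimes>\<^bsub>F\<^esub> (u \<ominus>\<^bsub>F\<^esub> v) = discriminant F t n \<oplus>\<^bsub>F\<^esub>
        (let e = v \<otimes>\<^bsub>F\<^esub> v \<ominus>\<^bsub>F\<^esub> (t \<otimes>\<^bsub>F\<^esub> v \<ominus>\<^bsub>F\<^esub> n) in e \<oplus>\<^bsub>F\<^esub> e \<oplus>\<^bsub>F\<^esub> e \<oplus>\<^bsub>F\<^esub> e) \<oplus>\<^bsub>F\<^esub>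
        (u \<oplus>\<^bsub>F\<^esub> v \<ominus>\<^bsub>F\<^esub> t) \<otimes>\<^bsub>F\<^esub> (u \<ominus>\<^bsub>F\<^esub> v \<ominus>\<^bsub>F\<^esub> v \<ominus>\<^bsub>F\<^esub> v \<oplus>\<^bsub>F\<^esub> t)"
      using uv(2,3) tn unfolding Let_def by (elim F.component_cases) (simp add: F.component_simps algebra_simps)
    also have "\<dots> = discriminant F t n" unfolding eqs T Let_def using uv by simp
    finally show ?thesis
      using F.integral[of "u \<ominus>\<^bsub>F\<^esub> v" "u \<ominus>\<^bsub>F\<^esub> v"] \<open>u \<noteq> v\<close> uv by auto
  qed
  from Q.conjugate_root[OF pq(1,2) disc q ne roots] have \<sigma>a: "\<sigma> a = \<kappa> (t, \<ominus>\<^bsub>F\<^esub> \<one>\<^bsub>F\<^esub>)"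
    using pq by simp
  have "\<sigma> (\<kappa> (x0, x1)) = \<kappa> (x0 \<oplus>\<^bsub>F\<^esub> t \<otimes>\<^bsub>F\<^esub> x1, \<ominus>\<^bsub>F\<^esub> x1)"
    if x: "x0 \<in> carrier F" "x1 \<in> carrier F" for x0 x1
  proof -
    have "\<kappa> (x0, x1) = \<kappa> (x0, \<zero>\<^bsub>F\<^esub>) \<oplus>\<^bsub>K\<^esub> x1 \<odot>\<^bsub>K\<^esub> a"
      using x unfolding a_eq by (simp add: \<kappa>_hom(3,5)[symmetric])
    then have "\<sigma> (\<kappa> (x0, x1)) = \<kappa> (x0, \<zero>\<^bsub>F\<^esub>) \<oplus>\<^bsub>K\<^esub> x1 \<odot>\<^bsub>K\<^esub> \<sigma> a"
      using x a scal by (simp add: \<sigma>_hom)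
    also have "\<dots> = \<kappa> (x0 \<oplus>\<^bsub>F\<^esub> t \<otimes>\<^bsub>F\<^esub> x1, \<ominus>\<^bsub>F\<^esub> x1)"
      using x unfolding \<sigma>a by (simp add: \<kappa>_hom(3,5)[symmetric] F.r_minus F.m_comm)
    finally show ?thesis .
  qed
  then show ?thesis
    using that[OF tn disc Kalg \<kappa>] by blast
qed

text \<open>Dual to the pullback: as every element of \<open>M\<close> is an image, closure under
  the operations is inherited from \<open>A\<close>.\<close>

lemma field_algebra_pushforward:
  assumes "field_algebra F A" and bij: "bij_betw h (carrier A) (carrier M)"
    and hom: "h \<zero>\<^bsub>A\<^esub> = \<zero>\<^bsub>M\<^esub>" "h \<one>\<^bsub>A\<^esub> = \<one>\<^bsub>M\<^esub>"
      "\<And>x y. x \<in> carrier A \<Longrightarrow> y \<in> carrier A \<Longrightarrow> h (x \<oplus>\<^bsub>A\<^esub> y) = h x \<oplus>\<^bsub>M\<^esub> h y"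
      "\<And>x y. x \<in> carrier A \<Longrightarrow> y \<in> carrier A \<Longrightarrow> h (x \<otimes>\<^bsub>A\<^esub> y) = h x \<otimes>\<^bsub>M\<^esub> h y"
      "\<And>c x. c \<in> carrier F \<Longrightarrow> x \<in> carrier A \<Longrightarrow> h (c \<odot>\<^bsub>A\<^esub> x) = c \<odot>\<^bsub>M\<^esub> h x"
  shows "field_algebra F M" "h \<in> alg_iso F A M"
proof -
  interpret A: field_algebra F A by fact
  let ?g = "inv_into (carrier A) h"
  have inj: "inj_on h (carrier A)" using bij by (simp add: bij_betw_def)
  have surj: "\<exists>x\<in>carrier A. y = h x" if "y \<in> carrier M" for y
    using bij that by (auto simp: bij_betw_def)
  have h: "h x \<in> carrier M" if "x \<in> carrier A" for x using bij that by (auto simp: bij_betw_def)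
  have g: "?g (h x) = x" if "x \<in> carrier A" for x using inj that by simp
  have "?g (h \<zero>\<^bsub>A\<^esub>) = \<zero>\<^bsub>A\<^esub>" "?g (h \<one>\<^bsub>A\<^esub>) = \<one>\<^bsub>A\<^esub>" "h \<zero>\<^bsub>A\<^esub> \<in> carrier M" "h \<one>\<^bsub>A\<^esub> \<in> carrier M"
    by (rule g h; simp)+
  then show "field_algebra F M"
    by (intro field_algebra_pullback(1)[OF assms(1) bij_betw_inv_into[OF bij]])
      (auto simp: hom(1,2) hom(3-5)[symmetric] g h dest!: surj)
  show "h \<in> alg_iso F A M"
    using bij h by (auto simp: alg_iso_def alg_hom_def ring_hom_def hom)
qed

section \<open>The tensor product in coordinates\<close>

text \<open>The data that \<open>etale_coordinates\<close> supplies for each factor. The generators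
  a = \<open>\<kappa>1 (\<zero>, \<one>)\<close> and b = \<open>\<kappa>2 (\<zero>, \<one>)\<close>
  have conjugates t1 - a and t2 - b.\<close>

locale etale_pair = quadratic_pair F t1 n1 t2 n2 + K1: field_algebra F K1 + K2: field_algebra F K2
  for F :: "'f ring" (structure) and t1 n1 t2 n2 :: 'f
    and K1 :: "('f, 'k1) module" and K2 :: "('f, 'k2) module" +
  fixes \<sigma>1 :: "'k1 \<Rightarrow> 'k1" and \<sigma>2 :: "'k2 \<Rightarrow> 'k2" and \<kappa>1 :: "'f \<times> 'f \<Rightarrow> 'k1" and \<kappa>2 :: "'f \<times> 'f \<Rightarrow> 'k2"
  assumes disc1: "discriminant F t1 n1 \<noteq> \<zero>" and disc2: "discriminant F t2 n2 \<noteq> \<zero>"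
    and \<kappa>1: "\<kappa>1 \<in> alg_iso F (quad_alg F t1 n1) K1" and \<kappa>2: "\<kappa>2 \<in> alg_iso F (quad_alg F t2 n2) K2"
    and \<sigma>1: "\<And>x0 x1. \<lbrakk>x0 \<in> carrier F; x1 \<in> carrier F\<rbrakk> \<Longrightarrow> \<sigma>1 (\<kappa>1 (x0, x1)) = \<kappa>1 (x0 \<oplus> t1 \<otimes> x1, \<ominus> x1)"
    and \<sigma>2: "\<And>x0 x1. \<lbrakk>x0 \<in> carrier F; x1 \<in> carrier F\<rbrakk> \<Longrightarrow> \<sigma>2 (\<kappa>2 (x0, x1)) = \<kappa>2 (x0 \<oplus> t2 \<otimes> x1, \<ominus> x1)"
begin

sublocale FM: field_monoid F "K1 \<times>\<times> K2"
  using DirProd_monoid[OF K1.M.monoid_axioms K2.M.monoid_axioms] field_axioms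
  by (intro field_monoid.intro)

sublocale C4: field_algebra F tensor_model by (fact tensor_model_algebra)

lemmas \<kappa>1_hom = alg_homD[OF alg_isoD(1)[OF \<kappa>1]] and \<kappa>2_hom = alg_homD[OF alg_isoD(1)[OF \<kappa>2]]

lemma \<kappa>_closed [simp]:
  "\<lbrakk>x0 \<in> carrier F; x1 \<in> carrier F\<rbrakk> \<Longrightarrow> \<kappa>1 (x0, x1) \<in> carrier K1"
  "\<lbrakk>x0 \<in> carrier F; x1 \<in> carrier F\<rbrakk> \<Longrightarrow> \<kappa>2 (x0, x1) \<in> carrier K2"
  using \<kappa>1_hom(1) \<kappa>2_hom(1) by auto

lemma \<kappa>1_cases:
  assumes "x \<in> carrier K1"
  obtains x0 x1 where "x = \<kappa>1 (x0, x1)" "x0 \<in> carrier F" "x1 \<in> carrier F"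
proof -
  have "x \<in> \<kappa>1 ` (carrier F \<times> carrier F)" using alg_isoD(4)[OF \<kappa>1] assms by simp
  with that show ?thesis by blast
qed

lemma \<kappa>2_cases:
  assumes "x \<in> carrier K2"
  obtains x0 x1 where "x = \<kappa>2 (x0, x1)" "x0 \<in> carrier F" "x1 \<in> carrier F"
proof -
  have "x \<in> \<kappa>2 ` (carrier F \<times> carrier F)" using alg_isoD(4)[OF \<kappa>2] assms by simp
  with that show ?thesis by blast
qed

section \<open>Bilinear maps in coordinates\<close>

definition bilinear_map :: "('f, 'm, 's) module_scheme \<Rightarrow> ('k1 \<Rightarrow> 'k2 \<Rightarrow> 'm) \<Rightarrow> bool" where
  "bilinear_map M \<beta> \<longleftrightarrow> (\<forall>x\<in>carrier K1. \<forall>y\<in>carrier K2. \<beta> x y \<in> carrier M) \<and>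
     (\<forall>x\<in>carrier K1. \<forall>x'\<in>carrier K1. \<forall>y\<in>carrier K2. \<beta> (x \<oplus>\<^bsub>K1\<^esub> x') y = \<beta> x y \<oplus>\<^bsub>M\<^esub> \<beta> x' y) \<and>
     (\<forall>x\<in>carrier K1. \<forall>y\<in>carrier K2. \<forall>y'\<in>carrier K2. \<beta> x (y \<oplus>\<^bsub>K2\<^esub> y') = \<beta> x y \<oplus>\<^bsub>M\<^esub> \<beta> x y') \<and>
     (\<forall>c\<in>carrier F. \<forall>x\<in>carrier K1. \<forall>y\<in>carrier K2. \<beta> (c \<odot>\<^bsub>K1\<^esub> x) y = c \<odot>\<^bsub>M\<^esub> \<beta> x y) \<and>
     (\<forall>c\<in>carrier F. \<forall>x\<in>carrier K1. \<forall>y\<in>carrier K2. \<beta> x (c \<odot>\<^bsub>K2\<^esub> y) = c \<odot>\<^bsub>M\<^esub> \<beta> x y)"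

lemma bilinear_mapD:
  assumes "bilinear_map M \<beta>"
  shows "\<lbrakk>x \<in> carrier K1; y \<in> carrier K2\<rbrakk> \<Longrightarrow> \<beta> x y \<in> carrier M"
    "\<lbrakk>x \<in> carrier K1; x' \<in> carrier K1; y \<in> carrier K2\<rbrakk> \<Longrightarrow> \<beta> (x \<oplus>\<^bsub>K1\<^esub> x') y = \<beta> x y \<oplus>\<^bsub>M\<^esub> \<beta> x' y"
    "\<lbrakk>x \<in> carrier K1; y \<in> carrier K2; y' \<in> carrier K2\<rbrakk> \<Longrightarrow> \<beta> x (y \<oplus>\<^bsub>K2\<^esub> y') = \<beta> x y \<oplus>\<^bsub>M\<^esub> \<beta> x y'"
    "\<lbrakk>c \<in> carrier F; x \<in> carrier K1; y \<in> carrier K2\<rbrakk> \<Longrightarrow> \<beta> (c \<odot>\<^bsub>K1\<^esub> x) y = c \<odot>\<^bsub>M\<^esub> \<beta> x y"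
    "\<lbrakk>c \<in> carrier F; x \<in> carrier K1; y \<in> carrier K2\<rbrakk> \<Longrightarrow> \<beta> x (c \<odot>\<^bsub>K2\<^esub> y) = c \<odot>\<^bsub>M\<^esub> \<beta> x y"
  using assms by (auto simp: bilinear_map_def)

abbreviation "gen_a \<equiv> \<kappa>1 (\<zero>, \<one>)"
abbreviation "gen_b \<equiv> \<kappa>2 (\<zero>, \<one>)"

text \<open>The linear map on quadruples that sends the four basis vectors, read as the tensors of
  1, a with 1, b in the order 1, a, b, ab, to the values of \<beta>.\<close>

definition bilinear_coords :: "('f, 'm, 's) module_scheme \<Rightarrow> ('k1 \<Rightarrow> 'k2 \<Rightarrow> 'm) \<Rightarrow> 'f quadruple \<Rightarrow> 'm" where
  "bilinear_coords M \<beta> = (\<lambda>(z0, z1, z2, z3).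
     (z0 \<odot>\<^bsub>M\<^esub> \<beta> \<one>\<^bsub>K1\<^esub> \<one>\<^bsub>K2\<^esub> \<oplus>\<^bsub>M\<^esub> z1 \<odot>\<^bsub>M\<^esub> \<beta> gen_a \<one>\<^bsub>K2\<^esub>) \<oplus>\<^bsub>M\<^esub>
     (z2 \<odot>\<^bsub>M\<^esub> \<beta> \<one>\<^bsub>K1\<^esub> gen_b \<oplus>\<^bsub>M\<^esub> z3 \<odot>\<^bsub>M\<^esub> \<beta> gen_a gen_b))"

text \<open>The coordinates of the pure tensor of x and y in the basis 1, a, b, ab.\<close>

definition coords :: "'k1 \<times> 'k2 \<Rightarrow> 'f quadruple" where
  "coords = (\<lambda>(x, y). case (inv_into (carrier F \<times> carrier F) \<kappa>1 x, inv_into (carrier F \<times> carrier F) \<kappa>2 y) of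
     ((x0, x1), (y0, y1)) \<Rightarrow> (x0 \<otimes> y0, x1 \<otimes> y0, x0 \<otimes> y1, x1 \<otimes> y1))"

lemma coords [simp]:
  assumes "x0 \<in> carrier F" "x1 \<in> carrier F" "y0 \<in> carrier F" "y1 \<in> carrier F"
  shows "coords (\<kappa>1 (x0, x1), \<kappa>2 (y0, y1)) = (x0 \<otimes> y0, x1 \<otimes> y0, x0 \<otimes> y1, x1 \<otimes> y1)"
  using assms alg_isoD(3)[OF \<kappa>1] alg_isoD(3)[OF \<kappa>2] by (simp add: coords_def)

lemma \<kappa>_one: "\<one>\<^bsub>K1\<^esub> = \<kappa>1 (\<one>, \<zero>)" "\<one>\<^bsub>K2\<^esub> = \<kappa>2 (\<one>, \<zero>)"
  using \<kappa>1_hom(4) \<kappa>2_hom(4) by auto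

lemma \<kappa>_simps:
  assumes "x0 \<in> carrier F" "x1 \<in> carrier F" "y0 \<in> carrier F" "y1 \<in> carrier F"
  shows "\<kappa>1 (x0, x1) \<oplus>\<^bsub>K1\<^esub> \<kappa>1 (y0, y1) = \<kappa>1 (x0 \<oplus> y0, x1 \<oplus> y1)"
    "\<kappa>2 (x0, x1) \<oplus>\<^bsub>K2\<^esub> \<kappa>2 (y0, y1) = \<kappa>2 (x0 \<oplus> y0, x1 \<oplus> y1)"
    "\<kappa>1 (x0, x1) \<otimes>\<^bsub>K1\<^esub> \<kappa>1 (y0, y1) = \<kappa>1 (x0 \<otimes> y0 \<ominus> n1 \<otimes> (x1 \<otimes> y1), x0 \<otimes> y1 \<oplus> x1 \<otimes> y0 \<oplus> t1 \<otimes> (x1 \<otimes> y1))"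
    "\<kappa>2 (x0, x1) \<otimes>\<^bsub>K2\<^esub> \<kappa>2 (y0, y1) = \<kappa>2 (x0 \<otimes> y0 \<ominus> n2 \<otimes> (x1 \<otimes> y1), x0 \<otimes> y1 \<oplus> x1 \<otimes> y0 \<oplus> t2 \<otimes> (x1 \<otimes> y1))"
    "c \<in> carrier F \<Longrightarrow> c \<odot>\<^bsub>K1\<^esub> \<kappa>1 (x0, x1) = \<kappa>1 (c \<otimes> x0, c \<otimes> x1)"
    "c \<in> carrier F \<Longrightarrow> c \<odot>\<^bsub>K2\<^esub> \<kappa>2 (x0, x1) = \<kappa>2 (c \<otimes> x0, c \<otimes> x1)"
  using assms by (simp_all add: \<kappa>1_hom(2,3,5)[symmetric] \<kappa>2_hom(2,3,5)[symmetric] quad_alg_mult)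

lemma coords_closed: "p \<in> carrier (K1 \<times>\<times> K2) \<Longrightarrow> coords p \<in> carrier tensor_model"
  by (auto elim!: \<kappa>1_cases \<kappa>2_cases)

text \<open>This is what the linear extension of \<open>coords\<close> needs in order to be
  multiplicative on the monoid algebra.\<close>

lemma coords_mult:
  assumes "p \<in> carrier (K1 \<times>\<times> K2)" "q \<in> carrier (K1 \<times>\<times> K2)"
  shows "coords (p \<otimes>\<^bsub>K1 \<times>\<times> K2\<^esub> q) = coords p \<otimes>\<^bsub>tensor_model\<^esub> coords q"
proof -
  obtain x0 x1 y0 y1 where p: "p = (\<kappa>1 (x0, x1), \<kappa>2 (y0, y1))" and
    c1: "x0 \<in> carrier F" "x1 \<in> carrier F" "y0 \<in> carrier F" "y1 \<in> carrier F"
    using assms(1) by (auto elim!: \<kappa>1_cases \<kappa>2_cases)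
  obtain u0 u1 v0 v1 where q: "q = (\<kappa>1 (u0, u1), \<kappa>2 (v0, v1))" and
    c2: "u0 \<in> carrier F" "u1 \<in> carrier F" "v0 \<in> carrier F" "v1 \<in> carrier F"
    using assms(2) by (auto elim!: \<kappa>1_cases \<kappa>2_cases)
  have "coords (p \<otimes>\<^bsub>K1 \<times>\<times> K2\<^esub> q) =
    ((x0 \<otimes> u0 \<ominus> n1 \<otimes> (x1 \<otimes> u1)) \<otimes> (y0 \<otimes> v0 \<ominus> n2 \<otimes> (y1 \<otimes> v1)),
     (x0 \<otimes> u1 \<oplus> x1 \<otimes> u0 \<oplus> t1 \<otimes> (x1 \<otimes> u1)) \<otimes> (y0 \<otimes> v0 \<ominus> n2 \<otimes> (y1 \<otimes> v1)),
     (x0 \<otimes> u0 \<ominus> n1 \<otimes> (x1 \<otimes> u1)) \<otimes> (y0 \<otimes> v1 \<oplus> y1 \<otimes> v0 \<oplus> t2 \<otimes> (y1 \<otimes> v1)),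
     (x0 \<otimes> u1 \<oplus> x1 \<otimes> u0 \<oplus> t1 \<otimes> (x1 \<otimes> u1)) \<otimes> (y0 \<otimes> v1 \<oplus> y1 \<otimes> v0 \<oplus> t2 \<otimes> (y1 \<otimes> v1)))"
    using c1 c2 by (simp add: p q \<kappa>_simps)
  also have "\<dots> = (x0 \<otimes> y0, x1 \<otimes> y0, x0 \<otimes> y1, x1 \<otimes> y1) \<otimes>\<^bsub>tensor_model\<^esub> (u0 \<otimes> v0, u1 \<otimes> v0, u0 \<otimes> v1, u1 \<otimes> v1)"
    using c1 c2 t1 n1 t2 n2
    by (elim component_cases) (simp add: biquad_alg_mult quadruple_defs component_simps algebra_simps)
  also have "\<dots> = coords p \<otimes>\<^bsub>tensor_model\<^esub> coords q"
    using c1 c2 by (simp add: p q)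
  finally show ?thesis .
qed

lemma coords_one: "coords \<one>\<^bsub>K1 \<times>\<times> K2\<^esub> = \<one>\<^bsub>tensor_model\<^esub>"
  by (simp add: \<kappa>_one)

lemma coords_bilinear: "bilinear_map tensor_model (\<lambda>x y. coords (x, y))"
  unfolding bilinear_map_def
  by (auto elim!: \<kappa>1_cases \<kappa>2_cases simp: \<kappa>_simps l_distr r_distr m_assoc m_lcomm)

lemma bilinear_coords_linear:
  assumes M: "module F M" and \<beta>: "bilinear_map M \<beta>"
  shows "z \<in> carrier tensor_model \<Longrightarrow> bilinear_coords M \<beta> z \<in> carrier M"
    "z \<in> carrier tensor_model \<Longrightarrow> z' \<in> carrier tensor_model \<Longrightarrow>
      bilinear_coords M \<beta> (z \<oplus>\<^bsub>tensor_model\<^esub> z') = bilinear_coords M \<beta> z \<oplus>\<^bsub>M\<^esub> bilinear_coords M \<beta> z'"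
    "c \<in> carrier F \<Longrightarrow> z \<in> carrier tensor_model \<Longrightarrow>
      bilinear_coords M \<beta> (c \<odot>\<^bsub>tensor_model\<^esub> z) = c \<odot>\<^bsub>M\<^esub> bilinear_coords M \<beta> z"
proof -
  interpret M: module F M by (fact M)
  note [simp] = bilinear_mapD(1)[OF \<beta>]
  show "z \<in> carrier tensor_model \<Longrightarrow> bilinear_coords M \<beta> z \<in> carrier M"
    by (auto simp: bilinear_coords_def)
  show "z \<in> carrier tensor_model \<Longrightarrow> z' \<in> carrier tensor_model \<Longrightarrow>
      bilinear_coords M \<beta> (z \<oplus>\<^bsub>tensor_model\<^esub> z') = bilinear_coords M \<beta> z \<oplus>\<^bsub>M\<^esub> bilinear_coords M \<beta> z'"
    by (auto simp: bilinear_coords_def M.smult_l_distr M.M.a_ac)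
  show "c \<in> carrier F \<Longrightarrow> z \<in> carrier tensor_model \<Longrightarrow>
      bilinear_coords M \<beta> (c \<odot>\<^bsub>tensor_model\<^esub> z) = c \<odot>\<^bsub>M\<^esub> bilinear_coords M \<beta> z"
    by (auto simp: bilinear_coords_def M.smult_r_distr M.smult_assoc1)
qed

lemma bilinear_coords_coords:
  assumes M: "module F M" and \<beta>: "bilinear_map M \<beta>" and xy: "x \<in> carrier K1" "y \<in> carrier K2"
  shows "bilinear_coords M \<beta> (coords (x, y)) = \<beta> x y"
proof -
  interpret M: module F M by (fact M)
  note B = bilinear_mapD[OF \<beta>]
  obtain x0 x1 where x: "x = \<kappa>1 (x0, x1)" "x0 \<in> carrier F" "x1 \<in> carrier F" using xy(1) by (rule \<kappa>1_cases)
  obtain y0 y1 where y: "y = \<kappa>2 (y0, y1)" "y0 \<in> carrier F" "y1 \<in> carrier F" using xy(2) by (rule \<kappa>2_cases)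
  have x': "x = x0 \<odot>\<^bsub>K1\<^esub> \<one>\<^bsub>K1\<^esub> \<oplus>\<^bsub>K1\<^esub> x1 \<odot>\<^bsub>K1\<^esub> gen_a"
    using x by (simp add: \<kappa>_one \<kappa>_simps)
  have y': "y = y0 \<odot>\<^bsub>K2\<^esub> \<one>\<^bsub>K2\<^esub> \<oplus>\<^bsub>K2\<^esub> y1 \<odot>\<^bsub>K2\<^esub> gen_b"
    using y by (simp add: \<kappa>_one \<kappa>_simps)
  have "\<beta> x y = x0 \<odot>\<^bsub>M\<^esub> \<beta> \<one>\<^bsub>K1\<^esub> y \<oplus>\<^bsub>M\<^esub> x1 \<odot>\<^bsub>M\<^esub> \<beta> gen_a y"
    unfolding x' using x xy by (simp add: B)
  also have "\<beta> \<one>\<^bsub>K1\<^esub> y = y0 \<odot>\<^bsub>M\<^esub> \<beta> \<one>\<^bsub>K1\<^esub> \<one>\<^bsub>K2\<^esub> \<oplus>\<^bsub>M\<^esub> y1 \<odot>\<^bsub>M\<^esub> \<beta> \<one>\<^bsub>K1\<^esub> gen_b"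
    unfolding y' using y by (simp add: B)
  also have "\<beta> gen_a y = y0 \<odot>\<^bsub>M\<^esub> \<beta> gen_a \<one>\<^bsub>K2\<^esub> \<oplus>\<^bsub>M\<^esub> y1 \<odot>\<^bsub>M\<^esub> \<beta> gen_a gen_b"
    unfolding y' using y by (simp add: B)
  also have "x0 \<odot>\<^bsub>M\<^esub> (y0 \<odot>\<^bsub>M\<^esub> \<beta> \<one>\<^bsub>K1\<^esub> \<one>\<^bsub>K2\<^esub> \<oplus>\<^bsub>M\<^esub> y1 \<odot>\<^bsub>M\<^esub> \<beta> \<one>\<^bsub>K1\<^esub> gen_b) \<oplus>\<^bsub>M\<^esub>
      x1 \<odot>\<^bsub>M\<^esub> (y0 \<odot>\<^bsub>M\<^esub> \<beta> gen_a \<one>\<^bsub>K2\<^esub> \<oplus>\<^bsub>M\<^esub> y1 \<odot>\<^bsub>M\<^esub> \<beta> gen_a gen_b) = bilinear_coords M \<beta> (coords (x, y))"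
    using x(2,3) y(2,3) unfolding x(1) y(1)
    by (simp add: bilinear_coords_def M.smult_r_distr M.smult_assoc1[symmetric] M.M.a_ac B)
  finally show ?thesis by simp
qed

section \<open>The quotient by the bilinear relations\<close>

abbreviation "KK \<equiv> tensor F K1 K2"
abbreviation "pure \<equiv> pure_tensor F K1 K2"
text \<open>The coordinate map on the monoid algebra. It will turn out to be constant on cosets of
  the tensor ideal and, together with its right inverse \<open>section_coords\<close>, identifies
  the quotient with \<open>tensor_model\<close>.\<close>

abbreviation "\<Phi> \<equiv> FM.linear_extension tensor_model coords"

definition coset :: "('k1 \<times> 'k2 \<Rightarrow> 'f) \<Rightarrow> ('k1 \<times> 'k2 \<Rightarrow> 'f) set" where
  "coset f = tensor_ideal F K1 K2 +>\<^bsub>FM.FG\<^esub> f"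

lemma delta_closed: "\<lbrakk>x \<in> carrier K1; y \<in> carrier K2\<rbrakk> \<Longrightarrow> delta F (x, y) \<in> carrier FM.FG"
  by simp

lemma bilinear_relations_closed: "bilinear_relations F K1 K2 \<subseteq> carrier FM.FG"
  unfolding bilinear_relations_def Let_def
  by (auto intro!: FM.FG.M.minus_closed FM.FG.M.a_closed FM.FG.smult_closed)

lemma tensor_ideal: "ideal (tensor_ideal F K1 K2) FM.FG"
  unfolding tensor_ideal_def using bilinear_relations_closed by (rule FM.FG.M.genideal_ideal)

interpretation I: ideal "tensor_ideal F K1 K2" FM.FG by (fact tensor_ideal)

lemma coset_eq_iff:
  "\<lbrakk>f \<in> carrier FM.FG; g \<in> carrier FM.FG\<rbrakk> \<Longrightarrow> coset f = coset g \<longleftrightarrow> f \<ominus>\<^bsub>FM.FG\<^esub> g \<in> tensor_ideal F K1 K2"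
  unfolding coset_def using FM.FG.M.quotient_eq_iff_same_a_r_cos[OF tensor_ideal] by simp

lemma coset_self: "f \<in> carrier FM.FG \<Longrightarrow> f \<in> coset f"
  unfolding coset_def by (rule I.a_rcos_self)

lemma coset_mem: "\<lbrakk>f \<in> carrier FM.FG; g \<in> coset f\<rbrakk> \<Longrightarrow> g \<in> carrier FM.FG \<and> coset g = coset f"
proof -
  assume f: "f \<in> carrier FM.FG" and "g \<in> coset f"
  then obtain h where h: "h \<in> tensor_ideal F K1 K2" "g = h \<oplus>\<^bsub>FM.FG\<^esub> f"
    by (auto simp: coset_def a_r_coset_def')
  then have "h \<in> carrier FM.FG" by (auto intro: I.Icarr)
  then have "g \<in> carrier FM.FG" "g \<ominus>\<^bsub>FM.FG\<^esub> f = h"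
    using f h by (simp_all add: FM.FG.M.minus_eq FM.FG.M.a_assoc FM.FG.M.r_neg)
  with f h show "g \<in> carrier FM.FG \<and> coset g = coset f" by (simp add: coset_eq_iff)
qed

lemma KK_carrier: "carrier KK = coset ` carrier FM.FG"
  by (auto simp: tensor_def Let_def ring.defs FactRing_def A_RCOSETS_def' coset_def)

lemma KK_ops:
  assumes "f \<in> carrier FM.FG" "g \<in> carrier FM.FG"
  shows "coset f \<oplus>\<^bsub>KK\<^esub> coset g = coset (f \<oplus>\<^bsub>FM.FG\<^esub> g)"
    "coset f \<otimes>\<^bsub>KK\<^esub> coset g = coset (f \<otimes>\<^bsub>FM.FG\<^esub> g)"
    "\<one>\<^bsub>KK\<^esub> = coset \<one>\<^bsub>FM.FG\<^esub>" "\<zero>\<^bsub>KK\<^esub> = coset \<zero>\<^bsub>FM.FG\<^esub>"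
proof -
  have KK: "add KK = add (FM.FG Quot tensor_ideal F K1 K2)" "monoid.mult KK = monoid.mult (FM.FG Quot tensor_ideal F K1 K2)"
    "\<one>\<^bsub>KK\<^esub> = \<one>\<^bsub>FM.FG Quot tensor_ideal F K1 K2\<^esub>" "\<zero>\<^bsub>KK\<^esub> = \<zero>\<^bsub>FM.FG Quot tensor_ideal F K1 K2\<^esub>"
    by (simp_all add: tensor_def Let_def ring.defs)
  interpret h: ring_hom_ring FM.FG "FM.FG Quot tensor_ideal F K1 K2" "coset"
    using I.rcos_ring_hom_ring unfolding coset_def[abs_def] .
  show "coset f \<oplus>\<^bsub>KK\<^esub> coset g = coset (f \<oplus>\<^bsub>FM.FG\<^esub> g)" "coset f \<otimes>\<^bsub>KK\<^esub> coset g = coset (f \<otimes>\<^bsub>FM.FG\<^esub> g)"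
    "\<one>\<^bsub>KK\<^esub> = coset \<one>\<^bsub>FM.FG\<^esub>" "\<zero>\<^bsub>KK\<^esub> = coset \<zero>\<^bsub>FM.FG\<^esub>"
    using assms by (simp_all only: KK h.hom_add h.hom_mult h.hom_one h.hom_zero)
qed

lemma ideal_smult_closed:
  assumes "c \<in> carrier F" "f \<in> tensor_ideal F K1 K2"
  shows "c \<odot>\<^bsub>FM.FG\<^esub> f \<in> tensor_ideal F K1 K2"
proof -
  have "f \<in> carrier FM.FG" using assms(2) by (rule I.Icarr)
  then have "c \<odot>\<^bsub>FM.FG\<^esub> f = (c \<odot>\<^bsub>FM.FG\<^esub> \<one>\<^bsub>FM.FG\<^esub>) \<otimes>\<^bsub>FM.FG\<^esub> f"
    using assms(1) by (simp only: FM.FG.scalar_mult)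
  also have "\<dots> \<in> tensor_ideal F K1 K2"
    using assms by (intro I.I_l_closed FM.FG.smult_closed FM.FG.M.one_closed)
  finally show ?thesis .
qed

lemma coset_smult:
  assumes c: "c \<in> carrier F" and f: "f \<in> carrier FM.FG" and g: "g \<in> carrier FM.FG" and eq: "coset f = coset g"
  shows "coset (c \<odot>\<^bsub>FM.FG\<^esub> f) = coset (c \<odot>\<^bsub>FM.FG\<^esub> g)"
proof -
  have "c \<odot>\<^bsub>FM.FG\<^esub> f \<ominus>\<^bsub>FM.FG\<^esub> c \<odot>\<^bsub>FM.FG\<^esub> g = c \<odot>\<^bsub>FM.FG\<^esub> (f \<ominus>\<^bsub>FM.FG\<^esub> g)"
    using c f g by (simp add: FM.FG.M.minus_eq FM.FG.smult_r_distr FM.FG.smult_r_minus)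
  moreover have "f \<ominus>\<^bsub>FM.FG\<^esub> g \<in> tensor_ideal F K1 K2" using eq f g by (simp add: coset_eq_iff)
  ultimately show ?thesis using c f g ideal_smult_closed by (simp add: coset_eq_iff)
qed

text \<open>The scalar multiplication of \<open>tensor\<close> is a union over all representatives
  of a coset. They all yield the same coset because the ideal is closed under scalars.\<close>

lemma KK_smult:
  assumes "c \<in> carrier F" "f \<in> carrier FM.FG"
  shows "c \<odot>\<^bsub>KK\<^esub> coset f = coset (c \<odot>\<^bsub>FM.FG\<^esub> f)"
proof -
  have "c \<odot>\<^bsub>KK\<^esub> coset f = (\<Union>g\<in>coset f. coset (c \<odot>\<^bsub>FM.FG\<^esub> g))"
    by (simp add: tensor_def Let_def ring.defs module.defs coset_def)
  also have "\<dots> = (\<Union>g\<in>coset f. coset (c \<odot>\<^bsub>FM.FG\<^esub> f))"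
  proof (intro SUP_cong refl)
    fix g assume "g \<in> coset f"
    from coset_mem[OF assms(2) this] show "coset (c \<odot>\<^bsub>FM.FG\<^esub> g) = coset (c \<odot>\<^bsub>FM.FG\<^esub> f)"
      using assms by (intro coset_smult) auto
  qed
  also have "\<dots> = coset (c \<odot>\<^bsub>FM.FG\<^esub> f)" using coset_self[OF assms(2)] by blast
  finally show ?thesis .
qed

lemma pure_tensor_coset: "pure x y = coset (delta F (x, y))"
  by (simp add: pure_tensor_def coset_def)

lemma coset_delta_bilinear:
  assumes x: "x \<in> carrier K1" "x' \<in> carrier K1" and y: "y \<in> carrier K2" "y' \<in> carrier K2"
  shows "coset (delta F (x \<oplus>\<^bsub>K1\<^esub> x', y)) = coset (delta F (x, y) \<oplus>\<^bsub>FM.FG\<^esub> delta F (x', y))"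
    "coset (delta F (x, y \<oplus>\<^bsub>K2\<^esub> y')) = coset (delta F (x, y) \<oplus>\<^bsub>FM.FG\<^esub> delta F (x, y'))"
    "c \<in> carrier F \<Longrightarrow> coset (delta F (c \<odot>\<^bsub>K1\<^esub> x, y)) = coset (c \<odot>\<^bsub>FM.FG\<^esub> delta F (x, y))"
    "c \<in> carrier F \<Longrightarrow> coset (delta F (x, c \<odot>\<^bsub>K2\<^esub> y)) = coset (c \<odot>\<^bsub>FM.FG\<^esub> delta F (x, y))"
proof -
  have gen: "bilinear_relations F K1 K2 \<subseteq> tensor_ideal F K1 K2"
    unfolding tensor_ideal_def by (rule FM.FG.M.genideal_self[OF bilinear_relations_closed])
  have rel: "coset f = coset g"
    if "f \<in> carrier FM.FG" "g \<in> carrier FM.FG" "f \<ominus>\<^bsub>FM.FG\<^esub> g \<in> bilinear_relations F K1 K2" for f g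
    using that gen by (auto simp: coset_eq_iff)
  note closed = delta_closed FM.FG.M.a_closed FM.FG.smult_closed K1.M.a_closed K2.M.a_closed
    K1.smult_closed K2.smult_closed
  show "coset (delta F (x \<oplus>\<^bsub>K1\<^esub> x', y)) = coset (delta F (x, y) \<oplus>\<^bsub>FM.FG\<^esub> delta F (x', y))"
    using x y by (intro rel closed; (unfold bilinear_relations_def Let_def)?) blast+
  show "coset (delta F (x, y \<oplus>\<^bsub>K2\<^esub> y')) = coset (delta F (x, y) \<oplus>\<^bsub>FM.FG\<^esub> delta F (x, y'))"
    using x y by (intro rel closed; (unfold bilinear_relations_def Let_def)?) blast+
  show "coset (delta F (c \<odot>\<^bsub>K1\<^esub> x, y)) = coset (c \<odot>\<^bsub>FM.FG\<^esub> delta F (x, y))" if "c \<in> carrier F"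
    using x y that by (intro rel closed; (unfold bilinear_relations_def Let_def)?) blast+
  show "coset (delta F (x, c \<odot>\<^bsub>K2\<^esub> y)) = coset (c \<odot>\<^bsub>FM.FG\<^esub> delta F (x, y))" if "c \<in> carrier F"
    using x y that by (intro rel closed; (unfold bilinear_relations_def Let_def)?) blast+
qed

text \<open>A linear right inverse of \<open>\<Phi>\<close>: the representative that is supported on
  the four basis pairs.\<close>

abbreviation "section_coords \<equiv> bilinear_coords FM.FG (\<lambda>x y. delta F (x, y))"

lemma \<Phi>_hom: "\<Phi> \<in> alg_hom F FM.FG tensor_model"
  using coords_closed coords_mult coords_one
  by (intro FM.linear_extension_hom C4.field_algebra_axioms) auto

lemmas \<Phi>_simps = alg_homD[OF \<Phi>_hom]

lemma \<Phi>_delta: "\<lbrakk>x \<in> carrier K1; y \<in> carrier K2\<rbrakk> \<Longrightarrow> \<Phi> (delta F (x, y)) = coords (x, y)"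
  using coords_closed by (intro FM.linear_extension_delta C4.module_axioms) auto

lemma section_closed: "z \<in> carrier tensor_model \<Longrightarrow> section_coords z \<in> carrier FM.FG"
  by (auto simp: bilinear_coords_def)

lemma section_linear:
  "z \<in> carrier tensor_model \<Longrightarrow> z' \<in> carrier tensor_model \<Longrightarrow>
    section_coords (z \<oplus>\<^bsub>tensor_model\<^esub> z') = section_coords z \<oplus>\<^bsub>FM.FG\<^esub> section_coords z'"
  "c \<in> carrier F \<Longrightarrow> z \<in> carrier tensor_model \<Longrightarrow>
    section_coords (c \<odot>\<^bsub>tensor_model\<^esub> z) = c \<odot>\<^bsub>FM.FG\<^esub> section_coords z"
  by (auto simp: bilinear_coords_def FM.FG.smult_l_distr FM.FG.smult_r_distr FM.FG.smult_assoc1 FM.FG.M.a_ac)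

lemma \<Phi>_section: "z \<in> carrier tensor_model \<Longrightarrow> \<Phi> (section_coords z) = z"
  by (auto simp: bilinear_coords_def \<Phi>_simps \<Phi>_delta \<kappa>_one)

text \<open>Modulo the relations, x is expanded in 1, a and y in 1, b.\<close>

lemma coset_delta_section:
  assumes "x \<in> carrier K1" "y \<in> carrier K2"
  shows "coset (delta F (x, y)) = coset (section_coords (coords (x, y)))"
proof -
  obtain x0 x1 where x: "x = \<kappa>1 (x0, x1)" "x0 \<in> carrier F" "x1 \<in> carrier F" using assms(1) by (rule \<kappa>1_cases)
  obtain y0 y1 where y: "y = \<kappa>2 (y0, y1)" "y0 \<in> carrier F" "y1 \<in> carrier F" using assms(2) by (rule \<kappa>2_cases)
  have x': "x = x0 \<odot>\<^bsub>K1\<^esub> \<one>\<^bsub>K1\<^esub> \<oplus>\<^bsub>K1\<^esub> x1 \<odot>\<^bsub>K1\<^esub> gen_a"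
    using x by (simp add: \<kappa>_one \<kappa>_simps)
  have y': "y = y0 \<odot>\<^bsub>K2\<^esub> \<one>\<^bsub>K2\<^esub> \<oplus>\<^bsub>K2\<^esub> y1 \<odot>\<^bsub>K2\<^esub> gen_b"
    using y by (simp add: \<kappa>_one \<kappa>_simps)
  let ?d = "\<lambda>u v. delta F (u, v)"
  have expand_y: "coset (?d u y) = coset (y0 \<odot>\<^bsub>FM.FG\<^esub> ?d u \<one>\<^bsub>K2\<^esub> \<oplus>\<^bsub>FM.FG\<^esub> y1 \<odot>\<^bsub>FM.FG\<^esub> ?d u gen_b)"
    if u: "u \<in> carrier K1" for u
  proof -
    have "coset (?d u y) = coset (?d u (y0 \<odot>\<^bsub>K2\<^esub> \<one>\<^bsub>K2\<^esub>)) \<oplus>\<^bsub>KK\<^esub> coset (?d u (y1 \<odot>\<^bsub>K2\<^esub> gen_b))"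
      using coset_delta_bilinear(2)[OF u u, of "y0 \<odot>\<^bsub>K2\<^esub> \<one>\<^bsub>K2\<^esub>" "y1 \<odot>\<^bsub>K2\<^esub> gen_b", folded y'] u y(2,3)
      by (simp add: KK_ops)
    also have "\<dots> = coset (y0 \<odot>\<^bsub>FM.FG\<^esub> ?d u \<one>\<^bsub>K2\<^esub>) \<oplus>\<^bsub>KK\<^esub> coset (y1 \<odot>\<^bsub>FM.FG\<^esub> ?d u gen_b)"
      using u y(2,3) by (simp add: coset_delta_bilinear(4)[OF u u _ K2.M.one_closed])
    finally show ?thesis using u y by (simp add: KK_ops)
  qed
  have "coset (?d x y) = coset (?d (x0 \<odot>\<^bsub>K1\<^esub> \<one>\<^bsub>K1\<^esub>) y) \<oplus>\<^bsub>KK\<^esub> coset (?d (x1 \<odot>\<^bsub>K1\<^esub> gen_a) y)"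
    using coset_delta_bilinear(1)[OF _ _ assms(2,2), of "x0 \<odot>\<^bsub>K1\<^esub> \<one>\<^bsub>K1\<^esub>" "x1 \<odot>\<^bsub>K1\<^esub> gen_a", folded x']
      x(2,3) assms(2) by (simp add: KK_ops)
  also have "\<dots> = coset (x0 \<odot>\<^bsub>FM.FG\<^esub> ?d \<one>\<^bsub>K1\<^esub> y) \<oplus>\<^bsub>KK\<^esub> coset (x1 \<odot>\<^bsub>FM.FG\<^esub> ?d gen_a y)"
    using x(2,3) assms(2) by (simp add: coset_delta_bilinear(3)[OF _ K1.M.one_closed assms(2,2)])
  also have "coset (x0 \<odot>\<^bsub>FM.FG\<^esub> ?d \<one>\<^bsub>K1\<^esub> y) =
      coset (x0 \<odot>\<^bsub>FM.FG\<^esub> (y0 \<odot>\<^bsub>FM.FG\<^esub> ?d \<one>\<^bsub>K1\<^esub> \<one>\<^bsub>K2\<^esub> \<oplus>\<^bsub>FM.FG\<^esub> y1 \<odot>\<^bsub>FM.FG\<^esub> ?d \<one>\<^bsub>K1\<^esub> gen_b))"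
    using x y assms by (intro coset_smult expand_y) auto
  also have "coset (x1 \<odot>\<^bsub>FM.FG\<^esub> ?d gen_a y) =
      coset (x1 \<odot>\<^bsub>FM.FG\<^esub> (y0 \<odot>\<^bsub>FM.FG\<^esub> ?d gen_a \<one>\<^bsub>K2\<^esub> \<oplus>\<^bsub>FM.FG\<^esub> y1 \<odot>\<^bsub>FM.FG\<^esub> ?d gen_a gen_b))"
    using x y assms by (intro coset_smult expand_y) auto
  also have "coset (x0 \<odot>\<^bsub>FM.FG\<^esub> (y0 \<odot>\<^bsub>FM.FG\<^esub> ?d \<one>\<^bsub>K1\<^esub> \<one>\<^bsub>K2\<^esub> \<oplus>\<^bsub>FM.FG\<^esub> y1 \<odot>\<^bsub>FM.FG\<^esub> ?d \<one>\<^bsub>K1\<^esub> gen_b)) \<oplus>\<^bsub>KK\<^esub>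
      coset (x1 \<odot>\<^bsub>FM.FG\<^esub> (y0 \<odot>\<^bsub>FM.FG\<^esub> ?d gen_a \<one>\<^bsub>K2\<^esub> \<oplus>\<^bsub>FM.FG\<^esub> y1 \<odot>\<^bsub>FM.FG\<^esub> ?d gen_a gen_b)) =
      coset (section_coords (coords (x, y)))"
    using x(2,3) y(2,3) unfolding x(1) y(1)
    by (simp add: KK_ops bilinear_coords_def FM.FG.smult_r_distr FM.FG.smult_assoc1[symmetric] FM.FG.M.a_ac)
  finally show ?thesis .
qed

text \<open>The four basis tensors span the quotient. By linearity this follows from the case of
  pure tensors.\<close>

lemma coset_section:
  assumes "f \<in> carrier FM.FG"
  shows "coset f = coset (section_coords (\<Phi> f))"
  using assms
proof (induction f rule: FM.monoid_alg_induct)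
  case zero
  have "\<Phi> \<zero>\<^bsub>FM.FG\<^esub> = \<zero>\<^bsub>tensor_model\<^esub>"
    using alg_hom_zero[OF \<Phi>_hom] FM.FG.M.ring_axioms C4.M.ring_axioms by simp
  then show ?case by (simp add: bilinear_coords_def FM.FG.smult_l_null)
next
  case (step f c p)
  obtain x y where p: "p = (x, y)" "x \<in> carrier K1" "y \<in> carrier K2" using step by auto
  have d: "delta F p \<in> carrier FM.FG" "coords p \<in> carrier tensor_model" "\<Phi> (delta F p) = coords p"
    using p coords_closed \<Phi>_delta by auto
  note cl = d step.hyps section_closed \<Phi>_simps(1) FM.FG.smult_closed C4.smult_closed
  have "coset (f \<oplus>\<^bsub>FM.FG\<^esub> c \<odot>\<^bsub>FM.FG\<^esub> delta F p) = coset f \<oplus>\<^bsub>KK\<^esub> coset (c \<odot>\<^bsub>FM.FG\<^esub> delta F p)"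
    using cl by (simp add: KK_ops(1))
  also have "coset (c \<odot>\<^bsub>FM.FG\<^esub> delta F p) = coset (c \<odot>\<^bsub>FM.FG\<^esub> section_coords (coords p))"
    using p cl coset_delta_section by (intro coset_smult) auto
  also have "coset f \<oplus>\<^bsub>KK\<^esub> \<dots> = coset (section_coords (\<Phi> f) \<oplus>\<^bsub>FM.FG\<^esub> c \<odot>\<^bsub>FM.FG\<^esub> section_coords (coords p))"
    unfolding step.IH using cl by (simp add: KK_ops(1))
  also have "section_coords (\<Phi> f) \<oplus>\<^bsub>FM.FG\<^esub> c \<odot>\<^bsub>FM.FG\<^esub> section_coords (coords p) =
      section_coords (\<Phi> f \<oplus>\<^bsub>tensor_model\<^esub> c \<odot>\<^bsub>tensor_model\<^esub> coords p)"
    using cl by (simp only: section_linear)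
  also have "\<Phi> f \<oplus>\<^bsub>tensor_model\<^esub> c \<odot>\<^bsub>tensor_model\<^esub> coords p = \<Phi> (f \<oplus>\<^bsub>FM.FG\<^esub> c \<odot>\<^bsub>FM.FG\<^esub> delta F p)"
    using cl by (simp only: \<Phi>_simps(3,5))
  finally show ?case .
qed

end

section \<open>The coordinate isomorphism of the tensor product\<close>

context etale_pair
begin

text \<open>Both sides are linear in f and agree on basis elements. Hence the linear extension of
  any bilinear map factors through \<open>\<Phi>\<close>.\<close>

lemma linear_extension_bilinear:
  assumes M: "module F M" and \<beta>: "bilinear_map M \<beta>" and f: "f \<in> carrier FM.FG"
  shows "FM.linear_extension M (\<lambda>p. \<beta> (fst p) (snd p)) f = bilinear_coords M \<beta> (\<Phi> f)"
proof (rule FM.linear_extension_unique[OF M _ f, symmetric])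
  note B = bilinear_coords_linear[OF M \<beta>]
  show "(\<lambda>p. \<beta> (fst p) (snd p)) \<in> carrier (K1 \<times>\<times> K2) \<rightarrow> carrier M"
    using bilinear_mapD(1)[OF \<beta>] by auto
  show "bilinear_coords M \<beta> (\<Phi> f) \<in> carrier M" if "f \<in> carrier FM.FG" for f
    using that by (intro B(1) \<Phi>_simps(1))
  show "bilinear_coords M \<beta> (\<Phi> (f \<oplus>\<^bsub>FM.FG\<^esub> g)) = bilinear_coords M \<beta> (\<Phi> f) \<oplus>\<^bsub>M\<^esub> bilinear_coords M \<beta> (\<Phi> g)"
    if "f \<in> carrier FM.FG" "g \<in> carrier FM.FG" for f g
    using that by (simp only: \<Phi>_simps(3) B(2) \<Phi>_simps(1))
  show "bilinear_coords M \<beta> (\<Phi> (c \<odot>\<^bsub>FM.FG\<^esub> f)) = c \<odot>\<^bsub>M\<^esub> bilinear_coords M \<beta> (\<Phi> f)"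
    if "c \<in> carrier F" "f \<in> carrier FM.FG" for c f
    using that by (simp only: \<Phi>_simps(5) B(3) \<Phi>_simps(1))
  show "bilinear_coords M \<beta> (\<Phi> (delta F p)) = \<beta> (fst p) (snd p)" if "p \<in> carrier (K1 \<times>\<times> K2)" for p
    using that bilinear_coords_coords[OF M \<beta>] by (auto simp: \<Phi>_delta)
qed

text \<open>The kernel of a ring homomorphism is an ideal, so it is enough that
  \<open>\<Phi>\<close> kills the generating relations, which is the bilinearity of
  \<open>coords\<close>. This is the half that keeps the four basis tensors independent in the
  quotient.\<close>

lemma tensor_ideal_kernel:
  assumes "f \<in> tensor_ideal F K1 K2"
  shows "\<Phi> f = \<zero>\<^bsub>tensor_model\<^esub>"
proof -
  interpret \<Phi>: ring_hom_ring FM.FG tensor_model \<Phi>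
    using \<Phi>_hom by (intro ring_hom_ringI2 FM.FG.M.ring_axioms C4.M.ring_axioms) (simp add: alg_hom_def)
  note B = bilinear_mapD[OF coords_bilinear]
  have "bilinear_relations F K1 K2 \<subseteq> a_kernel FM.FG tensor_model \<Phi>"
  proof
    fix r assume r: "r \<in> bilinear_relations F K1 K2"
    have diff: "\<Phi> (f \<ominus>\<^bsub>FM.FG\<^esub> g) = \<zero>\<^bsub>tensor_model\<^esub>"
      if "f \<in> carrier FM.FG" "g \<in> carrier FM.FG" "\<Phi> f = \<Phi> g" for f g
    proof -
      have "\<Phi> (f \<ominus>\<^bsub>FM.FG\<^esub> g) = \<Phi> g \<oplus>\<^bsub>tensor_model\<^esub> \<ominus>\<^bsub>tensor_model\<^esub> \<Phi> g"
        using that by (simp only: FM.FG.M.minus_eq \<Phi>.hom_add \<Phi>.hom_a_inv FM.FG.M.a_inv_closed)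
      also have "\<dots> = \<zero>\<^bsub>tensor_model\<^esub>" using that(2) by (intro C4.M.r_neg \<Phi>_simps(1))
      finally show ?thesis .
    qed
    note closed = delta_closed FM.FG.M.a_closed FM.FG.smult_closed K1.M.a_closed K2.M.a_closed
      K1.smult_closed K2.smult_closed
    have "\<Phi> r = \<zero>\<^bsub>tensor_model\<^esub>"
      using r unfolding bilinear_relations_def Let_def
    proof (elim UnE CollectE exE conjE)
      fix x x' y
      assume *: "x \<in> carrier K1" "x' \<in> carrier K1" "y \<in> carrier K2"
      assume r: "r = delta F (x \<oplus>\<^bsub>K1\<^esub> x', y) \<ominus>\<^bsub>FM.FG\<^esub> (delta F (x, y) \<oplus>\<^bsub>FM.FG\<^esub> delta F (x', y))"
      show ?thesis unfolding r
        by (rule diff) (use * in \<open>simp_all only: \<Phi>_simps(3,5) \<Phi>_delta B(2-5) closed\<close>)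
    next
      fix x y y'
      assume *: "x \<in> carrier K1" "y \<in> carrier K2" "y' \<in> carrier K2"
      assume r: "r = delta F (x, y \<oplus>\<^bsub>K2\<^esub> y') \<ominus>\<^bsub>FM.FG\<^esub> (delta F (x, y) \<oplus>\<^bsub>FM.FG\<^esub> delta F (x, y'))"
      show ?thesis unfolding r
        by (rule diff) (use * in \<open>simp_all only: \<Phi>_simps(3,5) \<Phi>_delta B(2-5) closed\<close>)
    next
      fix c x y
      assume *: "c \<in> carrier F" "x \<in> carrier K1" "y \<in> carrier K2"
      assume r: "r = delta F (c \<odot>\<^bsub>K1\<^esub> x, y) \<ominus>\<^bsub>FM.FG\<^esub> c \<odot>\<^bsub>FM.FG\<^esub> delta F (x, y)"
      show ?thesis unfolding r
        by (rule diff) (use * in \<open>simp_all only: \<Phi>_simps(3,5) \<Phi>_delta B(2-5) closed\<close>)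
    next
      fix c x y
      assume *: "c \<in> carrier F" "x \<in> carrier K1" "y \<in> carrier K2"
      assume r: "r = delta F (x, c \<odot>\<^bsub>K2\<^esub> y) \<ominus>\<^bsub>FM.FG\<^esub> c \<odot>\<^bsub>FM.FG\<^esub> delta F (x, y)"
      show ?thesis unfolding r
        by (rule diff) (use * in \<open>simp_all only: \<Phi>_simps(3,5) \<Phi>_delta B(2-5) closed\<close>)
    qed
    then show "r \<in> a_kernel FM.FG tensor_model \<Phi>"
      using subsetD[OF bilinear_relations_closed r] unfolding a_kernel_def' by blast
  qed
  then have "tensor_ideal F K1 K2 \<subseteq> a_kernel FM.FG tensor_model \<Phi>"
    unfolding tensor_ideal_def using \<Phi>.kernel_is_ideal by (intro FM.FG.M.genideal_minimal)
  with assms show ?thesis unfolding a_kernel_def' by blast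
qed

lemma coset_\<Phi>:
  assumes f: "f \<in> carrier FM.FG" and g: "g \<in> carrier FM.FG" and eq: "coset f = coset g"
  shows "\<Phi> f = \<Phi> g"
proof -
  let ?d = "f \<ominus>\<^bsub>FM.FG\<^esub> g"
  have "?d \<in> tensor_ideal F K1 K2" using assms by (simp add: coset_eq_iff)
  then have d: "\<Phi> ?d = \<zero>\<^bsub>tensor_model\<^esub>" by (rule tensor_ideal_kernel)
  have "f = ?d \<oplus>\<^bsub>FM.FG\<^esub> g" "?d \<in> carrier FM.FG"
    using f g by (simp_all add: FM.FG.M.minus_eq FM.FG.M.a_assoc FM.FG.M.l_neg)
  then have "\<Phi> f = \<Phi> ?d \<oplus>\<^bsub>tensor_model\<^esub> \<Phi> g" using g by (metis \<Phi>_simps(3))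
  also have "\<dots> = \<Phi> g" unfolding d using g by (intro C4.M.l_zero \<Phi>_simps(1))
  finally show ?thesis .
qed

definition \<iota> :: "'f quadruple \<Rightarrow> ('k1 \<times> 'k2 \<Rightarrow> 'f) set" where
  "\<iota> z = coset (section_coords z)"

lemma \<iota>_\<Phi>: "f \<in> carrier FM.FG \<Longrightarrow> \<iota> (\<Phi> f) = coset f"
  by (simp add: \<iota>_def coset_section)

text \<open>Injectivity comes from \<open>coset_\<Phi>\<close>, that is, from the ideal lying in the
  kernel, and surjectivity from \<open>coset_section\<close>.\<close>

lemma \<iota>_bij: "bij_betw \<iota> (carrier tensor_model) (carrier KK)"
  unfolding bij_betw_def
proof
  show "inj_on \<iota> (carrier tensor_model)"
  proof (rule inj_onI)
    fix z z' assume z: "z \<in> carrier tensor_model" "z' \<in> carrier tensor_model" "\<iota> z = \<iota> z'"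
    then have "\<Phi> (section_coords z) = \<Phi> (section_coords z')"
      unfolding \<iota>_def by (intro coset_\<Phi> section_closed)
    with z(1,2) show "z = z'" by (simp only: \<Phi>_section)
  qed
  show "\<iota> ` carrier tensor_model = carrier KK"
  proof (intro equalityI subsetI)
    fix x assume "x \<in> \<iota> ` carrier tensor_model"
    then show "x \<in> carrier KK" unfolding KK_carrier \<iota>_def using section_closed by blast
  next
    fix x assume "x \<in> carrier KK"
    then obtain f where "f \<in> carrier FM.FG" "x = coset f" unfolding KK_carrier by blast
    then show "x \<in> \<iota> ` carrier tensor_model" using \<iota>_\<Phi>[symmetric] \<Phi>_simps(1) by blast
  qed
qed

lemma \<iota>_iso: "field_algebra F KK" "\<iota> \<in> alg_iso F tensor_model KK"
proof -
  have 1: "section_coords \<zero>\<^bsub>tensor_model\<^esub> = \<zero>\<^bsub>FM.FG\<^esub>"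
    by (simp add: bilinear_coords_def FM.FG.smult_l_null)
  have 2: "\<iota> \<one>\<^bsub>tensor_model\<^esub> = \<one>\<^bsub>KK\<^esub>"
    using \<iota>_\<Phi>[OF FM.FG.M.one_closed] KK_ops(3)[OF FM.FG.M.one_closed FM.FG.M.one_closed] \<Phi>_simps(4) by simp
  have 3: "\<iota> (x \<otimes>\<^bsub>tensor_model\<^esub> y) = \<iota> x \<otimes>\<^bsub>KK\<^esub> \<iota> y"
    if "x \<in> carrier tensor_model" "y \<in> carrier tensor_model" for x y
  proof -
    have "\<iota> x \<otimes>\<^bsub>KK\<^esub> \<iota> y = \<iota> (\<Phi> (section_coords x \<otimes>\<^bsub>FM.FG\<^esub> section_coords y))"
      using that section_closed by (simp only: \<iota>_\<Phi> FM.mult_closed) (simp only: \<iota>_def KK_ops(2))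
    also have "\<Phi> (section_coords x \<otimes>\<^bsub>FM.FG\<^esub> section_coords y) = x \<otimes>\<^bsub>tensor_model\<^esub> y"
      using that section_closed by (simp only: \<Phi>_simps(2) \<Phi>_section)
    finally show ?thesis by simp
  qed
  note push = field_algebra_pushforward[OF C4.field_algebra_axioms \<iota>_bij]
  have 4: "\<iota> \<zero>\<^bsub>tensor_model\<^esub> = \<zero>\<^bsub>KK\<^esub>"
    unfolding \<iota>_def 1 using KK_ops(4)[OF FM.FG.M.one_closed FM.FG.M.one_closed] by simp
  have 5: "\<iota> (x \<oplus>\<^bsub>tensor_model\<^esub> y) = \<iota> x \<oplus>\<^bsub>KK\<^esub> \<iota> y"
    if "x \<in> carrier tensor_model" "y \<in> carrier tensor_model" for x y
    unfolding \<iota>_def using that section_closed by (simp only: section_linear KK_ops(1))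
  have 6: "\<iota> (c \<odot>\<^bsub>tensor_model\<^esub> x) = c \<odot>\<^bsub>KK\<^esub> \<iota> x"
    if "c \<in> carrier F" "x \<in> carrier tensor_model" for c x
    unfolding \<iota>_def using that section_closed by (simp only: section_linear KK_smult)
  show "field_algebra F KK" by (rule push(1)) (fact 4 2 5 3 6)+
  show "\<iota> \<in> alg_iso F tensor_model KK" by (rule push(2)) (fact 4 2 5 3 6)+
qed

sublocale KK: field_algebra F KK by (fact \<iota>_iso(1))

lemmas \<iota>_hom = alg_homD[OF alg_isoD(1)[OF \<iota>_iso(2)]]

lemma \<iota>_cases:
  assumes "x \<in> carrier KK"
  obtains z where "z \<in> carrier tensor_model" "x = \<iota> z"
  using alg_isoD(4)[OF \<iota>_iso(2)] assms by blast

lemma pure_\<iota>: "\<lbrakk>x \<in> carrier K1; y \<in> carrier K2\<rbrakk> \<Longrightarrow> pure x y = \<iota> (coords (x, y))"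
  unfolding pure_tensor_coset by (simp add: \<iota>_\<Phi>[symmetric] \<Phi>_delta)

text \<open>The linear extension of \<beta> factors through \<open>\<Phi>\<close>, which is constant
  on a coset; so the image of the coset is a singleton and \<open>the_elem\<close> returns its
  member.\<close>

lemma tensor_lift_\<iota>:
  assumes M: "module F M" and \<beta>: "bilinear_map M \<beta>" and z: "z \<in> carrier tensor_model"
  shows "tensor_lift F M \<beta> (\<iota> z) = bilinear_coords M \<beta> z"
proof -
  have "(\<lambda>f. \<Oplus>\<^bsub>M\<^esub>p \<in> support F f. f p \<odot>\<^bsub>M\<^esub> \<beta> (fst p) (snd p)) ` \<iota> z = {bilinear_coords M \<beta> z}"
  proof (intro equalityI subsetI)
    fix m assume "m \<in> (\<lambda>f. \<Oplus>\<^bsub>M\<^esub>p \<in> support F f. f p \<odot>\<^bsub>M\<^esub> \<beta> (fst p) (snd p)) ` \<iota> z"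
    then obtain f where f: "f \<in> coset (section_coords z)"
      "m = FM.linear_extension M (\<lambda>p. \<beta> (fst p) (snd p)) f"
      by (auto simp: FM.linear_extension_def \<iota>_def)
    from coset_mem[OF section_closed[OF z] f(1)] have fc: "f \<in> carrier FM.FG" "coset f = coset (section_coords z)"
      by auto
    have "m = bilinear_coords M \<beta> (\<Phi> f)" unfolding f(2) by (rule linear_extension_bilinear[OF M \<beta> fc(1)])
    also have "\<Phi> f = \<Phi> (section_coords z)" using fc section_closed[OF z] by (intro coset_\<Phi>)
    also have "\<dots> = z" using z by (rule \<Phi>_section)
    finally show "m \<in> {bilinear_coords M \<beta> z}" by simp
  next
    fix m assume "m \<in> {bilinear_coords M \<beta> z}"
    then have "m = FM.linear_extension M (\<lambda>p. \<beta> (fst p) (snd p)) (section_coords z)"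
      using linear_extension_bilinear[OF M \<beta> section_closed[OF z]] \<Phi>_section[OF z] by simp
    then show "m \<in> (\<lambda>f. \<Oplus>\<^bsub>M\<^esub>p \<in> support F f. f p \<odot>\<^bsub>M\<^esub> \<beta> (fst p) (snd p)) ` \<iota> z"
      using coset_self[OF section_closed[OF z]] by (auto simp: FM.linear_extension_def \<iota>_def)
  qed
  then show ?thesis by (simp add: tensor_lift_def)
qed

end

section \<open>The automorphism \<open>tau3\<close> in coordinates\<close>

context quadratic_pair
begin

text \<open>The result of substituting t1 - a for a and t2 - b for b in z0 + z1 a + z2 b + z3 ab,
  with a always to the left of b.\<close>

definition tau :: "'f quadruple \<Rightarrow> 'f quadruple" where
  "tau = (\<lambda>(z0, z1, z2, z3).
     (z0 \<oplus> t1 \<otimes> z1 \<oplus> t2 \<otimes> z2 \<oplus> t1 \<otimes> t2 \<otimes> z3, \<ominus> z1 \<ominus> t2 \<otimes> z3, \<ominus> z2 \<ominus> t1 \<otimes> z3, z3))"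

lemma tau_closed: "z \<in> carrier tensor_model \<Longrightarrow> tau z \<in> carrier tensor_model"
  by (auto simp: tau_def)

end

context etale_pair
begin

lemma pure_bilinear: "bilinear_map KK pure"
proof -
  note B = bilinear_mapD[OF coords_bilinear] and cl = K1.M.a_closed K2.M.a_closed K1.smult_closed K2.smult_closed
  show ?thesis
    unfolding bilinear_map_def
    by (intro conjI ballI) (simp_all only: pure_\<iota> B cl \<iota>_hom(1) \<iota>_hom(3)[symmetric] \<iota>_hom(5)[symmetric])
qed

lemma \<sigma>_linear:
  "x \<in> carrier K1 \<Longrightarrow> \<sigma>1 x \<in> carrier K1"
  "\<lbrakk>x \<in> carrier K1; x' \<in> carrier K1\<rbrakk> \<Longrightarrow> \<sigma>1 (x \<oplus>\<^bsub>K1\<^esub> x') = \<sigma>1 x \<oplus>\<^bsub>K1\<^esub> \<sigma>1 x'"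
  "\<lbrakk>c \<in> carrier F; x \<in> carrier K1\<rbrakk> \<Longrightarrow> \<sigma>1 (c \<odot>\<^bsub>K1\<^esub> x) = c \<odot>\<^bsub>K1\<^esub> \<sigma>1 x"
  "y \<in> carrier K2 \<Longrightarrow> \<sigma>2 y \<in> carrier K2"
  "\<lbrakk>y \<in> carrier K2; y' \<in> carrier K2\<rbrakk> \<Longrightarrow> \<sigma>2 (y \<oplus>\<^bsub>K2\<^esub> y') = \<sigma>2 y \<oplus>\<^bsub>K2\<^esub> \<sigma>2 y'"
  "\<lbrakk>c \<in> carrier F; y \<in> carrier K2\<rbrakk> \<Longrightarrow> \<sigma>2 (c \<odot>\<^bsub>K2\<^esub> y) = c \<odot>\<^bsub>K2\<^esub> \<sigma>2 y"
  by (auto elim!: \<kappa>1_cases \<kappa>2_cases simp: \<sigma>1 \<sigma>2 \<kappa>_simps r_distr minus_add r_minus a_ac m_lcomm)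

lemma tau3_\<iota>:
  assumes "z \<in> carrier tensor_model"
  shows "tau3 F K1 K2 \<sigma>1 \<sigma>2 (\<iota> z) = \<iota> (tau z)"
proof -
  obtain z0 z1 z2 z3 where z: "z = (z0, z1, z2, z3)"
    "z0 \<in> carrier F" "z1 \<in> carrier F" "z2 \<in> carrier F" "z3 \<in> carrier F"
    using assms by auto
  note B = bilinear_mapD[OF pure_bilinear]
  have bil: "bilinear_map KK (\<lambda>x y. pure (\<sigma>1 x) (\<sigma>2 y))"
    unfolding bilinear_map_def by (simp add: \<sigma>_linear B)
  have "tau3 F K1 K2 \<sigma>1 \<sigma>2 (\<iota> z) = bilinear_coords KK (\<lambda>x y. pure (\<sigma>1 x) (\<sigma>2 y)) z"
    unfolding tau3_def using KK.module_axioms bil assms by (rule tensor_lift_\<iota>)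
  also have "\<dots> = \<iota> ((z0 \<odot>\<^bsub>tensor_model\<^esub> coords (\<sigma>1 \<one>\<^bsub>K1\<^esub>, \<sigma>2 \<one>\<^bsub>K2\<^esub>) \<oplus>\<^bsub>tensor_model\<^esub> z1 \<odot>\<^bsub>tensor_model\<^esub> coords (\<sigma>1 gen_a, \<sigma>2 \<one>\<^bsub>K2\<^esub>)) \<oplus>\<^bsub>tensor_model\<^esub>
      (z2 \<odot>\<^bsub>tensor_model\<^esub> coords (\<sigma>1 \<one>\<^bsub>K1\<^esub>, \<sigma>2 gen_b) \<oplus>\<^bsub>tensor_model\<^esub> z3 \<odot>\<^bsub>tensor_model\<^esub> coords (\<sigma>1 gen_a, \<sigma>2 gen_b)))"
    using z coords_closed by (simp add: bilinear_coords_def pure_\<iota> \<sigma>_linear \<iota>_hom(3,5) del: biquad_alg_simps)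
  also have "(z0 \<odot>\<^bsub>tensor_model\<^esub> coords (\<sigma>1 \<one>\<^bsub>K1\<^esub>, \<sigma>2 \<one>\<^bsub>K2\<^esub>) \<oplus>\<^bsub>tensor_model\<^esub> z1 \<odot>\<^bsub>tensor_model\<^esub> coords (\<sigma>1 gen_a, \<sigma>2 \<one>\<^bsub>K2\<^esub>)) \<oplus>\<^bsub>tensor_model\<^esub>
      (z2 \<odot>\<^bsub>tensor_model\<^esub> coords (\<sigma>1 \<one>\<^bsub>K1\<^esub>, \<sigma>2 gen_b) \<oplus>\<^bsub>tensor_model\<^esub> z3 \<odot>\<^bsub>tensor_model\<^esub> coords (\<sigma>1 gen_a, \<sigma>2 gen_b)) = tau z"
    using z by (simp add: \<kappa>_one \<sigma>1 \<sigma>2 tau_def) (simp add: minus_eq r_minus l_minus a_ac m_ac)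
  finally show ?thesis .
qed

end

section \<open>The fixed algebra\<close>

context quadratic_pair
begin

text \<open>\<open>c = ab + \<sigma>\<^sub>1(a) \<sigma>\<^sub>2(b)\<close> has trace \<open>t3\<close> and norm \<open>n3\<close> over \<open>F\<close>, and it generates the fixed algebra.\<close>

definition "t3 = t1 \<otimes> t2"

definition "n3 = n2 \<otimes> (t1 \<otimes> t1) \<oplus> n1 \<otimes> (t2 \<otimes> t2) \<ominus> (n1 \<otimes> n2 \<oplus> n1 \<otimes> n2 \<oplus> n1 \<otimes> n2 \<oplus> n1 \<otimes> n2)"

text \<open>The coordinates of u + v c; expanding a b + (t1 - a) (t2 - b) gives c = t1 t2 - t2 a -
  t1 b + 2 a b.\<close>

definition fixed_quadruple :: "'f \<times> 'f \<Rightarrow> 'f quadruple" where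
  "fixed_quadruple = (\<lambda>(u, v). (u \<oplus> t1 \<otimes> t2 \<otimes> v, \<ominus> (t2 \<otimes> v), \<ominus> (t1 \<otimes> v), v \<oplus> v))"

text \<open>\<open>z tau(z) = norm_constant z + norm_linear z \<cdot> c\<close>, and the reduced norm of \<open>z\<close> in a quaternion algebra
  where \<open>a b\<close> has trace \<open>s\<close> is \<open>norm_constant z + s \<cdot> norm_linear z\<close>.\<close>

definition norm_constant :: "'f quadruple \<Rightarrow> 'f" where
  "norm_constant = (\<lambda>(z0, z1, z2, z3).
     z0 \<otimes> z0 \<oplus> t1 \<otimes> z0 \<otimes> z1 \<oplus> n1 \<otimes> z1 \<otimes> z1 \<oplus> n2 \<otimes> (z2 \<otimes> z2 \<oplus> t1 \<otimes> z2 \<otimes> z3 \<oplus> n1 \<otimes> z3 \<otimes> z3) \<oplus>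
     t2 \<otimes> (z0 \<otimes> z2 \<oplus> t1 \<otimes> z1 \<otimes> z2 \<oplus> n1 \<otimes> z1 \<otimes> z3))"

definition norm_linear :: "'f quadruple \<Rightarrow> 'f" where
  "norm_linear = (\<lambda>(z0, z1, z2, z3). z0 \<otimes> z3 \<ominus> z1 \<otimes> z2)"

lemma t3_closed [simp, intro]: "t3 \<in> carrier F" and n3_closed [simp, intro]: "n3 \<in> carrier F"
  by (simp_all add: t3_def n3_def)

lemma norm_closed:
  "z \<in> carrier tensor_model \<Longrightarrow> norm_constant z \<in> carrier F"
  "z \<in> carrier tensor_model \<Longrightarrow> norm_linear z \<in> carrier F"
  by (auto simp: norm_constant_def norm_linear_def)

lemma fixed_quadruple_closed:
  "x \<in> carrier F \<times> carrier F \<Longrightarrow> fixed_quadruple x \<in> carrier tensor_model"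
  by (auto simp: fixed_quadruple_def)

text \<open>The point is c^2 = t3 c - n3. With c' = a (t2 - b) + (t1 - a) b one has c + c' = t1 t2
  and c c' = n2 (t1^2 - 2 n1) + n1 (t2^2 - 2 n2), which is \<open>n3\<close>.\<close>

lemma fixed_quadruple_mult:
  assumes "x0 \<in> carrier F" "x1 \<in> carrier F" "y0 \<in> carrier F" "y1 \<in> carrier F"
  shows "fixed_quadruple ((x0, x1) \<otimes>\<^bsub>quad_alg F t3 n3\<^esub> (y0, y1)) =
    fixed_quadruple (x0, x1) \<otimes>\<^bsub>tensor_model\<^esub> fixed_quadruple (y0, y1)"
  using assms t1 n1 t2 n2 unfolding quad_alg_mult t3_def n3_def fixed_quadruple_def biquad_alg_mult
    quadruple_defs prod.case
  \<comment> \<open>Once the operations are collected, congruence strips \<open>component F\<close>,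
    and each coordinate becomes a separate identity in the class ring.\<close>
  by (elim component_cases, simp only: component_simps prod.inject,
      intro conjI arg_cong[where f = "component F"]; simp add: algebra_simps)

end

section \<open>Fixed points of \<open>tau\<close> in every characteristic\<close>

context etale_pair
begin

lemma tau_norm:
  assumes "z \<in> carrier tensor_model"
  shows "z \<otimes>\<^bsub>tensor_model\<^esub> tau z = fixed_quadruple (norm_constant z, norm_linear z)"
  using assms t1 n1 t2 n2
  unfolding biquad_alg_simps tau_def norm_constant_def norm_linear_def fixed_quadruple_def
  by (elim SigmaE component_cases,
      simp only: biquad_alg_mult quadruple_defs component_simps prod.case prod.inject,
      intro conjI arg_cong[where f = "component F"]; simp add: algebra_simps)

text \<open>In characteristic two the discriminant is the square of the trace coefficient.\<close>

lemma char_two_trace: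
  assumes "\<one> \<oplus> \<one> = \<zero>"
  shows "t1 \<noteq> \<zero>" "t2 \<noteq> \<zero>"
proof -
  have four: "n \<oplus> n \<oplus> n \<oplus> n = \<zero>" if "n \<in> carrier F" for n
  proof -
    have "n \<oplus> n \<oplus> n \<oplus> n = (\<one> \<oplus> \<one>) \<otimes> (n \<oplus> n)" using that by (simp add: l_distr a_assoc)
    then show ?thesis using that by (simp add: assms)
  qed
  show "t1 \<noteq> \<zero>" "t2 \<noteq> \<zero>" using disc1 disc2 by (auto simp: four minus_eq)
qed

text \<open>The quadruple of u + v c determines both 2 v and t1 v, and by
  \<open>char_two_trace\<close> the factors 2 and t1 do not vanish together.\<close>

lemma fixed_quadruple_inj:
  assumes x: "x \<in> carrier F \<times> carrier F" and y: "y \<in> carrier F \<times> carrier F"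
    and eq: "fixed_quadruple x = fixed_quadruple y"
  shows "x = y"
proof -
  obtain u v u' v' where uv: "x = (u, v)" "y = (u', v')" by (cases x, cases y)
  with x y have cl: "u \<in> carrier F" "v \<in> carrier F" "u' \<in> carrier F" "v' \<in> carrier F" by auto
  let ?w = "v \<ominus> v'"
  have w: "?w \<in> carrier F" using cl by simp
  have eqs: "\<ominus> (t1 \<otimes> v) = \<ominus> (t1 \<otimes> v')" "v \<oplus> v = v' \<oplus> v'" "u \<oplus> t1 \<otimes> t2 \<otimes> v = u' \<oplus> t1 \<otimes> t2 \<otimes> v'"
    using eq by (simp_all only: fixed_quadruple_def uv prod.case prod.inject)
  have "t1 \<otimes> ?w = \<ominus> (t1 \<otimes> v') \<ominus> \<ominus> (t1 \<otimes> v)" "(\<one> \<oplus> \<one>) \<otimes> ?w = (v \<oplus> v) \<ominus> (v' \<oplus> v')"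
    using cl t1 by (elim component_cases; simp add: component_simps algebra_simps)+
  then have "t1 \<otimes> ?w = \<zero>" "(\<one> \<oplus> \<one>) \<otimes> ?w = \<zero>" unfolding eqs using cl by simp_all
  then have "?w = \<zero>"
    using integral[of t1 ?w] integral[of "\<one> \<oplus> \<one>" ?w] char_two_trace w by auto
  then have v: "v = v'" using cl by simp
  with eqs(3) cl have "u = u'" by simp
  with v uv show ?thesis by simp
qed

text \<open>The witness v is z3 / 2 if two is invertible. In characteristic two the fixed point
  equations give z3 = 0 and t1 z1 = t2 z2, and v is z1 / t2.\<close>

lemma tau_fixed:
  assumes z: "z \<in> carrier tensor_model" and fixed: "tau z = z"
  shows "\<exists>x\<in>carrier F \<times> carrier F. z = fixed_quadruple x"
proof -
  obtain z0 z1 z2 z3 where zz: "z = (z0, z1, z2, z3)" and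
    cl: "z0 \<in> carrier F" "z1 \<in> carrier F" "z2 \<in> carrier F" "z3 \<in> carrier F"
    using z by auto
  have eqs: "z0 \<oplus> t1 \<otimes> z1 \<oplus> t2 \<otimes> z2 \<oplus> t1 \<otimes> t2 \<otimes> z3 = z0" "\<ominus> z1 \<ominus> t2 \<otimes> z3 = z1" "\<ominus> z2 \<ominus> t1 \<otimes> z3 = z2"
    using fixed by (auto simp: zz tau_def)
  have e0: "t1 \<otimes> z1 \<oplus> t2 \<otimes> z2 \<oplus> t1 \<otimes> t2 \<otimes> z3 = \<zero>"
  proof -
    have "t1 \<otimes> z1 \<oplus> t2 \<otimes> z2 \<oplus> t1 \<otimes> t2 \<otimes> z3 =
        (z0 \<oplus> t1 \<otimes> z1 \<oplus> t2 \<otimes> z2 \<oplus> t1 \<otimes> t2 \<otimes> z3) \<ominus> z0"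
      using cl t1 t2 by (elim component_cases) (simp add: component_simps algebra_simps)
    also have "\<dots> = \<zero>" unfolding eqs(1) using cl by (simp add: minus_eq r_neg)
    finally show ?thesis .
  qed
  have e1: "(\<one> \<oplus> \<one>) \<otimes> z1 \<oplus> t2 \<otimes> z3 = \<zero>"
  proof -
    have "(\<one> \<oplus> \<one>) \<otimes> z1 \<oplus> t2 \<otimes> z3 = z1 \<ominus> (\<ominus> z1 \<ominus> t2 \<otimes> z3)"
      using cl t1 t2 by (elim component_cases) (simp add: component_simps algebra_simps)
    also have "\<dots> = \<zero>" unfolding eqs(2) using cl by (simp add: minus_eq r_neg)
    finally show ?thesis .
  qed
  have e2: "(\<one> \<oplus> \<one>) \<otimes> z2 \<oplus> t1 \<otimes> z3 = \<zero>"
  proof -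
    have "(\<one> \<oplus> \<one>) \<otimes> z2 \<oplus> t1 \<otimes> z3 = z2 \<ominus> (\<ominus> z2 \<ominus> t1 \<otimes> z3)"
      using cl t1 t2 by (elim component_cases) (simp add: component_simps algebra_simps)
    also have "\<dots> = \<zero>" unfolding eqs(3) using cl by (simp add: minus_eq r_neg)
    finally show ?thesis .
  qed
  have "\<exists>v\<in>carrier F. z1 = \<ominus> (t2 \<otimes> v) \<and> z2 = \<ominus> (t1 \<otimes> v) \<and> z3 = v \<oplus> v"
  proof (cases "\<one> \<oplus> \<one> = \<zero>")
    case False
    then have U: "\<one> \<oplus> \<one> \<in> Units F" by (simp add: field_Units)
    define h where "h = inv (\<one> \<oplus> \<one>)"
    have h: "h \<in> carrier F" "(\<one> \<oplus> \<one>) \<otimes> h = \<one>" using U by (simp_all add: h_def)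
    let ?v = "h \<otimes> z3"
    have "?v \<oplus> ?v = ((\<one> \<oplus> \<one>) \<otimes> h) \<otimes> z3" using h(1) cl by (elim component_cases) (simp add: component_simps algebra_simps)
    then have v3: "z3 = ?v \<oplus> ?v" using h cl by simp
    have half: "w = \<ominus> (t \<otimes> ?v)" if "w \<in> carrier F" "t \<in> carrier F" "(\<one> \<oplus> \<one>) \<otimes> w \<oplus> t \<otimes> z3 = \<zero>" for w t
    proof -
      have "((\<one> \<oplus> \<one>) \<otimes> h) \<otimes> w = h \<otimes> ((\<one> \<oplus> \<one>) \<otimes> w \<oplus> t \<otimes> z3) \<ominus> t \<otimes> ?v"
        using h(1) cl that(1,2) by (elim component_cases) (simp add: component_simps algebra_simps)
      then show ?thesis using that h cl by (simp add: minus_eq)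
    qed
    show ?thesis using half[OF cl(2) t2 e1] half[OF cl(3) t1 e2] v3 h cl by (intro bexI[of _ ?v]) auto
  next
    case True
    note t = char_two_trace[OF True]
    have neg: "\<ominus> x = x" if "x \<in> carrier F" for x
    proof -
      have "x \<oplus> x = (\<one> \<oplus> \<one>) \<otimes> x" using that by (simp add: l_distr)
      then show ?thesis using that True by (intro minus_equality) auto
    qed
    have z3: "z3 = \<zero>" using e1 True t integral[of t2 z3] cl by auto
    have U: "t2 \<in> Units F" using t by (simp add: field_Units)
    define v where "v = inv t2 \<otimes> z1"
    have v: "v \<in> carrier F" using U cl by (simp add: v_def)
    have z1: "z1 = t2 \<otimes> v" using U cl by (simp add: v_def m_assoc[symmetric])
    have "t1 \<otimes> z1 \<oplus> t2 \<otimes> z2 = \<zero>" using e0 z3 cl by simp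
    then have "t2 \<otimes> z2 = t2 \<otimes> (t1 \<otimes> v)"
      using cl v z1 neg[of "t2 \<otimes> z2"] minus_equality[of "t1 \<otimes> z1" "t2 \<otimes> z2"] by (simp add: m_lcomm)
    then have z2: "z2 = t1 \<otimes> v" using t cl v by (simp add: m_lcancel)
    have "v \<oplus> v = (\<one> \<oplus> \<one>) \<otimes> v" using v by (simp add: l_distr)
    then have "v \<oplus> v = \<zero>" using v by (simp add: True)
    then show ?thesis using z1 z2 z3 v neg by (intro bexI[of _ v]) auto
  qed
  then obtain v where v: "v \<in> carrier F" "z1 = \<ominus> (t2 \<otimes> v)" "z2 = \<ominus> (t1 \<otimes> v)" "z3 = v \<oplus> v" by blast
  then show ?thesis using cl
    by (intro bexI[of _ "(z0 \<ominus> t1 \<otimes> t2 \<otimes> v, v)"]) (auto simp: zz fixed_quadruple_def minus_eq a_assoc l_neg)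
qed

lemma tau_fixed_quadruple:
  "x \<in> carrier F \<times> carrier F \<Longrightarrow> tau (fixed_quadruple x) = fixed_quadruple x"
  using t1 n1 t2 n2 unfolding tau_def fixed_quadruple_def
  by (elim SigmaE component_cases) (simp add: component_simps algebra_simps)

abbreviation "KF \<equiv> K3 F K1 K2 \<sigma>1 \<sigma>2"

lemma KF_simps:
  "carrier KF = {x \<in> carrier KK. tau3 F K1 K2 \<sigma>1 \<sigma>2 x = x}" "monoid.mult KF = monoid.mult KK"
  "\<one>\<^bsub>KF\<^esub> = \<one>\<^bsub>KK\<^esub>" "\<zero>\<^bsub>KF\<^esub> = \<zero>\<^bsub>KK\<^esub>" "add KF = add KK" "smult KF = smult KK"
  by (simp_all add: K3_def)

definition "\<kappa>3 = \<iota> \<circ> fixed_quadruple"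

lemma \<iota>_eq_iff:
  "\<lbrakk>z \<in> carrier tensor_model; z' \<in> carrier tensor_model\<rbrakk> \<Longrightarrow> \<iota> z = \<iota> z' \<longleftrightarrow> z = z'"
  by (rule inj_on_eq_iff[OF alg_isoD(3)[OF \<iota>_iso(2)]])

text \<open>The fixed algebra is cut out inside the quotient; \<open>\<iota>\<close> translates its
  condition into \<open>tau z = z\<close>, whose solutions are described by
  \<open>tau_fixed\<close>.\<close>

lemma \<kappa>3_bij: "bij_betw \<kappa>3 (carrier (quad_alg F t3 n3)) (carrier KF)"
  unfolding bij_betw_def
proof
  show "inj_on \<kappa>3 (carrier (quad_alg F t3 n3))"
  proof (rule inj_onI)
    fix x y assume *: "x \<in> carrier (quad_alg F t3 n3)" "y \<in> carrier (quad_alg F t3 n3)" "\<kappa>3 x = \<kappa>3 y"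
    then have "fixed_quadruple x = fixed_quadruple y"
      using \<iota>_eq_iff[OF fixed_quadruple_closed fixed_quadruple_closed, of x y] by (simp add: \<kappa>3_def)
    with * show "x = y" using fixed_quadruple_inj by simp
  qed
  show "\<kappa>3 ` carrier (quad_alg F t3 n3) = carrier KF"
  proof (intro equalityI subsetI)
    fix y assume "y \<in> \<kappa>3 ` carrier (quad_alg F t3 n3)"
    then obtain x where x: "x \<in> carrier F \<times> carrier F" "y = \<iota> (fixed_quadruple x)"
      by (auto simp: \<kappa>3_def)
    then show "y \<in> carrier KF"
      using \<iota>_hom(1)[OF fixed_quadruple_closed] tau3_\<iota>[OF fixed_quadruple_closed] tau_fixed_quadruple
      by (simp add: KF_simps)
  next
    fix y assume y: "y \<in> carrier KF"
    then have "y \<in> carrier KK" by (simp add: KF_simps)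
    then obtain z where z: "z \<in> carrier tensor_model" "y = \<iota> z" by (rule \<iota>_cases)
    then have "\<iota> (tau z) = \<iota> z" using y tau3_\<iota> by (simp add: KF_simps)
    then have "tau z = z" using \<iota>_eq_iff[OF tau_closed] z(1) by blast
    with z(1) obtain x where "x \<in> carrier F \<times> carrier F" "z = fixed_quadruple x" using tau_fixed by blast
    then show "y \<in> \<kappa>3 ` carrier (quad_alg F t3 n3)" using z(2) by (auto simp: \<kappa>3_def)
  qed
qed

lemma \<kappa>3_iso: "field_algebra F KF" "\<kappa>3 \<in> alg_iso F (quad_alg F t3 n3) KF"
proof -
  have Q: "field_algebra F (quad_alg F t3 n3)" by (intro quad_alg_algebra) auto
  note push = field_algebra_pushforward[OF Q \<kappa>3_bij]
  have add: "\<kappa>3 (x \<oplus>\<^bsub>quad_alg F t3 n3\<^esub> y) = \<kappa>3 x \<oplus>\<^bsub>KF\<^esub> \<kappa>3 y"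
    if xy: "x \<in> carrier (quad_alg F t3 n3)" "y \<in> carrier (quad_alg F t3 n3)" for x y
  proof -
    have "fixed_quadruple (x \<oplus>\<^bsub>quad_alg F t3 n3\<^esub> y) = fixed_quadruple x \<oplus>\<^bsub>tensor_model\<^esub> fixed_quadruple y"
      using xy t1 t2 unfolding quad_alg_simps fixed_quadruple_def
      by (elim SigmaE component_cases) (simp add: component_simps algebra_simps)
    then show ?thesis using xy \<iota>_hom(3)[OF fixed_quadruple_closed fixed_quadruple_closed]
      by (simp add: \<kappa>3_def KF_simps)
  qed
  have mult: "\<kappa>3 (x \<otimes>\<^bsub>quad_alg F t3 n3\<^esub> y) = \<kappa>3 x \<otimes>\<^bsub>KF\<^esub> \<kappa>3 y"
    if xy: "x \<in> carrier (quad_alg F t3 n3)" "y \<in> carrier (quad_alg F t3 n3)" for x y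
  proof -
    have "fixed_quadruple (x \<otimes>\<^bsub>quad_alg F t3 n3\<^esub> y) = fixed_quadruple x \<otimes>\<^bsub>tensor_model\<^esub> fixed_quadruple y"
      using xy fixed_quadruple_mult by auto
    then show ?thesis using xy \<iota>_hom(2)[OF fixed_quadruple_closed fixed_quadruple_closed]
      by (simp add: \<kappa>3_def KF_simps)
  qed
  have smult: "\<kappa>3 (c \<odot>\<^bsub>quad_alg F t3 n3\<^esub> x) = c \<odot>\<^bsub>KF\<^esub> \<kappa>3 x"
    if cx: "c \<in> carrier F" "x \<in> carrier (quad_alg F t3 n3)" for c x
  proof -
    have "fixed_quadruple (c \<odot>\<^bsub>quad_alg F t3 n3\<^esub> x) = c \<odot>\<^bsub>tensor_model\<^esub> fixed_quadruple x"
      using cx t1 t2 unfolding quad_alg_simps fixed_quadruple_def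
      by (elim SigmaE component_cases) (simp add: component_simps algebra_simps)
    then show ?thesis using cx \<iota>_hom(5)[OF _ fixed_quadruple_closed] by (simp add: \<kappa>3_def KF_simps)
  qed
  have zero: "\<kappa>3 \<zero>\<^bsub>quad_alg F t3 n3\<^esub> = \<zero>\<^bsub>KF\<^esub>" and one: "\<kappa>3 \<one>\<^bsub>quad_alg F t3 n3\<^esub> = \<one>\<^bsub>KF\<^esub>"
    using alg_hom_zero[OF alg_isoD(1)[OF \<iota>_iso(2)] C4.M.ring_axioms KK.M.ring_axioms] \<iota>_hom(4)
    by (simp_all add: \<kappa>3_def fixed_quadruple_def KF_simps)
  show "field_algebra F KF" by (rule push(1)) (fact zero one add mult smult)+
  show "\<kappa>3 \<in> alg_iso F (quad_alg F t3 n3) KF" by (rule push(2)) (fact zero one add mult smult)+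
qed

lemma trace_KF:
  assumes "u \<in> carrier F" "v \<in> carrier F"
  shows "alg_trace F KF (\<kappa>3 (u, v)) = u \<oplus> u \<oplus> t3 \<otimes> v"
  using alg_trace_quad[OF \<kappa>3_iso(2,1)] assms by simp

end

section \<open>Standard involutions and central simple algebras\<close>

context field_algebra
begin

lemma scalars_closed: "x \<in> scalars R M \<Longrightarrow> x \<in> carrier M"
  by (auto simp: scalars_def)

lemma ideal_smult_closed:
  assumes "ideal I M" "c \<in> carrier R" "x \<in> I"
  shows "c \<odot>\<^bsub>M\<^esub> x \<in> I"
proof -
  interpret I: ideal I M by fact
  have "(c \<odot>\<^bsub>M\<^esub> \<one>\<^bsub>M\<^esub>) \<otimes>\<^bsub>M\<^esub> x \<in> I" using assms by (intro I.I_l_closed) auto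
  then show ?thesis using assms I.Icarr by (simp add: scalar_mult)
qed

lemma ideal_scalar_imp_carrier:
  assumes I: "ideal I M" and c: "c \<in> carrier R" "c \<noteq> \<zero>" "c \<odot>\<^bsub>M\<^esub> \<one>\<^bsub>M\<^esub> \<in> I"
  shows "I = carrier M"
proof -
  have "c \<in> Units R" using c by (simp add: field_Units)
  then have "\<one>\<^bsub>M\<^esub> = inv c \<odot>\<^bsub>M\<^esub> (c \<odot>\<^bsub>M\<^esub> \<one>\<^bsub>M\<^esub>)" "inv c \<in> carrier R"
    using c by (simp_all add: smult_assoc1[symmetric])
  then have "\<one>\<^bsub>M\<^esub> \<in> I" using ideal_smult_closed[OF I _ c(3)] by metis
  then show ?thesis by (rule ideal.one_imp_carrier[OF I])
qed

end

text \<open>\<open>standard_involution\<close> and \<open>reduced_norm\<close> are only defined for records without further fields.\<close>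

locale plain_field_algebra = field_algebra R M
  for R :: "'f ring" (structure) and M :: "('f, 'b) module" (structure)
begin

text \<open>Both x J(x) and (x + 1) J(x + 1) are scalars. Their difference is x + J(x) + 1, so x +
  J(x) is a scalar as well.\<close>

lemma standard_involution_trace:
  assumes J: "standard_involution R M J" and x: "x \<in> carrier M"
  obtains t where "t \<in> carrier R" "J x = t \<odot>\<^bsub>M\<^esub> \<one>\<^bsub>M\<^esub> \<ominus>\<^bsub>M\<^esub> x"
proof -
  have Jx: "J x \<in> carrier M" using J x by (auto simp: standard_involution_def)
  have J1: "J (x \<oplus>\<^bsub>M\<^esub> \<one>\<^bsub>M\<^esub>) = J x \<oplus>\<^bsub>M\<^esub> \<one>\<^bsub>M\<^esub>"
    using J x by (simp add: standard_involution_def)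
  have "y \<otimes>\<^bsub>M\<^esub> J y \<in> scalars R M" if "y \<in> carrier M" for y
    using J that by (simp add: standard_involution_def)
  from this[OF x] this[of "x \<oplus>\<^bsub>M\<^esub> \<one>\<^bsub>M\<^esub>"] x
  have "x \<otimes>\<^bsub>M\<^esub> J x \<in> scalars R M" "(x \<oplus>\<^bsub>M\<^esub> \<one>\<^bsub>M\<^esub>) \<otimes>\<^bsub>M\<^esub> (J x \<oplus>\<^bsub>M\<^esub> \<one>\<^bsub>M\<^esub>) \<in> scalars R M"
    by (simp_all add: J1)
  then obtain c d where c: "c \<in> carrier R" "x \<otimes>\<^bsub>M\<^esub> J x = c \<odot>\<^bsub>M\<^esub> \<one>\<^bsub>M\<^esub>"
    and d: "d \<in> carrier R" "(x \<oplus>\<^bsub>M\<^esub> \<one>\<^bsub>M\<^esub>) \<otimes>\<^bsub>M\<^esub> (J x \<oplus>\<^bsub>M\<^esub> \<one>\<^bsub>M\<^esub>) = d \<odot>\<^bsub>M\<^esub> \<one>\<^bsub>M\<^esub>"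
    by (auto simp: scalars_def)
  define y where "y = x \<oplus>\<^bsub>M\<^esub> (J x \<oplus>\<^bsub>M\<^esub> \<one>\<^bsub>M\<^esub>)"
  have y: "y \<in> carrier M" using x Jx by (simp add: y_def)
  have "(x \<oplus>\<^bsub>M\<^esub> \<one>\<^bsub>M\<^esub>) \<otimes>\<^bsub>M\<^esub> (J x \<oplus>\<^bsub>M\<^esub> \<one>\<^bsub>M\<^esub>) = x \<otimes>\<^bsub>M\<^esub> J x \<oplus>\<^bsub>M\<^esub> y"
    using x Jx by (simp add: y_def M.l_distr M.r_distr M.a_ac)
  then have "c \<odot>\<^bsub>M\<^esub> \<one>\<^bsub>M\<^esub> \<oplus>\<^bsub>M\<^esub> y = d \<odot>\<^bsub>M\<^esub> \<one>\<^bsub>M\<^esub>" using c(2) d(2) by simp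
  moreover have "y = \<ominus>\<^bsub>M\<^esub> (c \<odot>\<^bsub>M\<^esub> \<one>\<^bsub>M\<^esub>) \<oplus>\<^bsub>M\<^esub> (c \<odot>\<^bsub>M\<^esub> \<one>\<^bsub>M\<^esub> \<oplus>\<^bsub>M\<^esub> y)"
    using y c(1) by (simp add: M.r_neg1)
  ultimately have y_eq: "y = (\<ominus> c \<oplus> d) \<odot>\<^bsub>M\<^esub> \<one>\<^bsub>M\<^esub>"
    using c(1) d(1) by (simp add: smult_l_distr smult_l_minus)
  have "\<ominus>\<^bsub>M\<^esub> x \<oplus>\<^bsub>M\<^esub> y = J x \<oplus>\<^bsub>M\<^esub> \<one>\<^bsub>M\<^esub>"
    unfolding y_def using x Jx by (simp add: M.r_neg1)
  moreover have "J x = (J x \<oplus>\<^bsub>M\<^esub> \<one>\<^bsub>M\<^esub>) \<oplus>\<^bsub>M\<^esub> \<ominus>\<^bsub>M\<^esub> \<one>\<^bsub>M\<^esub>"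
    using Jx by (simp add: M.a_assoc M.r_neg)
  ultimately have "J x = (\<ominus>\<^bsub>M\<^esub> x \<oplus>\<^bsub>M\<^esub> y) \<oplus>\<^bsub>M\<^esub> \<ominus>\<^bsub>M\<^esub> \<one>\<^bsub>M\<^esub>" by simp
  also have "\<dots> = (y \<oplus>\<^bsub>M\<^esub> \<ominus>\<^bsub>M\<^esub> \<one>\<^bsub>M\<^esub>) \<oplus>\<^bsub>M\<^esub> \<ominus>\<^bsub>M\<^esub> x"
    using x y by (simp add: M.a_ac)
  also have "y \<oplus>\<^bsub>M\<^esub> \<ominus>\<^bsub>M\<^esub> \<one>\<^bsub>M\<^esub> = (\<ominus> c \<oplus> d \<oplus> \<ominus> \<one>) \<odot>\<^bsub>M\<^esub> \<one>\<^bsub>M\<^esub>"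
    unfolding y_eq using c(1) d(1) by (simp add: smult_l_distr smult_l_minus)
  finally have "J x = (\<ominus> c \<oplus> d \<oplus> \<ominus> \<one>) \<odot>\<^bsub>M\<^esub> \<one>\<^bsub>M\<^esub> \<ominus>\<^bsub>M\<^esub> x" by (simp add: M.minus_eq)
  then show ?thesis using c(1) d(1) by (intro that[of "\<ominus> c \<oplus> d \<oplus> \<ominus> \<one>"]) auto
qed

lemma standard_involution_scalar:
  assumes "standard_involution R M J" "x \<in> scalars R M"
  shows "J x = x"
  using assms by (auto simp: standard_involution_def scalars_def)

text \<open>This makes \<open>reduced_norm\<close> independent of the involution. For involutions t
  - x and t' - x the norms differ by (t - t') x, which for x outside the scalars is a scalar only if
  t = t'. On scalars every standard involution is the identity.\<close>

lemma standard_involution_norm_unique: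
  assumes J: "standard_involution R M J" "standard_involution R M J'" and x: "x \<in> carrier M"
    and n: "n \<in> carrier R" "n' \<in> carrier R"
    and eq: "x \<otimes>\<^bsub>M\<^esub> J x = n \<odot>\<^bsub>M\<^esub> \<one>\<^bsub>M\<^esub>" "x \<otimes>\<^bsub>M\<^esub> J' x = n' \<odot>\<^bsub>M\<^esub> \<one>\<^bsub>M\<^esub>"
  shows "n = n'"
proof (cases "x \<in> scalars R M")
  case True
  then have "n \<odot>\<^bsub>M\<^esub> \<one>\<^bsub>M\<^esub> = n' \<odot>\<^bsub>M\<^esub> \<one>\<^bsub>M\<^esub>" using J eq standard_involution_scalar by metis
  then show ?thesis using n scalars_inj by blast
next
  case False
  obtain t where t: "t \<in> carrier R" "J x = t \<odot>\<^bsub>M\<^esub> \<one>\<^bsub>M\<^esub> \<ominus>\<^bsub>M\<^esub> x"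
    using standard_involution_trace[OF J(1) x] by blast
  obtain t' where t': "t' \<in> carrier R" "J' x = t' \<odot>\<^bsub>M\<^esub> \<one>\<^bsub>M\<^esub> \<ominus>\<^bsub>M\<^esub> x"
    using standard_involution_trace[OF J(2) x] by blast
  have diff: "(r \<ominus>\<^bsub>M\<^esub> p) \<ominus>\<^bsub>M\<^esub> (q \<ominus>\<^bsub>M\<^esub> p) = r \<ominus>\<^bsub>M\<^esub> q"
    if "p \<in> carrier M" "q \<in> carrier M" "r \<in> carrier M" for p q r
  proof -
    have "(r \<ominus>\<^bsub>M\<^esub> p) \<ominus>\<^bsub>M\<^esub> (q \<ominus>\<^bsub>M\<^esub> p) = (r \<oplus>\<^bsub>M\<^esub> \<ominus>\<^bsub>M\<^esub> q) \<oplus>\<^bsub>M\<^esub> (\<ominus>\<^bsub>M\<^esub> p \<oplus>\<^bsub>M\<^esub> p)"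
      using that by (simp only: M.minus_eq M.minus_add M.minus_minus M.a_ac M.a_inv_closed M.a_closed)
    then show ?thesis using that by (simp add: M.l_neg M.minus_eq)
  qed
  have norms: "x \<otimes>\<^bsub>M\<^esub> (r \<odot>\<^bsub>M\<^esub> \<one>\<^bsub>M\<^esub> \<ominus>\<^bsub>M\<^esub> x) = r \<odot>\<^bsub>M\<^esub> x \<ominus>\<^bsub>M\<^esub> x \<otimes>\<^bsub>M\<^esub> x" if "r \<in> carrier R" for r
    using that x by (simp add: M.minus_eq M.r_distr M.r_minus smult_mult_right)
  have "(t \<ominus> t') \<odot>\<^bsub>M\<^esub> x = t \<odot>\<^bsub>M\<^esub> x \<ominus>\<^bsub>M\<^esub> t' \<odot>\<^bsub>M\<^esub> x"
    using t t' x by (simp add: M.minus_eq R.minus_eq smult_l_distr smult_l_minus)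
  also have "\<dots> = x \<otimes>\<^bsub>M\<^esub> J x \<ominus>\<^bsub>M\<^esub> x \<otimes>\<^bsub>M\<^esub> J' x"
    unfolding t(2) t'(2) norms[OF t(1)] norms[OF t'(1)] using t t' x by (intro diff[symmetric]) auto
  also have "\<dots> = (n \<ominus> n') \<odot>\<^bsub>M\<^esub> \<one>\<^bsub>M\<^esub>"
    unfolding eq using n by (simp add: M.minus_eq R.minus_eq smult_l_distr smult_l_minus)
  finally have *: "(t \<ominus> t') \<odot>\<^bsub>M\<^esub> x = (n \<ominus> n') \<odot>\<^bsub>M\<^esub> \<one>\<^bsub>M\<^esub>" .
  have "t \<ominus> t' = \<zero>"
  proof (rule ccontr)
    assume "t \<ominus> t' \<noteq> \<zero>"
    then have U: "t \<ominus> t' \<in> Units R" using t t' by (simp add: field_Units)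
    then have "x = (inv (t \<ominus> t') \<otimes> (t \<ominus> t')) \<odot>\<^bsub>M\<^esub> x" using x by simp
    also have "\<dots> = inv (t \<ominus> t') \<odot>\<^bsub>M\<^esub> ((n \<ominus> n') \<odot>\<^bsub>M\<^esub> \<one>\<^bsub>M\<^esub>)"
      using U t t' x n by (subst smult_assoc1) (auto simp: *)
    also have "\<dots> = (inv (t \<ominus> t') \<otimes> (n \<ominus> n')) \<odot>\<^bsub>M\<^esub> \<one>\<^bsub>M\<^esub>"
      using U n by (subst smult_assoc1) auto
    finally show False using False U n unfolding scalars_def by blast
  qed
  then have "(n \<ominus> n') \<odot>\<^bsub>M\<^esub> \<one>\<^bsub>M\<^esub> = \<zero>\<^bsub>M\<^esub>" using * x by (simp add: smult_l_null)
  then have "n \<ominus> n' = \<zero>" using n one_not_zero_M by (intro smult_eq_zero) auto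
  then show ?thesis using n by simp
qed

lemma reduced_norm_eq:
  assumes "standard_involution R M J" "x \<in> carrier M" "n \<in> carrier R"
    "x \<otimes>\<^bsub>M\<^esub> J x = n \<odot>\<^bsub>M\<^esub> \<one>\<^bsub>M\<^esub>"
  shows "reduced_norm R M x = n"
  unfolding reduced_norm_def
  using assms by (intro the_equality) (auto dest: standard_involution_norm_unique)

end

lemma standard_involution_transfer:
  assumes h: "h \<in> alg_iso F A B" and A: "field_algebra F A" and J: "standard_involution F A J"
  shows "standard_involution F B (\<lambda>x. h (J (inv_into (carrier A) h x)))"
proof -
  interpret A: field_algebra F A by fact
  note hom = alg_homD[OF alg_isoD(1)[OF h]]
  note inv = alg_homD[OF alg_isoD(1)[OF alg_iso_inv[OF h A]]]
  have g: "inv_into (carrier A) h (h x) = x" if "x \<in> carrier A" for x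
    using alg_isoD(3)[OF h] that by simp
  have hg: "h (inv_into (carrier A) h y) = y" if "y \<in> carrier B" for y
    using alg_isoD(4)[OF h] that by (intro f_inv_into_f) simp
  have Jc: "J x \<in> carrier A" if "x \<in> carrier A" for x
    using J that by (auto simp: standard_involution_def)
  show ?thesis
    unfolding standard_involution_def alg_iso_scalars[OF h A]
  proof (intro conjI ballI Pi_I)
    fix x assume x: "x \<in> carrier B"
    have "x \<otimes>\<^bsub>B\<^esub> h (J (inv_into (carrier A) h x)) =
        h (inv_into (carrier A) h x \<otimes>\<^bsub>A\<^esub> J (inv_into (carrier A) h x))"
      using x inv(1) Jc by (simp add: hom(2) hg)
    then show "x \<otimes>\<^bsub>B\<^esub> h (J (inv_into (carrier A) h x)) \<in> h ` scalars F A"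
      using J inv(1)[OF x] by (auto simp: standard_involution_def)
  qed (use J inv hom hg g Jc in \<open>auto simp: standard_involution_def\<close>)
qed

lemma central_simple_transfer:
  assumes h: "h \<in> alg_iso F A B" and A: "field_algebra F A" and B: "field_algebra F B"
    and cs: "central_simple F A"
  shows "central_simple F B"
proof -
  interpret A: field_algebra F A by fact
  interpret B: field_algebra F B by fact
  note hom = alg_homD[OF alg_isoD(1)[OF h]]
  interpret h: ring_hom_ring A B h
    using alg_isoD(1)[OF h] by (intro ring_hom_ringI2 A.M.ring_axioms B.M.ring_axioms) (simp add: alg_hom_def)
  have inj: "x = y" if "h x = h y" "x \<in> carrier A" "y \<in> carrier A" for x y
    using alg_isoD(3)[OF h] that by (auto simp: inj_on_def)
  have surj: "\<exists>x\<in>carrier A. y = h x" if "y \<in> carrier B" for y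
    using alg_isoD(4)[OF h] that by auto
  have center: "{z \<in> carrier A. \<forall>x \<in> carrier A. z \<otimes>\<^bsub>A\<^esub> x = x \<otimes>\<^bsub>A\<^esub> z} = scalars F A"
    and simple: "\<And>I. ideal I A \<Longrightarrow> I = {\<zero>\<^bsub>A\<^esub>} \<or> I = carrier A"
    using cs by (auto simp: central_simple_def)
  have "{z \<in> carrier B. \<forall>x \<in> carrier B. z \<otimes>\<^bsub>B\<^esub> x = x \<otimes>\<^bsub>B\<^esub> z} = scalars F B"
    unfolding alg_iso_scalars[OF h A] center[symmetric]
  proof (intro equalityI subsetI)
    fix z assume "z \<in> {z \<in> carrier B. \<forall>x \<in> carrier B. z \<otimes>\<^bsub>B\<^esub> x = x \<otimes>\<^bsub>B\<^esub> z}"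
    then have "z \<in> carrier B" and comm: "\<And>x. x \<in> carrier B \<Longrightarrow> z \<otimes>\<^bsub>B\<^esub> x = x \<otimes>\<^bsub>B\<^esub> z"
      by auto
    with surj obtain z' where z': "z' \<in> carrier A" "z = h z'" by blast
    have "z' \<otimes>\<^bsub>A\<^esub> x = x \<otimes>\<^bsub>A\<^esub> z'" if "x \<in> carrier A" for x
      using comm[OF hom(1)[OF that]] z' that by (intro inj) (simp_all add: hom(2))
    then show "z \<in> h ` {z \<in> carrier A. \<forall>x \<in> carrier A. z \<otimes>\<^bsub>A\<^esub> x = x \<otimes>\<^bsub>A\<^esub> z}" using z' by blast
  next
    fix z assume "z \<in> h ` {z \<in> carrier A. \<forall>x \<in> carrier A. z \<otimes>\<^bsub>A\<^esub> x = x \<otimes>\<^bsub>A\<^esub> z}"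
    then obtain z' where z': "z' \<in> carrier A" "z = h z'" and
      comm: "\<And>x. x \<in> carrier A \<Longrightarrow> z' \<otimes>\<^bsub>A\<^esub> x = x \<otimes>\<^bsub>A\<^esub> z'"
      by blast
    have "z \<otimes>\<^bsub>B\<^esub> x = x \<otimes>\<^bsub>B\<^esub> z" if "x \<in> carrier B" for x
    proof -
      obtain x' where "x' \<in> carrier A" "x = h x'" using surj \<open>x \<in> carrier B\<close> by blast
      then show ?thesis using z' comm[of x'] hom(2)[of z' x'] hom(2)[of x' z'] by simp
    qed
    then show "z \<in> {z \<in> carrier B. \<forall>x \<in> carrier B. z \<otimes>\<^bsub>B\<^esub> x = x \<otimes>\<^bsub>B\<^esub> z}"
      using z' hom(1) by blast
  qed
  moreover have "I = {\<zero>\<^bsub>B\<^esub>} \<or> I = carrier B" if "ideal I B" for I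
  proof -
    interpret I: ideal I B by fact
    \<comment> \<open>Ideals are compared through their preimages; as \<open>h\<close> is onto, I is
      the image of its preimage.\<close>
    let ?P = "{x \<in> carrier A. h x \<in> I}"
    have I_image: "I = h ` ?P"
    proof (intro equalityI subsetI)
      fix y assume "y \<in> I"
      moreover from this obtain x where "x \<in> carrier A" "y = h x" using surj I.Icarr by blast
      ultimately show "y \<in> h ` ?P" by blast
    qed blast
    have "ideal ?P A"
    proof (rule idealI[OF A.M.ring_axioms])
      show "subgroup ?P (add_monoid A)"
      proof (rule A.M.add.subgroupI)
        show "?P \<noteq> {}" using h.hom_zero I.zero_closed by auto
      qed (use hom(3) I.a_closed I.a_inv_closed in \<open>auto simp flip: a_inv_def\<close>)
      show "x \<otimes>\<^bsub>A\<^esub> a \<in> ?P" "a \<otimes>\<^bsub>A\<^esub> x \<in> ?P" if "a \<in> ?P" "x \<in> carrier A" for a x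
        using that hom(1,2) I.I_l_closed I.I_r_closed by auto
    qed
    from simple[OF this] show ?thesis
    proof
      assume "?P = {\<zero>\<^bsub>A\<^esub>}"
      then show ?thesis using I_image by simp
    next
      assume "?P = carrier A"
      then show ?thesis using I_image alg_isoD(4)[OF h] by simp
    qed
  qed
  ultimately show ?thesis
    unfolding central_simple_def using B.assoc_algebra_axioms B.one_not_zero_M by blast
qed

lemma quaternion_algebra_transfer:
  assumes h: "h \<in> alg_iso F A B" and A: "field_algebra F A" and B: "field_algebra F B"
  shows "quaternion_algebra F A \<longleftrightarrow> quaternion_algebra F B"
  using central_simple_transfer[OF h A B] alg_iso_has_dim[OF h A B]
    central_simple_transfer[OF alg_iso_inv[OF h A] B A] alg_iso_has_dim[OF alg_iso_inv[OF h A] B A]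
  unfolding quaternion_algebra_def by blast

section \<open>The quaternion algebra generated by two quadratic algebras\<close>

context quadratic_pair
begin

text \<open>The standard involution of the model: a, b and ab go to t1 - a, t2 - b and s - ab,
  because s is the trace of ab.\<close>

definition quat_conj :: "'f \<Rightarrow> 'f quadruple \<Rightarrow> 'f quadruple" where
  "quat_conj s = (\<lambda>(z0, z1, z2, z3). (z0 \<oplus> t1 \<otimes> z1 \<oplus> t2 \<otimes> z2 \<oplus> s \<otimes> z3, \<ominus> z1, \<ominus> z2, \<ominus> z3))"

definition nrd :: "'f \<Rightarrow> 'f quadruple \<Rightarrow> 'f" where
  "nrd s z = norm_constant z \<oplus> s \<otimes> norm_linear z"

text \<open>The coordinates of \<open>w = a b - b a\<close>. As \<open>w y = tau(y) w\<close>, its annihilator is a two-sided ideal; as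
  \<open>w\<^sup>2\<close> is a scalar, it is either invertible or lies in this ideal.\<close>

definition commutator :: "'f \<Rightarrow> 'f quadruple" where
  "commutator s = (t1 \<otimes> t2 \<ominus> s, \<ominus> t2, \<ominus> t1, \<one> \<oplus> \<one>)"

text \<open>The coordinates of \<open>commutator s\<close> are those of c - s in the tensor model,
  and this scalar is the quadratic polynomial x^2 - t3 x + n3 of c evaluated at s.\<close>

definition commutator_square :: "'f \<Rightarrow> 'f" where
  "commutator_square s = s \<otimes> s \<ominus> t3 \<otimes> s \<oplus> n3"

abbreviation "quad_a \<equiv> (\<zero>, \<one>, \<zero>, \<zero>)"
abbreviation "quad_b \<equiv> (\<zero>, \<zero>, \<one>, \<zero>)"

context
  fixes s assumes s [simp]: "s \<in> carrier F"
begin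

interpretation Q: field_algebra F "quat_model s" by (rule quat_model_algebra) simp

lemma commutator_closed [simp]: "commutator s \<in> carrier (quat_model s)"
  by (simp add: commutator_def)

lemma commutator_square_closed [simp]: "commutator_square s \<in> carrier F"
  by (simp add: commutator_square_def)

lemma nrd_closed: "z \<in> carrier (quat_model s) \<Longrightarrow> nrd s z \<in> carrier F"
  unfolding nrd_def using norm_closed by simp

lemma quat_conj_norm:
  assumes "z \<in> carrier (quat_model s)"
  shows "z \<otimes>\<^bsub>quat_model s\<^esub> quat_conj s z = nrd s z \<odot>\<^bsub>quat_model s\<^esub> \<one>\<^bsub>quat_model s\<^esub>"
  using assms t1 n1 t2 n2 s
  unfolding biquad_alg_simps quat_conj_def nrd_def norm_constant_def norm_linear_def
  by (elim SigmaE component_cases,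
      simp only: biquad_alg_mult biquad_alg_simps quadruple_defs component_simps prod.case prod.inject,
      intro conjI arg_cong[where f = "component F"]; simp add: algebra_simps)

lemma quat_conj_mult:
  assumes "x \<in> carrier (quat_model s)" "y \<in> carrier (quat_model s)"
  shows "quat_conj s (x \<otimes>\<^bsub>quat_model s\<^esub> y) = quat_conj s y \<otimes>\<^bsub>quat_model s\<^esub> quat_conj s x"
  using assms t1 n1 t2 n2 s
  unfolding biquad_alg_simps quat_conj_def
  by (elim SigmaE component_cases,
      simp only: biquad_alg_mult biquad_alg_simps quadruple_defs component_simps prod.case prod.inject,
      intro conjI arg_cong[where f = "component F"]; simp add: algebra_simps)

lemma quat_conj_standard_involution: "standard_involution F (quat_model s) (quat_conj s)"
proof -
  have add: "quat_conj s (x \<oplus>\<^bsub>quat_model s\<^esub> y) = quat_conj s x \<oplus>\<^bsub>quat_model s\<^esub> quat_conj s y"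
    and invol: "quat_conj s (quat_conj s x) = x"
    if "x \<in> carrier (quat_model s)" "y \<in> carrier (quat_model s)" for x y
    using that t1 t2 s unfolding biquad_alg_simps quat_conj_def
    by (elim SigmaE component_cases,
      simp only: biquad_alg_simps component_simps prod.case prod.inject,
      intro conjI arg_cong[where f = "component F"]; simp add: algebra_simps)+
  have smult: "quat_conj s (c \<odot>\<^bsub>quat_model s\<^esub> x) = c \<odot>\<^bsub>quat_model s\<^esub> quat_conj s x"
    if "c \<in> carrier F" "x \<in> carrier (quat_model s)" for x c
    using that t1 t2 s unfolding biquad_alg_simps quat_conj_def
    by (elim SigmaE component_cases,
      simp only: biquad_alg_simps component_simps prod.case prod.inject,
      intro conjI arg_cong[where f = "component F"]; simp add: algebra_simps)
  have one: "quat_conj s \<one>\<^bsub>quat_model s\<^esub> = \<one>\<^bsub>quat_model s\<^esub>" by (simp add: quat_conj_def)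
  have closed: "quat_conj s \<in> carrier (quat_model s) \<rightarrow> carrier (quat_model s)" by (auto simp: quat_conj_def)
  have norm: "x \<otimes>\<^bsub>quat_model s\<^esub> quat_conj s x \<in> scalars F (quat_model s)" if "x \<in> carrier (quat_model s)" for x
    unfolding quat_conj_norm[OF that] scalars_def using nrd_closed[OF that] by blast
  show ?thesis
    unfolding standard_involution_def
    by (intro conjI ballI) (rule closed one add smult quat_conj_mult invol[OF _ Q.M.zero_closed] norm; assumption?)+
qed

text \<open>The second identity extends w a = (t1 - a) w and w b = (t2 - b) w. In the third, z = (z0
  + z1 a) + (z2 + z3 a) b has commutator (z2 + z3 a) w with a, and a further factor w leaves a
  scalar multiple of z2 + z3 a. In the fourth, the commutator of z0 + z1 a with b is z1 w.\<close>

lemma commutator_identities: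
  "commutator s \<otimes>\<^bsub>quat_model s\<^esub> commutator s = commutator_square s \<odot>\<^bsub>quat_model s\<^esub> \<one>\<^bsub>quat_model s\<^esub>"
  "y \<in> carrier (quat_model s) \<Longrightarrow>
    commutator s \<otimes>\<^bsub>quat_model s\<^esub> y = tau y \<otimes>\<^bsub>quat_model s\<^esub> commutator s"
  "\<lbrakk>z0 \<in> carrier F; z1 \<in> carrier F; z2 \<in> carrier F; z3 \<in> carrier F\<rbrakk> \<Longrightarrow>
    (quad_a \<otimes>\<^bsub>quat_model s\<^esub> (z0, z1, z2, z3) \<ominus>\<^bsub>quat_model s\<^esub> (z0, z1, z2, z3) \<otimes>\<^bsub>quat_model s\<^esub> quad_a)
      \<otimes>\<^bsub>quat_model s\<^esub> commutator s = commutator_square s \<odot>\<^bsub>quat_model s\<^esub> (z2, z3, \<zero>, \<zero>)"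
  "\<lbrakk>z0 \<in> carrier F; z1 \<in> carrier F\<rbrakk> \<Longrightarrow>
    (z0, z1, \<zero>, \<zero>) \<otimes>\<^bsub>quat_model s\<^esub> quad_b \<ominus>\<^bsub>quat_model s\<^esub> quad_b \<otimes>\<^bsub>quat_model s\<^esub> (z0, z1, \<zero>, \<zero>) =
      z1 \<odot>\<^bsub>quat_model s\<^esub> commutator s"
proof -
  \<comment> \<open>Subtraction in the record is no operation with a coordinate formula; as addition
    of a scalar multiple it is covered by \<open>biquad_alg_simps\<close>.\<close>
  have minus: "x \<ominus>\<^bsub>quat_model s\<^esub> y = x \<oplus>\<^bsub>quat_model s\<^esub> (\<ominus> \<one>) \<odot>\<^bsub>quat_model s\<^esub> y"
    if "y \<in> carrier (quat_model s)" for x y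
    using that by (simp only: Q.M.minus_eq Q.smult_l_minus Q.smult_one one_closed)
  note elems = t1 n1 t2 n2 s
  note defs = commutator_def commutator_square_def t3_def n3_def tau_def
  show "commutator s \<otimes>\<^bsub>quat_model s\<^esub> commutator s = commutator_square s \<odot>\<^bsub>quat_model s\<^esub> \<one>\<^bsub>quat_model s\<^esub>"
    using elems unfolding biquad_alg_simps defs
    by (elim SigmaE component_cases,
      simp only: biquad_alg_mult biquad_alg_simps quadruple_defs component_simps prod.case prod.inject,
      intro conjI arg_cong[where f = "component F"]; simp add: algebra_simps)
  show "commutator s \<otimes>\<^bsub>quat_model s\<^esub> y = tau y \<otimes>\<^bsub>quat_model s\<^esub> commutator s"
    if "y \<in> carrier (quat_model s)"
    using that elems unfolding biquad_alg_simps defs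
    by (elim SigmaE component_cases,
      simp only: biquad_alg_mult biquad_alg_simps quadruple_defs component_simps prod.case prod.inject,
      intro conjI arg_cong[where f = "component F"]; simp add: algebra_simps)
  show "(quad_a \<otimes>\<^bsub>quat_model s\<^esub> (z0, z1, z2, z3) \<ominus>\<^bsub>quat_model s\<^esub> (z0, z1, z2, z3) \<otimes>\<^bsub>quat_model s\<^esub> quad_a)
      \<otimes>\<^bsub>quat_model s\<^esub> commutator s = commutator_square s \<odot>\<^bsub>quat_model s\<^esub> (z2, z3, \<zero>, \<zero>)"
    if "z0 \<in> carrier F" "z1 \<in> carrier F" "z2 \<in> carrier F" "z3 \<in> carrier F"
  proof -
    have "(z0, z1, z2, z3) \<otimes>\<^bsub>quat_model s\<^esub> quad_a \<in> carrier (quat_model s)"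
      using that by (intro Q.M.m_closed) auto
    note m = minus[OF this]
    show ?thesis
      unfolding m using that elems unfolding biquad_alg_simps defs
      by (elim SigmaE component_cases,
        simp only: biquad_alg_mult biquad_alg_simps quadruple_defs component_simps prod.case prod.inject,
        intro conjI arg_cong[where f = "component F"]; simp add: algebra_simps)
  qed
  show "(z0, z1, \<zero>, \<zero>) \<otimes>\<^bsub>quat_model s\<^esub> quad_b \<ominus>\<^bsub>quat_model s\<^esub> quad_b \<otimes>\<^bsub>quat_model s\<^esub> (z0, z1, \<zero>, \<zero>) =
      z1 \<odot>\<^bsub>quat_model s\<^esub> commutator s"
    if "z0 \<in> carrier F" "z1 \<in> carrier F"
  proof -
    have "quad_b \<otimes>\<^bsub>quat_model s\<^esub> (z0, z1, \<zero>, \<zero>) \<in> carrier (quat_model s)"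
      using that by (intro Q.M.m_closed) auto
    note m = minus[OF this]
    show ?thesis
      unfolding m using that elems unfolding biquad_alg_simps defs
      by (elim SigmaE component_cases,
        simp only: biquad_alg_mult biquad_alg_simps quadruple_defs component_simps prod.case prod.inject,
        intro conjI arg_cong[where f = "component F"]; simp add: algebra_simps)
  qed
qed

end

end

text \<open>Commutators with a and b remove coordinates. For a central z the third of the
  \<open>commutator_identities\<close> gives z2 = z3 = 0, and the fourth then gives z1 = 0. The same
  two steps lead from a nonzero element of an ideal to a nonzero scalar in it, since w is removed by
  multiplying with w and w^2 is an invertible scalar.\<close>

lemma (in quadratic_pair) quat_model_central_simple:
  assumes s: "s \<in> carrier F" and g: "commutator_square s \<noteq> \<zero>"
  shows "central_simple F (quat_model s)"
proof -
  let ?Q = "quat_model s" and ?w = "commutator s" and ?g = "commutator_square s"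
  interpret Q: field_algebra F ?Q using s by (rule quat_model_algebra)
  note id = commutator_identities[OF s]
  have gc: "?g \<in> carrier F" and wc: "?w \<in> carrier ?Q"
    using commutator_square_closed[OF s] commutator_closed[OF s] by simp_all
  have gU: "?g \<in> Units F" using g gc by (simp add: field_Units)
  have ab: "quad_a \<in> carrier ?Q" "quad_b \<in> carrier ?Q" by simp_all
  have w0: "?w \<noteq> \<zero>\<^bsub>?Q\<^esub>"
  proof
    assume w: "?w = \<zero>\<^bsub>?Q\<^esub>"
    have "?g \<odot>\<^bsub>?Q\<^esub> \<one>\<^bsub>?Q\<^esub> = \<zero>\<^bsub>?Q\<^esub>"
      unfolding id(1)[symmetric] w by (rule Q.M.l_null[OF Q.M.zero_closed])
    from Q.smult_eq_zero[OF gc Q.M.one_closed this Q.one_not_zero_M] g show False by simp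
  qed
  have center: "{z \<in> carrier ?Q. \<forall>x \<in> carrier ?Q. z \<otimes>\<^bsub>?Q\<^esub> x = x \<otimes>\<^bsub>?Q\<^esub> z} = scalars F ?Q"
  proof (intro equalityI subsetI)
    fix z assume z: "z \<in> {z \<in> carrier ?Q. \<forall>x \<in> carrier ?Q. z \<otimes>\<^bsub>?Q\<^esub> x = x \<otimes>\<^bsub>?Q\<^esub> z}"
    then obtain z0 z1 z2 z3 where zz: "z = (z0, z1, z2, z3)" and
      c: "z0 \<in> carrier F" "z1 \<in> carrier F" "z2 \<in> carrier F" "z3 \<in> carrier F"
      by auto
    have zc: "z \<in> carrier ?Q" using z by blast
    have comm: "x \<otimes>\<^bsub>?Q\<^esub> z \<ominus>\<^bsub>?Q\<^esub> z \<otimes>\<^bsub>?Q\<^esub> x = \<zero>\<^bsub>?Q\<^esub>" "z \<otimes>\<^bsub>?Q\<^esub> x \<ominus>\<^bsub>?Q\<^esub> x \<otimes>\<^bsub>?Q\<^esub> z = \<zero>\<^bsub>?Q\<^esub>"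
      if "x \<in> carrier ?Q" for x
    proof -
      have "x \<otimes>\<^bsub>?Q\<^esub> z = z \<otimes>\<^bsub>?Q\<^esub> x" "x \<otimes>\<^bsub>?Q\<^esub> z \<in> carrier ?Q"
        using z that Q.M.m_closed[OF that zc] by auto
      then show "x \<otimes>\<^bsub>?Q\<^esub> z \<ominus>\<^bsub>?Q\<^esub> z \<otimes>\<^bsub>?Q\<^esub> x = \<zero>\<^bsub>?Q\<^esub>" "z \<otimes>\<^bsub>?Q\<^esub> x \<ominus>\<^bsub>?Q\<^esub> x \<otimes>\<^bsub>?Q\<^esub> z = \<zero>\<^bsub>?Q\<^esub>"
        using Q.M.r_neg by (simp_all only: Q.M.minus_eq)
    qed
    have "?g \<odot>\<^bsub>?Q\<^esub> (z2, z3, \<zero>, \<zero>) = \<zero>\<^bsub>?Q\<^esub> \<otimes>\<^bsub>?Q\<^esub> ?w"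
      using id(3)[OF c] comm(1)[OF ab(1)] by (simp only: zz)
    then have "?g \<odot>\<^bsub>?Q\<^esub> (z2, z3, \<zero>, \<zero>) = \<zero>\<^bsub>?Q\<^esub>" by (simp only: Q.M.l_null[OF wc])
    then have z23: "z2 = \<zero>" "z3 = \<zero>" using c gc g integral[of ?g] by auto
    have "z1 \<odot>\<^bsub>?Q\<^esub> ?w = \<zero>\<^bsub>?Q\<^esub>"
      using id(4)[OF c(1,2)] comm(2)[OF ab(2)] by (simp only: zz z23)
    from Q.smult_eq_zero[OF c(2) wc this w0] have "z1 = \<zero>" .
    then have "z = z0 \<odot>\<^bsub>?Q\<^esub> \<one>\<^bsub>?Q\<^esub>" using c by (simp add: zz z23)
    then show "z \<in> scalars F ?Q" using c unfolding scalars_def by blast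
  next
    fix z assume "z \<in> scalars F ?Q"
    then obtain c where "c \<in> carrier F" "z = c \<odot>\<^bsub>?Q\<^esub> \<one>\<^bsub>?Q\<^esub>" unfolding scalars_def by blast
    then show "z \<in> {z \<in> carrier ?Q. \<forall>x \<in> carrier ?Q. z \<otimes>\<^bsub>?Q\<^esub> x = x \<otimes>\<^bsub>?Q\<^esub> z}"
      using Q.scalar_mult Q.smult_closed[OF _ Q.M.one_closed] by (simp del: biquad_alg_simps)
  qed
  have simple: "I = carrier ?Q" if I: "ideal I ?Q" and ne: "I \<noteq> {\<zero>\<^bsub>?Q\<^esub>}" for I
  proof -
    interpret I: ideal I ?Q by (fact I)
    have minus: "x \<ominus>\<^bsub>?Q\<^esub> y \<in> I" if "x \<in> I" "y \<in> I" for x y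
      using that unfolding Q.M.minus_eq by (intro I.a_closed I.a_inv_closed)
    \<comment> \<open>The case of an ideal element in F[a]: it is already a scalar, or its
      commutator with b is p1 w, and p1 w w is a scalar.\<close>
    have half: "I = carrier ?Q"
      if p: "(p0, p1, \<zero>, \<zero>) \<in> I" "(p0, p1) \<noteq> (\<zero>, \<zero>)" and c: "p0 \<in> carrier F" "p1 \<in> carrier F" for p0 p1
    proof (cases "p1 = \<zero>")
      case True
      then have "p0 \<odot>\<^bsub>?Q\<^esub> \<one>\<^bsub>?Q\<^esub> \<in> I" using p c by simp
      then show ?thesis using Q.ideal_scalar_imp_carrier[OF I c(1)] True p(2) by blast
    next
      case False
      have "p1 \<odot>\<^bsub>?Q\<^esub> ?w \<in> I"
        unfolding id(4)[OF c, symmetric] by (intro minus I.I_r_closed I.I_l_closed p(1) ab(2))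
      then have "(p1 \<odot>\<^bsub>?Q\<^esub> ?w) \<otimes>\<^bsub>?Q\<^esub> ?w \<in> I" using wc by (rule I.I_r_closed)
      moreover have "(p1 \<odot>\<^bsub>?Q\<^esub> ?w) \<otimes>\<^bsub>?Q\<^esub> ?w = (p1 \<otimes> ?g) \<odot>\<^bsub>?Q\<^esub> \<one>\<^bsub>?Q\<^esub>"
        using c gc wc by (simp only: Q.smult_mult_left id(1) Q.smult_assoc1 Q.M.one_closed)
      ultimately show ?thesis
        using Q.ideal_scalar_imp_carrier[OF I, of "p1 \<otimes> ?g"] c gc g False integral[of p1 ?g] by auto
    qed
    obtain x where x: "x \<in> I" "x \<noteq> \<zero>\<^bsub>?Q\<^esub>" using ne I.zero_closed by blast
    have "x \<in> carrier ?Q" using x(1) by (rule I.Icarr)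
    then obtain x0 x1 x2 x3 where xx: "x = (x0, x1, x2, x3)" and
      c: "x0 \<in> carrier F" "x1 \<in> carrier F" "x2 \<in> carrier F" "x3 \<in> carrier F"
      by auto
    show ?thesis
    proof (cases "(x2, x3) = (\<zero>, \<zero>)")
      case True
      then show ?thesis using half[of x0 x1] x c by (simp add: xx)
    next
      case False
      have "?g \<odot>\<^bsub>?Q\<^esub> (x2, x3, \<zero>, \<zero>) \<in> I"
        unfolding id(3)[OF c, symmetric] xx[symmetric]
        by (intro minus I.I_r_closed I.I_l_closed x(1) ab(1) wc)
      then have "inv ?g \<odot>\<^bsub>?Q\<^esub> (?g \<odot>\<^bsub>?Q\<^esub> (x2, x3, \<zero>, \<zero>)) \<in> I"
        by (rule Q.ideal_smult_closed[OF I Units_inv_closed[OF gU]])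
      moreover have "inv ?g \<odot>\<^bsub>?Q\<^esub> (?g \<odot>\<^bsub>?Q\<^esub> (x2, x3, \<zero>, \<zero>)) = (x2, x3, \<zero>, \<zero>)"
        using gU gc c by (simp add: Q.smult_assoc1[symmetric] del: biquad_alg_simps(5))
      ultimately have "(x2, x3, \<zero>, \<zero>) \<in> I" by (simp only:)
      from half[OF this False c(3,4)] show ?thesis .
    qed
  qed
  show ?thesis
    unfolding central_simple_def
    using Q.assoc_algebra_axioms Q.one_not_zero_M center simple by blast
qed

lemma (in etale_pair) quat_model_not_central_simple:
  assumes s: "s \<in> carrier F" and g: "commutator_square s = \<zero>"
  shows "\<not> central_simple F (quat_model s)"
proof
  let ?Q = "quat_model s" and ?w = "commutator s"
  assume cs: "central_simple F ?Q"
  interpret Q: field_algebra F ?Q using s by (rule quat_model_algebra)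
  note id = commutator_identities[OF s]
  have wc: "?w \<in> carrier ?Q" by (rule commutator_closed[OF s])
  have ww: "?w \<otimes>\<^bsub>?Q\<^esub> ?w = \<zero>\<^bsub>?Q\<^esub>"
    unfolding id(1) g by (rule Q.smult_l_null[OF Q.M.one_closed])
  have w0: "?w \<noteq> \<zero>\<^bsub>?Q\<^esub>"
  proof
    assume "?w = \<zero>\<^bsub>?Q\<^esub>"
    \<comment> \<open>The coordinates 2 and -t1 of w cannot both vanish, since t1 is nonzero in
      characteristic two.\<close>
    then have "\<one> \<oplus> \<one> = \<zero>" "\<ominus> t1 = \<zero>" by (auto simp: commutator_def)
    then show False using char_two_trace(1) minus_minus[of t1] by auto
  qed
  let ?I = "{x \<in> carrier ?Q. ?w \<otimes>\<^bsub>?Q\<^esub> x = \<zero>\<^bsub>?Q\<^esub>}"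
  have "ideal ?I ?Q"
  proof (rule idealI[OF Q.M.ring_axioms])
    show "subgroup ?I (add_monoid ?Q)"
    proof (rule Q.M.add.subgroupI)
      show "?I \<noteq> {}" using wc ww by blast
      show "\<ominus>\<^bsub>?Q\<^esub> a \<in> ?I" if "a \<in> ?I" for a
      proof -
        have "?w \<otimes>\<^bsub>?Q\<^esub> \<ominus>\<^bsub>?Q\<^esub> a = \<zero>\<^bsub>?Q\<^esub>" "\<ominus>\<^bsub>?Q\<^esub> a \<in> carrier ?Q"
          using that wc Q.M.r_minus[of ?w a] Q.M.minus_zero Q.M.a_inv_closed[of a] by simp_all
        then show ?thesis by blast
      qed
      show "a \<oplus>\<^bsub>?Q\<^esub> b \<in> ?I" if "a \<in> ?I" "b \<in> ?I" for a b
        using that wc Q.M.r_distr[of a b ?w] Q.M.l_zero[OF Q.M.zero_closed] Q.M.a_closed[of a b] by auto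
    qed blast
    show "a \<otimes>\<^bsub>?Q\<^esub> x \<in> ?I" if "a \<in> ?I" "x \<in> carrier ?Q" for a x
    proof -
      have ac: "a \<in> carrier ?Q" and a0: "?w \<otimes>\<^bsub>?Q\<^esub> a = \<zero>\<^bsub>?Q\<^esub>" using that(1) by blast+
      have "?w \<otimes>\<^bsub>?Q\<^esub> (a \<otimes>\<^bsub>?Q\<^esub> x) = (?w \<otimes>\<^bsub>?Q\<^esub> a) \<otimes>\<^bsub>?Q\<^esub> x"
        using wc ac that(2) by (rule Q.M.m_assoc[symmetric])
      also have "\<dots> = \<zero>\<^bsub>?Q\<^esub>" unfolding a0 by (rule Q.M.l_null[OF that(2)])
      finally show ?thesis using Q.M.m_closed[OF ac that(2)] by blast
    qed
    \<comment> \<open>Moving w past x at the cost of \<open>tau\<close> shows that the annihilator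
      absorbs factors on the left as well as on the right.\<close>
    show "x \<otimes>\<^bsub>?Q\<^esub> a \<in> ?I" if "a \<in> ?I" "x \<in> carrier ?Q" for a x
    proof -
      have ac: "a \<in> carrier ?Q" and a0: "?w \<otimes>\<^bsub>?Q\<^esub> a = \<zero>\<^bsub>?Q\<^esub>" using that(1) by blast+
      have tx: "tau x \<in> carrier ?Q" using tau_closed that(2) by simp
      have "?w \<otimes>\<^bsub>?Q\<^esub> (x \<otimes>\<^bsub>?Q\<^esub> a) = (?w \<otimes>\<^bsub>?Q\<^esub> x) \<otimes>\<^bsub>?Q\<^esub> a"
        using wc that(2) ac by (rule Q.M.m_assoc[symmetric])
      also have "\<dots> = tau x \<otimes>\<^bsub>?Q\<^esub> (?w \<otimes>\<^bsub>?Q\<^esub> a)"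
        unfolding id(2)[OF that(2)] using tx wc ac by (rule Q.M.m_assoc)
      also have "\<dots> = \<zero>\<^bsub>?Q\<^esub>" unfolding a0 by (rule Q.M.r_null[OF tx])
      finally show ?thesis using Q.M.m_closed[OF that(2) ac] by blast
    qed
  qed
  then have "?I = {\<zero>\<^bsub>?Q\<^esub>} \<or> ?I = carrier ?Q" using cs unfolding central_simple_def by blast
  then have "\<one>\<^bsub>?Q\<^esub> \<in> ?I" using wc ww w0 Q.M.one_closed by blast
  then have "?w = \<zero>\<^bsub>?Q\<^esub>" using Q.M.r_one[OF wc] by simp
  with w0 show False by simp
qed

lemma (in etale_pair) quat_model_quaternion_iff:
  assumes "s \<in> carrier F"
  shows "quaternion_algebra F (quat_model s) \<longleftrightarrow> commutator_square s \<noteq> \<zero>"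
  using quat_model_central_simple[OF assms] quat_model_not_central_simple[OF assms]
    biquad_alg_basis[OF quat_model_algebra[OF assms]]
  unfolding quaternion_algebra_def by blast

section \<open>Regular embeddings\<close>

context field_algebra
begin

text \<open>With c = a - t one has a c = c a = - n, and the sum equals both c b + b a and a b + b c.
  Then a (c b + b a) and (a b + b c) a are both a b a - n b.\<close>

lemma quadratic_sum_commutes:
  assumes c: "a \<in> carrier M" "b \<in> carrier M" "t \<in> carrier R" "n \<in> carrier R"
    and aa: "a \<otimes>\<^bsub>M\<^esub> a = t \<odot>\<^bsub>M\<^esub> a \<ominus>\<^bsub>M\<^esub> n \<odot>\<^bsub>M\<^esub> \<one>\<^bsub>M\<^esub>"
  shows "a \<otimes>\<^bsub>M\<^esub> (a \<otimes>\<^bsub>M\<^esub> b \<oplus>\<^bsub>M\<^esub> b \<otimes>\<^bsub>M\<^esub> a \<ominus>\<^bsub>M\<^esub> t \<odot>\<^bsub>M\<^esub> b) =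
    (a \<otimes>\<^bsub>M\<^esub> b \<oplus>\<^bsub>M\<^esub> b \<otimes>\<^bsub>M\<^esub> a \<ominus>\<^bsub>M\<^esub> t \<odot>\<^bsub>M\<^esub> b) \<otimes>\<^bsub>M\<^esub> a"
proof -
  let ?c = "a \<ominus>\<^bsub>M\<^esub> t \<odot>\<^bsub>M\<^esub> \<one>\<^bsub>M\<^esub>"
  have cc: "?c \<in> carrier M" using c by simp
  have ac: "a \<otimes>\<^bsub>M\<^esub> ?c = \<ominus>\<^bsub>M\<^esub> (n \<odot>\<^bsub>M\<^esub> \<one>\<^bsub>M\<^esub>)" "?c \<otimes>\<^bsub>M\<^esub> a = \<ominus>\<^bsub>M\<^esub> (n \<odot>\<^bsub>M\<^esub> \<one>\<^bsub>M\<^esub>)"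
    using c by (simp_all add: M.minus_eq M.r_distr M.l_distr M.r_minus M.l_minus scalar_mult aa)
      (simp_all add: M.a_ac M.r_neg1 M.r_neg2)
  have X1: "a \<otimes>\<^bsub>M\<^esub> b \<oplus>\<^bsub>M\<^esub> b \<otimes>\<^bsub>M\<^esub> a \<ominus>\<^bsub>M\<^esub> t \<odot>\<^bsub>M\<^esub> b = ?c \<otimes>\<^bsub>M\<^esub> b \<oplus>\<^bsub>M\<^esub> b \<otimes>\<^bsub>M\<^esub> a"
    using c by (simp add: M.minus_eq M.l_distr M.l_minus scalar_mult M.a_ac)
  have X2: "a \<otimes>\<^bsub>M\<^esub> b \<oplus>\<^bsub>M\<^esub> b \<otimes>\<^bsub>M\<^esub> a \<ominus>\<^bsub>M\<^esub> t \<odot>\<^bsub>M\<^esub> b = a \<otimes>\<^bsub>M\<^esub> b \<oplus>\<^bsub>M\<^esub> b \<otimes>\<^bsub>M\<^esub> ?c"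
    using c by (simp add: M.minus_eq M.r_distr M.r_minus scalar_mult M.a_ac)
  have "a \<otimes>\<^bsub>M\<^esub> (?c \<otimes>\<^bsub>M\<^esub> b \<oplus>\<^bsub>M\<^esub> b \<otimes>\<^bsub>M\<^esub> a) = (a \<otimes>\<^bsub>M\<^esub> ?c) \<otimes>\<^bsub>M\<^esub> b \<oplus>\<^bsub>M\<^esub> a \<otimes>\<^bsub>M\<^esub> b \<otimes>\<^bsub>M\<^esub> a"
    using c cc by (simp only: M.r_distr M.m_assoc M.m_closed)
  also have "\<dots> = a \<otimes>\<^bsub>M\<^esub> b \<otimes>\<^bsub>M\<^esub> a \<oplus>\<^bsub>M\<^esub> b \<otimes>\<^bsub>M\<^esub> (?c \<otimes>\<^bsub>M\<^esub> a)"
    unfolding ac using c by (simp add: M.l_minus M.r_minus scalar_mult M.a_comm)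
  also have "\<dots> = (a \<otimes>\<^bsub>M\<^esub> b \<oplus>\<^bsub>M\<^esub> b \<otimes>\<^bsub>M\<^esub> ?c) \<otimes>\<^bsub>M\<^esub> a"
    using c cc by (simp only: M.l_distr M.m_assoc M.m_closed)
  finally show ?thesis by (simp only: X1[symmetric] X2[symmetric])
qed

text \<open>This is \<open>a b + b\<^sup>* a\<^sup>*\<close> with \<open>a\<^sup>* = t\<^sub>1 - a\<close> and \<open>b\<^sup>* = t\<^sub>2 - b\<close>, the trace of \<open>a b\<close>. It is central in
  any algebra generated by roots \<open>a\<close>, \<open>b\<close> of quadratic polynomials with these traces.\<close>

definition ab_trace :: "'a \<Rightarrow> 'a \<Rightarrow> 'c \<Rightarrow> 'c \<Rightarrow> 'c" where
  "ab_trace t1 t2 a b = (a \<otimes>\<^bsub>M\<^esub> b \<oplus>\<^bsub>M\<^esub> b \<otimes>\<^bsub>M\<^esub> a \<ominus>\<^bsub>M\<^esub> t1 \<odot>\<^bsub>M\<^esub> b) \<oplus>\<^bsub>M\<^esub>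
     ((t1 \<otimes> t2) \<odot>\<^bsub>M\<^esub> \<one>\<^bsub>M\<^esub> \<ominus>\<^bsub>M\<^esub> t2 \<odot>\<^bsub>M\<^esub> a)"

lemma ab_trace_commute:
  assumes c: "a \<in> carrier M" "b \<in> carrier M" "t1 \<in> carrier R" "n1 \<in> carrier R" "t2 \<in> carrier R"
    and aa: "a \<otimes>\<^bsub>M\<^esub> a = t1 \<odot>\<^bsub>M\<^esub> a \<ominus>\<^bsub>M\<^esub> n1 \<odot>\<^bsub>M\<^esub> \<one>\<^bsub>M\<^esub>"
  shows "a \<otimes>\<^bsub>M\<^esub> ab_trace t1 t2 a b = ab_trace t1 t2 a b \<otimes>\<^bsub>M\<^esub> a"
proof -
  let ?y = "(t1 \<otimes> t2) \<odot>\<^bsub>M\<^esub> \<one>\<^bsub>M\<^esub> \<ominus>\<^bsub>M\<^esub> t2 \<odot>\<^bsub>M\<^esub> a"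
  have "a \<otimes>\<^bsub>M\<^esub> ?y = ?y \<otimes>\<^bsub>M\<^esub> a"
    using c by (simp add: M.minus_eq M.r_distr M.l_distr M.r_minus M.l_minus scalar_mult
        smult_mult_left smult_mult_right)
  moreover note quadratic_sum_commutes[OF c(1-4) aa]
  ultimately show ?thesis
    unfolding ab_trace_def using c by (simp add: M.l_distr M.r_distr)
qed

text \<open>The symmetry, hidden by the way the terms are grouped, lets commutation with b follow
  from commutation with a.\<close>

lemma ab_trace_sym:
  assumes c: "a \<in> carrier M" "b \<in> carrier M" "t1 \<in> carrier R" "t2 \<in> carrier R"
  shows "ab_trace t1 t2 a b = ab_trace t2 t1 b a"
  unfolding ab_trace_def using c by (simp add: M.minus_eq M.a_ac R.m_comm)

lemma ab_trace_closed:
  assumes c: "a \<in> carrier M" "b \<in> carrier M" "t1 \<in> carrier R" "t2 \<in> carrier R"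
  shows "ab_trace t1 t2 a b \<in> carrier M"
  unfolding ab_trace_def using c by simp

lemma cancel_middle:
  assumes "p \<in> carrier M" "q \<in> carrier M" "r \<in> carrier M" "p \<oplus>\<^bsub>M\<^esub> q = r"
  shows "q = r \<ominus>\<^bsub>M\<^esub> p"
proof -
  have "r \<ominus>\<^bsub>M\<^esub> p = \<ominus>\<^bsub>M\<^esub> p \<oplus>\<^bsub>M\<^esub> (p \<oplus>\<^bsub>M\<^esub> q)"
    unfolding assms(4)[symmetric] using assms(1,2) by (simp add: M.minus_eq M.a_comm)
  also have "\<dots> = q" using assms(1,2) by (rule M.r_neg1)
  finally show ?thesis by simp
qed

lemma ba_relation:
  assumes c: "a \<in> carrier M" "b \<in> carrier M" "t1 \<in> carrier R" "t2 \<in> carrier R" "s \<in> carrier R"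
    and s: "ab_trace t1 t2 a b = s \<odot>\<^bsub>M\<^esub> \<one>\<^bsub>M\<^esub>"
  shows "b \<otimes>\<^bsub>M\<^esub> a = (s \<ominus> t1 \<otimes> t2) \<odot>\<^bsub>M\<^esub> \<one>\<^bsub>M\<^esub> \<oplus>\<^bsub>M\<^esub> t2 \<odot>\<^bsub>M\<^esub> a \<oplus>\<^bsub>M\<^esub> t1 \<odot>\<^bsub>M\<^esub> b \<ominus>\<^bsub>M\<^esub> a \<otimes>\<^bsub>M\<^esub> b"
proof -
  let ?p = "a \<otimes>\<^bsub>M\<^esub> b \<ominus>\<^bsub>M\<^esub> t1 \<odot>\<^bsub>M\<^esub> b \<oplus>\<^bsub>M\<^esub> ((t1 \<otimes> t2) \<odot>\<^bsub>M\<^esub> \<one>\<^bsub>M\<^esub> \<ominus>\<^bsub>M\<^esub> t2 \<odot>\<^bsub>M\<^esub> a)"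
  have "?p \<oplus>\<^bsub>M\<^esub> b \<otimes>\<^bsub>M\<^esub> a = s \<odot>\<^bsub>M\<^esub> \<one>\<^bsub>M\<^esub>"
    unfolding s[symmetric] ab_trace_def using c by (simp add: M.minus_eq M.a_ac)
  from cancel_middle[OF _ _ _ this] have "b \<otimes>\<^bsub>M\<^esub> a = s \<odot>\<^bsub>M\<^esub> \<one>\<^bsub>M\<^esub> \<ominus>\<^bsub>M\<^esub> ?p"
    using c by simp
  also have "\<dots> = (s \<ominus> t1 \<otimes> t2) \<odot>\<^bsub>M\<^esub> \<one>\<^bsub>M\<^esub> \<oplus>\<^bsub>M\<^esub> t2 \<odot>\<^bsub>M\<^esub> a \<oplus>\<^bsub>M\<^esub> t1 \<odot>\<^bsub>M\<^esub> b \<ominus>\<^bsub>M\<^esub> a \<otimes>\<^bsub>M\<^esub> b"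
    using c by (simp add: M.minus_eq R.minus_eq M.minus_add smult_l_distr smult_l_minus M.a_ac)
  finally show ?thesis .
qed

text \<open>In terms of d = b - t2 the trace relation reads s = a d - t1 d + b a. Multiplying by b
  on the right and using d b = - n2 isolates b a b.\<close>

lemma bab_relation:
  assumes c: "a \<in> carrier M" "b \<in> carrier M" "t1 \<in> carrier R" "t2 \<in> carrier R" "n2 \<in> carrier R" "s \<in> carrier R"
    and bb: "b \<otimes>\<^bsub>M\<^esub> b = t2 \<odot>\<^bsub>M\<^esub> b \<ominus>\<^bsub>M\<^esub> n2 \<odot>\<^bsub>M\<^esub> \<one>\<^bsub>M\<^esub>"
    and s: "ab_trace t1 t2 a b = s \<odot>\<^bsub>M\<^esub> \<one>\<^bsub>M\<^esub>"
  shows "b \<otimes>\<^bsub>M\<^esub> (a \<otimes>\<^bsub>M\<^esub> b) = n2 \<odot>\<^bsub>M\<^esub> a \<oplus>\<^bsub>M\<^esub> s \<odot>\<^bsub>M\<^esub> b \<ominus>\<^bsub>M\<^esub> (t1 \<otimes> n2) \<odot>\<^bsub>M\<^esub> \<one>\<^bsub>M\<^esub>"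
proof -
  define d where "d = b \<ominus>\<^bsub>M\<^esub> t2 \<odot>\<^bsub>M\<^esub> \<one>\<^bsub>M\<^esub>"
  have dc: "d \<in> carrier M" using c by (simp add: d_def)
  have db: "d \<otimes>\<^bsub>M\<^esub> b = \<ominus>\<^bsub>M\<^esub> (n2 \<odot>\<^bsub>M\<^esub> \<one>\<^bsub>M\<^esub>)"
    using c by (simp add: d_def M.minus_eq M.l_distr M.l_minus scalar_mult bb) (simp add: M.a_ac M.r_neg1 M.r_neg2)
  have "s \<odot>\<^bsub>M\<^esub> \<one>\<^bsub>M\<^esub> = a \<otimes>\<^bsub>M\<^esub> d \<ominus>\<^bsub>M\<^esub> t1 \<odot>\<^bsub>M\<^esub> d \<oplus>\<^bsub>M\<^esub> b \<otimes>\<^bsub>M\<^esub> a"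
    unfolding s[symmetric] ab_trace_def d_def using c
    by (simp add: M.minus_eq M.r_distr M.r_minus scalar_mult smult_r_distr smult_r_minus M.minus_add
        smult_assoc1 M.a_ac)
  then have "(s \<odot>\<^bsub>M\<^esub> \<one>\<^bsub>M\<^esub>) \<otimes>\<^bsub>M\<^esub> b = (a \<otimes>\<^bsub>M\<^esub> d \<ominus>\<^bsub>M\<^esub> t1 \<odot>\<^bsub>M\<^esub> d \<oplus>\<^bsub>M\<^esub> b \<otimes>\<^bsub>M\<^esub> a) \<otimes>\<^bsub>M\<^esub> b" by simp
  then have "s \<odot>\<^bsub>M\<^esub> b = a \<otimes>\<^bsub>M\<^esub> (d \<otimes>\<^bsub>M\<^esub> b) \<ominus>\<^bsub>M\<^esub> t1 \<odot>\<^bsub>M\<^esub> (d \<otimes>\<^bsub>M\<^esub> b) \<oplus>\<^bsub>M\<^esub> b \<otimes>\<^bsub>M\<^esub> (a \<otimes>\<^bsub>M\<^esub> b)"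
    using c dc by (simp add: scalar_mult M.minus_eq M.l_distr M.l_minus smult_mult_left M.m_assoc)
  also have "a \<otimes>\<^bsub>M\<^esub> (d \<otimes>\<^bsub>M\<^esub> b) \<ominus>\<^bsub>M\<^esub> t1 \<odot>\<^bsub>M\<^esub> (d \<otimes>\<^bsub>M\<^esub> b) = (t1 \<otimes> n2) \<odot>\<^bsub>M\<^esub> \<one>\<^bsub>M\<^esub> \<ominus>\<^bsub>M\<^esub> n2 \<odot>\<^bsub>M\<^esub> a"
    unfolding db using c
    by (simp add: M.minus_eq M.r_minus scalar_mult smult_r_minus smult_assoc1 M.a_comm)
  finally have "((t1 \<otimes> n2) \<odot>\<^bsub>M\<^esub> \<one>\<^bsub>M\<^esub> \<ominus>\<^bsub>M\<^esub> n2 \<odot>\<^bsub>M\<^esub> a) \<oplus>\<^bsub>M\<^esub> b \<otimes>\<^bsub>M\<^esub> (a \<otimes>\<^bsub>M\<^esub> b) = s \<odot>\<^bsub>M\<^esub> b" by (rule sym)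
  from cancel_middle[OF _ _ _ this]
  have "b \<otimes>\<^bsub>M\<^esub> (a \<otimes>\<^bsub>M\<^esub> b) = s \<odot>\<^bsub>M\<^esub> b \<ominus>\<^bsub>M\<^esub> ((t1 \<otimes> n2) \<odot>\<^bsub>M\<^esub> \<one>\<^bsub>M\<^esub> \<ominus>\<^bsub>M\<^esub> n2 \<odot>\<^bsub>M\<^esub> a)"
    using c by simp
  also have "\<dots> = n2 \<odot>\<^bsub>M\<^esub> a \<oplus>\<^bsub>M\<^esub> s \<odot>\<^bsub>M\<^esub> b \<ominus>\<^bsub>M\<^esub> (t1 \<otimes> n2) \<odot>\<^bsub>M\<^esub> \<one>\<^bsub>M\<^esub>"
    using c by (simp add: M.minus_eq M.minus_add M.a_ac)
  finally show ?thesis .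
qed

definition quad_map :: "'c \<Rightarrow> 'c \<Rightarrow> 'a \<times> 'a \<times> 'a \<times> 'a \<Rightarrow> 'c" where
  "quad_map a b = (\<lambda>(z0, z1, z2, z3). z0 \<odot>\<^bsub>M\<^esub> \<one>\<^bsub>M\<^esub> \<oplus>\<^bsub>M\<^esub> (z1 \<odot>\<^bsub>M\<^esub> a \<oplus>\<^bsub>M\<^esub> (z2 \<odot>\<^bsub>M\<^esub> b \<oplus>\<^bsub>M\<^esub> z3 \<odot>\<^bsub>M\<^esub> (a \<otimes>\<^bsub>M\<^esub> b))))"

end

text \<open>The product of the model is assembled from the left multiplications by a and b.
  Multiplicativity thus follows once the linear map carries these to the left multiplications in
  \<open>B\<close>, which is what \<open>aa\<close>, \<open>bb\<close>, \<open>ba_relation\<close>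
  and \<open>bab_relation\<close> express.\<close>

lemma (in quadratic_pair) quad_map_hom:
  fixes B :: "('f, 'b) module"
  assumes B: "field_algebra F B" and c: "a \<in> carrier B" "b \<in> carrier B" "s \<in> carrier F"
    and aa: "a \<otimes>\<^bsub>B\<^esub> a = t1 \<odot>\<^bsub>B\<^esub> a \<ominus>\<^bsub>B\<^esub> n1 \<odot>\<^bsub>B\<^esub> \<one>\<^bsub>B\<^esub>"
    and bb: "b \<otimes>\<^bsub>B\<^esub> b = t2 \<odot>\<^bsub>B\<^esub> b \<ominus>\<^bsub>B\<^esub> n2 \<odot>\<^bsub>B\<^esub> \<one>\<^bsub>B\<^esub>"
    and tr: "field_algebra.ab_trace F B t1 t2 a b = s \<odot>\<^bsub>B\<^esub> \<one>\<^bsub>B\<^esub>"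
  shows "field_algebra.quad_map B a b \<in> alg_hom F (quat_model s) B"
proof -
  interpret B: field_algebra F B by fact
  let ?Q = "quat_model s" and ?\<phi> = "B.quad_map a b"
  interpret Q: field_algebra F ?Q using c(3) by (rule quat_model_algebra)
  note ba = B.ba_relation[OF c(1,2) t1 t2 c(3) tr] and bab = B.bab_relation[OF c(1,2) t1 t2 n2 c(3) bb tr]
  note expand = B.M.minus_eq minus_eq B.M.r_distr B.smult_mult_right B.smult_l_distr B.smult_r_distr B.smult_l_minus
    B.smult_r_minus B.smult_assoc1[symmetric] B.M.minus_add B.M.a_ac m_ac l_minus r_minus B.M.r_minus B.M.l_distr
    B.smult_mult_left B.M.l_minus l_distr r_distr
  have closed: "?\<phi> z \<in> carrier B" if "z \<in> carrier ?Q" for z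
    using that c by (auto simp: B.quad_map_def)
  have add: "?\<phi> (z \<oplus>\<^bsub>?Q\<^esub> z') = ?\<phi> z \<oplus>\<^bsub>B\<^esub> ?\<phi> z'" if "z \<in> carrier ?Q" "z' \<in> carrier ?Q" for z z'
    using that c by (auto simp: B.quad_map_def B.smult_l_distr B.M.a_ac)
  have smult: "?\<phi> (r \<odot>\<^bsub>?Q\<^esub> z) = r \<odot>\<^bsub>B\<^esub> ?\<phi> z" if "r \<in> carrier F" "z \<in> carrier ?Q" for r z
    using that c by (auto simp: B.quad_map_def B.smult_r_distr B.smult_assoc1)
  have one: "?\<phi> \<one>\<^bsub>?Q\<^esub> = \<one>\<^bsub>B\<^esub>" using c by (simp add: B.quad_map_def B.smult_l_null)
  have la: "?\<phi> (lmult_a F t1 n1 z) = a \<otimes>\<^bsub>B\<^esub> ?\<phi> z" if "z \<in> carrier ?Q" for z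
  proof -
    obtain z0 z1 z2 z3 where z: "z = (z0, z1, z2, z3)" "z0 \<in> carrier F" "z1 \<in> carrier F" "z2 \<in> carrier F" "z3 \<in> carrier F"
      using \<open>z \<in> carrier ?Q\<close> by auto
    have aab: "a \<otimes>\<^bsub>B\<^esub> (a \<otimes>\<^bsub>B\<^esub> b) = t1 \<odot>\<^bsub>B\<^esub> (a \<otimes>\<^bsub>B\<^esub> b) \<ominus>\<^bsub>B\<^esub> n1 \<odot>\<^bsub>B\<^esub> b"
      using c by (simp add: B.M.m_assoc[symmetric] aa B.M.minus_eq B.M.l_distr B.M.l_minus B.smult_mult_left)
    have "a \<otimes>\<^bsub>B\<^esub> ?\<phi> z = z0 \<odot>\<^bsub>B\<^esub> a \<oplus>\<^bsub>B\<^esub> (z1 \<odot>\<^bsub>B\<^esub> (a \<otimes>\<^bsub>B\<^esub> a) \<oplus>\<^bsub>B\<^esub> (z2 \<odot>\<^bsub>B\<^esub> (a \<otimes>\<^bsub>B\<^esub> b) \<oplus>\<^bsub>B\<^esub> z3 \<odot>\<^bsub>B\<^esub> (a \<otimes>\<^bsub>B\<^esub> (a \<otimes>\<^bsub>B\<^esub> b))))"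
      using z c by (simp add: B.quad_map_def B.M.r_distr B.smult_mult_right)
    also have "\<dots> = ?\<phi> (lmult_a F t1 n1 z)"
      unfolding aab aa using z c by (simp add: B.quad_map_def lmult_a_def expand)
    finally show ?thesis by simp
  qed
  have L: "?\<phi> (trace_b F t1 t2 n2 s z) = b \<otimes>\<^bsub>B\<^esub> ?\<phi> z" if "z \<in> carrier ?Q" for z
  proof -
    obtain z0 z1 z2 z3 where z: "z = (z0, z1, z2, z3)" "z0 \<in> carrier F" "z1 \<in> carrier F" "z2 \<in> carrier F" "z3 \<in> carrier F"
      using \<open>z \<in> carrier ?Q\<close> by auto
    have "b \<otimes>\<^bsub>B\<^esub> ?\<phi> z = z0 \<odot>\<^bsub>B\<^esub> b \<oplus>\<^bsub>B\<^esub> (z1 \<odot>\<^bsub>B\<^esub> (b \<otimes>\<^bsub>B\<^esub> a) \<oplus>\<^bsub>B\<^esub> (z2 \<odot>\<^bsub>B\<^esub> (b \<otimes>\<^bsub>B\<^esub> b) \<oplus>\<^bsub>B\<^esub> z3 \<odot>\<^bsub>B\<^esub> (b \<otimes>\<^bsub>B\<^esub> (a \<otimes>\<^bsub>B\<^esub> b))))"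
      using z c by (simp add: B.quad_map_def B.M.r_distr B.smult_mult_right)
    also have "\<dots> = ?\<phi> (trace_b F t1 t2 n2 s z)"
      unfolding ba bb bab using z c by (simp add: B.quad_map_def trace_b_def expand)
    finally show ?thesis by simp
  qed
  have mult: "?\<phi> (x \<otimes>\<^bsub>?Q\<^esub> y) = ?\<phi> x \<otimes>\<^bsub>B\<^esub> ?\<phi> y" if xy: "x \<in> carrier ?Q" "y \<in> carrier ?Q" for x y
  proof -
    obtain x0 x1 x2 x3 where x: "x = (x0, x1, x2, x3)" "x0 \<in> carrier F" "x1 \<in> carrier F" "x2 \<in> carrier F" "x3 \<in> carrier F"
      using xy by auto
    have Ly: "trace_b F t1 t2 n2 s y \<in> carrier ?Q" "lmult_a F t1 n1 y \<in> carrier ?Q"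
      and LLy: "lmult_a F t1 n1 (trace_b F t1 t2 n2 s y) \<in> carrier ?Q"
      using xy(2) c(3) by (auto simp: trace_b_def lmult_a_def)
    have "x \<otimes>\<^bsub>?Q\<^esub> y = (x0 \<odot>\<^bsub>?Q\<^esub> y \<oplus>\<^bsub>?Q\<^esub> x1 \<odot>\<^bsub>?Q\<^esub> lmult_a F t1 n1 y) \<oplus>\<^bsub>?Q\<^esub>
        (x2 \<odot>\<^bsub>?Q\<^esub> trace_b F t1 t2 n2 s y \<oplus>\<^bsub>?Q\<^esub> x3 \<odot>\<^bsub>?Q\<^esub> lmult_a F t1 n1 (trace_b F t1 t2 n2 s y))"
      by (simp add: x(1) biquad_alg_def)
    then have "?\<phi> (x \<otimes>\<^bsub>?Q\<^esub> y) = (x0 \<odot>\<^bsub>B\<^esub> ?\<phi> y \<oplus>\<^bsub>B\<^esub> x1 \<odot>\<^bsub>B\<^esub> (a \<otimes>\<^bsub>B\<^esub> ?\<phi> y)) \<oplus>\<^bsub>B\<^esub>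
        (x2 \<odot>\<^bsub>B\<^esub> (b \<otimes>\<^bsub>B\<^esub> ?\<phi> y) \<oplus>\<^bsub>B\<^esub> x3 \<odot>\<^bsub>B\<^esub> (a \<otimes>\<^bsub>B\<^esub> (b \<otimes>\<^bsub>B\<^esub> ?\<phi> y)))"
      using x(2-5) xy(2) Ly LLy
      by (simp only: add smult Q.smult_closed Q.M.a_closed L la)
    also have "\<dots> = ?\<phi> x \<otimes>\<^bsub>B\<^esub> ?\<phi> y"
    proof -
      have "?\<phi> x = x0 \<odot>\<^bsub>B\<^esub> \<one>\<^bsub>B\<^esub> \<oplus>\<^bsub>B\<^esub> (x1 \<odot>\<^bsub>B\<^esub> a \<oplus>\<^bsub>B\<^esub> (x2 \<odot>\<^bsub>B\<^esub> b \<oplus>\<^bsub>B\<^esub> x3 \<odot>\<^bsub>B\<^esub> (a \<otimes>\<^bsub>B\<^esub> b)))"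
        by (simp add: x(1) B.quad_map_def)
      then show ?thesis
        using x(2-5) c closed[OF xy(2)] by (simp add: B.M.l_distr B.smult_mult_left B.M.m_assoc B.M.a_ac)
    qed
    finally show ?thesis .
  qed
  show ?thesis
    unfolding alg_hom_def ring_hom_def using closed add smult one mult by blast
qed

lemma quaternion_field_algebra:
  assumes "field F" "quaternion_algebra F B"
  shows "field_algebra F B"
  using assms
  by (auto simp: quaternion_algebra_def central_simple_def intro!: field_algebra.intro field_algebra_axioms.intro)

section \<open>The parameter of a regular embedding\<close>

context etale_pair
begin

text \<open>Phrased as an isomorphism from the model that respects the generators, the condition
  both says that s is the trace of ab and gives all the structure of the triple.\<close>

definition has_parameter :: "('f, 'k1, 'k2, 'b) embedding_triple \<Rightarrow> 'f \<Rightarrow> bool" where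
  "has_parameter = (\<lambda>(B, \<alpha>1, \<alpha>2) s. \<exists>\<phi> \<in> alg_iso F (quat_model s) B.
     \<phi> quad_a = \<alpha>1 gen_a \<and> \<phi> quad_b = \<alpha>2 gen_b)"

text \<open>The element \<open>ab_trace\<close> of the two images commutes with both of them, hence
  with the algebra they generate, so it is central and equal to a scalar s. The homomorphism from
  \<open>quat_model s\<close> is onto because its image contains the generators, and it is injective
  by dimension.\<close>

lemma regular_has_parameter:
  fixes B :: "('f, 'b) module"
  assumes T: "(B, \<alpha>1, \<alpha>2) \<in> regular_embeddings F K1 K2"
  shows "\<exists>s\<in>carrier F. has_parameter (B, \<alpha>1, \<alpha>2) s"
proof -
  have quat: "quaternion_algebra F B" and \<alpha>1: "\<alpha>1 \<in> alg_hom F K1 B" and \<alpha>2: "\<alpha>2 \<in> alg_hom F K2 B"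
    and gen: "generate_ring B (scalars F B \<union> (\<alpha>1 ` carrier K1 \<union> \<alpha>2 ` carrier K2)) = carrier B"
    using T by (auto simp: regular_embeddings_def quaternion_embeddings_def alg_generate_def)
  interpret B: field_algebra F B using field_axioms quat by (rule quaternion_field_algebra)
  note h1 = alg_homD[OF \<alpha>1] and h2 = alg_homD[OF \<alpha>2]
  define a where "a = \<alpha>1 gen_a"
  define b where "b = \<alpha>2 gen_b"
  have ab: "a \<in> carrier B" "b \<in> carrier B" using h1(1) h2(1) by (simp_all add: a_def b_def)
  have \<alpha>1_eq: "\<alpha>1 (\<kappa>1 (x0, x1)) = x0 \<odot>\<^bsub>B\<^esub> \<one>\<^bsub>B\<^esub> \<oplus>\<^bsub>B\<^esub> x1 \<odot>\<^bsub>B\<^esub> a"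
    if "x0 \<in> carrier F" "x1 \<in> carrier F" for x0 x1
  proof -
    have "\<kappa>1 (x0, x1) = x0 \<odot>\<^bsub>K1\<^esub> \<one>\<^bsub>K1\<^esub> \<oplus>\<^bsub>K1\<^esub> x1 \<odot>\<^bsub>K1\<^esub> gen_a"
      using that by (simp add: \<kappa>_one \<kappa>_simps)
    then show ?thesis using that by (simp add: h1 a_def)
  qed
  have \<alpha>2_eq: "\<alpha>2 (\<kappa>2 (x0, x1)) = x0 \<odot>\<^bsub>B\<^esub> \<one>\<^bsub>B\<^esub> \<oplus>\<^bsub>B\<^esub> x1 \<odot>\<^bsub>B\<^esub> b"
    if "x0 \<in> carrier F" "x1 \<in> carrier F" for x0 x1
  proof -
    have "\<kappa>2 (x0, x1) = x0 \<odot>\<^bsub>K2\<^esub> \<one>\<^bsub>K2\<^esub> \<oplus>\<^bsub>K2\<^esub> x1 \<odot>\<^bsub>K2\<^esub> gen_b"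
      using that by (simp add: \<kappa>_one \<kappa>_simps)
    then show ?thesis using that by (simp add: h2 b_def)
  qed
  have aa: "a \<otimes>\<^bsub>B\<^esub> a = t1 \<odot>\<^bsub>B\<^esub> a \<ominus>\<^bsub>B\<^esub> n1 \<odot>\<^bsub>B\<^esub> \<one>\<^bsub>B\<^esub>"
  proof -
    have "gen_a \<otimes>\<^bsub>K1\<^esub> gen_a = \<kappa>1 (\<ominus> n1, t1)" by (simp add: \<kappa>_simps minus_eq)
    then have "a \<otimes>\<^bsub>B\<^esub> a = \<alpha>1 (\<kappa>1 (\<ominus> n1, t1))" by (simp add: a_def h1(2)[symmetric])
    then show ?thesis using ab by (simp add: \<alpha>1_eq B.M.minus_eq B.smult_l_minus B.M.a_comm)
  qed
  have bb: "b \<otimes>\<^bsub>B\<^esub> b = t2 \<odot>\<^bsub>B\<^esub> b \<ominus>\<^bsub>B\<^esub> n2 \<odot>\<^bsub>B\<^esub> \<one>\<^bsub>B\<^esub>"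
  proof -
    have "gen_b \<otimes>\<^bsub>K2\<^esub> gen_b = \<kappa>2 (\<ominus> n2, t2)" by (simp add: \<kappa>_simps minus_eq)
    then have "b \<otimes>\<^bsub>B\<^esub> b = \<alpha>2 (\<kappa>2 (\<ominus> n2, t2))" by (simp add: b_def h2(2)[symmetric])
    then show ?thesis using ab by (simp add: \<alpha>2_eq B.M.minus_eq B.smult_l_minus B.M.a_comm)
  qed
  \<comment> \<open>The form in which regularity is used: a subring with the scalars and both
    generators is everything. It is applied to the commutant of \<open>S\<close> and to the image of
    the model.\<close>
  have incl: "carrier B \<subseteq> E"
    if E: "subring E B" and sc: "scalars F B \<subseteq> E" and abE: "a \<in> E" "b \<in> E" for E
  proof -
    have sm: "c \<odot>\<^bsub>B\<^esub> x \<in> E" if "c \<in> carrier F" "x \<in> E" for c x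
    proof -
      have "c \<odot>\<^bsub>B\<^esub> \<one>\<^bsub>B\<^esub> \<in> E" using sc that by (auto simp: scalars_def)
      then have "(c \<odot>\<^bsub>B\<^esub> \<one>\<^bsub>B\<^esub>) \<otimes>\<^bsub>B\<^esub> x \<in> E" using that(2) by (rule subringE(6)[OF E])
      then show ?thesis using that subringE(1)[OF E] by (simp add: B.scalar_mult subset_iff)
    qed
    note closed = subringE(7)[OF E] sm subringE(3)[OF E] abE
    have "\<alpha>1 x \<in> E" if "x \<in> carrier K1" for x
      using that by (elim \<kappa>1_cases) (simp add: \<alpha>1_eq closed)
    moreover have "\<alpha>2 y \<in> E" if "y \<in> carrier K2" for y
      using that by (elim \<kappa>2_cases) (simp add: \<alpha>2_eq closed)
    ultimately have "scalars F B \<union> (\<alpha>1 ` carrier K1 \<union> \<alpha>2 ` carrier K2) \<subseteq> E" using sc by blast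
    moreover have "scalars F B \<union> (\<alpha>1 ` carrier K1 \<union> \<alpha>2 ` carrier K2) \<subseteq> carrier B"
      using h1(1) h2(1) B.scalars_closed by blast
    ultimately show ?thesis
      using B.M.generate_ring_min_subring1[OF _ E] gen by blast
  qed
  define S where "S = B.ab_trace t1 t2 a b"
  have Sc: "S \<in> carrier B" unfolding S_def using ab t1 t2 by (rule B.ab_trace_closed)
  have comm_a: "a \<otimes>\<^bsub>B\<^esub> S = S \<otimes>\<^bsub>B\<^esub> a"
    unfolding S_def by (rule B.ab_trace_commute[OF ab t1 n1 t2 aa])
  have comm_b: "b \<otimes>\<^bsub>B\<^esub> S = S \<otimes>\<^bsub>B\<^esub> b"
    unfolding S_def B.ab_trace_sym[OF ab t1 t2] by (rule B.ab_trace_commute[OF ab(2,1) t2 n2 t1 bb])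
  have sub: "subring {x \<in> carrier B. x \<otimes>\<^bsub>B\<^esub> S = S \<otimes>\<^bsub>B\<^esub> x} B"
  proof (rule B.M.subringI)
    fix x y assume xy: "x \<in> {x \<in> carrier B. x \<otimes>\<^bsub>B\<^esub> S = S \<otimes>\<^bsub>B\<^esub> x}" "y \<in> {x \<in> carrier B. x \<otimes>\<^bsub>B\<^esub> S = S \<otimes>\<^bsub>B\<^esub> x}"
    have c: "x \<in> carrier B" "y \<in> carrier B" and comm: "x \<otimes>\<^bsub>B\<^esub> S = S \<otimes>\<^bsub>B\<^esub> x" "y \<otimes>\<^bsub>B\<^esub> S = S \<otimes>\<^bsub>B\<^esub> y"
      using xy by auto
    have "(x \<otimes>\<^bsub>B\<^esub> y) \<otimes>\<^bsub>B\<^esub> S = x \<otimes>\<^bsub>B\<^esub> (S \<otimes>\<^bsub>B\<^esub> y)" using c Sc by (simp only: B.M.m_assoc comm(2))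
    also have "\<dots> = (x \<otimes>\<^bsub>B\<^esub> S) \<otimes>\<^bsub>B\<^esub> y" using c Sc by (simp only: B.M.m_assoc)
    also have "\<dots> = S \<otimes>\<^bsub>B\<^esub> (x \<otimes>\<^bsub>B\<^esub> y)" using c Sc by (simp only: B.M.m_assoc comm(1))
    finally show "x \<otimes>\<^bsub>B\<^esub> y \<in> {x \<in> carrier B. x \<otimes>\<^bsub>B\<^esub> S = S \<otimes>\<^bsub>B\<^esub> x}" using c by simp
  qed (use Sc in \<open>auto simp: B.M.l_minus B.M.r_minus B.M.l_distr B.M.r_distr\<close>)
  have sc: "scalars F B \<subseteq> {x \<in> carrier B. x \<otimes>\<^bsub>B\<^esub> S = S \<otimes>\<^bsub>B\<^esub> x}"
    using Sc by (auto simp: scalars_def B.scalar_mult)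
  have all: "carrier B \<subseteq> {x \<in> carrier B. x \<otimes>\<^bsub>B\<^esub> S = S \<otimes>\<^bsub>B\<^esub> x}"
    using ab comm_a comm_b by (intro incl[OF sub sc] CollectI conjI)
  have "S \<otimes>\<^bsub>B\<^esub> x = x \<otimes>\<^bsub>B\<^esub> S" if "x \<in> carrier B" for x
  proof -
    have "x \<otimes>\<^bsub>B\<^esub> S = S \<otimes>\<^bsub>B\<^esub> x" using subsetD[OF all that] by (simp only: mem_Collect_eq)
    then show ?thesis by (rule sym)
  qed
  then have "S \<in> {z \<in> carrier B. \<forall>x \<in> carrier B. z \<otimes>\<^bsub>B\<^esub> x = x \<otimes>\<^bsub>B\<^esub> z}" using Sc by blast
  then have "S \<in> scalars F B"
    using quat unfolding quaternion_algebra_def central_simple_def by blast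
  then obtain s where s: "s \<in> carrier F" "S = s \<odot>\<^bsub>B\<^esub> \<one>\<^bsub>B\<^esub>" by (auto simp: scalars_def)
  let ?Q = "quat_model s" and ?\<phi> = "B.quad_map a b"
  interpret Q: field_algebra F ?Q using s(1) by (rule quat_model_algebra)
  have \<phi>: "?\<phi> \<in> alg_hom F ?Q B"
    using B.field_algebra_axioms ab s(1) aa bb s(2)[unfolded S_def] by (rule quad_map_hom)
  interpret \<phi>: ring_hom_ring ?Q B ?\<phi>
    using \<phi> by (intro ring_hom_ringI2 Q.M.ring_axioms B.M.ring_axioms) (simp add: alg_hom_def)
  have \<phi>_ab: "?\<phi> quad_a = a" "?\<phi> quad_b = b"
    using ab by (simp_all add: B.quad_map_def B.smult_l_null)
  have surj: "?\<phi> ` carrier ?Q = carrier B"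
  proof
    show "?\<phi> ` carrier ?Q \<subseteq> carrier B" using alg_homD(1)[OF \<phi>] by blast
    show "carrier B \<subseteq> ?\<phi> ` carrier ?Q"
    proof (rule incl)
      show "subring (?\<phi> ` carrier ?Q) B" by (rule \<phi>.img_is_subring[OF Q.M.carrier_is_subring])
      have "?\<phi> quad_a \<in> ?\<phi> ` carrier ?Q" "?\<phi> quad_b \<in> ?\<phi> ` carrier ?Q"
        by (rule imageI, simp)+
      then show "a \<in> ?\<phi> ` carrier ?Q" "b \<in> ?\<phi> ` carrier ?Q" unfolding \<phi>_ab .
      show "scalars F B \<subseteq> ?\<phi> ` carrier ?Q"
      proof
        fix x assume "x \<in> scalars F B"
        then obtain c where c: "c \<in> carrier F" "x = c \<odot>\<^bsub>B\<^esub> \<one>\<^bsub>B\<^esub>" by (auto simp: scalars_def)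
        then have "x = ?\<phi> (c \<odot>\<^bsub>?Q\<^esub> \<one>\<^bsub>?Q\<^esub>)" using alg_homD(4,5)[OF \<phi>] Q.M.one_closed by metis
        then show "x \<in> ?\<phi> ` carrier ?Q" using c Q.smult_closed Q.M.one_closed by blast
      qed
    qed
  qed
  let ?us = "[\<one>\<^bsub>B\<^esub>, a, b, a \<otimes>\<^bsub>B\<^esub> b]"
  have us: "set ?us \<subseteq> carrier B" using ab by simp
  have lin: "B.lincomb [z0, z1, z2, z3] ?us = ?\<phi> (z0, z1, z2, z3)"
    if "z0 \<in> carrier F" "z1 \<in> carrier F" "z2 \<in> carrier F" "z3 \<in> carrier F" for z0 z1 z2 z3
    using that ab by (simp add: B.quad_map_def)
  have span: "B.M.Span (scalars F B) ?us = carrier B"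
    unfolding B.Span_eq_lincomb[OF us] surj[symmetric]
  proof (intro equalityI subsetI)
    fix x assume "x \<in> {B.lincomb cs ?us |cs. length cs = length ?us \<and> set cs \<subseteq> carrier F}"
    then obtain cs where cs: "x = B.lincomb cs ?us" "length cs = length ?us" "set cs \<subseteq> carrier F" by blast
    then obtain z0 z1 z2 z3 where z: "cs = [z0, z1, z2, z3]"
      by (auto simp: length_Suc_conv)
    have zc: "z0 \<in> carrier F" "z1 \<in> carrier F" "z2 \<in> carrier F" "z3 \<in> carrier F"
      using cs(3) z by simp_all
    have "x = ?\<phi> (z0, z1, z2, z3)" unfolding cs(1) z by (rule lin[OF zc])
    then show "x \<in> ?\<phi> ` carrier ?Q" using zc by auto
  next
    fix x assume "x \<in> ?\<phi> ` carrier ?Q"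
    then obtain z0 z1 z2 z3 where z: "x = ?\<phi> (z0, z1, z2, z3)"
      "z0 \<in> carrier F" "z1 \<in> carrier F" "z2 \<in> carrier F" "z3 \<in> carrier F" by auto
    then have "x = B.lincomb [z0, z1, z2, z3] ?us" using lin by (simp only:)
    then show "x \<in> {B.lincomb cs ?us |cs. length cs = length ?us \<and> set cs \<subseteq> carrier F}"
      using z(2-5) by (intro CollectI exI[of _ "[z0, z1, z2, z3]"]) (simp del: B.lincomb.simps)
  qed
  \<comment> \<open>Four vectors spanning a space of dimension four are independent, and a linear
    relation between them is exactly an element of the kernel.\<close>
  have "has_dim F B 4" using quat by (simp add: quaternion_algebra_def)
  from B.spanning_list_independent[OF this us span]
  have ind: "B.M.independent (scalars F B) ?us" by simp
  have kernel: "z = \<zero>\<^bsub>?Q\<^esub>" if z: "z \<in> carrier ?Q" "?\<phi> z = \<zero>\<^bsub>B\<^esub>" for z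
  proof -
    obtain z0 z1 z2 z3 where zz: "z = (z0, z1, z2, z3)"
      "z0 \<in> carrier F" "z1 \<in> carrier F" "z2 \<in> carrier F" "z3 \<in> carrier F" using z(1) by auto
    have "B.lincomb [z0, z1, z2, z3] ?us = \<zero>\<^bsub>B\<^esub>" using lin zz z(2) by (simp only:)
    with zz(2-5) have "set [z0, z1, z2, z3] \<subseteq> {\<zero>}"
      using B.independent_iff_lincomb[OF us, THEN iffD1, OF ind, rule_format, of "[z0, z1, z2, z3]"]
      by (simp del: B.lincomb.simps)
    then show ?thesis by (simp add: zz(1))
  qed
  have "inj_on ?\<phi> (carrier ?Q)"
  proof (rule inj_onI)
    fix x y assume xy: "x \<in> carrier ?Q" "y \<in> carrier ?Q" "?\<phi> x = ?\<phi> y"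
    have "?\<phi> (x \<ominus>\<^bsub>?Q\<^esub> y) = ?\<phi> y \<oplus>\<^bsub>B\<^esub> \<ominus>\<^bsub>B\<^esub> ?\<phi> y"
      using xy by (simp only: Q.M.minus_eq \<phi>.hom_add \<phi>.hom_a_inv Q.M.a_inv_closed)
    also have "\<dots> = \<zero>\<^bsub>B\<^esub>" using xy(2) by (intro B.M.r_neg \<phi>.hom_closed)
    finally have "x \<ominus>\<^bsub>?Q\<^esub> y = \<zero>\<^bsub>?Q\<^esub>" using xy by (intro kernel Q.M.minus_closed)
    then show "x = y" using xy Q.M.r_right_minus_eq by blast
  qed
  with surj \<phi> have "?\<phi> \<in> alg_iso F ?Q B" by (simp add: alg_iso_def bij_betw_def)
  with s(1) \<phi>_ab show ?thesis unfolding has_parameter_def a_def b_def by auto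
qed

end

section \<open>The invariant\<close>

context field
begin

text \<open>For \<xi> = u + v c with c^2 = t c - n the two expressions are Tr(\<xi>) and Tr(\<xi>
  c), since Tr(c^2) = t^2 - 2 n. The system has determinant 2 (t^2 - 2 n) - t^2 = t^2 - 4 n, and the
  solution is Cramer's rule.\<close>

lemma trace_form_solution:
  assumes c: "t \<in> carrier R" "n \<in> carrier R" "s \<in> carrier R" "u \<in> carrier R" "v \<in> carrier R"
    and d: "t \<otimes> t \<ominus> (n \<oplus> n \<oplus> n \<oplus> n) \<noteq> \<zero>"
  defines "i \<equiv> inv (t \<otimes> t \<ominus> (n \<oplus> n \<oplus> n \<oplus> n))"
  shows "u \<oplus> u \<oplus> t \<otimes> v = \<one> \<and> t \<otimes> u \<oplus> (t \<otimes> t \<ominus> (n \<oplus> n)) \<otimes> v = s \<longleftrightarrow>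
    u = i \<otimes> (t \<otimes> t \<ominus> (n \<oplus> n) \<ominus> t \<otimes> s) \<and> v = i \<otimes> (s \<oplus> s \<ominus> t)"
proof -
  let ?d = "t \<otimes> t \<ominus> (n \<oplus> n \<oplus> n \<oplus> n)"
  let ?e1 = "u \<oplus> u \<oplus> t \<otimes> v" and ?e2 = "t \<otimes> u \<oplus> (t \<otimes> t \<ominus> (n \<oplus> n)) \<otimes> v"
  have dU: "?d \<in> Units R" and ic: "i \<in> carrier R" and di: "?d \<otimes> i = \<one>" "i \<otimes> ?d = \<one>"
    using c d by (simp_all add: i_def field_Units)
  show ?thesis
  proof
    assume e: "?e1 = \<one> \<and> ?e2 = s"
    \<comment> \<open>The combinations come from the adjugate of the matrix with rows 2, t and t,
      t^2 - 2 n.\<close>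
    have "?d \<otimes> u = (t \<otimes> t \<ominus> (n \<oplus> n)) \<otimes> ?e1 \<ominus> t \<otimes> ?e2" "?d \<otimes> v = ?e2 \<oplus> ?e2 \<ominus> t \<otimes> ?e1"
      using c(1,2,4,5) by (elim component_cases; simp only: component_simps;
          intro arg_cong[where f = "component R"]; simp add: algebra_simps)+
    then have "?d \<otimes> u = t \<otimes> t \<ominus> (n \<oplus> n) \<ominus> t \<otimes> s" "?d \<otimes> v = s \<oplus> s \<ominus> t"
      unfolding e[THEN conjunct1] e[THEN conjunct2] using c by simp_all
    moreover have "u = i \<otimes> (?d \<otimes> u)" "v = i \<otimes> (?d \<otimes> v)"
      using c ic di(2) by (simp_all add: m_assoc[symmetric])
    ultimately show "u = i \<otimes> (t \<otimes> t \<ominus> (n \<oplus> n) \<ominus> t \<otimes> s) \<and> v = i \<otimes> (s \<oplus> s \<ominus> t)" by simp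
  next
    assume uv: "u = i \<otimes> (t \<otimes> t \<ominus> (n \<oplus> n) \<ominus> t \<otimes> s) \<and> v = i \<otimes> (s \<oplus> s \<ominus> t)"
    have "?e1 = ?d \<otimes> i" "?e2 = (?d \<otimes> i) \<otimes> s"
      unfolding uv[THEN conjunct1] uv[THEN conjunct2] using c(1-3) ic
      by (elim component_cases; simp only: component_simps;
          intro arg_cong[where f = "component R"]; simp add: algebra_simps)+
    then show "?e1 = \<one> \<and> ?e2 = s" using c di by simp
  qed
qed

text \<open>Let primes denote conjugates. From \<xi> + \<xi>' = 1 and \<xi> c + \<xi>' c' = s one
  gets s - c = \<xi>' (c' - c) and s - c' = \<xi> (c - c'); the product of these two equations is
  the claim.\<close>

lemma trace_form_norm:
  assumes c: "t \<in> carrier R" "n \<in> carrier R" "u \<in> carrier R" "v \<in> carrier R"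
    and e1: "u \<oplus> u \<oplus> t \<otimes> v = \<one>" and e2: "t \<otimes> u \<oplus> (t \<otimes> t \<ominus> (n \<oplus> n)) \<otimes> v = s"
  shows "s \<otimes> s \<ominus> t \<otimes> s \<oplus> n =
    \<ominus> ((t \<otimes> t \<ominus> (n \<oplus> n \<oplus> n \<oplus> n)) \<otimes> (u \<otimes> u \<oplus> t \<otimes> u \<otimes> v \<oplus> n \<otimes> v \<otimes> v))"
proof -
  let ?e1 = "u \<oplus> u \<oplus> t \<otimes> v" and ?e2 = "t \<otimes> u \<oplus> (t \<otimes> t \<ominus> (n \<oplus> n)) \<otimes> v"
  \<comment> \<open>The left side is homogenised with powers of \<open>?e1\<close>, so that this is
    a polynomial identity in t, n, u and v before \<open>?e1\<close> is set to one.\<close>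
  have "?e2 \<otimes> ?e2 \<ominus> t \<otimes> (?e1 \<otimes> ?e2) \<oplus> n \<otimes> (?e1 \<otimes> ?e1) =
    \<ominus> ((t \<otimes> t \<ominus> (n \<oplus> n \<oplus> n \<oplus> n)) \<otimes> (u \<otimes> u \<oplus> t \<otimes> u \<otimes> v \<oplus> n \<otimes> v \<otimes> v))"
    using c by (elim component_cases; simp only: component_simps;
        intro arg_cong[where f = "component R"]; simp add: algebra_simps)
  moreover have "s \<in> carrier R" using c unfolding e2[symmetric] by simp
  ultimately show ?thesis unfolding e1 e2 using c by simp
qed

end

section \<open>The element of the fixed algebra attached to a parameter\<close>

context etale_pair
begin

text \<open>With primes for conjugates, c = a b + a' b' and c' = a b' + a' b satisfy c - c' = (a -
  a') (b - b'), so the discriminant of c is the product of those of a and b.\<close>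

lemma disc3: "t3 \<otimes> t3 \<ominus> (n3 \<oplus> n3 \<oplus> n3 \<oplus> n3) \<noteq> \<zero>"
proof -
  have "t3 \<otimes> t3 \<ominus> (n3 \<oplus> n3 \<oplus> n3 \<oplus> n3) = discriminant F t1 n1 \<otimes> discriminant F t2 n2"
    using t1 n1 t2 n2 unfolding t3_def n3_def
    by (elim component_cases; simp only: component_simps;
        intro arg_cong[where f = "component F"]; simp add: algebra_simps)
  then show ?thesis
    using disc1 disc2 integral[of "discriminant F t1 n1" "discriminant F t2 n2"] by auto
qed

text \<open>The element \<open>\<xi>\<close> with \<open>Tr(\<xi>) = 1\<close> and \<open>Tr(\<xi> c) = s\<close>.\<close>

definition xi :: "'f \<Rightarrow> ('k1 \<times> 'k2 \<Rightarrow> 'f) set" where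
  "xi s = (let i = inv (t3 \<otimes> t3 \<ominus> (n3 \<oplus> n3 \<oplus> n3 \<oplus> n3)) in
     \<kappa>3 (i \<otimes> (t3 \<otimes> t3 \<ominus> (n3 \<oplus> n3) \<ominus> t3 \<otimes> s), i \<otimes> (s \<oplus> s \<ominus> t3)))"

lemma \<kappa>3_eq_iff:
  assumes "u \<in> carrier F" "v \<in> carrier F" "u' \<in> carrier F" "v' \<in> carrier F"
  shows "\<kappa>3 (u, v) = \<kappa>3 (u', v') \<longleftrightarrow> u = u' \<and> v = v'"
  using inj_on_eq_iff[OF alg_isoD(3)[OF \<kappa>3_iso(2)], of "(u, v)" "(u', v')"] assms by simp

lemma \<kappa>3_cases:
  assumes "x \<in> carrier KF"
  obtains u v where "u \<in> carrier F" "v \<in> carrier F" "x = \<kappa>3 (u, v)"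
proof -
  have "x \<in> \<kappa>3 ` (carrier F \<times> carrier F)" using alg_isoD(4)[OF \<kappa>3_iso(2)] assms by simp
  with that show ?thesis by blast
qed

lemma \<kappa>3_eq_xi_iff:
  assumes "u \<in> carrier F" "v \<in> carrier F" "s \<in> carrier F"
  shows "\<kappa>3 (u, v) = xi s \<longleftrightarrow>
    u \<oplus> u \<oplus> t3 \<otimes> v = \<one> \<and> t3 \<otimes> u \<oplus> (t3 \<otimes> t3 \<ominus> (n3 \<oplus> n3)) \<otimes> v = s"
proof -
  have "inv (t3 \<otimes> t3 \<ominus> (n3 \<oplus> n3 \<oplus> n3 \<oplus> n3)) \<in> carrier F"
    using disc3 by (simp add: field_Units)
  then show ?thesis
    unfolding xi_def Let_def trace_form_solution[OF t3_closed n3_closed assms(3,1,2) disc3]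
    using assms by (intro \<kappa>3_eq_iff) simp_all
qed

lemma xi_closed:
  assumes "s \<in> carrier F" shows "xi s \<in> carrier KF"
proof -
  have "inv (t3 \<otimes> t3 \<ominus> (n3 \<oplus> n3 \<oplus> n3 \<oplus> n3)) \<in> carrier F"
    using disc3 by (simp add: field_Units)
  then show ?thesis
    unfolding xi_def Let_def using assms by (intro alg_homD(1)[OF alg_isoD(1)[OF \<kappa>3_iso(2)]]) simp
qed

text \<open>The right side is the norm, the product with the conjugate u + t3 v - v c. If it
  vanished for a unit, the conjugate would be zero and with it the unit; otherwise the conjugate
  divided by the norm is the inverse.\<close>

lemma \<kappa>3_unit_iff:
  assumes uv: "u \<in> carrier F" "v \<in> carrier F"
  shows "\<kappa>3 (u, v) \<in> Units KF \<longleftrightarrow> u \<otimes> u \<oplus> t3 \<otimes> u \<otimes> v \<oplus> n3 \<otimes> v \<otimes> v \<noteq> \<zero>"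
proof -
  let ?N = "u \<otimes> u \<oplus> t3 \<otimes> u \<otimes> v \<oplus> n3 \<otimes> v \<otimes> v" and ?Q = "quad_alg F t3 n3"
  interpret KF: field_algebra F KF by (rule \<kappa>3_iso(1))
  interpret Q: field_algebra F ?Q by (intro quad_alg_algebra) auto
  note hom = alg_homD[OF alg_isoD(1)[OF \<kappa>3_iso(2)]]
  have Nc: "?N \<in> carrier F" using uv by simp
  let ?c = "(u \<oplus> t3 \<otimes> v, \<ominus> v)"
  have cc: "?c \<in> carrier ?Q" "(u, v) \<in> carrier ?Q" using uv by simp_all
  have identity: "(u, v) \<otimes>\<^bsub>?Q\<^esub> ?c = ?N \<odot>\<^bsub>?Q\<^esub> \<one>\<^bsub>?Q\<^esub>" "?c \<otimes>\<^bsub>?Q\<^esub> (u, v) = ?N \<odot>\<^bsub>?Q\<^esub> \<one>\<^bsub>?Q\<^esub>"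
    using uv t3_closed n3_closed unfolding quad_alg_mult quad_alg_simps
    by (elim component_cases; simp only: component_simps prod.inject;
        intro conjI arg_cong[where f = "component F"]; simp add: component_simps algebra_simps)+
  show ?thesis
  proof
    assume "\<kappa>3 (u, v) \<in> Units KF"
    then obtain y where y: "y \<in> carrier KF" "y \<otimes>\<^bsub>KF\<^esub> \<kappa>3 (u, v) = \<one>\<^bsub>KF\<^esub>" unfolding Units_def by blast
    show "?N \<noteq> \<zero>"
    proof
      assume N: "?N = \<zero>"
      have "\<kappa>3 ?c = (y \<otimes>\<^bsub>KF\<^esub> \<kappa>3 (u, v)) \<otimes>\<^bsub>KF\<^esub> \<kappa>3 ?c" unfolding y(2) by (rule KF.M.l_one[OF hom(1)[OF cc(1)], symmetric])
      also have "\<dots> = y \<otimes>\<^bsub>KF\<^esub> (\<kappa>3 (u, v) \<otimes>\<^bsub>KF\<^esub> \<kappa>3 ?c)" by (rule KF.M.m_assoc[OF y(1) hom(1)[OF cc(2)] hom(1)[OF cc(1)]])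
      also have "\<kappa>3 (u, v) \<otimes>\<^bsub>KF\<^esub> \<kappa>3 ?c = \<kappa>3 (?N \<odot>\<^bsub>?Q\<^esub> \<one>\<^bsub>?Q\<^esub>)"
        unfolding identity(1)[symmetric] by (rule hom(2)[OF cc(2,1), symmetric])
      also have "\<kappa>3 (?N \<odot>\<^bsub>?Q\<^esub> \<one>\<^bsub>?Q\<^esub>) = \<zero> \<odot>\<^bsub>KF\<^esub> \<kappa>3 \<one>\<^bsub>?Q\<^esub>"
        unfolding N by (rule hom(5)[OF zero_closed Q.M.one_closed])
      also have "\<dots> = \<zero>\<^bsub>KF\<^esub>" by (rule KF.smult_l_null[OF hom(1)[OF Q.M.one_closed]])
      also have "y \<otimes>\<^bsub>KF\<^esub> \<zero>\<^bsub>KF\<^esub> = \<zero>\<^bsub>KF\<^esub>" by (rule KF.M.r_null[OF y(1)])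
      also have "\<zero>\<^bsub>KF\<^esub> = \<kappa>3 \<zero>\<^bsub>?Q\<^esub>"
        using alg_hom_zero[OF alg_isoD(1)[OF \<kappa>3_iso(2)] Q.M.ring_axioms KF.M.ring_axioms] by (rule sym)
      finally have "\<kappa>3 (u \<oplus> t3 \<otimes> v, \<ominus> v) = \<kappa>3 (\<zero>, \<zero>)" by (simp only: quad_alg_simps)
      then have e: "u \<oplus> t3 \<otimes> v = \<zero>" "\<ominus> v = \<zero>"
        using \<kappa>3_eq_iff[of "u \<oplus> t3 \<otimes> v" "\<ominus> v" \<zero> \<zero>] uv by auto
      then have "v = \<zero>" using uv by simp
      moreover from this e(1) have "u = \<zero>" using uv by simp
      ultimately have "v = \<zero>" "u = \<zero>" by blast+
      then have "\<one>\<^bsub>KF\<^esub> = y \<otimes>\<^bsub>KF\<^esub> \<zero>\<^bsub>KF\<^esub>"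
        using y(2) alg_hom_zero[OF alg_isoD(1)[OF \<kappa>3_iso(2)] Q.M.ring_axioms KF.M.ring_axioms] by simp
      also have "\<dots> = \<zero>\<^bsub>KF\<^esub>" by (rule KF.M.r_null[OF y(1)])
      finally show False using KF.one_not_zero_M by simp
    qed
  next
    assume N: "?N \<noteq> \<zero>"
    then have NU: "?N \<in> Units F" using Nc by (simp add: field_Units)
    let ?y = "inv ?N \<odot>\<^bsub>KF\<^esub> \<kappa>3 ?c"
    have ic: "inv ?N \<in> carrier F" using NU by simp
    have one: "inv ?N \<odot>\<^bsub>KF\<^esub> \<kappa>3 (?N \<odot>\<^bsub>?Q\<^esub> \<one>\<^bsub>?Q\<^esub>) = \<one>\<^bsub>KF\<^esub>"
    proof -
      have "inv ?N \<odot>\<^bsub>KF\<^esub> \<kappa>3 (?N \<odot>\<^bsub>?Q\<^esub> \<one>\<^bsub>?Q\<^esub>) = (inv ?N \<otimes> ?N) \<odot>\<^bsub>KF\<^esub> \<one>\<^bsub>KF\<^esub>"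
        using ic Nc by (simp only: hom(4,5) Q.M.one_closed KF.smult_assoc1 KF.M.one_closed)
      then show ?thesis using NU by simp
    qed
    have yc: "?y \<in> carrier KF" and kc: "\<kappa>3 (u, v) \<in> carrier KF"
      using KF.smult_closed[OF ic hom(1)[OF cc(1)]] hom(1)[OF cc(2)] by simp_all
    have "?y \<otimes>\<^bsub>KF\<^esub> \<kappa>3 (u, v) = \<one>\<^bsub>KF\<^esub>"
      using ic cc by (simp only: KF.smult_mult_left hom(1) hom(2)[symmetric] identity(2) one)
    moreover have "\<kappa>3 (u, v) \<otimes>\<^bsub>KF\<^esub> ?y = \<one>\<^bsub>KF\<^esub>"
      using ic cc by (simp only: KF.smult_mult_right hom(1) hom(2)[symmetric] identity(1) one)
    ultimately show "\<kappa>3 (u, v) \<in> Units KF" using yc kc unfolding Units_def by blast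
  qed
qed

text \<open>The inverse map sends \<xi> to Tr(\<xi> c). By \<open>trace_form_norm\<close> the
  commutator square is the norm of \<xi> times a nonzero constant, so it is nonzero exactly when
  \<xi> is a unit.\<close>

lemma xi_bij:
  "bij_betw xi {s \<in> carrier F. commutator_square s \<noteq> \<zero>} {\<xi> \<in> Units KF. alg_trace F KF \<xi> = \<one>}"
  unfolding bij_betw_def
proof
  let ?S = "{s \<in> carrier F. commutator_square s \<noteq> \<zero>}"
  let ?U = "{\<xi> \<in> Units KF. alg_trace F KF \<xi> = \<one>}"
  have unit_iff: "\<kappa>3 (u, v) \<in> ?U \<longleftrightarrow> commutator_square s \<noteq> \<zero>"
    if uv: "u \<in> carrier F" "v \<in> carrier F" "s \<in> carrier F" and eq: "\<kappa>3 (u, v) = xi s" for u v s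
  proof -
    have e: "u \<oplus> u \<oplus> t3 \<otimes> v = \<one>" "t3 \<otimes> u \<oplus> (t3 \<otimes> t3 \<ominus> (n3 \<oplus> n3)) \<otimes> v = s"
      using eq \<kappa>3_eq_xi_iff[OF uv] by blast+
    let ?N = "u \<otimes> u \<oplus> t3 \<otimes> u \<otimes> v \<oplus> n3 \<otimes> v \<otimes> v" and ?D = "t3 \<otimes> t3 \<ominus> (n3 \<oplus> n3 \<oplus> n3 \<oplus> n3)"
    have N: "?N \<in> carrier F" and D: "?D \<in> carrier F" using uv by simp_all
    have "commutator_square s = \<ominus> (?D \<otimes> ?N)"
      unfolding commutator_square_def by (rule trace_form_norm[OF t3_closed n3_closed uv(1,2) e])
    moreover have "\<ominus> (?D \<otimes> ?N) = \<zero> \<longleftrightarrow> ?N = \<zero>"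
    proof
      assume "\<ominus> (?D \<otimes> ?N) = \<zero>"
      then have "?D \<otimes> ?N = \<zero>" using minus_minus[OF m_closed[OF D N]] by simp
      then show "?N = \<zero>" using integral[OF _ D N] disc3 by blast
    next
      assume "?N = \<zero>"
      then show "\<ominus> (?D \<otimes> ?N) = \<zero>" using D by simp
    qed
    ultimately show ?thesis
      using \<kappa>3_unit_iff[OF uv(1,2)] trace_KF[OF uv(1,2)] e(1) by simp
  qed
  show "inj_on xi ?S"
  proof (rule inj_onI)
    fix s s' assume s: "s \<in> ?S" "s' \<in> ?S" "xi s = xi s'"
    have "xi s \<in> carrier KF" using s(1) xi_closed by simp
    then obtain u v where uv: "u \<in> carrier F" "v \<in> carrier F" "xi s = \<kappa>3 (u, v)" by (rule \<kappa>3_cases)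
    then show "s = s'" using s \<kappa>3_eq_xi_iff[OF uv(1,2), of s] \<kappa>3_eq_xi_iff[OF uv(1,2), of s'] by simp
  qed
  show "xi ` ?S = ?U"
  proof (intro equalityI subsetI)
    fix \<xi> assume "\<xi> \<in> xi ` ?S"
    then obtain s where s: "s \<in> carrier F" "commutator_square s \<noteq> \<zero>" "\<xi> = xi s" by blast
    obtain u v where uv: "u \<in> carrier F" "v \<in> carrier F" "xi s = \<kappa>3 (u, v)" using xi_closed[OF s(1)] by (rule \<kappa>3_cases)
    have "\<kappa>3 (u, v) \<in> ?U" using unit_iff[OF uv(1,2) s(1) uv(3)[symmetric]] s(2) by blast
    then show "\<xi> \<in> ?U" unfolding s(3) uv(3) .
  next
    fix \<xi> assume \<xi>: "\<xi> \<in> ?U"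
    then have "\<xi> \<in> carrier KF" unfolding Units_def by blast
    then obtain u v where uv: "u \<in> carrier F" "v \<in> carrier F" "\<xi> = \<kappa>3 (u, v)" by (rule \<kappa>3_cases)
    \<comment> \<open>This is Tr(\<xi> c), the only possible preimage.\<close>
    define s where "s = t3 \<otimes> u \<oplus> (t3 \<otimes> t3 \<ominus> (n3 \<oplus> n3)) \<otimes> v"
    have s: "s \<in> carrier F" using uv by (simp add: s_def)
    have "alg_trace F KF (\<kappa>3 (u, v)) = \<one>" using \<xi> uv(3) by blast
    then have eq: "\<kappa>3 (u, v) = xi s"
      using \<kappa>3_eq_xi_iff[OF uv(1,2) s] trace_KF[OF uv(1,2)] by (simp add: s_def)
    have "\<kappa>3 (u, v) \<in> ?U" using \<xi> uv(3) by blast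
    then have "s \<in> ?S" using unit_iff[OF uv(1,2) s eq] s by blast
    then show "\<xi> \<in> xi ` ?S" unfolding uv(3) eq by blast
  qed
qed

section \<open>Invariant and parameter of an embedding\<close>

lemma embedding_algebra:
  assumes "(B, \<alpha>1, \<alpha>2) \<in> quaternion_embeddings F K1 K2"
  shows "field_algebra F B" "\<alpha>1 \<in> alg_hom F K1 B" "\<alpha>2 \<in> alg_hom F K2 B" "quaternion_algebra F B"
  using assms quaternion_field_algebra[OF field_axioms]
  unfolding quaternion_embeddings_def by blast+

lemma parameter_values:
  assumes T: "(B, \<alpha>1, \<alpha>2) \<in> quaternion_embeddings F K1 K2" and s: "s \<in> carrier F"
    and \<phi>: "\<phi> \<in> alg_iso F (quat_model s) B" "\<phi> quad_a = \<alpha>1 gen_a" "\<phi> quad_b = \<alpha>2 gen_b"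
    and x: "x0 \<in> carrier F" "x1 \<in> carrier F"
  shows "\<alpha>1 (\<kappa>1 (x0, x1)) = \<phi> (x0, x1, \<zero>, \<zero>)" "\<alpha>2 (\<kappa>2 (x0, x1)) = \<phi> (x0, \<zero>, x1, \<zero>)"
proof -
  let ?Q = "quat_model s"
  interpret Q: field_algebra F ?Q using s by (rule quat_model_algebra)
  note h1 = alg_homD[OF embedding_algebra(2)[OF T]] and h2 = alg_homD[OF embedding_algebra(3)[OF T]]
    and hom = alg_homD[OF alg_isoD(1)[OF \<phi>(1)]]
  have ab: "quad_a \<in> carrier ?Q" "quad_b \<in> carrier ?Q" by simp_all
  have "\<kappa>1 (x0, x1) = x0 \<odot>\<^bsub>K1\<^esub> \<one>\<^bsub>K1\<^esub> \<oplus>\<^bsub>K1\<^esub> x1 \<odot>\<^bsub>K1\<^esub> gen_a"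
    using x by (simp add: \<kappa>_one \<kappa>_simps)
  then have "\<alpha>1 (\<kappa>1 (x0, x1)) = x0 \<odot>\<^bsub>B\<^esub> \<phi> \<one>\<^bsub>?Q\<^esub> \<oplus>\<^bsub>B\<^esub> x1 \<odot>\<^bsub>B\<^esub> \<phi> quad_a"
    unfolding \<phi>(2) hom(4) using x by (simp add: h1)
  also have "\<dots> = \<phi> (x0 \<odot>\<^bsub>?Q\<^esub> \<one>\<^bsub>?Q\<^esub> \<oplus>\<^bsub>?Q\<^esub> x1 \<odot>\<^bsub>?Q\<^esub> quad_a)"
    using x ab by (simp only: hom(3,5) Q.smult_closed Q.M.one_closed)
  finally show "\<alpha>1 (\<kappa>1 (x0, x1)) = \<phi> (x0, x1, \<zero>, \<zero>)" using x by simp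
  have "\<kappa>2 (x0, x1) = x0 \<odot>\<^bsub>K2\<^esub> \<one>\<^bsub>K2\<^esub> \<oplus>\<^bsub>K2\<^esub> x1 \<odot>\<^bsub>K2\<^esub> gen_b"
    using x by (simp add: \<kappa>_one \<kappa>_simps)
  then have "\<alpha>2 (\<kappa>2 (x0, x1)) = x0 \<odot>\<^bsub>B\<^esub> \<phi> \<one>\<^bsub>?Q\<^esub> \<oplus>\<^bsub>B\<^esub> x1 \<odot>\<^bsub>B\<^esub> \<phi> quad_b"
    unfolding \<phi>(3) hom(4) using x by (simp add: h2)
  also have "\<dots> = \<phi> (x0 \<odot>\<^bsub>?Q\<^esub> \<one>\<^bsub>?Q\<^esub> \<oplus>\<^bsub>?Q\<^esub> x1 \<odot>\<^bsub>?Q\<^esub> quad_b)"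
    using x ab by (simp only: hom(3,5) Q.smult_closed Q.M.one_closed)
  finally show "\<alpha>2 (\<kappa>2 (x0, x1)) = \<phi> (x0, \<zero>, x1, \<zero>)" using x by simp
qed

text \<open>By \<open>tau_norm\<close> the argument of the trace is \<xi> times
  \<open>norm_constant z\<close> plus \<open>norm_linear z\<close> times \<xi> c, and the trace is
  linear.\<close>

lemma trace_norm_form:
  assumes uv: "u \<in> carrier F" "v \<in> carrier F" and z: "z \<in> carrier tensor_model"
  shows "alg_trace F KF (\<kappa>3 (u, v) \<otimes>\<^bsub>KK\<^esub> (\<iota> z \<otimes>\<^bsub>KK\<^esub> tau3 F K1 K2 \<sigma>1 \<sigma>2 (\<iota> z))) =
    norm_constant z \<otimes> (u \<oplus> u \<oplus> t3 \<otimes> v) \<oplus>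
    norm_linear z \<otimes> (t3 \<otimes> u \<oplus> (t3 \<otimes> t3 \<ominus> (n3 \<oplus> n3)) \<otimes> v)"
proof -
  note hom = alg_homD[OF alg_isoD(1)[OF \<kappa>3_iso(2)]]
  have c: "norm_constant z \<in> carrier F" "norm_linear z \<in> carrier F" using norm_closed[OF z] .
  have "\<iota> z \<otimes>\<^bsub>KK\<^esub> tau3 F K1 K2 \<sigma>1 \<sigma>2 (\<iota> z) = \<kappa>3 (norm_constant z, norm_linear z)"
    unfolding tau3_\<iota>[OF z] \<iota>_hom(2)[OF z tau_closed[OF z], symmetric] tau_norm[OF z] by (simp add: \<kappa>3_def)
  then have product: "\<kappa>3 (u, v) \<otimes>\<^bsub>KK\<^esub> (\<iota> z \<otimes>\<^bsub>KK\<^esub> tau3 F K1 K2 \<sigma>1 \<sigma>2 (\<iota> z)) =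
      \<kappa>3 ((u, v) \<otimes>\<^bsub>quad_alg F t3 n3\<^esub> (norm_constant z, norm_linear z))"
    using uv c by (simp add: KF_simps(2)[symmetric] hom(2))
  have trace: "alg_trace F KF (\<kappa>3 ((u, v) \<otimes>\<^bsub>quad_alg F t3 n3\<^esub> (norm_constant z, norm_linear z))) = norm_constant z \<otimes> (u \<oplus> u \<oplus> t3 \<otimes> v) \<oplus>
    norm_linear z \<otimes> (t3 \<otimes> u \<oplus> (t3 \<otimes> t3 \<ominus> (n3 \<oplus> n3)) \<otimes> v)"
  proof -
    have "(u \<otimes> p \<ominus> n \<otimes> (v \<otimes> r)) \<oplus> (u \<otimes> p \<ominus> n \<otimes> (v \<otimes> r)) \<oplus> t \<otimes> (u \<otimes> r \<oplus> v \<otimes> p \<oplus> t \<otimes> (v \<otimes> r)) =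
        p \<otimes> (u \<oplus> u \<oplus> t \<otimes> v) \<oplus> r \<otimes> (t \<otimes> u \<oplus> (t \<otimes> t \<ominus> (n \<oplus> n)) \<otimes> v)"
      if "p \<in> carrier F" "r \<in> carrier F" "t \<in> carrier F" "n \<in> carrier F" for p r t n
      using that uv by (elim component_cases; simp only: component_simps;
        intro arg_cong[where f = "component F"]; simp add: algebra_simps)
    from this[OF c t3_closed n3_closed] show ?thesis
      using uv c by (simp add: quad_alg_mult trace_KF)
  qed
  show ?thesis unfolding product by (rule trace)
qed

text \<open>The lift sends the basis tensors to the images of 1, a, b, ab, so as a linear map it is
  the isomorphism \<phi> read in coordinates. The involution \<open>quat_conj s\<close> is carried
  along \<phi> and computes the reduced norm.\<close>

lemma reduced_norm_parameter:
  fixes B :: "('f, 'b) module"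
  assumes T: "(B, \<alpha>1, \<alpha>2) \<in> quaternion_embeddings F K1 K2" and s: "s \<in> carrier F"
    and p: "has_parameter (B, \<alpha>1, \<alpha>2) s" and z: "z \<in> carrier tensor_model"
  shows "reduced_norm F B (tensor_lift F B (\<lambda>x y. \<alpha>1 x \<otimes>\<^bsub>B\<^esub> \<alpha>2 y) (\<iota> z)) = nrd s z"
proof -
  let ?Q = "quat_model s"
  obtain \<phi> where \<phi>: "\<phi> \<in> alg_iso F ?Q B" "\<phi> quad_a = \<alpha>1 gen_a" "\<phi> quad_b = \<alpha>2 gen_b"
    using p unfolding has_parameter_def by auto
  interpret B: field_algebra F B by (rule embedding_algebra(1)[OF T])
  interpret B: plain_field_algebra F B by unfold_locales
  interpret Q: field_algebra F ?Q using s by (rule quat_model_algebra)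
  note h1 = alg_homD[OF embedding_algebra(2)[OF T]] and h2 = alg_homD[OF embedding_algebra(3)[OF T]]
    and hom = alg_homD[OF alg_isoD(1)[OF \<phi>(1)]]
  have zQ: "z \<in> carrier ?Q" using z by simp
  obtain z0 z1 z2 z3 where zz: "z = (z0, z1, z2, z3)"
    and c: "z0 \<in> carrier F" "z1 \<in> carrier F" "z2 \<in> carrier F" "z3 \<in> carrier F" using z by auto
  let ?\<beta> = "\<lambda>x y. \<alpha>1 x \<otimes>\<^bsub>B\<^esub> \<alpha>2 y"
  have bil: "bilinear_map B ?\<beta>"
    unfolding bilinear_map_def
    by (intro conjI ballI) (simp_all add: h1 h2 B.M.l_distr B.M.r_distr B.smult_mult_left B.smult_mult_right)
  have ab: "quad_a \<otimes>\<^bsub>?Q\<^esub> quad_b = (\<zero>, \<zero>, \<zero>, \<one>)"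
    using s by (simp add: biquad_alg_mult quadruple_defs)
  have mem: "quad_a \<in> carrier ?Q" "quad_b \<in> carrier ?Q" "(\<zero>, \<zero>, \<zero>, \<one>) \<in> carrier ?Q" by simp_all
  have one: "\<alpha>1 \<one>\<^bsub>K1\<^esub> = \<one>\<^bsub>B\<^esub>" "\<alpha>2 \<one>\<^bsub>K2\<^esub> = \<one>\<^bsub>B\<^esub>" by (fact h1(4) h2(4))+
  have "tensor_lift F B ?\<beta> (\<iota> z) = bilinear_coords B ?\<beta> z"
    using B.module_axioms bil z by (rule tensor_lift_\<iota>)
  also have "\<dots> = (z0 \<odot>\<^bsub>B\<^esub> \<phi> \<one>\<^bsub>?Q\<^esub> \<oplus>\<^bsub>B\<^esub> z1 \<odot>\<^bsub>B\<^esub> \<phi> quad_a) \<oplus>\<^bsub>B\<^esub> (z2 \<odot>\<^bsub>B\<^esub> \<phi> quad_b \<oplus>\<^bsub>B\<^esub> z3 \<odot>\<^bsub>B\<^esub> \<phi> (quad_a \<otimes>\<^bsub>?Q\<^esub> quad_b))"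
    unfolding hom(2)[OF mem(1,2)] \<phi>(2,3) hom(4)
    by (simp add: zz bilinear_coords_def one h1(1) h2(1))
  also have "\<dots> = \<phi> ((z0 \<odot>\<^bsub>?Q\<^esub> \<one>\<^bsub>?Q\<^esub> \<oplus>\<^bsub>?Q\<^esub> z1 \<odot>\<^bsub>?Q\<^esub> quad_a) \<oplus>\<^bsub>?Q\<^esub> (z2 \<odot>\<^bsub>?Q\<^esub> quad_b \<oplus>\<^bsub>?Q\<^esub> z3 \<odot>\<^bsub>?Q\<^esub> (\<zero>, \<zero>, \<zero>, \<one>)))"
    unfolding ab using c mem by (simp only: hom(3,5) Q.smult_closed Q.M.one_closed Q.M.a_closed)
  also have "(z0 \<odot>\<^bsub>?Q\<^esub> \<one>\<^bsub>?Q\<^esub> \<oplus>\<^bsub>?Q\<^esub> z1 \<odot>\<^bsub>?Q\<^esub> quad_a) \<oplus>\<^bsub>?Q\<^esub> (z2 \<odot>\<^bsub>?Q\<^esub> quad_b \<oplus>\<^bsub>?Q\<^esub> z3 \<odot>\<^bsub>?Q\<^esub> (\<zero>, \<zero>, \<zero>, \<one>)) = z"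
    using c by (simp add: zz)
  finally have lift: "tensor_lift F B ?\<beta> (\<iota> z) = \<phi> z" .
  let ?J = "\<lambda>x. \<phi> (quat_conj s (inv_into (carrier ?Q) \<phi> x))"
  have J: "standard_involution F B ?J"
    by (rule standard_involution_transfer[OF \<phi>(1) Q.field_algebra_axioms quat_conj_standard_involution[OF s]])
  have cc: "quat_conj s z \<in> carrier ?Q" using zQ quat_conj_standard_involution[OF s]
    unfolding standard_involution_def by blast
  have "\<phi> z \<otimes>\<^bsub>B\<^esub> ?J (\<phi> z) = \<phi> (z \<otimes>\<^bsub>?Q\<^esub> quat_conj s z)"
    using inv_into_f_f[OF alg_isoD(3)[OF \<phi>(1)] zQ] hom(2)[OF zQ cc] by simp
  also have "\<dots> = nrd s z \<odot>\<^bsub>B\<^esub> \<one>\<^bsub>B\<^esub>"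
    unfolding quat_conj_norm[OF s zQ] hom(5)[OF nrd_closed[OF s zQ] Q.M.one_closed] hom(4) ..
  finally show ?thesis
    unfolding lift by (rule B.reduced_norm_eq[OF J hom(1)[OF zQ] nrd_closed[OF s zQ]])
qed

text \<open>Both sides of the defining equation are combinations of \<open>norm_constant\<close> and
  \<open>norm_linear\<close>, and the equation for all z amounts to equality of the two
  coefficients.\<close>

lemma is_quat_inv_iff:
  fixes B :: "('f, 'b) module"
  assumes T: "(B, \<alpha>1, \<alpha>2) \<in> quaternion_embeddings F K1 K2" and s: "s \<in> carrier F"
    and p: "has_parameter (B, \<alpha>1, \<alpha>2) s"
  shows "is_quat_inv F K1 K2 \<sigma>1 \<sigma>2 (B, \<alpha>1, \<alpha>2) \<xi> \<longleftrightarrow> \<xi> = xi s"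
proof -
  have *: "is_quat_inv F K1 K2 \<sigma>1 \<sigma>2 (B, \<alpha>1, \<alpha>2) (\<kappa>3 (u, v)) \<longleftrightarrow> \<kappa>3 (u, v) = xi s"
    if uv: "u \<in> carrier F" "v \<in> carrier F" for u v
  proof -
    let ?e1 = "u \<oplus> u \<oplus> t3 \<otimes> v" and ?e2 = "t3 \<otimes> u \<oplus> (t3 \<otimes> t3 \<ominus> (n3 \<oplus> n3)) \<otimes> v"
    have e: "?e1 \<in> carrier F" "?e2 \<in> carrier F" using uv by simp_all
    have kc: "\<kappa>3 (u, v) \<in> carrier KF"
      using alg_homD(1)[OF alg_isoD(1)[OF \<kappa>3_iso(2)]] uv by simp
    have "is_quat_inv F K1 K2 \<sigma>1 \<sigma>2 (B, \<alpha>1, \<alpha>2) (\<kappa>3 (u, v)) \<longleftrightarrow>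
      (\<forall>x\<in>carrier KK. reduced_norm F B (tensor_lift F B (\<lambda>x y. \<alpha>1 x \<otimes>\<^bsub>B\<^esub> \<alpha>2 y) x) =
        alg_trace F KF (\<kappa>3 (u, v) \<otimes>\<^bsub>KK\<^esub> (x \<otimes>\<^bsub>KK\<^esub> tau3 F K1 K2 \<sigma>1 \<sigma>2 x)))"
      using kc by (simp add: is_quat_inv_def Let_def)
    also have "\<dots> \<longleftrightarrow> (\<forall>z\<in>carrier tensor_model. nrd s z = norm_constant z \<otimes> ?e1 \<oplus> norm_linear z \<otimes> ?e2)"
      unfolding alg_isoD(4)[OF \<iota>_iso(2), symmetric] ball_simps(9)
      using reduced_norm_parameter[OF T s p] trace_norm_form[OF uv] by (intro ball_cong refl) simp
    also have "\<dots> \<longleftrightarrow> ?e1 = \<one> \<and> ?e2 = s"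
    proof
      assume h: "\<forall>z\<in>carrier tensor_model. nrd s z = norm_constant z \<otimes> ?e1 \<oplus> norm_linear z \<otimes> ?e2"
      \<comment> \<open>At z = 1 the form \<open>norm_linear\<close> vanishes and
        \<open>norm_constant\<close> is 1.\<close>
      have "nrd s (\<one>, \<zero>, \<zero>, \<zero>) = norm_constant (\<one>, \<zero>, \<zero>, \<zero>) \<otimes> ?e1 \<oplus> norm_linear (\<one>, \<zero>, \<zero>, \<zero>) \<otimes> ?e2"
        using h by (rule bspec) simp
      then have e1: "?e1 = \<one>"
        using s e by (simp add: nrd_def norm_constant_def norm_linear_def minus_eq)
      \<comment> \<open>At z = 1 + ab the form \<open>norm_linear\<close> is 1, and
        \<open>norm_constant\<close> cancels because its coefficient is already known to be
        1.\<close>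
      have "nrd s (\<one>, \<zero>, \<zero>, \<one>) = norm_constant (\<one>, \<zero>, \<zero>, \<one>) \<otimes> ?e1 \<oplus> norm_linear (\<one>, \<zero>, \<zero>, \<one>) \<otimes> ?e2"
        using h by (rule bspec) simp
      then have "norm_constant (\<one>, \<zero>, \<zero>, \<one>) \<oplus> s = norm_constant (\<one>, \<zero>, \<zero>, \<one>) \<oplus> ?e2"
        unfolding e1 nrd_def using norm_closed(1)[of "(\<one>, \<zero>, \<zero>, \<one>)"] s e
        by (simp add: norm_linear_def minus_eq)
      then have "s = ?e2"
        using norm_closed(1)[of "(\<one>, \<zero>, \<zero>, \<one>)"] s e add.l_cancel[of "norm_constant (\<one>, \<zero>, \<zero>, \<one>)" s ?e2]
        by simp
      with e1 show "?e1 = \<one> \<and> ?e2 = s" by blast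
    next
      assume "?e1 = \<one> \<and> ?e2 = s"
      then have e: "?e1 = \<one>" "?e2 = s" by blast+
      show "\<forall>z\<in>carrier tensor_model. nrd s z = norm_constant z \<otimes> ?e1 \<oplus> norm_linear z \<otimes> ?e2"
      proof
        fix z assume "z \<in> carrier tensor_model"
        from norm_closed[OF this] s show "nrd s z = norm_constant z \<otimes> ?e1 \<oplus> norm_linear z \<otimes> ?e2"
          unfolding e nrd_def by (simp add: m_comm)
      qed
    qed
    also have "\<dots> \<longleftrightarrow> \<kappa>3 (u, v) = xi s" by (rule \<kappa>3_eq_xi_iff[OF uv s, symmetric])
    finally show ?thesis .
  qed
  show ?thesis
  proof (cases "\<xi> \<in> carrier KF")
    case True
    then obtain u v where uv: "u \<in> carrier F" "v \<in> carrier F" "\<xi> = \<kappa>3 (u, v)" by (rule \<kappa>3_cases)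
    show ?thesis unfolding uv(3) by (rule *[OF uv(1,2)])
  next
    case False
    \<comment> \<open>Both sides are false here, as \<open>xi s\<close> lies in the fixed
      algebra.\<close>
    then show ?thesis using xi_closed[OF s] by (auto simp: is_quat_inv_def Let_def)
  qed
qed

lemma parameter_commutator_square:
  assumes T: "(B, \<alpha>1, \<alpha>2) \<in> quaternion_embeddings F K1 K2" and s: "s \<in> carrier F"
    and p: "has_parameter (B, \<alpha>1, \<alpha>2) s"
  shows "commutator_square s \<noteq> \<zero>"
proof -
  obtain \<phi> where \<phi>: "\<phi> \<in> alg_iso F (quat_model s) B" using p unfolding has_parameter_def by auto
  from quaternion_algebra_transfer[OF \<phi> quat_model_algebra[OF s] embedding_algebra(1)[OF T]]
  show ?thesis using embedding_algebra(4)[OF T] quat_model_quaternion_iff[OF s] by blast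
qed

text \<open>An isomorphism of triples composed with one from the model is again one from the model.
  Conversely, two isomorphisms from the same model differ by an isomorphism of the algebras, which
  respects the embeddings because each of them is determined by the image of its generator.\<close>

lemma embedding_iso_parameter:
  fixes B :: "('f, 'b) module"
  assumes T: "(B, \<alpha>1, \<alpha>2) \<in> quaternion_embeddings F K1 K2" and s: "s \<in> carrier F"
    and p: "has_parameter (B, \<alpha>1, \<alpha>2) s"
  shows "embedding_iso F K1 K2 `` {(B, \<alpha>1, \<alpha>2)} = {T' \<in> quaternion_embeddings F K1 K2. has_parameter T' s}"
proof (intro equalityI subsetI)
  obtain \<phi> where \<phi>: "\<phi> \<in> alg_iso F (quat_model s) B" "\<phi> quad_a = \<alpha>1 gen_a" "\<phi> quad_b = \<alpha>2 gen_b"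
    using p unfolding has_parameter_def by auto
  {
    fix T' :: "('f, 'k1, 'k2, 'b) embedding_triple"
    assume "T' \<in> embedding_iso F K1 K2 `` {(B, \<alpha>1, \<alpha>2)}"
    then obtain B' \<alpha>1' \<alpha>2' \<psi> where T': "T' = (B', \<alpha>1', \<alpha>2')" "(B', \<alpha>1', \<alpha>2') \<in> quaternion_embeddings F K1 K2"
      and \<psi>: "\<psi> \<in> alg_iso F B B'" "\<And>x. x \<in> carrier K1 \<Longrightarrow> \<psi> (\<alpha>1 x) = \<alpha>1' x"
        "\<And>y. y \<in> carrier K2 \<Longrightarrow> \<psi> (\<alpha>2 y) = \<alpha>2' y"
      unfolding embedding_iso_def by auto
    have "(\<psi> \<circ> \<phi>) quad_a = \<alpha>1' gen_a" "(\<psi> \<circ> \<phi>) quad_b = \<alpha>2' gen_b"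
      by (simp_all add: \<phi> \<psi>)
    with alg_iso_comp[OF \<phi>(1) \<psi>(1)] have "has_parameter T' s"
      unfolding has_parameter_def T'(1) by blast
    then show "T' \<in> {T' \<in> quaternion_embeddings F K1 K2. has_parameter T' s}" using T' by blast
  next
    fix T' :: "('f, 'k1, 'k2, 'b) embedding_triple"
    assume "T' \<in> {T' \<in> quaternion_embeddings F K1 K2. has_parameter T' s}"
    moreover obtain B' \<alpha>1' \<alpha>2' where T': "T' = (B', \<alpha>1', \<alpha>2')" by (cases T')
    ultimately have QE: "(B', \<alpha>1', \<alpha>2') \<in> quaternion_embeddings F K1 K2" and "has_parameter (B', \<alpha>1', \<alpha>2') s"
      by blast+
    then obtain \<phi>' where \<phi>': "\<phi>' \<in> alg_iso F (quat_model s) B'" "\<phi>' quad_a = \<alpha>1' gen_a" "\<phi>' quad_b = \<alpha>2' gen_b"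
      unfolding has_parameter_def by auto
    let ?\<psi> = "\<phi>' \<circ> inv_into (carrier (quat_model s)) \<phi>"
    have iso: "?\<psi> \<in> alg_iso F B B'"
      by (rule alg_iso_comp[OF alg_iso_inv[OF \<phi>(1) quat_model_algebra[OF s]] \<phi>'(1)])
    have val: "?\<psi> (\<phi> z) = \<phi>' z" if "z \<in> carrier (quat_model s)" for z
      using inv_into_f_f[OF alg_isoD(3)[OF \<phi>(1)] that] by simp
    have "?\<psi> (\<alpha>1 x) = \<alpha>1' x" if x: "x \<in> carrier K1" for x
    proof -
      obtain x0 x1 where x: "x = \<kappa>1 (x0, x1)" "x0 \<in> carrier F" "x1 \<in> carrier F" using x by (rule \<kappa>1_cases)
      have "(x0, x1, \<zero>, \<zero>) \<in> carrier (quat_model s)" using x by simp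
      from val[OF this] show ?thesis
        unfolding x(1) parameter_values(1)[OF T s \<phi> x(2,3)] parameter_values(1)[OF QE s \<phi>' x(2,3)] .
    qed
    moreover have "?\<psi> (\<alpha>2 x) = \<alpha>2' x" if x: "x \<in> carrier K2" for x
    proof -
      obtain x0 x1 where x: "x = \<kappa>2 (x0, x1)" "x0 \<in> carrier F" "x1 \<in> carrier F" using x by (rule \<kappa>2_cases)
      have "(x0, \<zero>, x1, \<zero>) \<in> carrier (quat_model s)" using x by simp
      from val[OF this] show ?thesis
        unfolding x(1) parameter_values(2)[OF T s \<phi> x(2,3)] parameter_values(2)[OF QE s \<phi>' x(2,3)] .
    qed
    ultimately have "\<exists>\<psi>\<in>alg_iso F B B'. (\<forall>x\<in>carrier K1. \<psi> (\<alpha>1 x) = \<alpha>1' x) \<and> (\<forall>y\<in>carrier K2. \<psi> (\<alpha>2 y) = \<alpha>2' y)"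
      using iso by (intro bexI[of _ ?\<psi>]) blast+
    then show "T' \<in> embedding_iso F K1 K2 `` {(B, \<alpha>1, \<alpha>2)}"
      unfolding T' embedding_iso_def using T QE by blast
  }
qed

text \<open>The cardinality assumption provides room for a copy of \<open>quat_model s\<close> on
  the given type. The embeddings are the inclusions of F[a] and F[b], and the algebra they generate
  contains 1, a, b and ab.\<close>

lemma exists_regular_embedding:
  assumes card: "carrier F \<times> carrier F \<times> carrier F \<times> carrier F \<lesssim> (UNIV :: 'b set)"
    and s: "s \<in> carrier F" and g: "commutator_square s \<noteq> \<zero>"
  shows "\<exists>T \<in> (regular_embeddings F K1 K2 :: ('f, 'k1, 'k2, 'b) embedding_triple set). has_parameter T s"
proof -
  let ?Q = "quat_model s"
  interpret Q: field_algebra F ?Q using s by (rule quat_model_algebra)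
  obtain h :: "'f quadruple \<Rightarrow> 'b" where inj: "inj_on h (carrier ?Q)"
    using card unfolding lepoll_def biquad_alg_simps by blast
  define k where "k = inv_into (carrier ?Q) h"
  have k: "k (h z) = z" if "z \<in> carrier ?Q" for z unfolding k_def using inj that by (rule inv_into_f_f)
  define B :: "('f, 'b) module" where "B = \<lparr>
     carrier = h ` carrier ?Q,
     monoid.mult = (\<lambda>x y. h (k x \<otimes>\<^bsub>?Q\<^esub> k y)),
     one = h \<one>\<^bsub>?Q\<^esub>,
     ring.zero = h \<zero>\<^bsub>?Q\<^esub>,
     add = (\<lambda>x y. h (k x \<oplus>\<^bsub>?Q\<^esub> k y)),
     smult = (\<lambda>c x. h (c \<odot>\<^bsub>?Q\<^esub> k x))\<rparr>"
  have bij: "bij_betw h (carrier ?Q) (carrier B)" using inj by (simp add: bij_betw_def B_def)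
  have h_ops: "h \<zero>\<^bsub>?Q\<^esub> = \<zero>\<^bsub>B\<^esub>" "h \<one>\<^bsub>?Q\<^esub> = \<one>\<^bsub>B\<^esub>"
    "\<And>x y. x \<in> carrier ?Q \<Longrightarrow> y \<in> carrier ?Q \<Longrightarrow> h (x \<oplus>\<^bsub>?Q\<^esub> y) = h x \<oplus>\<^bsub>B\<^esub> h y"
    "\<And>x y. x \<in> carrier ?Q \<Longrightarrow> y \<in> carrier ?Q \<Longrightarrow> h (x \<otimes>\<^bsub>?Q\<^esub> y) = h x \<otimes>\<^bsub>B\<^esub> h y"
    "\<And>c x. c \<in> carrier F \<Longrightarrow> x \<in> carrier ?Q \<Longrightarrow> h (c \<odot>\<^bsub>?Q\<^esub> x) = c \<odot>\<^bsub>B\<^esub> h x"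
    by (simp_all only: B_def k partial_object.simps monoid.simps ring.simps module.simps)
  have push: "field_algebra F B" "h \<in> alg_iso F ?Q B"
    by (rule field_algebra_pushforward[OF Q.field_algebra_axioms bij]; fact h_ops)+
  interpret B: field_algebra F B by (rule push(1))
  note hom = alg_homD[OF alg_isoD(1)[OF push(2)]]
  define \<alpha>1 where "\<alpha>1 x = (case inv_into (carrier F \<times> carrier F) \<kappa>1 x of (x0, x1) \<Rightarrow> h (x0, x1, \<zero>, \<zero>))" for x
  define \<alpha>2 where "\<alpha>2 x = (case inv_into (carrier F \<times> carrier F) \<kappa>2 x of (x0, x1) \<Rightarrow> h (x0, \<zero>, x1, \<zero>))" for x
  have \<alpha>1: "\<alpha>1 (\<kappa>1 (x0, x1)) = h (x0, x1, \<zero>, \<zero>)" if "x0 \<in> carrier F" "x1 \<in> carrier F" for x0 x1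
    using that alg_isoD(3)[OF \<kappa>1] by (simp add: \<alpha>1_def)
  have \<alpha>2: "\<alpha>2 (\<kappa>2 (x0, x1)) = h (x0, \<zero>, x1, \<zero>)" if "x0 \<in> carrier F" "x1 \<in> carrier F" for x0 x1
    using that alg_isoD(3)[OF \<kappa>2] by (simp add: \<alpha>2_def)
  have prods: "(x0, x1, \<zero>, \<zero>) \<otimes>\<^bsub>?Q\<^esub> (y0, y1, \<zero>, \<zero>) =
      (x0 \<otimes> y0 \<ominus> n1 \<otimes> (x1 \<otimes> y1), x0 \<otimes> y1 \<oplus> x1 \<otimes> y0 \<oplus> t1 \<otimes> (x1 \<otimes> y1), \<zero>, \<zero>)"
    "(x0, \<zero>, x1, \<zero>) \<otimes>\<^bsub>?Q\<^esub> (y0, \<zero>, y1, \<zero>) =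
      (x0 \<otimes> y0 \<ominus> n2 \<otimes> (x1 \<otimes> y1), \<zero>, x0 \<otimes> y1 \<oplus> x1 \<otimes> y0 \<oplus> t2 \<otimes> (x1 \<otimes> y1), \<zero>)"
    if "x0 \<in> carrier F" "x1 \<in> carrier F" "y0 \<in> carrier F" "y1 \<in> carrier F" for x0 x1 y0 y1
    using that t1 n1 t2 n2 s
    by (elim component_cases; simp only: biquad_alg_mult quadruple_defs component_simps prod.case prod.inject;
        intro conjI arg_cong[where f = "component F"]; simp add: algebra_simps)+
  have "\<alpha>1 \<in> alg_hom F K1 B"
  proof -
    have m: "(x0, x1, \<zero>, \<zero>) \<in> carrier ?Q" if "x0 \<in> carrier F" "x1 \<in> carrier F" for x0 x1 using that by simp
    have closed: "\<alpha>1 x \<in> carrier B" if "x \<in> carrier K1" for x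
      using that by (elim \<kappa>1_cases) (simp only: \<alpha>1 hom(1)[OF m])
    have smult: "\<alpha>1 (r \<odot>\<^bsub>K1\<^esub> x) = r \<odot>\<^bsub>B\<^esub> \<alpha>1 x" if r: "r \<in> carrier F" and "x \<in> carrier K1" for r x
      using that by (elim \<kappa>1_cases) (simp add: \<kappa>_simps \<alpha>1 hom(5)[OF r m, symmetric])
    have add: "\<alpha>1 (x \<oplus>\<^bsub>K1\<^esub> y) = \<alpha>1 x \<oplus>\<^bsub>B\<^esub> \<alpha>1 y" if "x \<in> carrier K1" "y \<in> carrier K1" for x y
      using that by (elim \<kappa>1_cases) (simp add: \<kappa>_simps \<alpha>1 hom(3)[OF m m, symmetric])
    have mult: "\<alpha>1 (x \<otimes>\<^bsub>K1\<^esub> y) = \<alpha>1 x \<otimes>\<^bsub>B\<^esub> \<alpha>1 y" if "x \<in> carrier K1" "y \<in> carrier K1" for x y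
      using that by (elim \<kappa>1_cases) (simp add: \<kappa>_simps \<alpha>1 hom(2)[OF m m, symmetric] prods(1))
    have one: "\<alpha>1 \<one>\<^bsub>K1\<^esub> = \<one>\<^bsub>B\<^esub>" using hom(4) by (simp add: \<kappa>_one \<alpha>1)
    show ?thesis
      unfolding alg_hom_def ring_hom_def
      by (intro CollectI conjI ballI allI impI Pi_I; (elim conjE)?) (simp_all only: closed smult add mult one)
  qed
  moreover have "\<alpha>2 \<in> alg_hom F K2 B"
  proof -
    have m: "(x0, \<zero>, x1, \<zero>) \<in> carrier ?Q" if "x0 \<in> carrier F" "x1 \<in> carrier F" for x0 x1 using that by simp
    have closed: "\<alpha>2 x \<in> carrier B" if "x \<in> carrier K2" for x
      using that by (elim \<kappa>2_cases) (simp only: \<alpha>2 hom(1)[OF m])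
    have smult: "\<alpha>2 (r \<odot>\<^bsub>K2\<^esub> x) = r \<odot>\<^bsub>B\<^esub> \<alpha>2 x" if r: "r \<in> carrier F" and "x \<in> carrier K2" for r x
      using that by (elim \<kappa>2_cases) (simp add: \<kappa>_simps \<alpha>2 hom(5)[OF r m, symmetric])
    have add: "\<alpha>2 (x \<oplus>\<^bsub>K2\<^esub> y) = \<alpha>2 x \<oplus>\<^bsub>B\<^esub> \<alpha>2 y" if "x \<in> carrier K2" "y \<in> carrier K2" for x y
      using that by (elim \<kappa>2_cases) (simp add: \<kappa>_simps \<alpha>2 hom(3)[OF m m, symmetric])
    have mult: "\<alpha>2 (x \<otimes>\<^bsub>K2\<^esub> y) = \<alpha>2 x \<otimes>\<^bsub>B\<^esub> \<alpha>2 y" if "x \<in> carrier K2" "y \<in> carrier K2" for x y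
      using that by (elim \<kappa>2_cases) (simp add: \<kappa>_simps \<alpha>2 hom(2)[OF m m, symmetric] prods(2))
    have one: "\<alpha>2 \<one>\<^bsub>K2\<^esub> = \<one>\<^bsub>B\<^esub>" using hom(4) by (simp add: \<kappa>_one \<alpha>2)
    show ?thesis
      unfolding alg_hom_def ring_hom_def
      by (intro CollectI conjI ballI allI impI Pi_I; (elim conjE)?) (simp_all only: closed smult add mult one)
  qed
  moreover have "inj_on \<alpha>1 (carrier K1)"
  proof (rule inj_onI)
    fix x y assume xy: "x \<in> carrier K1" "y \<in> carrier K1" "\<alpha>1 x = \<alpha>1 y"
    obtain x0 x1 where x: "x = \<kappa>1 (x0, x1)" "x0 \<in> carrier F" "x1 \<in> carrier F" using xy(1) by (rule \<kappa>1_cases)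
    obtain y0 y1 where y: "y = \<kappa>1 (y0, y1)" "y0 \<in> carrier F" "y1 \<in> carrier F" using xy(2) by (rule \<kappa>1_cases)
    have "h (x0, x1, \<zero>, \<zero>) = h (y0, y1, \<zero>, \<zero>)" using xy(3) x y by (simp add: \<alpha>1)
    with inj have "(x0, x1, \<zero>, \<zero>) = (y0, y1, \<zero>, \<zero>)" using x y by (elim inj_onD) simp_all
    then show "x = y" using x y by simp
  qed
  moreover have "inj_on \<alpha>2 (carrier K2)"
  proof (rule inj_onI)
    fix x y assume xy: "x \<in> carrier K2" "y \<in> carrier K2" "\<alpha>2 x = \<alpha>2 y"
    obtain x0 x1 where x: "x = \<kappa>2 (x0, x1)" "x0 \<in> carrier F" "x1 \<in> carrier F" using xy(1) by (rule \<kappa>2_cases)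
    obtain y0 y1 where y: "y = \<kappa>2 (y0, y1)" "y0 \<in> carrier F" "y1 \<in> carrier F" using xy(2) by (rule \<kappa>2_cases)
    have "h (x0, \<zero>, x1, \<zero>) = h (y0, \<zero>, y1, \<zero>)" using xy(3) x y by (simp add: \<alpha>2)
    with inj have "(x0, \<zero>, x1, \<zero>) = (y0, \<zero>, y1, \<zero>)" using x y by (elim inj_onD) simp_all
    then show "x = y" using x y by simp
  qed
  moreover have "quaternion_algebra F B"
    using quaternion_algebra_transfer[OF push(2) Q.field_algebra_axioms push(1)] quat_model_quaternion_iff[OF s] g
    by blast
  ultimately have QE: "(B, \<alpha>1, \<alpha>2) \<in> quaternion_embeddings F K1 K2"
    unfolding quaternion_embeddings_def by blast
  have p: "has_parameter (B, \<alpha>1, \<alpha>2) s"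
    unfolding has_parameter_def using push(2) \<alpha>1[OF zero_closed one_closed] \<alpha>2[OF zero_closed one_closed] by auto
  let ?S = "scalars F B \<union> (\<alpha>1 ` carrier K1 \<union> \<alpha>2 ` carrier K2)"
  let ?G = "generate_ring B ?S"
  have S: "?S \<subseteq> carrier B"
    using B.scalars_closed alg_homD(1)[OF embedding_algebra(2)[OF QE]] alg_homD(1)[OF embedding_algebra(3)[OF QE]]
    by blast
  \<comment> \<open>The generated ring contains the scalars, so it is a subspace, and it remains to
    find the basis vectors in it.\<close>
  have smult: "c \<odot>\<^bsub>B\<^esub> x \<in> ?G" if c: "c \<in> carrier F" and x: "x \<in> ?G" for c x
  proof -
    have "c \<odot>\<^bsub>B\<^esub> \<one>\<^bsub>B\<^esub> \<in> ?G" using c by (intro generate_ring.incl) (auto simp: scalars_def)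
    then have "(c \<odot>\<^bsub>B\<^esub> \<one>\<^bsub>B\<^esub>) \<otimes>\<^bsub>B\<^esub> x \<in> ?G" using x by (rule generate_ring.eng_mult)
    then show ?thesis using B.scalar_mult(1)[OF c] B.M.generate_ring_in_carrier[OF S x] by simp
  qed
  have mem: "quad_a \<in> carrier ?Q" "quad_b \<in> carrier ?Q" "(\<zero>, \<zero>, \<zero>, \<one>) \<in> carrier ?Q" by simp_all
  have ab: "quad_a \<otimes>\<^bsub>?Q\<^esub> quad_b = (\<zero>, \<zero>, \<zero>, \<one>)"
    using s by (simp add: biquad_alg_mult quadruple_defs)
  have gens: "h quad_a \<in> ?G" "h quad_b \<in> ?G" "h (\<zero>, \<zero>, \<zero>, \<one>) \<in> ?G"
  proof -
    show a: "h quad_a \<in> ?G"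
      unfolding \<alpha>1[OF zero_closed one_closed, symmetric] by (intro generate_ring.incl UnI2 UnI1 imageI) simp
    show b: "h quad_b \<in> ?G"
      unfolding \<alpha>2[OF zero_closed one_closed, symmetric] by (intro generate_ring.incl UnI2 imageI) simp
    show "h (\<zero>, \<zero>, \<zero>, \<one>) \<in> ?G"
      unfolding ab[symmetric] hom(2)[OF mem(1,2)] using a b by (rule generate_ring.eng_mult)
  qed
  have "?G = carrier B"
  proof
    show "?G \<subseteq> carrier B" using S by (rule B.M.generate_ring_incl)
    show "carrier B \<subseteq> ?G"
    proof
      fix x assume "x \<in> carrier B"
      then obtain z where "z \<in> carrier ?Q" "x = h z" using alg_isoD(4)[OF push(2)] by blast
      then obtain z0 z1 z2 z3 where x: "x = h (z0, z1, z2, z3)"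
        and c: "z0 \<in> carrier F" "z1 \<in> carrier F" "z2 \<in> carrier F" "z3 \<in> carrier F" by auto
      have "(z0, z1, z2, z3) = (z0 \<odot>\<^bsub>?Q\<^esub> \<one>\<^bsub>?Q\<^esub> \<oplus>\<^bsub>?Q\<^esub> z1 \<odot>\<^bsub>?Q\<^esub> quad_a) \<oplus>\<^bsub>?Q\<^esub> (z2 \<odot>\<^bsub>?Q\<^esub> quad_b \<oplus>\<^bsub>?Q\<^esub> z3 \<odot>\<^bsub>?Q\<^esub> (\<zero>, \<zero>, \<zero>, \<one>))"
        using c by simp
      then have "x = (z0 \<odot>\<^bsub>B\<^esub> \<one>\<^bsub>B\<^esub> \<oplus>\<^bsub>B\<^esub> z1 \<odot>\<^bsub>B\<^esub> h quad_a) \<oplus>\<^bsub>B\<^esub> (z2 \<odot>\<^bsub>B\<^esub> h quad_b \<oplus>\<^bsub>B\<^esub> z3 \<odot>\<^bsub>B\<^esub> h (\<zero>, \<zero>, \<zero>, \<one>))"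
        unfolding x using c mem by (simp only: hom(3,4,5) Q.smult_closed Q.M.one_closed Q.M.a_closed)
      also have "\<dots> \<in> ?G"
        by (intro generate_ring.eng_add smult gens c generate_ring.one)
      finally show "x \<in> ?G" .
    qed
  qed
  then have "(B, \<alpha>1, \<alpha>2) \<in> regular_embeddings F K1 K2"
    using QE unfolding regular_embeddings_def alg_generate_def by blast
  with p show ?thesis by blast
qed

section \<open>The classification of regular embeddings\<close>

lemma regular_embeddings_subset: "regular_embeddings F K1 K2 \<subseteq> quaternion_embeddings F K1 K2"
  unfolding regular_embeddings_def by blast

text \<open>The isomorphism classes are the sets of triples with a common parameter s, one for each
  s whose commutator square is nonzero. On such a set the invariant is constantly
  \<open>xi s\<close>, and \<open>xi_bij\<close> does the rest.\<close>

lemma regular_embeddings_classified: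
  assumes card: "carrier F \<times> carrier F \<times> carrier F \<times> carrier F \<lesssim> (UNIV :: 'b set)"
  shows "(\<forall>T \<in> (regular_embeddings F K1 K2 :: ('f, 'k1, 'k2, 'b) embedding_triple set).
            \<exists>!\<xi>. is_quat_inv F K1 K2 \<sigma>1 \<sigma>2 T \<xi>) \<and>
         bij_betw (quat_inv_class F K1 K2 \<sigma>1 \<sigma>2)
           (Q_reg F K1 K2 :: ('f, 'k1, 'k2, 'b) embedding_triple set set)
           {\<xi> \<in> Units KF. alg_trace F KF \<xi> = \<one>}"
proof
  let ?reg = "regular_embeddings F K1 K2 :: ('f, 'k1, 'k2, 'b) embedding_triple set"
  let ?QE = "quaternion_embeddings F K1 K2 :: ('f, 'k1, 'k2, 'b) embedding_triple set"
  let ?S = "{s \<in> carrier F. commutator_square s \<noteq> \<zero>}"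
  let ?cls = "\<lambda>s. {T \<in> ?QE. has_parameter T s}"
  have inv_iff: "is_quat_inv F K1 K2 \<sigma>1 \<sigma>2 T \<xi> \<longleftrightarrow> \<xi> = xi s"
    if "T \<in> ?QE" "has_parameter T s" "s \<in> carrier F" for T s \<xi>
    using that is_quat_inv_iff by (cases T) blast
  have param: "\<exists>s\<in>?S. has_parameter T s" if reg: "T \<in> ?reg" for T
  proof -
    obtain B \<alpha>1 \<alpha>2 where T: "T = (B, \<alpha>1, \<alpha>2)" by (cases T)
    obtain s where s: "s \<in> carrier F" "has_parameter (B, \<alpha>1, \<alpha>2) s"
      using regular_has_parameter[OF reg[unfolded T]] by blast
    moreover have "(B, \<alpha>1, \<alpha>2) \<in> quaternion_embeddings F K1 K2"
      using subsetD[OF regular_embeddings_subset reg] unfolding T .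
    ultimately show ?thesis using parameter_commutator_square unfolding T by blast
  qed
  show "\<forall>T \<in> ?reg. \<exists>!\<xi>. is_quat_inv F K1 K2 \<sigma>1 \<sigma>2 T \<xi>"
  proof
    fix T assume T: "T \<in> ?reg"
    obtain s where s: "s \<in> carrier F" "has_parameter T s" using param[OF T] by blast
    show "\<exists>!\<xi>. is_quat_inv F K1 K2 \<sigma>1 \<sigma>2 T \<xi>"
      unfolding inv_iff[OF subsetD[OF regular_embeddings_subset T] s(2,1)] by blast
  qed
  have class_eq: "embedding_iso F K1 K2 `` {T} = ?cls s"
    if "T \<in> ?reg" "has_parameter T s" "s \<in> carrier F" for T s
    using that subsetD[OF regular_embeddings_subset that(1)] embedding_iso_parameter by (cases T) blast
  have Q_reg: "(Q_reg F K1 K2 :: ('f, 'k1, 'k2, 'b) embedding_triple set set) = ?cls ` ?S"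
  proof (intro equalityI subsetI)
    fix C :: "('f, 'k1, 'k2, 'b) embedding_triple set" assume "C \<in> Q_reg F K1 K2"
    then obtain T where T: "T \<in> ?reg" "C = embedding_iso F K1 K2 `` {T}"
      unfolding Q_reg_def quotient_def by blast
    with param[OF T(1)] class_eq[OF T(1)] show "C \<in> ?cls ` ?S" by blast
  next
    fix C assume "C \<in> ?cls ` ?S"
    then obtain s where s: "s \<in> carrier F" "commutator_square s \<noteq> \<zero>" "C = ?cls s" by blast
    obtain T where T: "T \<in> ?reg" "has_parameter T s" using exists_regular_embedding[OF card s(1,2)] by blast
    have "C = embedding_iso F K1 K2 `` {T}" using class_eq[OF T s(1)] s(3) by simp
    then show "C \<in> Q_reg F K1 K2" unfolding Q_reg_def using quotientI[OF T(1)] by blast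
  qed
  have class_inv: "quat_inv_class F K1 K2 \<sigma>1 \<sigma>2 (?cls s) = xi s" if s: "s \<in> ?S" for s
  proof -
    \<comment> \<open>\<open>quat_inv_class\<close> takes \<open>the_elem\<close> of an image, so
      the invariant has to be constant on the class and the class nonempty.\<close>
    have "quat_inv F K1 K2 \<sigma>1 \<sigma>2 T = xi s" if "T \<in> ?cls s" for T
      unfolding quat_inv_def using that s inv_iff[of T s] by (intro the_equality) blast+
    moreover obtain T where "T \<in> ?cls s"
      using exists_regular_embedding[OF card, of s] s regular_embeddings_subset by blast
    ultimately have "quat_inv F K1 K2 \<sigma>1 \<sigma>2 ` ?cls s = {xi s}" by blast
    then show ?thesis by (simp add: quat_inv_class_def)
  qed
  have "bij_betw (quat_inv_class F K1 K2 \<sigma>1 \<sigma>2) (?cls ` ?S) {\<xi> \<in> Units KF. alg_trace F KF \<xi> = \<one>}"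
    unfolding bij_betw_def
  proof
    show "inj_on (quat_inv_class F K1 K2 \<sigma>1 \<sigma>2) (?cls ` ?S)"
    proof (rule inj_onI)
      fix C C' assume C: "C \<in> ?cls ` ?S" "C' \<in> ?cls ` ?S"
        and eq: "quat_inv_class F K1 K2 \<sigma>1 \<sigma>2 C = quat_inv_class F K1 K2 \<sigma>1 \<sigma>2 C'"
      obtain s s' where s: "s \<in> ?S" "C = ?cls s" and s': "s' \<in> ?S" "C' = ?cls s'" using C by blast
      have "xi s = xi s'" using eq class_inv[OF s(1)] class_inv[OF s'(1)] unfolding s(2) s'(2) by simp
      from inj_onD[OF bij_betw_imp_inj_on[OF xi_bij] this s(1) s'(1)] have "s = s'" .
      then show "C = C'" unfolding s(2) s'(2) by simp
    qed
    have "quat_inv_class F K1 K2 \<sigma>1 \<sigma>2 ` ?cls ` ?S = xi ` ?S"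
      unfolding image_image using class_inv by (rule image_cong[OF refl])
    also have "\<dots> = {\<xi> \<in> Units KF. alg_trace F KF \<xi> = \<one>}" by (rule bij_betw_imp_surj_on[OF xi_bij])
    finally show "quat_inv_class F K1 K2 \<sigma>1 \<sigma>2 ` ?cls ` ?S = {\<xi> \<in> Units KF. alg_trace F KF \<xi> = \<one>}" .
  qed
  then show "bij_betw (quat_inv_class F K1 K2 \<sigma>1 \<sigma>2) (Q_reg F K1 K2 :: ('f, 'k1, 'k2, 'b) embedding_triple set set)
      {\<xi> \<in> Units KF. alg_trace F KF \<xi> = \<one>}"
    unfolding Q_reg .
qed

end

theorem theorem2p4:
  fixes F :: "'f ring"
    and K1 :: "('f, 'k1) module" and K2 :: "('f, 'k2) module"
    and \<sigma>1 :: "'k1 \<Rightarrow> 'k1" and \<sigma>2 :: "'k2 \<Rightarrow> 'k2"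
  assumes "field F"
    and "quadratic_etale F K1" and "quadratic_etale F K2"
    and "nontrivial_automorphism F K1 \<sigma>1" and "nontrivial_automorphism F K2 \<sigma>2"
    and "carrier F \<times> carrier F \<times> carrier F \<times> carrier F \<lesssim> (UNIV :: 'b set)"
  shows "(\<forall>T \<in> (regular_embeddings F K1 K2 :: ('f, 'k1, 'k2, 'b) embedding_triple set).
            \<exists>!\<xi>. is_quat_inv F K1 K2 \<sigma>1 \<sigma>2 T \<xi>) \<and>
         bij_betw (quat_inv_class F K1 K2 \<sigma>1 \<sigma>2)
           (Q_reg F K1 K2 :: ('f, 'k1, 'k2, 'b) embedding_triple set set)
           {\<xi> \<in> Units (K3 F K1 K2 \<sigma>1 \<sigma>2).
              alg_trace F (K3 F K1 K2 \<sigma>1 \<sigma>2) \<xi> = \<one>\<^bsub>F\<^esub>}"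
proof -
  obtain t1 n1 \<kappa>1 where 1: "t1 \<in> carrier F" "n1 \<in> carrier F" "discriminant F t1 n1 \<noteq> \<zero>\<^bsub>F\<^esub>"
    "field_algebra F K1" "\<kappa>1 \<in> alg_iso F (quad_alg F t1 n1) K1"
    "\<And>x0 x1. \<lbrakk>x0 \<in> carrier F; x1 \<in> carrier F\<rbrakk> \<Longrightarrow>
      \<sigma>1 (\<kappa>1 (x0, x1)) = \<kappa>1 (x0 \<oplus>\<^bsub>F\<^esub> t1 \<otimes>\<^bsub>F\<^esub> x1, \<ominus>\<^bsub>F\<^esub> x1)"
    using etale_coordinates[OF assms(1,2,4)] by metis
  obtain t2 n2 \<kappa>2 where 2: "t2 \<in> carrier F" "n2 \<in> carrier F" "discriminant F t2 n2 \<noteq> \<zero>\<^bsub>F\<^esub>"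
    "field_algebra F K2" "\<kappa>2 \<in> alg_iso F (quad_alg F t2 n2) K2"
    "\<And>x0 x1. \<lbrakk>x0 \<in> carrier F; x1 \<in> carrier F\<rbrakk> \<Longrightarrow>
      \<sigma>2 (\<kappa>2 (x0, x1)) = \<kappa>2 (x0 \<oplus>\<^bsub>F\<^esub> t2 \<otimes>\<^bsub>F\<^esub> x1, \<ominus>\<^bsub>F\<^esub> x1)"
    using etale_coordinates[OF assms(1,3,5)] by metis
  interpret etale_pair F t1 n1 t2 n2 K1 K2 \<sigma>1 \<sigma>2 \<kappa>1 \<kappa>2
    using 1 2 assms(1)
    by (intro etale_pair.intro etale_pair_axioms.intro quadratic_pair.intro quadratic_pair_axioms.intro)
  show ?thesis using assms(6) by (rule regular_embeddings_classified)
qed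

end
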